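(* (Harnack inequality.) Let $H$ satisfy the structural assumptions listed in the context. Then there is a constant $C>0$, depending only on the data, such that for every solution $(m,u)$ (in the sense defined in the context) and every pair of concentric balls $B_R\subset B_{2R}\subset\Omega$ of radii $R$ and $2R$ with $u\ge0$ in $B_{2R}$, $$\max_{B_R}u\ \le\ C\left(\min_{B_R}u+R\right),$$ where $\max_{B_R}$ and $\min_{B_R}$ denote the essential supremum and essential infimum over $B_R$.
   Context: Setting. $\Omega\subset\mathbb{R}^d$ is open and connected, and $H:\Omega\times\mathbb{R}^d\times(0,\infty)\to\mathbb{R}$, $H=H(x,p,m)$, is measurable and differentiable in $p$; $D_pH$ denotes the gradient in the variable $p$. For almost every $x\in\Omega$ the maps $(p,m)\mapsto H(x,p,m)$ and $(p,m)\mapsto D_pH(x,p,m)$ are continuous on $\mathbb{R}^d\times(0,\infty)$. $Du$ is the gradient in $x$. Structural assumptions on $H$. Real parameters satisfy $\alpha>1$, $0\le\tau<1$, $\beta>\frac{\tau}{\alpha-1}$; set $\delta:=\frac{\beta+\tau}{\alpha}$ (so $\beta>\delta$), and let $\epsilon>0$ satisfy $\beta-\delta>\epsilon$. There is a (sufficiently large) constant $C>0$ such that for all $x\in\Omega$, $p\in\mathbb{R}^d$, $m>0$: (1) $|D_pH(x,p,m)|\le C\left(\frac1m+\frac1{m^\tau}\right)|p|^{\alpha-1}+C\left(m^{\beta-\delta}+\frac1m\right)$; (2) $D_pH(x,p,m)\cdot p\ge C^{-1}\frac{1}{m^\tau+1}|p|^\alpha-C\left(m^{\beta-\delta-\epsilon}+1\right)|p|$;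 (3) $H(x,0,m)\ge -C(m^\beta+1)$ for $m>0$, and $H(x,0,m)\le -C^{-1}m^\beta$ for $m\ge C$. "The data" means $d$, $\alpha,\tau,\beta,\epsilon$ and the constant $C$ in (1)–(3). The constant in the claim may differ from that in (1)–(3). Exponent $\gamma$. $\gamma:=\frac{\beta+1}{\delta}=\frac{\beta+1}{\beta+\tau}\,\alpha$; one has $\gamma>\alpha>1$. Set-valued extension to $m=0$. For a continuous map $F:\mathbb{R}^d\times(0,\infty)\to\mathbb{R}^{n}$, extend $F$ to a set-valued map on $\mathbb{R}^d\times[0,\infty)$ by taking the closure of its graph: for $m>0$, $F(p,m)$ is the singleton of its value, and $F(p,0)$ is the set of all $z\in\mathbb{R}^n$ for which there is a sequence $(p_k,m_k)\in\mathbb{R}^d\times(0,\infty)$ with $(p_k,m_k)\to(p,0)$ and $F(p_k,m_k)\to z$. For a.e. $x$ apply this to $(p,m)\mapsto H(x,p,m)$ and to the product map $(p,m)\mapsto mD_pH(x,p,m)$ (the product is formed first and then extended). Given $(m,u)$, admissible $h$ and $j$ are measurable functions on $\Omega$ (with values in $\mathbb{R}$ and $\mathbb{R}^d$) such that, for a.e. $x$, $h(x)\in H(x,Du(x),m(x))$ and $j(x)\in m(x)D_pH(x,Du(x),m(x))$, the right-hand sides being these set-valued extensions. Solution. A pair $(m,u)$ with $m\in L^{\beta+1}_{\mathrm{loc}}(\Omega)$, $m\ge0$, $u\in W^{1,\gamma}_{\mathrm{loc}}(\Omega)$ is a solution of the system $H(x,Du,m)=0$, $-\operatorname{div}(mD_pH(x,Du,m))=0$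 in $\Omega$ if: (i) for some admissible $h$, $h\le0$ a.e. in $\Omega$ and $h=0$ a.e. in $\{x\in\Omega: m(x)>0\}$; and (ii) for some admissible $j$, $\int_\Omega j\cdot D\phi=0$ for all smooth $\phi$ compactly supported in $\Omega$. (Any admissible $j$ belongs to $L^{\gamma/(\gamma-1)}_{\mathrm{loc}}(\Omega)$.) *)

theory Defs
  imports "HOL-Analysis.Analysis" "HOL-Probability.Essential_Supremum"
begin

text \<open>Euclidean space $R^d$ is a type of class \<open>euclidean_space\<close>. Functions on an open set \<open>\<Omega>\<close> are
  total functions whose values outside \<open>\<Omega>\<close> are never used; ``measurable'' and ``almost everywhere''
  refer to the completed Lebesgue measure on \<open>\<Omega>\<close>.\<close>

section \<open>Gradients, test functions and local Sobolev spaces\<close>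

definition gradient :: "('a::euclidean_space \<Rightarrow> real) \<Rightarrow> 'a \<Rightarrow> 'a" where
  "gradient f x = (THE D. GDERIV f x :> D)"

lemma gradient_eqI:
  assumes "GDERIV f x :> D"
  shows "gradient f x = D"
  unfolding gradient_def
proof (rule the_equality)
  show "GDERIV f x :> D" by fact
next
  fix E assume "GDERIV f x :> E"
  with assms have "(\<lambda>h. h \<bullet> D) = (\<lambda>h. h \<bullet> E)"
    unfolding gderiv_def by (rule has_derivative_unique)
  then have "h \<bullet> D = h \<bullet> E" for h
    by (rule fun_cong)
  then show "E = D"
    by (metis vector_eq_ldot)
qed

fun iter_dir_deriv :: "'a::euclidean_space list \<Rightarrow> ('a \<Rightarrow> real) \<Rightarrow> 'a \<Rightarrow> real" where
  "iter_dir_deriv [] f = f"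
| "iter_dir_deriv (v # vs) f = iter_dir_deriv vs (\<lambda>x. frechet_derivative f (at x) v)"

text \<open>$C^\infty$: all iterated directional derivatives exist and are differentiable (hence also
  continuous).\<close>

definition smooth :: "('a::euclidean_space \<Rightarrow> real) \<Rightarrow> bool" where
  "smooth f \<longleftrightarrow> (\<forall>vs x. iter_dir_deriv vs f differentiable (at x))"

text \<open>A smooth function with compact support in \<open>\<Omega>\<close> is identified with its extension by zero.\<close>

definition test_functions :: "'a::euclidean_space set \<Rightarrow> ('a \<Rightarrow> real) set" where
  "test_functions \<Omega> =
     {\<phi>. smooth \<phi> \<and> compact (closure {x. \<phi> x \<noteq> 0}) \<and> closure {x. \<phi> x \<noteq> 0} \<subseteq> \<Omega>}"

definition Lp_loc ::
  "'a::euclidean_space set \<Rightarrow> real \<Rightarrow> ('a \<Rightarrow> 'b::euclidean_space) set" where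
  "Lp_loc \<Omega> p = {f. f \<in> borel_measurable (lebesgue_on \<Omega>) \<and>
     (\<forall>K. compact K \<and> K \<subseteq> \<Omega> \<longrightarrow> integrable (lebesgue_on K) (\<lambda>x. norm (f x) powr p))}"

definition weak_gradient :: "'a::euclidean_space set \<Rightarrow> ('a \<Rightarrow> real) \<Rightarrow> ('a \<Rightarrow> 'a) \<Rightarrow> bool" where
  "weak_gradient \<Omega> u G \<longleftrightarrow> u \<in> Lp_loc \<Omega> 1 \<and> G \<in> Lp_loc \<Omega> 1 \<and>
     (\<forall>\<phi>\<in>test_functions \<Omega>.
        (LINT x|lebesgue_on \<Omega>. u x *\<^sub>R gradient \<phi> x) = - (LINT x|lebesgue_on \<Omega>. \<phi> x *\<^sub>R G x))"

definition W1p_loc :: "'a::euclidean_space set \<Rightarrow> real \<Rightarrow> ('a \<Rightarrow> real) set" where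
  "W1p_loc \<Omega> p = {u \<in> Lp_loc \<Omega> p. \<exists>G\<in>Lp_loc \<Omega> p. weak_gradient \<Omega> u G}"

definition essinf :: "'a measure \<Rightarrow> ('a \<Rightarrow> ereal) \<Rightarrow> ereal" where
  "essinf M f = - esssup M (\<lambda>x. - f x)"


section \<open>The Hamiltonian\<close>

text \<open>\<open>D\<^sub>pH(x,p,m)\<close>\<close>

definition Dp :: "('a \<Rightarrow> 'a::euclidean_space \<Rightarrow> real \<Rightarrow> real) \<Rightarrow> 'a \<Rightarrow> 'a \<Rightarrow> real \<Rightarrow> 'a" where
  "Dp H x p m = gradient (\<lambda>q. H x q m) p"

definition hamiltonian :: "'a::euclidean_space set \<Rightarrow> ('a \<Rightarrow> 'a \<Rightarrow> real \<Rightarrow> real) \<Rightarrow> bool" where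
  "hamiltonian \<Omega> H \<longleftrightarrow>
     (\<lambda>(x, p, m). H x p m) \<in> borel_measurable (lebesgue_on (\<Omega> \<times> UNIV \<times> {0<..})) \<and>
     (\<forall>x\<in>\<Omega>. \<forall>p. \<forall>m>0. (\<lambda>q. H x q m) differentiable (at p)) \<and>
     (AE x in lebesgue_on \<Omega>.
        continuous_on (UNIV \<times> {0<..}) (\<lambda>(p, m). H x p m) \<and>
        continuous_on (UNIV \<times> {0<..}) (\<lambda>(p, m). Dp H x p m))"

definition delta :: "real \<Rightarrow> real \<Rightarrow> real \<Rightarrow> real" where
  "delta \<alpha> \<tau> \<beta> = (\<beta> + \<tau>) / \<alpha>"

definition gamma :: "real \<Rightarrow> real \<Rightarrow> real \<Rightarrow> real" where
  "gamma \<alpha> \<tau> \<beta> = (\<beta> + 1) / delta \<alpha> \<tau> \<beta>"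

definition admissible_parameters :: "real \<Rightarrow> real \<Rightarrow> real \<Rightarrow> real \<Rightarrow> bool" where
  "admissible_parameters \<alpha> \<tau> \<beta> \<epsilon> \<longleftrightarrow>
     \<alpha> > 1 \<and> 0 \<le> \<tau> \<and> \<tau> < 1 \<and> \<beta> > \<tau> / (\<alpha> - 1) \<and> \<epsilon> > 0 \<and> \<beta> - delta \<alpha> \<tau> \<beta> > \<epsilon>"

definition structural_assumptions ::
  "real \<Rightarrow> real \<Rightarrow> real \<Rightarrow> real \<Rightarrow> real \<Rightarrow>
   'a::euclidean_space set \<Rightarrow> ('a \<Rightarrow> 'a \<Rightarrow> real \<Rightarrow> real) \<Rightarrow> bool" where
  "structural_assumptions \<alpha> \<tau> \<beta> \<epsilon> C \<Omega> H \<longleftrightarrow>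
     (\<forall>x\<in>\<Omega>. \<forall>p. \<forall>m>0.
        norm (Dp H x p m)
          \<le> C * (1 / m + 1 / m powr \<tau>) * norm p powr (\<alpha> - 1)
            + C * (m powr (\<beta> - delta \<alpha> \<tau> \<beta>) + 1 / m)) \<and>
     (\<forall>x\<in>\<Omega>. \<forall>p. \<forall>m>0.
        Dp H x p m \<bullet> p
          \<ge> 1 / C * (1 / (m powr \<tau> + 1)) * norm p powr \<alpha>
            - C * (m powr (\<beta> - delta \<alpha> \<tau> \<beta> - \<epsilon>) + 1) * norm p) \<and>
     (\<forall>x\<in>\<Omega>. \<forall>m>0. H x 0 m \<ge> - C * (m powr \<beta> + 1)) \<and>
     (\<forall>x\<in>\<Omega>. \<forall>m\<ge>C. H x 0 m \<le> - (1 / C) * m powr \<beta>)"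


section \<open>Solutions\<close>

text \<open>Closure of the graph of \<open>F\<close> over \<open>m = 0\<close>. Negative \<open>m\<close> does not occur almost everywhere for the
  densities considered; it gets the empty set.\<close>

definition graph_closure ::
  "('a::euclidean_space \<Rightarrow> real \<Rightarrow> 'b::euclidean_space) \<Rightarrow> 'a \<Rightarrow> real \<Rightarrow> 'b set" where
  "graph_closure F p m =
     (if m > 0 then {F p m}
      else if m = 0 then
        {z. \<exists>(P :: nat \<Rightarrow> 'a) (M :: nat \<Rightarrow> real). (\<forall>k. M k > 0) \<and>
              P \<longlonglongrightarrow> p \<and> M \<longlonglongrightarrow> 0 \<and> (\<lambda>k. F (P k) (M k)) \<longlonglongrightarrow> z}
      else {})"

definition admissible_h ::
  "'a::euclidean_space set \<Rightarrow> ('a \<Rightarrow> 'a \<Rightarrow> real \<Rightarrow> real) \<Rightarrow> ('a \<Rightarrow> real) \<Rightarrow> ('a \<Rightarrow> 'a)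
   \<Rightarrow> ('a \<Rightarrow> real) \<Rightarrow> bool" where
  "admissible_h \<Omega> H m Du h \<longleftrightarrow>
     h \<in> borel_measurable (lebesgue_on \<Omega>) \<and>
     (AE x in lebesgue_on \<Omega>. h x \<in> graph_closure (H x) (Du x) (m x))"

definition admissible_j ::
  "'a::euclidean_space set \<Rightarrow> ('a \<Rightarrow> 'a \<Rightarrow> real \<Rightarrow> real) \<Rightarrow> ('a \<Rightarrow> real) \<Rightarrow> ('a \<Rightarrow> 'a)
   \<Rightarrow> ('a \<Rightarrow> 'a) \<Rightarrow> bool" where
  "admissible_j \<Omega> H m Du j \<longleftrightarrow>
     j \<in> borel_measurable (lebesgue_on \<Omega>) \<and>
     (AE x in lebesgue_on \<Omega>. j x \<in> graph_closure (\<lambda>p r. r *\<^sub>R Dp H x p r) (Du x) (m x))"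

text \<open>The weak gradient is unique up to null sets, so it does not matter which version \<open>Du\<close> is taken.
  Under the structural assumptions every admissible \<open>j\<close> is in $L^{\gamma/(\gamma-1)}_{loc}$, so the
  integrand below is integrable and the value zero does not arise from the convention for
  non-integrable functions.\<close>

definition solution ::
  "real \<Rightarrow> real \<Rightarrow> real \<Rightarrow> 'a::euclidean_space set \<Rightarrow> ('a \<Rightarrow> 'a \<Rightarrow> real \<Rightarrow> real)
   \<Rightarrow> ('a \<Rightarrow> real) \<Rightarrow> ('a \<Rightarrow> real) \<Rightarrow> bool" where
  "solution \<alpha> \<tau> \<beta> \<Omega> H m u \<longleftrightarrow>
     m \<in> Lp_loc \<Omega> (\<beta> + 1) \<and> (AE x in lebesgue_on \<Omega>. m x \<ge> 0) \<and>
     u \<in> W1p_loc \<Omega> (gamma \<alpha> \<tau> \<beta>) \<and>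
     (\<exists>Du. weak_gradient \<Omega> u Du \<and>
        (\<exists>h. admissible_h \<Omega> H m Du h \<and>
           (AE x in lebesgue_on \<Omega>. h x \<le> 0) \<and>
           (AE x in lebesgue_on \<Omega>. m x > 0 \<longrightarrow> h x = 0)) \<and>
        (\<exists>j. admissible_j \<Omega> H m Du j \<and>
           (\<forall>\<phi>\<in>test_functions \<Omega>. (LINT x|lebesgue_on \<Omega>. j x \<bullet> gradient \<phi> x) = 0)))"

end

theory Submission
  imports Defs
begin

text \<open>
  The theorem reduces the system to a single degenerate elliptic equation for \<open>u\<close> and then follows
  De Giorgi's method.

  \<^bold>\<open>The equation.\<close> Fix \<open>x\<close>. Comparing \<open>H(x,p,m)\<close> with \<open>H(x,0,m)\<close> along the segment from \<open>0\<close> to \<open>p\<close>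
  shows that \<open>H(x,p,m) = 0\<close> forces \<open>m^\<delta>\<close> and \<open>|p|\<close> to be comparable as soon as one of them is large
  (\<open>fibre_gradient_le_density\<close>, \<open>fibre_density_le_gradient\<close>). If \<open>m = 0\<close>, then only \<open>H \<le> 0\<close> is known,
  but this already bounds \<open>|p|\<close>, and hence every limit of \<open>m D\<^sub>pH\<close> as well. Inserting this into the
  bounds on \<open>D\<^sub>pH\<close>, the powers of \<open>m\<close> turn into powers of \<open>|p|\<close>, and the current \<open>j\<close> satisfies
  \<open>|j| \<le> K (|Du|^(\<gamma>-1) + 1)\<close> and \<open>j \<bullet> Du \<ge> c |Du|^\<gamma> - K\<close> almost everywhere, with constants that depend
  only on the data (\<open>structure_conditions\<close>). From here on the density and the Hamiltonian are
  forgotten: \<open>div j = 0\<close> with these two bounds is an equation of \<open>\<gamma>\<close>-Laplace type with bounded lower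
  order terms (\<open>weak_solution_if_solution\<close>), and the terms \<open>K\<close> scale so that \<open>u + R\<close> is the right
  quantity on balls of radius comparable to \<open>R\<close>.

  \<^bold>\<open>The tools.\<close> Mollification shows that \<open>\<eta> \<Psi>(u)\<close> is an admissible test function for a \<open>C\<^sup>1\<close> cutoff \<open>\<eta>\<close>
  and a \<open>C\<^sup>1\<close> Lipschitz function \<open>\<Psi>\<close> (\<open>weak_solution_composite_test\<close>). No Sobolev embedding is used.
  The elementary bound \<open>\<integral>|F(x+z) - F(x)|^\<gamma> \<le> |z|^\<gamma> \<integral>|DF|^\<gamma>\<close> (\<open>translation_estimate\<close>), averaged over
  \<open>z\<close>, yields both inequalities that are needed: a bound of \<open>\<integral>|F|^\<gamma>\<close> for functions with small support
  (\<open>faber_krahn_of_translations\<close>), and one for functions that vanish on a set of positive density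
  (\<open>poincare_of_translations\<close>).

  \<^bold>\<open>Pointwise bounds.\<close> One Caccioppoli inequality (\<open>energy_estimate\<close>) provides level energies for
  \<open>(u + R)/M\<close> and for multiples of \<open>- ln (u + R)\<close>. De Giorgi's iteration turns small excess of such a
  function into an upper bound (\<open>degiorgi_iteration\<close>). Applied to \<open>u\<close>, this is local boundedness
  (\<open>local_upper_bound\<close>). Applied to the logarithm, whose excess is controlled by the logarithmic energy
  and Poincare's inequality, it says that a solution with \<open>u + R \<ge> M\<close> on a fixed proportion of a ball is
  at least \<open>e M\<close> on the ball of twice the radius (\<open>expansion_of_positivity\<close>).

  \<^bold>\<open>Harnack's inequality.\<close> In \<open>harnack_weak_solution\<close>, \<open>(u + R) (3/2 - |x - x\<^sub>0|/R)^b\<close> is maximised over the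
  ball of radius \<open>3R/2\<close>. Near a maximum point \<open>u + R\<close> is at most a fixed multiple of a number \<open>M\<close> and, by
  the upper bound, exceeds \<open>M\<close> on a set of positive density.
  Positivity expands from there by doubling the radius up to a fixed multiple of \<open>R\<close>. The exponent \<open>b\<close> is so
  large that the weight compensates the losses of all doublings, and the value which arrives is a fixed
  fraction of the maximum. A chain of balls of fixed length carries it to all of \<open>B\<^sub>R\<close>.
\<close>

section \<open>Smooth bump functions\<close>

text \<open>The factor \<open>1 / t ^ k\<close> makes the family stable under differentiation.\<close>
definition bump_profile :: "nat \<Rightarrow> real \<Rightarrow> real" where
  "bump_profile k t = (if t > 0 then exp (- 1 / t) / t ^ k else 0)"

lemma power_le_fact_exp:
  fixes x :: real
  assumes "x \<ge> 0"
  shows "x ^ n \<le> fact n * exp x"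
proof -
  have s: "(\<lambda>n. x ^ n /\<^sub>R fact n) sums exp x" by (rule exp_converges)
  have "sum (\<lambda>n. x ^ n /\<^sub>R fact n) {n} \<le> (\<Sum>n. x ^ n /\<^sub>R fact n)"
    by (rule sum_le_suminf) (use s assms in \<open>auto simp: sums_iff\<close>)
  then show ?thesis using s by (simp add: sums_iff field_simps)
qed

lemma bump_profile_le:
  assumes "t > 0"
  shows "bump_profile k t \<le> fact (k + 2) * t\<^sup>2"
proof -
  have "(1 / t) ^ (k + 2) \<le> fact (k + 2) * exp (1 / t)"
    by (rule power_le_fact_exp) (use assms in simp)
  then show ?thesis
    using assms by (simp add: bump_profile_def exp_minus field_simps power_add power2_eq_square)
qed

lemma bump_profile_nonneg: "bump_profile k t \<ge> 0"
  by (simp add: bump_profile_def)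

text \<open>At \<open>t = 0\<close> the difference quotient tends to zero because \<open>exp (-1/t)\<close> beats every power of \<open>t\<close>;
  the quadratic bound above is all that is needed.\<close>
lemma DERIV_bump_profile:
  "(bump_profile k has_real_derivative
      (bump_profile (k + 2) t - real k * bump_profile (k + 1) t)) (at t)"
proof (cases t "0::real" rule: linorder_cases)
  case less
  have "((\<lambda>_. 0::real) has_real_derivative 0) (at t)" by simp
  then have "(bump_profile k has_real_derivative 0) (at t)"
    by (rule has_field_derivative_transform_within_open[where S="{..<0}"])
       (use less in \<open>auto simp: bump_profile_def\<close>)
  then show ?thesis using less by (simp add: bump_profile_def)
next
  case greater
  have 1: "((\<lambda>t. exp (- inverse t)) has_real_derivative exp (- inverse t) * inverse t ^ 2) (at t)"
    using greater by (auto intro!: derivative_eq_intros simp: power2_eq_square)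
  have 2: "((\<lambda>t. inverse t ^ k) has_real_derivative - real k * inverse t ^ (k + 1)) (at t)"
  proof (cases k)
    case (Suc n)
    have "((\<lambda>t. inverse t ^ Suc n) has_real_derivative
        (1 + real n) * (- (inverse t ^ Suc (Suc 0)) * inverse t ^ n)) (at t)"
      by (rule DERIV_power_Suc[OF DERIV_inverse]) (use greater in simp)
    then show ?thesis by (simp add: Suc algebra_simps)
  qed simp
  have "((\<lambda>t. exp (- inverse t) * inverse t ^ k) has_real_derivative
      (bump_profile (k + 2) t - real k * bump_profile (k + 1) t)) (at t)"
    by (rule DERIV_cong[OF DERIV_mult[OF 1 2]])
       (use greater in \<open>simp add: bump_profile_def divide_inverse power_add algebra_simps power_inverse power2_eq_square\<close>)
  then show ?thesis
    by (rule has_field_derivative_transform_within_open[where S="{0<..}"])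
       (use greater in \<open>auto simp: bump_profile_def divide_inverse power_inverse\<close>)
next
  case equal
  have "((\<lambda>h. bump_profile k h / h) \<longlongrightarrow> 0) (at 0)"
  proof (rule Lim_null_comparison)
    show "\<forall>\<^sub>F h in at 0. norm (bump_profile k h / h) \<le> fact (k + 2) * \<bar>h\<bar>"
    proof (rule eventuallyI)
      fix h :: real
      show "norm (bump_profile k h / h) \<le> fact (k + 2) * \<bar>h\<bar>"
      proof (cases "h > 0")
        case True
        then show ?thesis
          using bump_profile_le[of h k] bump_profile_nonneg[of k h]
          by (simp add: pos_divide_le_eq power2_eq_square mult.assoc)
      next
        case False
        have "0 \<le> fact (k + 2) * \<bar>h\<bar>" by (intro mult_nonneg_nonneg fact_ge_zero abs_ge_zero)
        with False show ?thesis by (simp only: bump_profile_def) simp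
      qed
    qed
    show "((\<lambda>h::real. fact (k + 2) * \<bar>h\<bar>) \<longlongrightarrow> 0) (at 0)"
      by (auto intro!: tendsto_eq_intros)
  qed
  then show ?thesis using equal
    by (simp add: has_field_derivative_iff bump_profile_def)
qed

text \<open>Smoothness is defined through iterated directional derivatives. Showing it for one bump function
  directly would require a formula for all of them; it is easier to exhibit an algebra of
  differentiable functions that contains the bump functions and is mapped into itself by every
  directional derivative.\<close>
inductive_set bump_algebra :: "('a::euclidean_space \<Rightarrow> real) set" where
  const: "(\<lambda>x. c) \<in> bump_algebra"
| inner: "(\<lambda>x. x \<bullet> v) \<in> bump_algebra"
| bump: "(\<lambda>x. bump_profile k (r - (x - a) \<bullet> (x - a))) \<in> bump_algebra"
| add: "f \<in> bump_algebra \<Longrightarrow> g \<in> bump_algebra \<Longrightarrow> (\<lambda>x. f x + g x) \<in> bump_algebra"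
| mult: "f \<in> bump_algebra \<Longrightarrow> g \<in> bump_algebra \<Longrightarrow> (\<lambda>x. f x * g x) \<in> bump_algebra"

lemma bump_algebra_derivative:
  assumes "f \<in> bump_algebra"
  shows "\<exists>D. (\<forall>x. (f has_derivative D x) (at x)) \<and> (\<forall>v. (\<lambda>x. D x v) \<in> bump_algebra)"
  using assms
proof induction
  case (const c)
  show ?case
    by (rule exI[of _ "\<lambda>x v. 0"]) (auto intro: bump_algebra.const)
next
  case (inner v)
  show ?case
    by (rule exI[of _ "\<lambda>x h. h \<bullet> v"])
       (auto intro!: derivative_eq_intros bump_algebra.const)
next
  case (bump k r a)
  let ?p = "\<lambda>k x. bump_profile k (r - (x - a) \<bullet> (x - a))"
  let ?D = "\<lambda>x v. (?p (k + 2) x + (- real k) * ?p (k + 1) x) * ((-2) * (x \<bullet> v + (- (a \<bullet> v))))"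
  have d: "((\<lambda>x. r - (x - a) \<bullet> (x - a)) has_derivative (\<lambda>v. (-2) * (x \<bullet> v + (- (a \<bullet> v))))) (at x)" for x
    by (auto intro!: derivative_eq_intros ext simp: inner_diff_left inner_diff_right inner_commute)
  have "(?p k has_derivative ?D x) (at x)" for x
  proof -
    have "(bump_profile k has_derivative (\<lambda>h. h * (?p (k + 2) x - real k * ?p (k + 1) x)))
        (at (r - (x - a) \<bullet> (x - a)))"
      using DERIV_bump_profile[of k "r - (x - a) \<bullet> (x - a)"]
      by (simp add: has_field_derivative_def mult.commute[of _ "_ - _"])
    from has_derivative_compose[OF d this] show ?thesis
      by (simp add: mult.commute)
  qed
  moreover have "(\<lambda>x. ?D x v) \<in> bump_algebra" for v
    by (intro bump_algebra.intros)
  ultimately show ?case by (intro exI[of _ ?D]) blast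
next
  case (add f g)
  then obtain D E where D: "\<forall>x. (f has_derivative D x) (at x)" "\<forall>v. (\<lambda>x. D x v) \<in> bump_algebra"
    and E: "\<forall>x. (g has_derivative E x) (at x)" "\<forall>v. (\<lambda>x. E x v) \<in> bump_algebra" by blast
  show ?case
    by (rule exI[of _ "\<lambda>x v. D x v + E x v"])
       (use D E in \<open>auto intro!: has_derivative_add bump_algebra.add\<close>)
next
  case (mult f g)
  then obtain D E where D: "\<forall>x. (f has_derivative D x) (at x)" "\<forall>v. (\<lambda>x. D x v) \<in> bump_algebra"
    and E: "\<forall>x. (g has_derivative E x) (at x)" "\<forall>v. (\<lambda>x. E x v) \<in> bump_algebra" by blast
  have "(\<lambda>x. f x * E x v + D x v * g x) \<in> bump_algebra" for v
    by (intro bump_algebra.add bump_algebra.mult mult.hyps) (use D E in auto)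
  then show ?case
    using D E by (intro exI[of _ "\<lambda>x v. f x * E x v + D x v * g x"]) (auto intro!: has_derivative_mult)
qed

lemma bump_algebra_smooth:
  assumes "f \<in> bump_algebra"
  shows "smooth f"
proof -
  have "\<forall>x. iter_dir_deriv vs f differentiable (at x)" for vs
    using assms
  proof (induction vs arbitrary: f)
    case Nil
    then show ?case using bump_algebra_derivative by (fastforce simp: differentiable_def)
  next
    case (Cons v vs)
    obtain D where D: "\<forall>x. (f has_derivative D x) (at x)" "\<forall>v. (\<lambda>x. D x v) \<in> bump_algebra"
      using bump_algebra_derivative[OF Cons.prems] by blast
    have "(\<lambda>x. frechet_derivative f (at x) v) = (\<lambda>x. D x v)"
      using D(1) frechet_derivative_at by metis
    then show ?case using Cons.IH[of "\<lambda>x. D x v"] D(2) by simp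
  qed
  then show ?thesis by (simp add: smooth_def)
qed

lemma smooth_dir_deriv:
  assumes "smooth f"
  shows "smooth (\<lambda>x. frechet_derivative f (at x) v)"
  unfolding smooth_def
proof (intro allI)
  fix vs x
  have "iter_dir_deriv (v # vs) f differentiable (at x)"
    using assms unfolding smooth_def by blast
  then show "iter_dir_deriv vs (\<lambda>x. frechet_derivative f (at x) v) differentiable (at x)" by simp
qed

lemma smooth_differentiable: "smooth f \<Longrightarrow> f differentiable (at x)"
  unfolding smooth_def by (metis iter_dir_deriv.simps(1))

section \<open>Continuously differentiable functions\<close>

lemma GDERIV_gradient:
  fixes f :: "'a::euclidean_space \<Rightarrow> real"
  assumes "f differentiable (at x)"
  shows "GDERIV f x :> gradient f x"
proof -
  obtain D where D: "(f has_derivative D) (at x)" using assms by (auto simp: differentiable_def)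
  then interpret l: linear D by (simp add: bounded_linear.linear has_derivative_bounded_linear)
  have "D h = h \<bullet> (\<Sum>i\<in>Basis. D i *\<^sub>R i)" for h
  proof -
    have "D h = D (\<Sum>i\<in>Basis. (h \<bullet> i) *\<^sub>R i)" by (simp add: euclidean_representation)
    also have "\<dots> = h \<bullet> (\<Sum>i\<in>Basis. D i *\<^sub>R i)" by (simp add: l.sum l.scaleR inner_sum_right mult.commute)
    finally show ?thesis .
  qed
  then have "D = (\<lambda>h. h \<bullet> (\<Sum>i\<in>Basis. D i *\<^sub>R i))" by blast
  then have "GDERIV f x :> (\<Sum>i\<in>Basis. D i *\<^sub>R i)" using D by (simp add: gderiv_def)
  then show ?thesis using gradient_eqI by metis
qed

text \<open>The gradient is an explicit argument, so that sums, products, composites and convolutions come with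
  a formula for their gradients.\<close>
definition C1 :: "('a::euclidean_space \<Rightarrow> real) \<Rightarrow> ('a \<Rightarrow> 'a) \<Rightarrow> bool" where
  "C1 f g \<longleftrightarrow> continuous_on UNIV g \<and> (\<forall>x. GDERIV f x :> g x)"

lemma C1_continuous: "C1 f g \<Longrightarrow> continuous_on UNIV f"
  unfolding C1_def gderiv_def
  by (meson continuous_at_imp_continuous_on has_derivative_continuous)

lemma C1_gradient: "C1 f g \<Longrightarrow> gradient f x = g x"
  unfolding C1_def by (simp add: gradient_eqI)

lemma smooth_C1:
  assumes "smooth f"
  shows "C1 f (gradient f)"
proof -
  have G: "GDERIV f x :> gradient f x" for x
    by (rule GDERIV_gradient[OF smooth_differentiable[OF assms]])
  have "gradient f x = (\<Sum>i\<in>Basis. frechet_derivative f (at x) i *\<^sub>R i)" for x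
  proof -
    have "frechet_derivative f (at x) = (\<lambda>h. h \<bullet> gradient f x)"
      using G[of x] unfolding gderiv_def by (rule frechet_derivative_at[symmetric])
    then show ?thesis
      using euclidean_representation[of "gradient f x"] by (simp add: inner_commute)
  qed
  then have "gradient f = (\<lambda>x. \<Sum>i\<in>Basis. frechet_derivative f (at x) i *\<^sub>R i)" by blast
  moreover have "continuous_on UNIV (\<lambda>x. frechet_derivative f (at x) i)" for i
    using smooth_differentiable[OF smooth_dir_deriv[OF assms]]
    by (meson continuous_at_imp_continuous_on differentiable_imp_continuous_within)
  ultimately have "continuous_on UNIV (gradient f)" by (simp add: continuous_on_sum continuous_on_scaleR)
  then show ?thesis using G by (simp add: C1_def)
qed

lemma C1_zero_outside:
  assumes "C1 f g" and "open S" and "\<And>x. x \<in> S \<Longrightarrow> f x = 0" and "x \<in> S"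
  shows "g x = 0"
proof -
  have "((\<lambda>_. 0::real) has_derivative (\<lambda>h. h \<bullet> 0)) (at x)" by simp
  then have "(f has_derivative (\<lambda>h. h \<bullet> 0)) (at x)"
    by (rule has_derivative_transform_within_open) (use assms in auto)
  then have "GDERIV f x :> 0" by (simp add: gderiv_def)
  then show ?thesis using assms(1) unfolding C1_def by (metis gradient_eqI)
qed

lemma C1_zero_outside_cball:
  assumes "C1 f g" and "\<And>x. x \<notin> cball c r \<Longrightarrow> f x = 0" and "x \<notin> cball c r"
  shows "g x = 0"
  by (rule C1_zero_outside[OF assms(1), of "- cball c r"]) (use assms in auto)

lemma bounded_if_zero_outside_cball:
  fixes g :: "'a::euclidean_space \<Rightarrow> 'b::real_normed_vector"
  assumes "continuous_on UNIV g" and "\<And>x. x \<notin> cball c r \<Longrightarrow> g x = 0"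
  obtains M where "M > 0" "\<And>x. norm (g x) \<le> M"
proof -
  have "compact (g ` cball c r)"
    by (rule compact_continuous_image) (use continuous_on_subset[OF assms(1)] in auto)
  then obtain M where M: "\<And>x. x \<in> cball c r \<Longrightarrow> norm (g x) \<le> M"
    by (meson bounded_iff compact_imp_bounded imageI)
  have "norm (g x) \<le> max M 1" for x
    by (cases "x \<in> cball c r") (use M[of x] assms(2)[of x] in auto)
  then show thesis using that[of "max M 1"] by auto
qed

lemma uniformly_continuous_if_zero_outside_cball:
  fixes g :: "'a::euclidean_space \<Rightarrow> 'b::real_normed_vector"
  assumes "continuous_on UNIV g" and "\<And>x. x \<notin> cball c r \<Longrightarrow> g x = 0" and "e > 0"
  obtains d where "d > 0" "\<And>x h. norm h < d \<Longrightarrow> norm (g (x + h) - g x) \<le> e"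
proof -
  have "uniformly_continuous_on (cball c (\<bar>r\<bar> + 2)) g"
    by (rule compact_uniformly_continuous) (use continuous_on_subset[OF assms(1)] in auto)
  then obtain d where d: "d > 0" "\<And>x x'. x \<in> cball c (\<bar>r\<bar> + 2) \<Longrightarrow> x' \<in> cball c (\<bar>r\<bar> + 2) \<Longrightarrow>
      dist x' x < d \<Longrightarrow> dist (g x') (g x) < e"
    using \<open>e > 0\<close> unfolding uniformly_continuous_on_def by meson
  have "norm (g (x + h) - g x) \<le> e" if h: "norm h < min d 1" for x h
  proof (cases "x \<in> cball c (\<bar>r\<bar> + 1)")
    case True
    then have "x + h \<in> cball c (\<bar>r\<bar> + 2)"
      using h norm_triangle_ineq4[of "c - x" h] by (simp add: dist_norm algebra_simps)
    then show ?thesis using d(2)[of x "x + h"] True h by (simp add: dist_norm)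
  next
    case False
    have "norm (c - x) \<le> norm (c - (x + h)) + norm h"
      using norm_triangle_ineq[of "c - (x + h)" h] by simp
    then have "x + h \<notin> cball c r" "x \<notin> cball c r"
      using False h by (auto simp: dist_norm)
    then show ?thesis using assms by auto
  qed
  then show thesis using that[of "min d 1"] d(1) by auto
qed

text \<open>Uniform continuity of the gradient makes the first order remainder uniform in the base point. This is
  what allows differentiation under a convolution with an arbitrary integrable function.\<close>
lemma C1_uniform_remainder:
  assumes "C1 f g" and "\<And>x. x \<notin> cball c r \<Longrightarrow> f x = 0" and "e > 0"
  obtains d where "d > 0" "\<And>x h. norm h < d \<Longrightarrow> \<bar>f (x + h) - f x - h \<bullet> g x\<bar> \<le> e * norm h"
proof -
  have g: "continuous_on UNIV g" using assms(1) by (simp add: C1_def)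
  obtain d where d: "d > 0" "\<And>x h. norm h < d \<Longrightarrow> norm (g (x + h) - g x) \<le> e"
    using uniformly_continuous_if_zero_outside_cball[OF g _ \<open>e > 0\<close>, of c r]
      C1_zero_outside_cball[OF assms(1,2)] by blast
  have "\<bar>f (x + h) - f x - h \<bullet> g x\<bar> \<le> e * norm h" if h: "norm h < d" for x h
  proof -
    define p where "p t = f (x + t *\<^sub>R h)" for t :: real
    have D: "DERIV p t :> h \<bullet> g (x + t *\<^sub>R h)" for t
    proof -
      have "((\<lambda>t. x + t *\<^sub>R h) has_derivative (\<lambda>s. s *\<^sub>R h)) (at t)"
        by (auto intro!: derivative_eq_intros)
      moreover have "(f has_derivative (\<lambda>k. k \<bullet> g (x + t *\<^sub>R h))) (at (x + t *\<^sub>R h))"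
        using assms(1) by (simp add: C1_def gderiv_def)
      ultimately have "((\<lambda>t. f (x + t *\<^sub>R h)) has_derivative (\<lambda>s. (s *\<^sub>R h) \<bullet> g (x + t *\<^sub>R h))) (at t)"
        by (rule has_derivative_compose)
      then show ?thesis by (simp add: p_def[abs_def] has_field_derivative_def mult.commute[of _ "_ \<bullet> _"])
    qed
    obtain t where t: "0 < t" "t < 1" "p 1 - p 0 = (1 - 0) * (h \<bullet> g (x + t *\<^sub>R h))"
      using MVT2[of 0 1 p "\<lambda>t. h \<bullet> g (x + t *\<^sub>R h)"] D by auto
    have "f (x + h) - f x - h \<bullet> g x = h \<bullet> (g (x + t *\<^sub>R h) - g x)"
      using t(3) by (simp add: p_def inner_diff_right)
    also have "\<bar>\<dots>\<bar> \<le> norm h * norm (g (x + t *\<^sub>R h) - g x)"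
      by (rule Cauchy_Schwarz_ineq2)
    also have "\<dots> \<le> norm h * e"
    proof -
      have "norm (t *\<^sub>R h) < d" using t h mult_less_le_imp_less[of t 1 "norm h" "norm h"]
        by (smt (verit) mult_left_le_one_le norm_ge_zero norm_scaleR abs_of_pos)
      then show ?thesis by (intro mult_left_mono d(2)) auto
    qed
    finally show ?thesis by (simp add: mult.commute)
  qed
  then show thesis using that d(1) by blast
qed

section \<open>Mollification\<close>

lemma integrable_continuous_zero_outside_cball:
  fixes g :: "'a::euclidean_space \<Rightarrow> 'b::euclidean_space"
  assumes "continuous_on UNIV g" and "\<And>x. x \<notin> cball c r \<Longrightarrow> g x = 0"
  shows "integrable lborel g"
proof -
  have "integrable lborel (\<lambda>x. indicator (cball c r) x *\<^sub>R g x)"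
    by (rule borel_integrable_compact) (use continuous_on_subset[OF assms(1)] in auto)
  also have "(\<lambda>x. indicator (cball c r) x *\<^sub>R g x) = g"
    using assms(2) by (auto simp: indicator_def)
  finally show ?thesis .
qed

lemma distr_lborel_reflect: "distr lborel borel (\<lambda>y. x - y) = (lborel :: 'a::euclidean_space measure)"
  using lborel_affine[of "-1" x] by (simp add: density_1)

lemma distr_lborel_translate: "distr lborel borel (\<lambda>y. y + x) = (lborel :: 'a::euclidean_space measure)"
  proof -
  have "(\<lambda>y. y + x) = (+) x" by (auto simp: add.commute)
  then show ?thesis using lborel_distr_plus[of x] by simp
qed

lemma
  fixes f :: "'a::euclidean_space \<Rightarrow> 'b::euclidean_space"
  assumes [measurable]: "f \<in> borel_measurable borel"
  shows integral_reflect: "(\<integral>y. f (x - y) \<partial>lborel) = (\<integral>y. f y \<partial>lborel)"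
    and integrable_reflect: "integrable lborel (\<lambda>y. f (x - y)) \<longleftrightarrow> integrable lborel f"
    and integral_translate: "(\<integral>y. f (y + x) \<partial>lborel) = (\<integral>y. f y \<partial>lborel)"
    and integrable_translate: "integrable lborel (\<lambda>y. f (y + x)) \<longleftrightarrow> integrable lborel f"
proof -
  show "(\<integral>y. f (x - y) \<partial>lborel) = (\<integral>y. f y \<partial>lborel)"
    by (subst (2) distr_lborel_reflect[of x, symmetric]) (subst integral_distr; simp)
  show "integrable lborel (\<lambda>y. f (x - y)) \<longleftrightarrow> integrable lborel f"
    by (subst (2) distr_lborel_reflect[of x, symmetric]) (subst integrable_distr_eq; simp)
  show "(\<integral>y. f (y + x) \<partial>lborel) = (\<integral>y. f y \<partial>lborel)"
    by (subst (2) distr_lborel_translate[of x, symmetric]) (subst integral_distr; simp)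
  show "integrable lborel (\<lambda>y. f (y + x)) \<longleftrightarrow> integrable lborel f"
    by (subst (2) distr_lborel_translate[of x, symmetric]) (subst integrable_distr_eq; simp)
qed

lemma nn_integral_translate:
  fixes f :: "'a::euclidean_space \<Rightarrow> ennreal"
  assumes [measurable]: "f \<in> borel_measurable borel"
  shows "(\<integral>\<^sup>+y. f (y + x) \<partial>lborel) = (\<integral>\<^sup>+y. f y \<partial>lborel)"
  by (subst (2) distr_lborel_translate[of x, symmetric]) (subst nn_integral_distr; simp)

lemma AE_translate:
  fixes P :: "'a::euclidean_space \<Rightarrow> bool"
  assumes "AE x in lborel. P x"
  shows "AE x in lborel. P (x + z)"
proof -
  obtain N where N: "N \<in> null_sets lborel" "{x. \<not> P x} \<subseteq> N"
    using assms unfolding eventually_ae_filter by auto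
  have [measurable]: "N \<in> sets borel" using N(1) by auto
  have "(\<integral>\<^sup>+x. indicator N (x + z) \<partial>lborel) = 0"
    using N(1) by (subst nn_integral_translate) auto
  then have "AE x in lborel. indicator N (x + z) = (0::ennreal)"
    by (subst (asm) nn_integral_0_iff_AE) auto
  then show ?thesis
    by (rule AE_mp) (use N(2) in \<open>auto simp: indicator_def intro!: AE_I2 split: if_splits\<close>)
qed

definition conv :: "('a::euclidean_space \<Rightarrow> real) \<Rightarrow> ('a \<Rightarrow> 'b::euclidean_space) \<Rightarrow> 'a \<Rightarrow> 'b" where
  "conv \<eta> f x = (\<integral>y. \<eta> (x - y) *\<^sub>R f y \<partial>lborel)"

lemma conv_measurable [measurable]:
  assumes [measurable]: "\<eta> \<in> borel_measurable borel" "f \<in> borel_measurable borel"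
  shows "conv \<eta> f \<in> borel_measurable borel"
  unfolding conv_def[abs_def] by measurable

lemma integrable_bounded_scaleR:
  fixes f :: "'a::euclidean_space \<Rightarrow> 'b::euclidean_space"
  assumes f: "integrable lborel f" and [measurable]: "\<eta> \<in> borel_measurable borel"
    and "\<And>x. \<bar>\<eta> x\<bar> \<le> M"
  shows "integrable lborel (\<lambda>y. \<eta> y *\<^sub>R f y)"
proof (rule Bochner_Integration.integrable_bound)
  show "integrable lborel (\<lambda>y. M *\<^sub>R f y)" using f by simp
  show "(\<lambda>y. \<eta> y *\<^sub>R f y) \<in> borel_measurable lborel"
    using borel_measurable_integrable[OF f] by simp
  have "M \<ge> 0" using assms(3)[of undefined] by linarith
  then show "AE x in lborel. norm (\<eta> x *\<^sub>R f x) \<le> norm (M *\<^sub>R f x)"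
    by (intro AE_I2) (simp add: mult_right_mono assms(3))
qed

lemma integrable_scaleR_bounded:
  fixes g :: "'a::euclidean_space \<Rightarrow> 'b::euclidean_space"
  assumes f: "integrable lborel f" and [measurable]: "g \<in> borel_measurable borel"
    and "\<And>x. norm (g x) \<le> M"
  shows "integrable lborel (\<lambda>y. f y *\<^sub>R g y)"
proof (rule Bochner_Integration.integrable_bound)
  show "integrable lborel (\<lambda>y. M * f y)" using f by simp
  show "(\<lambda>y. f y *\<^sub>R g y) \<in> borel_measurable lborel"
    using borel_measurable_integrable[OF f] by simp
  have "M \<ge> 0" using norm_ge_zero order_trans assms(3)[of undefined] by blast
  then show "AE x in lborel. norm (f x *\<^sub>R g x) \<le> norm (M * f x)"
    by (intro AE_I2) (simp add: abs_mult mult.commute[of M] mult_left_mono assms(3))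
qed

lemma conv_commute:
  fixes \<eta> f :: "'a::euclidean_space \<Rightarrow> real"
  assumes [measurable]: "\<eta> \<in> borel_measurable borel" "f \<in> borel_measurable borel"
  shows "conv \<eta> f = conv f \<eta>"
proof
  fix x
  have "conv \<eta> f x = (\<integral>y. \<eta> (x - (x - y)) *\<^sub>R f (x - y) \<partial>lborel)"
    unfolding conv_def by (subst integral_reflect[where x=x]) auto
  then show "conv \<eta> f x = conv f \<eta> x" by (simp add: conv_def mult.commute)
qed

text \<open>The uniform remainder of \<open>\<eta>\<close> is integrated against \<open>\<bar>u\<bar>\<close>, so integrability of \<open>u\<close> suffices.\<close>
lemma C1_conv:
  fixes u :: "'a::euclidean_space \<Rightarrow> real"
  assumes C: "C1 \<eta> g" and z: "\<And>x. x \<notin> cball c r \<Longrightarrow> \<eta> x = 0" and u: "integrable lborel u"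
  shows "C1 (conv \<eta> u) (\<lambda>x. \<integral>y. u y *\<^sub>R g (x - y) \<partial>lborel)"
proof -
  have g: "continuous_on UNIV g" using C by (simp add: C1_def)
  have \<eta>: "continuous_on UNIV \<eta>" by (rule C1_continuous[OF C])
  have gz: "x \<notin> cball c r \<Longrightarrow> g x = 0" for x by (rule C1_zero_outside_cball[OF C z])
  have [measurable]: "\<eta> \<in> borel_measurable borel" "g \<in> borel_measurable borel"
    using \<eta> g by (auto intro: borel_measurable_continuous_onI)
  have [measurable]: "u \<in> borel_measurable borel" using borel_measurable_integrable[OF u] by simp
  obtain M1 where M1: "\<And>x. \<bar>\<eta> x\<bar> \<le> M1" using bounded_if_zero_outside_cball[OF \<eta> z] by (metis real_norm_def)
  obtain M2 where M2: "\<And>x. norm (g x) \<le> M2" using bounded_if_zero_outside_cball[OF g gz] by metis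
  have i1: "integrable lborel (\<lambda>y. \<eta> (x - y) * u y)" for x
    using integrable_bounded_scaleR[OF u, of "\<lambda>y. \<eta> (x - y)" M1] M1 by simp
  have i2: "integrable lborel (\<lambda>y. u y *\<^sub>R g (x - y))" for x
    using integrable_scaleR_bounded[OF u, of "\<lambda>y. g (x - y)" M2] M2 by simp
  define N where "N = (\<integral>y. \<bar>u y\<bar> \<partial>lborel)"
  have N0: "N \<ge> 0" by (simp add: N_def)
  have "GDERIV (conv \<eta> u) x :> (\<integral>y. u y *\<^sub>R g (x - y) \<partial>lborel)" for x
    unfolding gderiv_def has_derivative_at_alt
  proof (intro conjI allI impI)
    show "bounded_linear (\<lambda>h. h \<bullet> (\<integral>y. u y *\<^sub>R g (x - y) \<partial>lborel))"
      by (rule bounded_linear_inner_left)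
    fix e :: real assume "e > 0"
    then have e': "e / (N + 1) > 0" using N0 by simp
    obtain d where d: "d > 0" "\<And>x h. norm h < d \<Longrightarrow> \<bar>\<eta> (x + h) - \<eta> x - h \<bullet> g x\<bar> \<le> e / (N + 1) * norm h"
      using C1_uniform_remainder[OF C z e'] by blast
    have "norm (conv \<eta> u y - conv \<eta> u x - (y - x) \<bullet> (\<integral>y. u y *\<^sub>R g (x - y) \<partial>lborel)) \<le> e * norm (y - x)"
      if y: "norm (y - x) < d" for y
    proof -
      define h where "h = y - x"
      have "conv \<eta> u y - conv \<eta> u x - (y - x) \<bullet> (\<integral>y. u y *\<^sub>R g (x - y) \<partial>lborel)
          = (\<integral>w. \<eta> (y - w) * u w - \<eta> (x - w) * u w - h \<bullet> (u w *\<^sub>R g (x - w)) \<partial>lborel)"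
      proof -
        have "h \<bullet> (\<integral>y. u y *\<^sub>R g (x - y) \<partial>lborel) = (\<integral>y. h \<bullet> (u y *\<^sub>R g (x - y)) \<partial>lborel)"
          by (rule integral_inner_right[symmetric]) (rule i2)
        moreover have "integrable lborel (\<lambda>y. h \<bullet> (u y *\<^sub>R g (x - y)))"
          by (rule integrable_inner_right) (rule i2)
        ultimately show ?thesis
          unfolding conv_def h_def using i1 by simp
      qed
      also have "norm \<dots> \<le> (\<integral>w. \<bar>u w\<bar> * (e / (N + 1) * norm h) \<partial>lborel)"
      proof (rule Bochner_Integration.integral_norm_bound_integral)
        show "integrable lborel (\<lambda>w. \<eta> (y - w) * u w - \<eta> (x - w) * u w - h \<bullet> (u w *\<^sub>R g (x - w)))"
          using i1 i2 by (intro Bochner_Integration.integrable_diff integrable_inner_right) auto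
        show "integrable lborel (\<lambda>w. \<bar>u w\<bar> * (e / (N + 1) * norm h))" using u by simp
        fix w
        have "\<eta> (y - w) * u w - \<eta> (x - w) * u w - h \<bullet> (u w *\<^sub>R g (x - w))
            = u w * (\<eta> ((x - w) + h) - \<eta> (x - w) - h \<bullet> g (x - w))"
          by (simp add: h_def algebra_simps)
        then have "norm (\<eta> (y - w) * u w - \<eta> (x - w) * u w - h \<bullet> (u w *\<^sub>R g (x - w)))
            = \<bar>u w\<bar> * \<bar>\<eta> ((x - w) + h) - \<eta> (x - w) - h \<bullet> g (x - w)\<bar>"
          by (simp add: abs_mult)
        also have "\<dots> \<le> \<bar>u w\<bar> * (e / (N + 1) * norm h)"
          by (rule mult_left_mono[OF d(2)]) (use y h_def in auto)
        finally show "norm (\<eta> (y - w) * u w - \<eta> (x - w) * u w - h \<bullet> (u w *\<^sub>R g (x - w)))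
            \<le> \<bar>u w\<bar> * (e / (N + 1) * norm h)" .
      qed
      also have "\<dots> = N / (N + 1) * (e * norm h)" by (simp add: N_def)
      also have "\<dots> \<le> 1 * (e * norm h)"
        using N0 \<open>e > 0\<close> by (intro mult_right_mono) auto
      finally show ?thesis by (simp add: h_def)
    qed
    then show "\<exists>d>0. \<forall>y. norm (y - x) < d \<longrightarrow>
        norm (conv \<eta> u y - conv \<eta> u x - (y - x) \<bullet> (\<integral>y. u y *\<^sub>R g (x - y) \<partial>lborel)) \<le> e * norm (y - x)"
      using d(1) by blast
  qed
  moreover have "continuous_on UNIV (\<lambda>x. \<integral>y. u y *\<^sub>R g (x - y) \<partial>lborel)"
    unfolding continuous_on_iff
  proof (intro ballI allI impI)
    fix x and e :: real assume "e > 0"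
    then have e': "e / (N + 1) > 0" using N0 by simp
    obtain d where d: "d > 0" "\<And>x h. norm h < d \<Longrightarrow> norm (g (x + h) - g x) \<le> e / (N + 1)"
      using uniformly_continuous_if_zero_outside_cball[OF g gz e'] by blast
    have "dist (\<integral>w. u w *\<^sub>R g (y - w) \<partial>lborel) (\<integral>w. u w *\<^sub>R g (x - w) \<partial>lborel) < e"
      if y: "dist y x < d" for y
    proof -
      have "(\<integral>w. u w *\<^sub>R g (y - w) \<partial>lborel) - (\<integral>w. u w *\<^sub>R g (x - w) \<partial>lborel)
          = (\<integral>w. u w *\<^sub>R g (y - w) - u w *\<^sub>R g (x - w) \<partial>lborel)"
        using i2 by simp
      also have "norm \<dots> \<le> (\<integral>w. \<bar>u w\<bar> * (e / (N + 1)) \<partial>lborel)"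
      proof (rule Bochner_Integration.integral_norm_bound_integral)
        show "integrable lborel (\<lambda>w. u w *\<^sub>R g (y - w) - u w *\<^sub>R g (x - w))" using i2 by simp
        show "integrable lborel (\<lambda>w. \<bar>u w\<bar> * (e / (N + 1)))" using u by simp
        fix w
        have "norm (u w *\<^sub>R g (y - w) - u w *\<^sub>R g (x - w)) = \<bar>u w\<bar> * norm (g ((x - w) + (y - x)) - g (x - w))"
          by (simp add: algebra_simps flip: scaleR_diff_right)
        also have "\<dots> \<le> \<bar>u w\<bar> * (e / (N + 1))"
          by (rule mult_left_mono[OF d(2)]) (use y in \<open>auto simp: dist_norm\<close>)
        finally show "norm (u w *\<^sub>R g (y - w) - u w *\<^sub>R g (x - w)) \<le> \<bar>u w\<bar> * (e / (N + 1))" .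
      qed
      also have "\<dots> = e * (N / (N + 1))" by (simp add: N_def)
      also have "\<dots> < e * 1" using \<open>e > 0\<close> N0 by (intro mult_strict_left_mono) auto
      finally show ?thesis by (simp add: dist_norm)
    qed
    then show "\<exists>d>0. \<forall>x'\<in>UNIV. dist x' x < d \<longrightarrow>
        dist (\<integral>w. u w *\<^sub>R g (x' - w) \<partial>lborel) (\<integral>w. u w *\<^sub>R g (x - w) \<partial>lborel) < e"
      using d(1) by blast
  qed
  ultimately show ?thesis by (simp add: C1_def)
qed

text \<open>Directional derivatives fall on the kernel, whose directional derivatives are again smooth and vanish
  outside the same ball; so the claim follows by induction on the number of derivatives.\<close>
lemma smooth_conv:
  fixes u :: "'a::euclidean_space \<Rightarrow> real"
  assumes "smooth \<eta>" and "\<And>x. x \<notin> cball c r \<Longrightarrow> \<eta> x = 0" and u: "integrable lborel u"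
  shows "smooth (conv \<eta> u)"
proof -
  have diff: "conv \<eta> u differentiable (at x)"
    if "smooth \<eta>" "\<And>x. x \<notin> cball c r \<Longrightarrow> \<eta> x = 0" for \<eta> :: "'a \<Rightarrow> real" and x
    using C1_conv[OF smooth_C1[OF that(1)] that(2) u]
    by (force simp: C1_def gderiv_def differentiable_def)
  have "\<forall>x. iter_dir_deriv vs (conv \<eta> u) differentiable (at x)" for vs
    using assms(1,2)
  proof (induction vs arbitrary: \<eta>)
    case Nil
    then show ?case using diff by simp
  next
    case (Cons v vs)
    let ?g = "gradient \<eta>"
    have C: "C1 \<eta> ?g" by (rule smooth_C1[OF Cons.prems(1)])
    have fd: "frechet_derivative \<eta> (at x) v = v \<bullet> ?g x" for x
      using C unfolding C1_def gderiv_def by (metis frechet_derivative_at)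
    have g: "continuous_on UNIV ?g" using C by (simp add: C1_def)
    have gz: "x \<notin> cball c r \<Longrightarrow> ?g x = 0" for x
      by (rule C1_zero_outside_cball[OF C Cons.prems(2)])
    have [measurable]: "?g \<in> borel_measurable borel" using g by (rule borel_measurable_continuous_onI)
    obtain M2 where M2: "\<And>x. norm (?g x) \<le> M2" using bounded_if_zero_outside_cball[OF g gz] by metis
    have i2: "integrable lborel (\<lambda>y. u y *\<^sub>R ?g (x - y))" for x
      using integrable_scaleR_bounded[OF u, of "\<lambda>y. ?g (x - y)" M2] M2 by simp
    have "frechet_derivative (conv \<eta> u) (at x) v = conv (\<lambda>x. frechet_derivative \<eta> (at x) v) u x" for x
    proof -
      have "(conv \<eta> u has_derivative (\<lambda>h. h \<bullet> (\<integral>y. u y *\<^sub>R ?g (x - y) \<partial>lborel))) (at x)"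
        using C1_conv[OF C Cons.prems(2) u] by (simp add: C1_def gderiv_def)
      then have "frechet_derivative (conv \<eta> u) (at x) v = v \<bullet> (\<integral>y. u y *\<^sub>R ?g (x - y) \<partial>lborel)"
        using frechet_derivative_at by metis
      also have "\<dots> = (\<integral>y. v \<bullet> (u y *\<^sub>R ?g (x - y)) \<partial>lborel)"
        by (rule integral_inner_right[symmetric]) (rule i2)
      finally show ?thesis by (simp add: conv_def fd mult.commute)
    qed
    then have "(\<lambda>x. frechet_derivative (conv \<eta> u) (at x) v) = conv (\<lambda>x. frechet_derivative \<eta> (at x) v) u"
      by blast
    moreover have "\<forall>x. iter_dir_deriv vs (conv (\<lambda>x. frechet_derivative \<eta> (at x) v) u) differentiable (at x)"
    proof (rule Cons.IH)
      show "smooth (\<lambda>x. frechet_derivative \<eta> (at x) v)" by (rule smooth_dir_deriv[OF Cons.prems(1)])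
      show "frechet_derivative \<eta> (at x) v = 0" if "x \<notin> cball c r" for x
        using gz[OF that] fd by simp
    qed
    ultimately show ?case by simp
  qed
  then show ?thesis by (simp add: smooth_def)
qed

lemma conv_zero_outside:
  assumes "\<And>x. x \<notin> cball 0 e \<Longrightarrow> \<eta> x = 0" "\<And>x. x \<notin> cball c r \<Longrightarrow> f x = 0" "x \<notin> cball c (r + e)"
  shows "conv \<eta> f x = 0"
proof -
  have "\<eta> (x - y) *\<^sub>R f y = 0" for y
  proof (rule ccontr)
    assume "\<eta> (x - y) *\<^sub>R f y \<noteq> 0"
    then have "x - y \<in> cball 0 e" "y \<in> cball c r" using assms(1,2) by fastforce+
    then have "dist c x \<le> r + e"
      using dist_triangle[of c x y] by (simp add: dist_norm norm_minus_commute)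
    with assms(3) show False by simp
  qed
  then have "(\<lambda>y. \<eta> (x - y) *\<^sub>R f y) = (\<lambda>y. 0)" by blast
  then show ?thesis by (simp add: conv_def)
qed

definition unit_kernel :: "real \<Rightarrow> ('a::euclidean_space \<Rightarrow> real) \<Rightarrow> bool" where
  "unit_kernel e \<eta> \<longleftrightarrow> (\<forall>x. \<eta> x \<ge> 0) \<and> (\<forall>x. x \<notin> cball 0 e \<longrightarrow> \<eta> x = 0) \<and> (\<integral>x. \<eta> x \<partial>lborel) = 1 \<and>
     continuous_on UNIV \<eta>"

definition mollifier :: "real \<Rightarrow> 'a::euclidean_space \<Rightarrow> real" where
  "mollifier e x = bump_profile 0 (e\<^sup>2 - x \<bullet> x) / (\<integral>y. bump_profile 0 (e\<^sup>2 - (y::'a) \<bullet> y) \<partial>lborel)"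

lemma smooth_mollifier_translate: "smooth (\<lambda>y::'a::euclidean_space. mollifier e (x - y))" "smooth (\<lambda>y::'a::euclidean_space. mollifier e y)"
proof -
  have "(\<lambda>y. bump_profile 0 (e\<^sup>2 - (y - x) \<bullet> (y - x)) * inverse (\<integral>y. bump_profile 0 (e\<^sup>2 - (y::'a) \<bullet> y) \<partial>lborel))
      \<in> bump_algebra" for x :: 'a
    by (intro bump_algebra.intros)
  from bump_algebra_smooth[OF this[of x]] bump_algebra_smooth[OF this[of 0]]
  show "smooth (\<lambda>y::'a::euclidean_space. mollifier e (x - y))" "smooth (\<lambda>y::'a. mollifier e y)"
    by (simp_all add: mollifier_def field_simps inner_diff_left inner_diff_right inner_commute)
qed

lemma unit_kernel_mollifier:
  assumes "e > 0"
  shows "unit_kernel e (mollifier e :: 'a::euclidean_space \<Rightarrow> real)"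
proof -
  let ?b = "\<lambda>x::'a. bump_profile 0 (e\<^sup>2 - x \<bullet> x)"
  have pos: "norm x < e \<longleftrightarrow> e\<^sup>2 - x \<bullet> x > 0" for x :: 'a
    unfolding power2_norm_eq_inner[symmetric] using assms
    by (metis diff_gt_0_iff_gt less_eq_real_def norm_ge_zero power2_less_imp_less power_strict_mono zero_less_numeral)
  have z: "?b x = 0" if "\<not> norm x < e" for x
    using that pos[of x] by (simp add: bump_profile_def)
  have c: "continuous_on UNIV ?b"
  proof -
    have "?b \<in> bump_algebra" using bump_algebra.bump[of 0 "e\<^sup>2" 0] by simp
    then show ?thesis using C1_continuous smooth_C1 bump_algebra_smooth by blast
  qed
  have i: "integrable lborel ?b"
    by (rule integrable_continuous_zero_outside_cball[OF c, of 0 e]) (use z in auto)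
  have nz: "(\<integral>x. ?b x \<partial>lborel) \<noteq> 0"
  proof
    assume "(\<integral>x. ?b x \<partial>lborel) = 0"
    then have "AE x in lborel. ?b x = 0"
      using integral_nonneg_eq_0_iff_AE[OF i] bump_profile_nonneg by auto
    then have "AE x in lborel. x \<notin> ball (0::'a) e"
      by eventually_elim (use pos in \<open>auto simp: bump_profile_def\<close>)
    then have "emeasure lborel (ball (0::'a) e) = 0"
      by (subst (asm) AE_iff_measurable[of "ball 0 e"]) auto
    then show False using content_ball_pos[OF assms, of "0::'a"] by (simp add: measure_def)
  qed
  moreover have "(\<integral>x. ?b x \<partial>lborel) \<ge> 0" using bump_profile_nonneg by (simp add: integral_nonneg)
  ultimately show ?thesis
    unfolding unit_kernel_def mollifier_def using z c
    by (auto simp: bump_profile_nonneg intro!: continuous_intros)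
qed

lemma unit_kernel_integrable:
  assumes "unit_kernel e \<eta>"
  shows "integrable lborel \<eta>"
proof (rule integrable_continuous_zero_outside_cball)
  show "continuous_on UNIV \<eta>" "\<And>x. x \<notin> cball 0 e \<Longrightarrow> \<eta> x = 0"
    using assms by (auto simp: unit_kernel_def)
qed

lemma unit_kernel_measurable: "unit_kernel e \<eta> \<Longrightarrow> \<eta> \<in> borel_measurable borel"
  unfolding unit_kernel_def by (auto intro: borel_measurable_continuous_onI)

lemma conv_kernel_uniform:
  fixes f :: "'a::euclidean_space \<Rightarrow> 'b::euclidean_space" and \<eta> :: "'a \<Rightarrow> real"
  assumes k: "unit_kernel e \<eta>" and [measurable]: "f \<in> borel_measurable borel" and b: "\<And>x. norm (f x) \<le> M"
    and d: "\<And>h. norm h \<le> e \<Longrightarrow> norm (f (x + h) - f x) \<le> d"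
  shows "norm (conv \<eta> f x - f x) \<le> d"
proof -
  have [measurable]: "\<eta> \<in> borel_measurable borel" by (rule unit_kernel_measurable[OF k])
  have i\<eta>: "integrable lborel (\<lambda>y. \<eta> (x - y))"
    by (subst integrable_reflect) (auto intro: unit_kernel_integrable[OF k])
  have one: "(\<integral>y. \<eta> (x - y) \<partial>lborel) = 1"
    using k by (subst integral_reflect) (auto simp: unit_kernel_def)
  have i: "integrable lborel (\<lambda>y. \<eta> (x - y) *\<^sub>R f y)"
    by (rule integrable_scaleR_bounded[OF i\<eta> _ b]) simp
  have "conv \<eta> f x - f x = (\<integral>y. \<eta> (x - y) *\<^sub>R f y \<partial>lborel) - (\<integral>y. \<eta> (x - y) *\<^sub>R f x \<partial>lborel)"
    using i\<eta> by (simp add: conv_def one)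
  also have "\<dots> = (\<integral>y. \<eta> (x - y) *\<^sub>R f y - \<eta> (x - y) *\<^sub>R f x \<partial>lborel)"
    by (rule Bochner_Integration.integral_diff[symmetric]) (use i i\<eta> in auto)
  also have "norm \<dots> \<le> (\<integral>y. \<eta> (x - y) * d \<partial>lborel)"
  proof (rule Bochner_Integration.integral_norm_bound_integral)
    show "integrable lborel (\<lambda>y. \<eta> (x - y) *\<^sub>R f y - \<eta> (x - y) *\<^sub>R f x)" using i i\<eta> by simp
    show "integrable lborel (\<lambda>y. \<eta> (x - y) * d)" using i\<eta> by simp
    fix y
    have "norm (\<eta> (x - y) *\<^sub>R f y - \<eta> (x - y) *\<^sub>R f x) = \<eta> (x - y) * norm (f y - f x)"
      using k by (simp add: unit_kernel_def flip: scaleR_diff_right)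
    also have "\<dots> \<le> \<eta> (x - y) * d"
    proof (cases "x - y \<in> cball 0 e")
      case True
      then have "norm (f (x + (y - x)) - f x) \<le> d" by (intro d) (simp add: norm_minus_commute)
      then show ?thesis using k by (intro mult_left_mono) (auto simp: unit_kernel_def)
    next
      case False
      then show ?thesis using k by (simp add: unit_kernel_def)
    qed
    finally show "norm (\<eta> (x - y) *\<^sub>R f y - \<eta> (x - y) *\<^sub>R f x) \<le> \<eta> (x - y) * d" .
  qed
  also have "\<dots> = d" using one by simp
  finally show ?thesis .
qed

section \<open>Continuity of translations in L1\<close>

text \<open>The positive part of \<open>1\<^sub>U - 1\<^sub>U(\<cdot> - z\<^sub>n)\<close> is dominated by \<open>1\<^sub>U\<close> and tends to zero pointwise because \<open>U\<close>
  is open. Since both indicators have the same integral, the negative part has the same integral as the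
  positive part (Scheffe's argument).\<close>
lemma L1_translation_open:
  fixes U :: "'a::euclidean_space set"
  assumes "open U" "emeasure lborel U < \<infinity>" "z \<longlonglongrightarrow> 0"
  shows "(\<lambda>n. \<integral>x. \<bar>indicator U (x - z n) - indicator U x :: real\<bar> \<partial>lborel) \<longlonglongrightarrow> 0"
proof -
  have [measurable]: "U \<in> sets borel" using assms(1) by simp
  have iU: "integrable lborel (indicator U :: 'a \<Rightarrow> real)"
    using assms(2) by (simp add: integrable_indicator_iff)
  have iUz: "integrable lborel (\<lambda>x. indicator U (x - z n) :: real)" for n
    using integrable_translate[of "indicator U :: 'a \<Rightarrow> real" "- z n"] iU by simp
  have eq: "(\<integral>x. indicator U (x - z n) \<partial>lborel) = (\<integral>x. (indicator U x :: real) \<partial>lborel)" for n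
    using integral_translate[of "indicator U :: 'a \<Rightarrow> real" "- z n"] by simp
  define h where "h n x = max 0 (indicator U x - indicator U (x - z n) :: real)" for n x
  have ih: "integrable lborel (h n)" for n
    unfolding h_def[abs_def] using iU iUz by (intro integrable_max) auto
  have "(\<lambda>n. \<integral>x. h n x \<partial>lborel) \<longlonglongrightarrow> (\<integral>x. 0 \<partial>(lborel :: 'a measure))"
  proof (rule integral_dominated_convergence[OF _ _ iU])
    show "h n \<in> borel_measurable lborel" for n using ih by auto
    show "AE x in lborel. norm (h n x) \<le> indicator U x" for n
      by (auto simp: h_def indicator_def)
    show "AE x in lborel. (\<lambda>n. h n x) \<longlonglongrightarrow> 0"
    proof (rule AE_I2)
      fix x
      show "(\<lambda>n. h n x) \<longlonglongrightarrow> 0"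
      proof (cases "x \<in> U")
        case True
        have "(\<lambda>n. x - z n) \<longlonglongrightarrow> x - 0" by (intro tendsto_intros assms)
        then have "\<forall>\<^sub>F n in sequentially. x - z n \<in> U"
          using True assms(1) topological_tendstoD by fastforce
        then have "\<forall>\<^sub>F n in sequentially. h n x = 0"
          by eventually_elim (auto simp: h_def True)
        then show ?thesis by (rule tendsto_eventually)
      next
        case False
        then show ?thesis by (simp add: h_def indicator_def)
      qed
    qed
  qed simp
  moreover have "(\<integral>x. \<bar>indicator U (x - z n) - indicator U x :: real\<bar> \<partial>lborel) = 2 * (\<integral>x. h n x \<partial>lborel)" for n
  proof -
    have "(\<integral>x. \<bar>indicator U (x - z n) - indicator U x :: real\<bar> \<partial>lborel)
        = (\<integral>x. 2 * h n x + (indicator U (x - z n) - indicator U x) \<partial>lborel)"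
      by (intro Bochner_Integration.integral_cong) (auto simp: h_def max_def indicator_def)
    also have "\<dots> = 2 * (\<integral>x. h n x \<partial>lborel)"
      using ih iU iUz eq by simp
    finally show ?thesis .
  qed
  ultimately show ?thesis by (auto intro!: tendsto_mult_right_zero)
qed

text \<open>Indicators of measurable sets are reduced to open sets by outer regularity; simple functions and
  limits in mean follow because translation is an isometry.\<close>
lemma L1_translation:
  fixes f :: "'a::euclidean_space \<Rightarrow> 'b::euclidean_space"
  assumes "integrable lborel f" "z \<longlonglongrightarrow> 0"
  shows "(\<lambda>n. \<integral>x. norm (f (x - z n) - f x) \<partial>lborel) \<longlonglongrightarrow> 0"
proof -
  have tr: "integrable lborel (\<lambda>x. f (x - w))" "(\<integral>x. norm (f (x - w)) \<partial>lborel) = (\<integral>x. norm (f x) \<partial>lborel)"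
    if "integrable lborel f" for f :: "'a \<Rightarrow> 'b" and w
    using that integrable_translate[of f "- w"] integral_translate[of "\<lambda>x. norm (f x)" "- w"]
      borel_measurable_integrable[OF that] by auto
  show ?thesis using assms(1)
  proof (induction rule: integrable_induct)
    case (base A c)
    have [measurable]: "A \<in> sets borel" using base(1) by simp
    have "(\<lambda>n. \<integral>x. \<bar>indicator A (x - z n) - indicator A x :: real\<bar> \<partial>lborel) \<longlonglongrightarrow> 0"
    proof (rule LIMSEQ_I)
      fix e :: real assume "e > 0"
      obtain U where U: "open U" "A \<subseteq> U" "emeasure lborel (U - A) < ennreal (e / 3)"
        using outer_regular_lborel[of A "e / 3"] \<open>e > 0\<close> by auto
      have [measurable]: "U \<in> sets borel" using U(1) by simp
      have "emeasure lborel U = emeasure lborel A + emeasure lborel (U - A)"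
        by (subst plus_emeasure) (use U in \<open>auto simp: Un_absorb1\<close>)
      also have "\<dots> < \<infinity>"
        using base(2) less_trans[OF U(3) ennreal_less_top] by (simp add: less_top)
      finally have finU: "emeasure lborel U < \<infinity>" .
      have iD: "integrable lborel (indicator (U - A) :: 'a \<Rightarrow> real)"
        using less_trans[OF U(3) ennreal_less_top] by (simp add: integrable_indicator_iff)
      have iA: "integrable lborel (indicator A :: 'a \<Rightarrow> real)"
        using base(2) by (simp add: integrable_indicator_iff)
      have iU: "integrable lborel (indicator U :: 'a \<Rightarrow> real)"
        using finU by (simp add: integrable_indicator_iff)
      have mD: "(\<integral>x. (indicator (U - A) x :: real) \<partial>lborel) < e / 3"
      proof -
        have "ennreal (measure lborel (U - A)) < ennreal (e / 3)"
          using U(3) less_trans[OF U(3) ennreal_less_top]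
          by (simp add: emeasure_eq_ennreal_measure[symmetric] less_top)
        then have "measure lborel (U - A) < e / 3" by (simp add: ennreal_less_iff)
        then show ?thesis by simp
      qed
      have sh: "integrable lborel (\<lambda>x. indicator B (x - z n) :: real)"
        "(\<integral>x. indicator B (x - z n) \<partial>lborel) = (\<integral>x. (indicator B x :: real) \<partial>lborel)"
        if "integrable lborel (indicator B :: 'a \<Rightarrow> real)" "B \<in> sets borel" for B n
        using that integrable_translate[of "indicator B :: 'a \<Rightarrow> real" "- z n"]
          integral_translate[of "indicator B :: 'a \<Rightarrow> real" "- z n"] by auto
      have "\<forall>\<^sub>F n in sequentially. (\<integral>x. \<bar>indicator U (x - z n) - indicator U x :: real\<bar> \<partial>lborel) < e / 3"
        using L1_translation_open[OF U(1) finU assms(2)] \<open>e > 0\<close> by (intro order_tendstoD) auto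
      then have "\<forall>\<^sub>F n in sequentially. (\<integral>x. \<bar>indicator A (x - z n) - indicator A x :: real\<bar> \<partial>lborel) < e"
      proof eventually_elim
        case (elim n)
        have "(\<integral>x. \<bar>indicator A (x - z n) - indicator A x :: real\<bar> \<partial>lborel)
          \<le> (\<integral>x. \<bar>indicator U (x - z n) - indicator U x :: real\<bar> + (indicator (U - A) (x - z n) + indicator (U - A) x) \<partial>lborel)"
        proof (rule integral_mono)
          show "integrable lborel (\<lambda>x. \<bar>indicator A (x - z n) - indicator A x :: real\<bar>)"
            by (intro integrable_abs Bochner_Integration.integrable_diff sh iA) simp
          show "integrable lborel (\<lambda>x. \<bar>indicator U (x - z n) - indicator U x :: real\<bar>
              + (indicator (U - A) (x - z n) + indicator (U - A) x))"
            by (intro Bochner_Integration.integrable_add integrable_abs Bochner_Integration.integrable_diff sh iU iD) auto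
          show "\<bar>indicator A (x - z n) - indicator A x :: real\<bar>
              \<le> \<bar>indicator U (x - z n) - indicator U x\<bar> + (indicator (U - A) (x - z n) + indicator (U - A) x)" for x
            using U(2) by (auto simp: indicator_def)
        qed
        also have "\<dots> = (\<integral>x. \<bar>indicator U (x - z n) - indicator U x :: real\<bar> \<partial>lborel)
            + ((\<integral>x. indicator (U - A) (x - z n) \<partial>lborel) + (\<integral>x. indicator (U - A) x \<partial>lborel))"
        proof -
          have "integrable lborel (\<lambda>x. indicator U (x - z n) :: real)"
            "integrable lborel (\<lambda>x. indicator (U - A) (x - z n) :: real)"
            by (intro sh iU iD; simp)+
          then show ?thesis using iU iD by simp
        qed
        also have "(\<integral>x. indicator (U - A) (x - z n) \<partial>lborel) = (\<integral>x. (indicator (U - A) x :: real) \<partial>lborel)"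
          using sh(2)[OF iD] by simp
        finally show ?case using elim mD by linarith
      qed
      then show "\<exists>no. \<forall>n\<ge>no. norm ((\<integral>x. \<bar>indicator A (x - z n) - indicator A x :: real\<bar> \<partial>lborel) - 0) < e"
        by (simp add: eventually_sequentially)
    qed
    then have "(\<lambda>n. (\<integral>x. \<bar>indicator A (x - z n) - indicator A x :: real\<bar> \<partial>lborel) * norm c) \<longlonglongrightarrow> 0"
      by (rule tendsto_mult_left_zero)
    then show ?case by (simp flip: scaleR_diff_left)
  next
    case (add f g)
    show ?case
    proof (rule Lim_null_comparison)
      show "(\<lambda>n. (\<integral>x. norm (f (x - z n) - f x) \<partial>lborel) + (\<integral>x. norm (g (x - z n) - g x) \<partial>lborel)) \<longlonglongrightarrow> 0"
        using add by (auto intro!: tendsto_add_zero)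
      have "(\<integral>x. norm (f (x - z n) + g (x - z n) - (f x + g x)) \<partial>lborel)
          \<le> (\<integral>x. norm (f (x - z n) - f x) + norm (g (x - z n) - g x) \<partial>lborel)" for n
        by (rule integral_mono)
           (use add tr in \<open>auto intro!: norm_diff_triangle_ineq Bochner_Integration.integrable_add Bochner_Integration.integrable_diff integrable_norm\<close>)
      also have "(\<integral>x. norm (f (x - z n) - f x) + norm (g (x - z n) - g x) \<partial>lborel)
          = (\<integral>x. norm (f (x - z n) - f x) \<partial>lborel) + (\<integral>x. norm (g (x - z n) - g x) \<partial>lborel)" for n
        by (rule Bochner_Integration.integral_add)
           (use add tr in \<open>auto intro!: Bochner_Integration.integrable_diff integrable_norm\<close>)
      finally show "\<forall>\<^sub>F n in sequentially. norm (\<integral>x. norm (f (x - z n) + g (x - z n) - (f x + g x)) \<partial>lborel)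
          \<le> (\<integral>x. norm (f (x - z n) - f x) \<partial>lborel) + (\<integral>x. norm (g (x - z n) - g x) \<partial>lborel)"
        by (intro eventuallyI) simp
    qed
  next
    case (lim f s)
    have [measurable]: "f \<in> borel_measurable borel" "s i \<in> borel_measurable borel" for i
      using borel_measurable_integrable[OF lim.hyps(4)] borel_measurable_integrable[OF lim.hyps(1)] by auto
    have "(\<lambda>i. \<integral>x. norm (s i x - f x) \<partial>lborel) \<longlonglongrightarrow> (\<integral>x. norm (0::'b) \<partial>(lborel :: 'a measure))"
    proof (rule integral_dominated_convergence)
      show "integrable lborel (\<lambda>x. 3 * norm (f x))" using lim by simp
      show "AE x in lborel. norm (norm (s i x - f x)) \<le> 3 * norm (f x)" for i
      proof (rule AE_I2)
        fix x
        show "norm (norm (s i x - f x)) \<le> 3 * norm (f x)"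
          using lim.hyps(3)[of x i] norm_triangle_ineq4[of "s i x" "f x"] by simp
      qed
      have "(\<lambda>i. norm (s i x - f x)) \<longlonglongrightarrow> norm (f x - f x)" for x
        by (intro tendsto_intros lim) simp
      then show "AE x in lborel. (\<lambda>i. norm (s i x - f x)) \<longlonglongrightarrow> norm (0::'b)" by simp
    qed auto
    then have L: "(\<lambda>i. \<integral>x. norm (s i x - f x) \<partial>lborel) \<longlonglongrightarrow> 0" by simp
    show ?case
    proof (rule LIMSEQ_I)
      fix e :: real assume "e > 0"
      then have "\<forall>\<^sub>F i in sequentially. (\<integral>x. norm (s i x - f x) \<partial>lborel) < e / 3"
        using L by (intro order_tendstoD) auto
      then obtain i where i: "(\<integral>x. norm (s i x - f x) \<partial>lborel) < e / 3"
        by (auto simp: eventually_sequentially)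
      have "\<forall>\<^sub>F n in sequentially. (\<integral>x. norm (s i (x - z n) - s i x) \<partial>lborel) < e / 3"
        using lim.IH[of i] \<open>e > 0\<close> by (intro order_tendstoD) auto
      then have "\<forall>\<^sub>F n in sequentially. (\<integral>x. norm (f (x - z n) - f x) \<partial>lborel) < e"
      proof eventually_elim
        case (elim n)
        have id: "integrable lborel (\<lambda>x. s i x - f x)" using lim by simp
        have "(\<integral>x. norm (f (x - z n) - f x) \<partial>lborel)
          \<le> (\<integral>x. norm (s i (x - z n) - f (x - z n)) + norm (s i (x - z n) - s i x) + norm (s i x - f x) \<partial>lborel)"
        proof (rule integral_mono)
          show "integrable lborel (\<lambda>x. norm (f (x - z n) - f x))" using lim.hyps(4) tr by simp
          show "integrable lborel (\<lambda>x. norm (s i (x - z n) - f (x - z n)) + norm (s i (x - z n) - s i x) + norm (s i x - f x))"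
            using lim.hyps(1)[of i] lim.hyps(4) tr by simp
          fix x
          show "norm (f (x - z n) - f x) \<le> norm (s i (x - z n) - f (x - z n)) + norm (s i (x - z n) - s i x) + norm (s i x - f x)"
            using norm_triangle_ineq4[of "s i (x - z n) - s i x + (s i x - f x)" "s i (x - z n) - f (x - z n)"]
              norm_triangle_ineq[of "s i (x - z n) - s i x" "s i x - f x"] by simp
        qed
        also have "\<dots> = (\<integral>x. norm (s i (x - z n) - f (x - z n)) \<partial>lborel)
            + (\<integral>x. norm (s i (x - z n) - s i x) \<partial>lborel) + (\<integral>x. norm (s i x - f x) \<partial>lborel)"
          using lim.hyps(1)[of i] lim.hyps(4) tr by simp
        also have "(\<integral>x. norm (s i (x - z n) - f (x - z n)) \<partial>lborel) = (\<integral>x. norm (s i x - f x) \<partial>lborel)"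
          using tr(2)[OF id] by simp
        finally show ?case using elim i by linarith
      qed
      then show "\<exists>no. \<forall>n\<ge>no. norm ((\<integral>x. norm (f (x - z n) - f x) \<partial>lborel) - 0) < e"
        by (simp add: eventually_sequentially)
    qed
  qed
qed

section \<open>Elementary inequalities\<close>

text \<open>The tangent line at \<open>a\<close> lies below the convex function \<open>x powr p\<close>.\<close>
lemma powr_tangent:
  fixes a x p :: real
  assumes "p > 1" "a \<ge> 0" "x \<ge> 0"
  shows "p * (a powr (p - 1) * x) \<le> x powr p + (p - 1) * a powr p"
proof -
  have "x * a powr (p - 1) \<le> x powr p / p + (a powr (p - 1)) powr (p / (p - 1)) / (p / (p - 1))"
    by (rule Youngs_inequality) (use assms in \<open>auto simp: field_simps\<close>)
  also have "(a powr (p - 1)) powr (p / (p - 1)) = a powr p"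
    using assms by (simp add: powr_powr)
  finally have "p * (x * a powr (p - 1)) \<le> p * (x powr p / p + a powr p / (p / (p - 1)))"
    using assms by (intro mult_left_mono) auto
  also have "\<dots> = x powr p + (p - 1) * a powr p"
    using assms by (simp add: field_simps)
  finally show ?thesis by (simp add: mult.commute)
qed

lemma powr_mult_le:
  fixes a b p :: real
  assumes "p \<ge> 1" "a \<ge> 0" "b \<ge> 0"
  shows "a powr (p - 1) * b \<le> a powr p + b powr p"
proof -
  have e: "x powr (p - 1) * x = x powr p" if "x \<ge> 0" for x :: real
    using that by (cases "x = 0") (auto simp: powr_diff)
  have "a powr (p - 1) * b \<le> max a b powr (p - 1) * max a b"
    by (intro mult_mono powr_mono2) (use assms in auto)
  also have "\<dots> = max a b powr p" using assms by (intro e) auto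
  also have "\<dots> \<le> a powr p + b powr p" by (auto simp: max_def)
  finally show ?thesis .
qed

lemma powr_add_le:
  fixes a b p :: real
  assumes "p \<ge> 0" "a \<ge> 0" "b \<ge> 0"
  shows "(a + b) powr p \<le> 2 powr p * (a powr p + b powr p)"
proof -
  have "(a + b) powr p \<le> (2 * max a b) powr p" by (intro powr_mono2) (use assms in auto)
  also have "\<dots> = 2 powr p * max a b powr p" using assms by (simp add: powr_mult)
  also have "\<dots> \<le> 2 powr p * (a powr p + b powr p)" by (intro mult_left_mono) (auto simp: max_def)
  finally show ?thesis .
qed

lemma le_one_plus_powr:
  fixes x p :: real
  assumes "p \<ge> 1" "x \<ge> 0"
  shows "x \<le> 1 + x powr p"
proof (cases "x \<le> 1")
  case False
  then have "x powr 1 \<le> x powr p" using assms by (intro powr_mono) auto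
  then show ?thesis using False by simp
qed (use assms in \<open>auto intro: add_increasing2\<close>)

text \<open>Integrate the tangent at the mean value \<open>\<integral> w g\<close> against the probability density \<open>w\<close>.\<close>
lemma jensen_powr:
  fixes w g :: "'a \<Rightarrow> real"
  assumes p: "p > 1" and w: "\<And>x. w x \<ge> 0" "integrable M w" "(\<integral>x. w x \<partial>M) = 1"
    and g: "\<And>x. g x \<ge> 0" "integrable M (\<lambda>x. w x * g x)" "integrable M (\<lambda>x. w x * g x powr p)"
  shows "(\<integral>x. w x * g x \<partial>M) powr p \<le> (\<integral>x. w x * g x powr p \<partial>M)"
proof -
  define a where "a = (\<integral>x. w x * g x \<partial>M)"
  have a: "a \<ge> 0" unfolding a_def using w g by (auto intro: integral_nonneg)
  have "(\<integral>x. p * a powr (p - 1) * (w x * g x) \<partial>M) \<le> (\<integral>x. w x * g x powr p + (p - 1) * a powr p * w x \<partial>M)"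
  proof (rule integral_mono)
    show "integrable M (\<lambda>x. p * a powr (p - 1) * (w x * g x))" using g by simp
    show "integrable M (\<lambda>x. w x * g x powr p + (p - 1) * a powr p * w x)" using g w by simp
    fix x
    have "w x * (p * (a powr (p - 1) * g x)) \<le> w x * (g x powr p + (p - 1) * a powr p)"
      by (intro mult_left_mono powr_tangent) (use p a g w in auto)
    then show "p * a powr (p - 1) * (w x * g x) \<le> w x * g x powr p + (p - 1) * a powr p * w x"
      by (simp add: algebra_simps)
  qed
  then have "p * (a powr (p - 1) * a) \<le> (\<integral>x. w x * g x powr p \<partial>M) + (p - 1) * a powr p"
    using w g by (simp add: a_def mult.assoc)
  moreover have "a powr (p - 1) * a = a powr p"
    using a by (cases "a = 0") (auto simp: powr_diff)
  ultimately have "p * a powr p \<le> (\<integral>x. w x * g x powr p \<partial>M) + (p - 1) * a powr p" by simp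
  then show ?thesis unfolding a_def[symmetric] by (simp add: algebra_simps)
qed

section \<open>Convergence of mollifications\<close>

lemma conv_jensen:
  fixes f :: "'a::euclidean_space \<Rightarrow> 'b::euclidean_space" and \<eta> :: "'a \<Rightarrow> real"
  assumes k: "unit_kernel e \<eta>" and p: "p > 1" and f: "integrable lborel f"
    and fp: "integrable lborel (\<lambda>x. norm (f x) powr p)"
  shows "norm (conv \<eta> f x) powr p \<le> conv \<eta> (\<lambda>y. norm (f y) powr p) x"
proof -
  have [measurable]: "\<eta> \<in> borel_measurable borel" by (rule unit_kernel_measurable[OF k])
  have k0: "\<And>x. \<eta> x \<ge> 0" and kc: "continuous_on UNIV \<eta>" and kz: "\<And>x. x \<notin> cball 0 e \<Longrightarrow> \<eta> x = 0"
    using k by (auto simp: unit_kernel_def)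
  obtain M where M: "\<And>x. \<bar>\<eta> x\<bar> \<le> M" using bounded_if_zero_outside_cball[OF kc kz] by (metis real_norm_def)
  have i: "integrable lborel (\<lambda>y. \<eta> (x - y) * norm (f y))"
    using integrable_bounded_scaleR[of "\<lambda>y. norm (f y)" "\<lambda>y. \<eta> (x - y)" M] M f by simp
  have ip: "integrable lborel (\<lambda>y. \<eta> (x - y) * norm (f y) powr p)"
    using integrable_bounded_scaleR[OF fp, of "\<lambda>y. \<eta> (x - y)" M] M by simp
  have iw: "integrable lborel (\<lambda>y. \<eta> (x - y))"
    by (subst integrable_reflect) (auto intro: unit_kernel_integrable[OF k])
  have one: "(\<integral>y. \<eta> (x - y) \<partial>lborel) = 1"
    using k by (subst integral_reflect) (auto simp: unit_kernel_def)
  have "norm (conv \<eta> f x) \<le> (\<integral>y. \<eta> (x - y) * norm (f y) \<partial>lborel)"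
    unfolding conv_def using integral_norm_bound[of lborel "\<lambda>y. \<eta> (x - y) *\<^sub>R f y"] k0 by simp
  then have "norm (conv \<eta> f x) powr p \<le> (\<integral>y. \<eta> (x - y) * norm (f y) \<partial>lborel) powr p"
    using p by (intro powr_mono2) auto
  also have "\<dots> \<le> (\<integral>y. \<eta> (x - y) * norm (f y) powr p \<partial>lborel)"
    by (rule jensen_powr) (use p k0 iw one i ip in auto)
  finally show ?thesis by (simp add: conv_def)
qed

text \<open>By Fubini the mean distance of a function from its mollification is an average of its mean distances
  from translates.\<close>
lemma conv_L1_le:
  fixes f :: "'a::euclidean_space \<Rightarrow> 'b::euclidean_space" and \<eta> :: "'a \<Rightarrow> real"
  assumes k: "unit_kernel e \<eta>" and f: "integrable lborel f"
    and d: "\<And>z. norm z \<le> e \<Longrightarrow> (\<integral>x. norm (f (x - z) - f x) \<partial>lborel) \<le> d"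
  shows "(\<integral>\<^sup>+x. norm (conv \<eta> f x - f x) \<partial>lborel) \<le> ennreal d"
proof -
  have [measurable]: "\<eta> \<in> borel_measurable borel" by (rule unit_kernel_measurable[OF k])
  have [measurable]: "f \<in> borel_measurable borel" using borel_measurable_integrable[OF f] by simp
  have k0: "\<And>x. \<eta> x \<ge> 0" and kc: "continuous_on UNIV \<eta>" and kz: "\<And>x. x \<notin> cball 0 e \<Longrightarrow> \<eta> x = 0"
    and k1: "(\<integral>x. \<eta> x \<partial>lborel) = 1"
    using k by (auto simp: unit_kernel_def)
  have ik: "integrable lborel \<eta>" by (rule unit_kernel_integrable[OF k])
  obtain M where M: "\<And>x. \<bar>\<eta> x\<bar> \<le> M" using bounded_if_zero_outside_cball[OF kc kz] by (metis real_norm_def)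
  have pt: "ennreal (norm (conv \<eta> f x - f x)) \<le> (\<integral>\<^sup>+z. ennreal (\<eta> z * norm (f (x - z) - f x)) \<partial>lborel)" for x
  proof -
    have i: "integrable lborel (\<lambda>z. \<eta> z *\<^sub>R f (x - z))"
      by (rule integrable_bounded_scaleR[OF _ _ M]) (use f in \<open>auto simp: integrable_reflect\<close>)
    have "conv \<eta> f x = (\<integral>z. \<eta> z *\<^sub>R f (x - z) \<partial>lborel)"
      unfolding conv_def using integral_reflect[of "\<lambda>y. \<eta> (x - y) *\<^sub>R f y" x] by simp
    moreover have "f x = (\<integral>z. \<eta> z *\<^sub>R f x \<partial>lborel)" using ik k1 by simp
    ultimately have "conv \<eta> f x - f x = (\<integral>z. \<eta> z *\<^sub>R f (x - z) \<partial>lborel) - (\<integral>z. \<eta> z *\<^sub>R f x \<partial>lborel)"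
      by simp
    also have "\<dots> = (\<integral>z. \<eta> z *\<^sub>R f (x - z) - \<eta> z *\<^sub>R f x \<partial>lborel)"
      by (rule Bochner_Integration.integral_diff[symmetric]) (use i ik in auto)
    also have "ennreal (norm \<dots>) \<le> (\<integral>\<^sup>+z. ennreal (norm (\<eta> z *\<^sub>R f (x - z) - \<eta> z *\<^sub>R f x)) \<partial>lborel)"
      by (rule integral_norm_bound_ennreal) (use i ik in auto)
    also have "\<dots> = (\<integral>\<^sup>+z. ennreal (\<eta> z * norm (f (x - z) - f x)) \<partial>lborel)"
      using k0 by (intro nn_integral_cong) (simp flip: scaleR_diff_right)
    finally show ?thesis .
  qed
  have "(\<integral>\<^sup>+x. norm (conv \<eta> f x - f x) \<partial>lborel)
      \<le> (\<integral>\<^sup>+x. \<integral>\<^sup>+z. ennreal (\<eta> z * norm (f (x - z) - f x)) \<partial>lborel \<partial>lborel)"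
    by (intro nn_integral_mono pt)
  also have "\<dots> = (\<integral>\<^sup>+z. \<integral>\<^sup>+x. ennreal (\<eta> z * norm (f (x - z) - f x)) \<partial>lborel \<partial>lborel)"
    by (rule lborel_pair.Fubini') measurable
  also have "\<dots> \<le> (\<integral>\<^sup>+z. ennreal (\<eta> z * d) \<partial>lborel)"
  proof (intro nn_integral_mono)
    fix z
    show "(\<integral>\<^sup>+x. ennreal (\<eta> z * norm (f (x - z) - f x)) \<partial>lborel) \<le> ennreal (\<eta> z * d)"
    proof (cases "norm z \<le> e")
      case True
      have "integrable lborel (\<lambda>x. f (x - z))"
        using integrable_translate[of f "- z"] f by simp
      then have "integrable lborel (\<lambda>x. norm (f (x - z) - f x))" using f by simp
      then have "(\<integral>\<^sup>+x. ennreal (\<eta> z * norm (f (x - z) - f x)) \<partial>lborel)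
          = ennreal (\<integral>x. \<eta> z * norm (f (x - z) - f x) \<partial>lborel)"
        using k0 by (intro nn_integral_eq_integral) auto
      also have "\<dots> \<le> ennreal (\<eta> z * d)"
        using d[OF True] k0 by (intro ennreal_leI) (simp add: mult_left_mono)
      finally show ?thesis .
    next
      case False
      then show ?thesis using kz[of z] by simp
    qed
  qed
  also have "\<dots> = ennreal (\<integral>z. \<eta> z * d \<partial>lborel)"
  proof (rule nn_integral_eq_integral)
    show "integrable lborel (\<lambda>z. \<eta> z * d)" using ik by simp
    have "e \<ge> 0"
    proof (rule ccontr)
      assume "\<not> e \<ge> 0"
      then have "\<eta> = (\<lambda>x. 0)" using kz by (metis mem_cball_0 norm_ge_zero order_trans)
      then show False using k1 by simp
    qed
    have "0 \<le> (\<integral>x. norm (f (x - 0) - f x) \<partial>lborel)" by simp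
    also have "\<dots> \<le> d" by (rule d) (use \<open>e \<ge> 0\<close> in simp)
    finally show "AE z in lborel. 0 \<le> \<eta> z * d" using k0 by simp
  qed
  also have "\<dots> = ennreal d" using k1 by simp
  finally show ?thesis .
qed

lemma small_translations:
  fixes f :: "'a::euclidean_space \<Rightarrow> 'b::euclidean_space"
  assumes f: "integrable lborel f" and "d > 0"
  obtains e where "e > 0" "\<And>z. norm z \<le> e \<Longrightarrow> (\<integral>x. norm (f (x - z) - f x) \<partial>lborel) \<le> d"
proof -
  have "\<exists>e>0. \<forall>z. norm z \<le> e \<longrightarrow> (\<integral>x. norm (f (x - z) - f x) \<partial>lborel) \<le> d"
  proof (rule ccontr)
    assume "\<not> ?thesis"
    then have "\<forall>n. \<exists>z. norm z \<le> 1 / real (Suc n) \<and> (\<integral>x. norm (f (x - z) - f x) \<partial>lborel) > d"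
      by (metis not_le of_nat_0_less_iff zero_less_Suc zero_less_divide_1_iff)
    then obtain z where z: "\<And>n. norm (z n) \<le> 1 / real (Suc n)"
      "\<And>n. (\<integral>x. norm (f (x - z n) - f x) \<partial>lborel) > d" by metis
    have "(\<lambda>n. 1 / real (Suc n)) \<longlonglongrightarrow> 0" using LIMSEQ_inverse_real_of_nat by (simp add: inverse_eq_divide)
    then have "z \<longlonglongrightarrow> 0"
      by (rule Lim_null_comparison[rotated]) (use z(1) in auto)
    from L1_translation[OF f this] have "\<forall>\<^sub>F n in sequentially. (\<integral>x. norm (f (x - z n) - f x) \<partial>lborel) < d"
      using \<open>d > 0\<close> by (intro order_tendstoD) auto
    then show False using z(2) by (auto simp: eventually_sequentially) (meson less_asym order_refl)
  qed
  then show thesis using that by blast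
qed

text \<open>The sum of the \<open>h n\<close> has finite integral; it is a common majorant, and wherever it is finite the terms
  tend to zero.\<close>
lemma ae_dominated_if_summable:
  fixes h :: "nat \<Rightarrow> 'a \<Rightarrow> real"
  assumes [measurable]: "\<And>n. h n \<in> borel_measurable M" and h0: "\<And>n x. h n x \<ge> 0"
    and b: "\<And>n. (\<integral>\<^sup>+x. h n x \<partial>M) \<le> ennreal ((1/2) ^ n)"
  obtains P where "integrable M P" "\<And>x. P x \<ge> 0" "AE x in M. (\<forall>n. h n x \<le> P x) \<and> (\<lambda>n. h n x) \<longlonglongrightarrow> 0"
proof -
  define S where "S x = (\<Sum>n. ennreal (h n x))" for x
  have [measurable]: "S \<in> borel_measurable M" unfolding S_def[abs_def] by measurable
  have "(\<integral>\<^sup>+x. S x \<partial>M) = (\<Sum>n. \<integral>\<^sup>+x. ennreal (h n x) \<partial>M)"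
    unfolding S_def by (rule nn_integral_suminf) measurable
  also have "\<dots> \<le> (\<Sum>n. ennreal ((1/2) ^ n))" by (intro suminf_le b) auto
  also have "\<dots> = ennreal (\<Sum>n. (1/2) ^ n)" by (rule suminf_ennreal2) auto
  also have "\<dots> < \<infinity>" by simp
  finally have fin: "(\<integral>\<^sup>+x. S x \<partial>M) < \<infinity>" .
  then have ae: "AE x in M. S x \<noteq> \<infinity>" by (intro nn_integral_PInf_AE) auto
  have eq: "(\<integral>\<^sup>+x. ennreal (enn2real (S x)) \<partial>M) = (\<integral>\<^sup>+x. S x \<partial>M)"
    by (rule nn_integral_cong_AE) (use ae in eventually_elim, simp add: less_top)
  have "integrable M (\<lambda>x. enn2real (S x))"
    by (rule integrableI_nonneg) (use fin eq in auto)
  moreover have "AE x in M. (\<forall>n. h n x \<le> enn2real (S x)) \<and> (\<lambda>n. h n x) \<longlonglongrightarrow> 0"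
    using ae
  proof eventually_elim
    case (elim x)
    have "h n x \<le> enn2real (S x)" for n
    proof -
      have "ennreal (h n x) \<le> S x"
        unfolding S_def using sum_le_suminf[of "\<lambda>n. ennreal (h n x)" "{n}"] by simp
      then show ?thesis using elim h0 by (simp add: enn2real_leI le_ennreal_iff less_top)
          (metis elim enn2real_ennreal enn2real_mono h0 less_top infinity_ennreal_def)
    qed
    moreover have "summable (\<lambda>n. h n x)"
      by (rule summable_suminf_not_top) (use h0 elim in \<open>auto simp: S_def\<close>)
    ultimately show ?case using summable_LIMSEQ_zero by blast
  qed
  ultimately show thesis using that[of "\<lambda>x. enn2real (S x)"] by auto
qed

text \<open>The radii are chosen so small that the errors are summable in mean. This gives convergence almost
  everywhere together with a common integrable majorant, which is the form used with dominated
  convergence below.\<close>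
lemma mollifier_sequence:
  fixes F :: "'a::euclidean_space \<Rightarrow> 'b::euclidean_space"
  assumes F: "integrable lborel F" and "e0 > 0"
  obtains e :: "nat \<Rightarrow> real" and P where "\<And>n. 0 < e n" "\<And>n. e n \<le> e0"
    "integrable lborel P" "\<And>x. P x \<ge> 0"
    "AE x in lborel. (\<forall>n. norm (conv (mollifier (e n)) F x - F x) \<le> P x) \<and>
       (\<lambda>n. conv (mollifier (e n)) F x) \<longlonglongrightarrow> F x"
proof -
  have [measurable]: "F \<in> borel_measurable borel" using borel_measurable_integrable[OF F] by simp
  have "\<exists>e. 0 < e \<and> e \<le> e0 \<and> (\<integral>\<^sup>+x. norm (conv (mollifier e) F x - F x) \<partial>lborel) \<le> ennreal ((1/2) ^ n)" for n
  proof -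
    obtain e where e: "e > 0" "\<And>z. norm z \<le> e \<Longrightarrow> (\<integral>x. norm (F (x - z) - F x) \<partial>lborel) \<le> (1/2) ^ n"
      using small_translations[OF F, of "(1/2) ^ n"] by auto
    have "(\<integral>\<^sup>+x. norm (conv (mollifier (min e e0)) F x - F x) \<partial>lborel) \<le> ennreal ((1/2) ^ n)"
      by (rule conv_L1_le[OF unit_kernel_mollifier F e(2)]) (use e(1) \<open>e0 > 0\<close> in auto)
    then show ?thesis using e(1) \<open>e0 > 0\<close> by (intro exI[of _ "min e e0"]) auto
  qed
  then obtain e where e: "\<And>n. 0 < e n" "\<And>n. e n \<le> e0"
    "\<And>n. (\<integral>\<^sup>+x. norm (conv (mollifier (e n)) F x - F x) \<partial>lborel) \<le> ennreal ((1/2) ^ n)" by metis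
  have [measurable]: "(mollifier (e n) :: 'a \<Rightarrow> real) \<in> borel_measurable borel" for n
    by (rule unit_kernel_measurable[OF unit_kernel_mollifier[OF e(1)]])
  obtain P where P: "integrable lborel P" "\<And>x. P x \<ge> 0"
    "AE x in lborel. (\<forall>n. norm (conv (mollifier (e n)) F x - F x) \<le> P x) \<and>
      (\<lambda>n. norm (conv (mollifier (e n)) F x - F x)) \<longlonglongrightarrow> 0"
    by (rule ae_dominated_if_summable[of "\<lambda>n x. norm (conv (mollifier (e n)) F x - F x)" lborel])
       (use e(3) in auto)
  show thesis
  proof (rule that[OF e(1,2) P(1,2)])
    show "AE x in lborel. (\<forall>n. norm (conv (mollifier (e n)) F x - F x) \<le> P x) \<and>
       (\<lambda>n. conv (mollifier (e n)) F x) \<longlonglongrightarrow> F x"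
      using P(3) by eventually_elim (auto simp: tendsto_norm_zero_iff LIM_zero_iff)
  qed
qed

section \<open>Sobolev functions on a ball\<close>

text \<open>Functions on a ball are given as Borel functions on the whole space with global integrability; in
  applications they are set to zero outside. Only the integration by parts formula refers to the ball, and
  there the support of the test function must have a positive distance from the boundary.\<close>
definition sobolev_on_ball :: "real \<Rightarrow> 'a::euclidean_space \<Rightarrow> real \<Rightarrow> ('a \<Rightarrow> real) \<Rightarrow> ('a \<Rightarrow> 'a) \<Rightarrow> bool" where
  "sobolev_on_ball p x0 \<rho> U G \<longleftrightarrow>
     integrable lborel U \<and> integrable lborel G \<and>
     integrable lborel (\<lambda>x. norm (U x) powr p) \<and> integrable lborel (\<lambda>x. norm (G x) powr p) \<and>
     (\<forall>r<\<rho>. \<forall>\<phi>. smooth \<phi> \<and> (\<forall>x. x \<notin> cball x0 r \<longrightarrow> \<phi> x = 0) \<longrightarrow>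
        (\<integral>x. U x *\<^sub>R gradient \<phi> x \<partial>lborel) = - (\<integral>x. \<phi> x *\<^sub>R G x \<partial>lborel))"

lemma gradient_mollified:
  fixes U :: "'a::euclidean_space \<Rightarrow> real"
  assumes S: "sobolev_on_ball p x0 \<rho> U G" and e: "0 < e" and x: "dist x0 x + e < \<rho>"
  shows "(\<integral>y. U y *\<^sub>R gradient (mollifier e) (x - y) \<partial>lborel) = conv (mollifier e) G x"
proof -
  let ?\<phi> = "\<lambda>y. mollifier e (x - y)"
  have C: "C1 (mollifier e) (gradient (mollifier e :: 'a \<Rightarrow> real))"
    by (rule smooth_C1[OF smooth_mollifier_translate(2)])
  have gr: "gradient ?\<phi> y = - gradient (mollifier e) (x - y)" for y
  proof (rule gradient_eqI)
    have "((\<lambda>y. x - y) has_derivative (\<lambda>h. - h)) (at y)" by (auto intro!: derivative_eq_intros)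
    moreover have "(mollifier e has_derivative (\<lambda>h. h \<bullet> gradient (mollifier e) (x - y))) (at (x - y))"
      using C by (simp add: C1_def gderiv_def)
    ultimately have "(?\<phi> has_derivative (\<lambda>h. (- h) \<bullet> gradient (mollifier e) (x - y))) (at y)"
      by (rule has_derivative_compose)
    then show "GDERIV ?\<phi> y :> - gradient (mollifier e) (x - y)" by (simp add: gderiv_def)
  qed
  have "?\<phi> y = 0" if "y \<notin> cball x0 (dist x0 x + e)" for y
  proof -
    have "x - y \<notin> cball 0 e" using that dist_triangle[of x0 y x] norm_minus_commute[of y x] by (simp add: dist_norm)
    then show ?thesis using unit_kernel_mollifier[OF e, where 'a='a] by (simp add: unit_kernel_def)
  qed
  then have "(\<integral>y. U y *\<^sub>R gradient ?\<phi> y \<partial>lborel) = - (\<integral>y. ?\<phi> y *\<^sub>R G y \<partial>lborel)"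
    using S x smooth_mollifier_translate(1) unfolding sobolev_on_ball_def by blast
  then show ?thesis by (simp add: gr conv_def)
qed

text \<open>A mollification converges in the mean, but the limits below need a majorant for the \<open>p\<close>-th powers.
  By Jensen's inequality \<open>\<bar>u n\<bar> powr p\<close> lies below the mollification of \<open>\<bar>U\<bar> powr p\<close>, and likewise for the
  gradients, so it suffices to have one sequence of radii that works for \<open>U\<close>, \<open>G\<close> and their \<open>p\<close>-th powers
  at once. Mollifying the product-valued function \<open>F\<close> provides such a sequence.\<close>
lemma sobolev_approximation:
  fixes U :: "'a::euclidean_space \<Rightarrow> real"
  assumes S: "sobolev_on_ball p x0 \<rho> U G" and p: "p > 1" and r: "r < \<rho>" and U0: "\<And>x. U x \<ge> 0"
  obtains u g P where "\<And>n. C1 (u n) (g n)" "\<And>n x. u n x \<ge> 0" "integrable lborel P" "\<And>x. P x \<ge> 0"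
    "AE x in lborel. (\<lambda>n. u n x) \<longlonglongrightarrow> U x"
    "AE x in lborel. \<forall>n. u n x powr p \<le> P x"
    "AE x in lborel. x \<in> ball x0 r \<longrightarrow> (\<lambda>n. g n x) \<longlonglongrightarrow> G x"
    "AE x in lborel. x \<in> ball x0 r \<longrightarrow> (\<forall>n. norm (g n x) powr p \<le> P x)"
    "AE x in lborel. norm (G x) powr p \<le> P x"
proof -
  have iU: "integrable lborel U" and iG: "integrable lborel G"
    and iUp: "integrable lborel (\<lambda>x. norm (U x) powr p)"
    and iGp: "integrable lborel (\<lambda>x. norm (G x) powr p)"
    using S by (auto simp: sobolev_on_ball_def)
  have [measurable]: "U \<in> borel_measurable borel" "G \<in> borel_measurable borel"
    using borel_measurable_integrable[OF iU] borel_measurable_integrable[OF iG] by auto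
  define F where "F x = (U x, G x, norm (U x) powr p, norm (G x) powr p)" for x
  have iF: "integrable lborel F"
  proof (rule Bochner_Integration.integrable_bound)
    show "integrable lborel (\<lambda>x. norm (U x) + (norm (G x) + (norm (U x) powr p + norm (G x) powr p)))"
      using iU iG iUp iGp by (intro Bochner_Integration.integrable_add integrable_norm)
    show "F \<in> borel_measurable lborel" unfolding F_def[abs_def] by measurable
    have "norm (a, b, c, d) \<le> norm a + (norm b + (norm c + norm d))" for a c d :: real and b :: 'a
      using norm_Pair_le[of a "(b, c, d)"] norm_Pair_le[of b "(c, d)"] norm_Pair_le[of c d] by linarith
    from this[of "U x" "G x" "norm (U x) powr p" "norm (G x) powr p" for x]
    show "AE x in lborel. norm (F x) \<le> norm (norm (U x) + (norm (G x) + (norm (U x) powr p + norm (G x) powr p)))"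
      by (simp add: F_def)
  qed
  obtain e :: "nat \<Rightarrow> real" and Q where e: "\<And>n. 0 < e n" "\<And>n. e n \<le> (\<rho> - r) / 2"
    and Q: "integrable lborel Q" "\<And>x. Q x \<ge> 0"
    "AE x in lborel. (\<forall>n. norm (conv (mollifier (e n)) F x - F x) \<le> Q x) \<and>
       (\<lambda>n. conv (mollifier (e n)) F x) \<longlonglongrightarrow> F x"
    using mollifier_sequence[OF iF, of "(\<rho> - r) / 2"] r by auto
  define m where "m n = (mollifier (e n) :: 'a \<Rightarrow> real)" for n
  have k: "unit_kernel (e n) (m n)" for n unfolding m_def by (rule unit_kernel_mollifier[OF e(1)])
  have [measurable]: "m n \<in> borel_measurable borel" for n by (rule unit_kernel_measurable[OF k])
  have cF: "conv (m n) F x = (conv (m n) U x, conv (m n) G x, conv (m n) (\<lambda>x. norm (U x) powr p) x,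
      conv (m n) (\<lambda>x. norm (G x) powr p) x)" for n x
  proof -
    have kc: "continuous_on UNIV (m n)" and kz: "\<And>x. x \<notin> cball 0 (e n) \<Longrightarrow> m n x = 0"
      using k[of n] by (auto simp: unit_kernel_def)
    obtain M where M: "\<And>x. \<bar>m n x\<bar> \<le> M" using bounded_if_zero_outside_cball[OF kc kz] by (metis real_norm_def)
    have i: "integrable lborel (\<lambda>y. m n (x - y) *\<^sub>R F y)"
      by (rule integrable_bounded_scaleR[OF iF _ M]) measurable
    have l: "bounded_linear (\<lambda>z::real \<times> 'a \<times> real \<times> real. fst z)"
      "bounded_linear (\<lambda>z::real \<times> 'a \<times> real \<times> real. fst (snd z))"
      "bounded_linear (\<lambda>z::real \<times> 'a \<times> real \<times> real. fst (snd (snd z)))"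
      "bounded_linear (\<lambda>z::real \<times> 'a \<times> real \<times> real. snd (snd (snd z)))"
      by (auto intro!: bounded_linear_intros)
    have "fst (conv (m n) F x) = conv (m n) U x"
      "fst (snd (conv (m n) F x)) = conv (m n) G x"
      "fst (snd (snd (conv (m n) F x))) = conv (m n) (\<lambda>x. norm (U x) powr p) x"
      "snd (snd (snd (conv (m n) F x))) = conv (m n) (\<lambda>x. norm (G x) powr p) x"
      using integral_bounded_linear[OF l(1) i] integral_bounded_linear[OF l(2) i]
        integral_bounded_linear[OF l(3) i] integral_bounded_linear[OF l(4) i]
      by (simp_all add: conv_def F_def)
    then show ?thesis by (simp add: prod_eq_iff)
  qed
  define u where "u n = conv (m n) U" for n
  define g where "g n x = (\<integral>y. U y *\<^sub>R gradient (m n) (x - y) \<partial>lborel)" for n x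
  define P where "P x = norm (U x) powr p + norm (G x) powr p + Q x" for x
  have jU: "norm (u n x) powr p \<le> conv (m n) (\<lambda>x. norm (U x) powr p) x" for n x
    unfolding u_def by (rule conv_jensen[OF k p iU iUp])
  have jG: "norm (conv (m n) G x) powr p \<le> conv (m n) (\<lambda>x. norm (G x) powr p) x" for n x
    by (rule conv_jensen[OF k p iG iGp])
  have gG: "g n x = conv (m n) G x" if "x \<in> ball x0 r" for n x
    unfolding g_def m_def by (rule gradient_mollified[OF S e(1)]) (use that e(2)[of n] r in auto)
  have conv: "AE x in lborel. (\<lambda>n. u n x) \<longlonglongrightarrow> U x \<and> (\<lambda>n. conv (m n) G x) \<longlonglongrightarrow> G x"
    using Q(3) unfolding m_def[symmetric]
  proof eventually_elim
    case (elim x)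
    then have l: "(\<lambda>n. conv (m n) F x) \<longlonglongrightarrow> F x" by blast
    from tendsto_fst[OF l] tendsto_fst[OF tendsto_snd[OF l]] show ?case
      by (simp add: cF F_def u_def)
  qed
  have bnd: "AE x in lborel. \<forall>n. norm (u n x) powr p \<le> P x \<and> norm (conv (m n) G x) powr p \<le> P x"
    using Q(3) unfolding m_def[symmetric]
  proof eventually_elim
    case (elim x)
    show ?case
    proof
      fix n
      have n: "norm (conv (m n) F x - F x) \<le> Q x" using elim by blast
      have c: "\<bar>c\<bar> \<le> norm (a, b, c, d)" "\<bar>d\<bar> \<le> norm (a, b, c, d)" for a c d :: real and b :: 'a
        using norm_fst_le[of c d] norm_snd_le[of d c] norm_snd_le[of "(c, d)" b] norm_snd_le[of "(b, c, d)" a]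
        unfolding real_norm_def by linarith+
      have "norm (conv (m n) (\<lambda>x. norm (U x) powr p) x - norm (U x) powr p) \<le> Q x"
        "norm (conv (m n) (\<lambda>x. norm (G x) powr p) x - norm (G x) powr p) \<le> Q x"
        by (rule order_trans[OF _ n], simp add: cF F_def c)+
      then have "conv (m n) (\<lambda>x. norm (U x) powr p) x - norm (U x) powr p \<le> Q x"
        "conv (m n) (\<lambda>x. norm (G x) powr p) x - norm (G x) powr p \<le> Q x"
        by simp_all
      then show "norm (u n x) powr p \<le> P x \<and> norm (conv (m n) G x) powr p \<le> P x"
        using jU[of n x] jG[of n x] powr_ge_zero[of "norm (U x)" p] powr_ge_zero[of "norm (G x)" p]
        unfolding P_def by linarith
    qed
  qed
  have u0: "u n x \<ge> 0" for n x
    unfolding u_def conv_def using k[of n] U0 by (auto simp: unit_kernel_def intro!: integral_nonneg)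
  show thesis
  proof (rule that[of u g P])
    show "C1 (u n) (g n)" for n
      unfolding u_def g_def[abs_def] m_def
      by (rule C1_conv[OF smooth_C1[OF smooth_mollifier_translate(2)] _ iU, of 0 "e n"])
         (use unit_kernel_mollifier[OF e(1), of n, where 'a='a] in \<open>simp add: unit_kernel_def\<close>)
    show "u n x \<ge> 0" for n x by (rule u0)
    show "integrable lborel P" unfolding P_def[abs_def] using iUp iGp Q(1) by simp
    show "P x \<ge> 0" for x unfolding P_def using Q(2)[of x] by simp
    show "AE x in lborel. (\<lambda>n. u n x) \<longlonglongrightarrow> U x" using conv by eventually_elim simp
    show "AE x in lborel. \<forall>n. u n x powr p \<le> P x" using bnd by eventually_elim (use u0 in auto)
    show "AE x in lborel. norm (G x) powr p \<le> P x"
      unfolding P_def using Q(2) by (auto intro!: AE_I2 add_increasing add_increasing2)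
    show "AE x in lborel. x \<in> ball x0 r \<longrightarrow> (\<lambda>n. g n x) \<longlonglongrightarrow> G x"
      using conv by eventually_elim (auto simp: gG)
    show "AE x in lborel. x \<in> ball x0 r \<longrightarrow> (\<forall>n. norm (g n x) powr p \<le> P x)"
      using bnd by eventually_elim (auto simp: gG)
  qed
qed

section \<open>Weak solutions and composites\<close>

text \<open>A nonnegative solution \<open>U\<close> with gradient \<open>G\<close> of \<open>div J = 0\<close>. The field \<open>J\<close> is not given as a function of
  \<open>x\<close> and \<open>G\<close>: only its growth and its coercivity enter the regularity theory.\<close>
definition weak_solution ::
  "real \<Rightarrow> real \<Rightarrow> real \<Rightarrow> 'a::euclidean_space \<Rightarrow> real \<Rightarrow> ('a \<Rightarrow> real) \<Rightarrow> ('a \<Rightarrow> 'a) \<Rightarrow> ('a \<Rightarrow> 'a) \<Rightarrow> bool" where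
  "weak_solution p c K x0 \<rho> U G J \<longleftrightarrow>
     sobolev_on_ball p x0 \<rho> U G \<and> (\<forall>x. U x \<ge> 0) \<and> integrable lborel J \<and>
     (AE x in lborel. norm (J x) \<le> K * (norm (G x) powr (p - 1) + 1)) \<and>
     (AE x in lborel. J x \<bullet> G x \<ge> c * norm (G x) powr p - K) \<and>
     (\<forall>r<\<rho>. \<forall>\<phi>. smooth \<phi> \<and> (\<forall>x. x \<notin> cball x0 r \<longrightarrow> \<phi> x = 0) \<longrightarrow>
        (\<integral>x. J x \<bullet> gradient \<phi> x \<partial>lborel) = 0)"

lemma C1_conv_right:
  fixes \<phi> :: "'a::euclidean_space \<Rightarrow> real"
  assumes C: "C1 \<phi> g" and z: "\<And>x. x \<notin> cball c r \<Longrightarrow> \<phi> x = 0" and k: "unit_kernel e \<eta>"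
  shows "C1 (conv \<eta> \<phi>) (conv \<eta> g)"
proof -
  have g: "continuous_on UNIV g" using C by (simp add: C1_def)
  have [measurable]: "\<phi> \<in> borel_measurable borel" "g \<in> borel_measurable borel" "\<eta> \<in> borel_measurable borel"
    using g C1_continuous[OF C] unit_kernel_measurable[OF k] by (auto intro: borel_measurable_continuous_onI)
  have "C1 (conv \<phi> \<eta>) (\<lambda>x. \<integral>y. \<eta> y *\<^sub>R g (x - y) \<partial>lborel)"
    by (rule C1_conv[OF C z unit_kernel_integrable[OF k]])
  moreover have "(\<integral>y. \<eta> y *\<^sub>R g (x - y) \<partial>lborel) = conv \<eta> g x" for x
    unfolding conv_def using integral_reflect[of "\<lambda>y. \<eta> (x - y) *\<^sub>R g y" x] by simp
  ultimately show ?thesis using conv_commute[of \<phi> \<eta>] by simp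
qed

text \<open>Mollification turns a \<open>C\<^sup>1\<close> function into a smooth one with slightly larger support, and its gradients
  converge uniformly.\<close>
lemma weak_solution_C1_test:
  fixes \<phi> :: "'a::euclidean_space \<Rightarrow> real"
  assumes W: "weak_solution p c K x0 \<rho> U G J" and C: "C1 \<phi> g"
    and z: "\<And>x. x \<notin> cball x0 r \<Longrightarrow> \<phi> x = 0" and r: "r < \<rho>"
  shows "(\<integral>x. J x \<bullet> g x \<partial>lborel) = 0"
proof -
  have iJ: "integrable lborel J" using W by (simp add: weak_solution_def)
  have [measurable]: "J \<in> borel_measurable borel" using borel_measurable_integrable[OF iJ] by simp
  have g: "continuous_on UNIV g" using C by (simp add: C1_def)
  have gz: "x \<notin> cball x0 r \<Longrightarrow> g x = 0" for x by (rule C1_zero_outside_cball[OF C z])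
  have [measurable]: "\<phi> \<in> borel_measurable borel" "g \<in> borel_measurable borel"
    using g C1_continuous[OF C] by (auto intro: borel_measurable_continuous_onI)
  obtain M where M: "\<And>x. norm (g x) \<le> M" using bounded_if_zero_outside_cball[OF g gz] by metis
  define \<eta> where "\<eta> n = (mollifier ((\<rho> - r) / (real n + 2)) :: 'a \<Rightarrow> real)" for n
  have e: "(\<rho> - r) / (real n + 2) > 0" for n using r by simp
  have k: "unit_kernel ((\<rho> - r) / (real n + 2)) (\<eta> n)" for n
    unfolding \<eta>_def by (rule unit_kernel_mollifier[OF e])
  have [measurable]: "\<eta> n \<in> borel_measurable borel" for n by (rule unit_kernel_measurable[OF k])
  have C': "C1 (conv (\<eta> n) \<phi>) (conv (\<eta> n) g)" for n by (rule C1_conv_right[OF C z k])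
  have i\<phi>: "integrable lborel \<phi>"
    by (rule integrable_continuous_zero_outside_cball[OF C1_continuous[OF C] z])
  have "(\<integral>x. J x \<bullet> conv (\<eta> n) g x \<partial>lborel) = 0" for n
  proof -
    have s: "smooth (conv (\<eta> n) \<phi>)"
    proof (rule smooth_conv[OF _ _ i\<phi>])
      show "smooth (\<eta> n)" unfolding \<eta>_def by (rule smooth_mollifier_translate(2))
      show "\<And>x. x \<notin> cball 0 ((\<rho> - r) / (real n + 2)) \<Longrightarrow> \<eta> n x = 0"
        using k[of n] by (simp add: unit_kernel_def)
    qed
    have z': "conv (\<eta> n) \<phi> x = 0" if "x \<notin> cball x0 (r + (\<rho> - r) / (real n + 2))" for x
      by (rule conv_zero_outside[OF _ z that]) (use k[of n] in \<open>simp_all add: unit_kernel_def\<close>)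
    have "(\<rho> - r) / (real n + 2) < (\<rho> - r) / 1"
      by (rule divide_strict_left_mono) (use r in auto)
    then have "r + (\<rho> - r) / (real n + 2) < \<rho>" by simp
    then have "(\<integral>x. J x \<bullet> gradient (conv (\<eta> n) \<phi>) x \<partial>lborel) = 0"
      using W s z' unfolding weak_solution_def by blast
    then show ?thesis by (simp add: C1_gradient[OF C'])
  qed
  moreover have "(\<lambda>n. \<integral>x. J x \<bullet> conv (\<eta> n) g x \<partial>lborel) \<longlonglongrightarrow> (\<integral>x. J x \<bullet> g x \<partial>lborel)"
  proof (rule integral_dominated_convergence)
    have lim: "(\<lambda>n. conv (\<eta> n) g x) \<longlonglongrightarrow> g x" for x
    proof (rule metric_LIMSEQ_I)
      fix d :: real assume "d > 0"
      obtain d' where d': "d' > 0" "\<And>x h. norm h < d' \<Longrightarrow> norm (g (x + h) - g x) \<le> d / 2"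
        using uniformly_continuous_if_zero_outside_cball[OF g gz, where e = "d / 2"] \<open>d > 0\<close> by auto
      obtain n0 :: nat where n0: "real n0 > (\<rho> - r) / d'" using reals_Archimedean2 by blast
      have "dist (conv (\<eta> n) g x) (g x) < d" if "n \<ge> n0" for n
      proof -
        have "(\<rho> - r) / d' < real n + 2" using n0 that by linarith
        then have "(\<rho> - r) / (real n + 2) < d'" using d'(1) by (simp add: field_simps)
        then have "norm (conv (\<eta> n) g x - g x) \<le> d / 2"
          by (intro conv_kernel_uniform[OF k _ M] d'(2)) auto
        then show ?thesis using \<open>d > 0\<close> by (simp add: dist_norm)
      qed
      then show "\<exists>no. \<forall>n\<ge>no. dist (conv (\<eta> n) g x) (g x) < d" by blast
    qed
    then show "AE x in lborel. (\<lambda>n. J x \<bullet> conv (\<eta> n) g x) \<longlonglongrightarrow> J x \<bullet> g x"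
      by (intro AE_I2 tendsto_intros)
    show "integrable lborel (\<lambda>x. (M + 2 * M) * norm (J x))" using iJ by simp
    show "AE x in lborel. norm (J x \<bullet> conv (\<eta> n) g x) \<le> (M + 2 * M) * norm (J x)" for n
    proof (rule AE_I2)
      fix x
      have "norm (g (x + h) - g x) \<le> 2 * M" for h
        using norm_triangle_ineq4[of "g (x + h)" "g x"] M[of "x + h"] M[of x] by linarith
      then have "norm (conv (\<eta> n) g x - g x) \<le> 2 * M"
        by (intro conv_kernel_uniform[OF k _ M]) simp_all
      then have "norm (conv (\<eta> n) g x) \<le> M + 2 * M"
        using M[of x] norm_triangle_ineq[of "conv (\<eta> n) g x - g x" "g x"] by simp
      then have "norm (J x) * norm (conv (\<eta> n) g x) \<le> norm (J x) * (M + 2 * M)"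
        by (intro mult_left_mono) auto
      then show "norm (J x \<bullet> conv (\<eta> n) g x) \<le> (M + 2 * M) * norm (J x)"
        using Cauchy_Schwarz_ineq2[of "J x" "conv (\<eta> n) g x"] by (simp add: mult.commute)
    qed
  qed measurable
  ultimately show ?thesis using LIMSEQ_unique by (simp add: LIMSEQ_const_iff)
qed

text \<open>The conditions concern the half-line only, because these functions are composed with nonnegative
  solutions; so \<open>ln (t + R)\<close> with \<open>R > 0\<close> is included.\<close>
definition C1_lipschitz :: "real \<Rightarrow> (real \<Rightarrow> real) \<Rightarrow> (real \<Rightarrow> real) \<Rightarrow> bool" where
  "C1_lipschitz L \<Psi> \<psi> \<longleftrightarrow> continuous_on {0..} \<psi> \<and>
     (\<forall>t\<ge>0. (\<Psi> has_real_derivative \<psi> t) (at t) \<and> \<bar>\<psi> t\<bar> \<le> L)"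

lemma C1_lipschitz_growth:
  assumes "C1_lipschitz L \<Psi> \<psi>" and "t \<ge> 0"
  shows "\<bar>\<Psi> t\<bar> \<le> \<bar>\<Psi> 0\<bar> + L * t"
proof (cases "t = 0")
  case False
  then obtain s where "0 < s" "s < t" "\<Psi> t - \<Psi> 0 = (t - 0) * \<psi> s"
    using MVT2[of 0 t \<Psi> \<psi>] assms by (auto simp: C1_lipschitz_def)
  moreover have "\<bar>t * \<psi> s\<bar> \<le> t * L"
    using assms \<open>0 < s\<close> by (simp add: abs_mult C1_lipschitz_def mult_left_mono)
  ultimately show ?thesis by (simp add: mult.commute)
qed simp

lemma C1_lipschitz_continuous: "C1_lipschitz L \<Psi> \<psi> \<Longrightarrow> continuous_on {0..} \<Psi>"
  unfolding C1_lipschitz_def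
  by (meson DERIV_isCont atLeast_iff continuous_at_imp_continuous_on)

lemma measurable_continuous_nonneg:
  fixes f :: "real \<Rightarrow> real"
  assumes "continuous_on {0..} f" and [measurable]: "U \<in> borel_measurable M" and U: "\<And>x. U x \<ge> 0"
  shows "(\<lambda>x. f (U x)) \<in> borel_measurable M"
proof -
  have "continuous_on UNIV (\<lambda>t. f (max 0 t))"
    by (rule continuous_on_compose2[OF assms(1)]) (auto intro!: continuous_intros)
  then have [measurable]: "(\<lambda>t. f (max 0 t)) \<in> borel_measurable borel"
    by (rule borel_measurable_continuous_onI)
  have "(\<lambda>x. f (max 0 (U x))) \<in> borel_measurable M" by measurable
  then show ?thesis using U by (simp add: max_absorb2)
qed

lemma C1_lipschitz_measurable:
  assumes "C1_lipschitz L \<Psi> \<psi>" "U \<in> borel_measurable M" "\<And>x. U x \<ge> 0"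
  shows "(\<lambda>x. \<Psi> (U x)) \<in> borel_measurable M" "(\<lambda>x. \<psi> (U x)) \<in> borel_measurable M"
proof -
  show "(\<lambda>x. \<Psi> (U x)) \<in> borel_measurable M"
    by (rule measurable_continuous_nonneg[OF C1_lipschitz_continuous[OF assms(1)] assms(2,3)])
  have "continuous_on {0..} \<psi>" using assms(1) by (simp add: C1_lipschitz_def)
  then show "(\<lambda>x. \<psi> (U x)) \<in> borel_measurable M"
    by (rule measurable_continuous_nonneg[OF _ assms(2,3)])
qed

lemma C1_lipschitz_L: "C1_lipschitz L \<Psi> \<psi> \<Longrightarrow> L \<ge> 0"
  unfolding C1_lipschitz_def by (meson abs_ge_zero order_refl order_trans)

lemma C1_mult_composite:
  assumes "C1 \<eta> g\<eta>" "C1 u g" "\<And>x. u x \<ge> 0" "C1_lipschitz L \<Psi> \<psi>"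
  shows "C1 (\<lambda>x. \<eta> x * \<Psi> (u x)) (\<lambda>x. (\<eta> x * \<psi> (u x)) *\<^sub>R g x + \<Psi> (u x) *\<^sub>R g\<eta> x)"
proof -
  have "continuous_on UNIV (\<lambda>x. \<psi> (u x))" "continuous_on UNIV (\<lambda>x. \<Psi> (u x))"
    using C1_lipschitz_continuous[OF assms(4)] assms C1_continuous[OF assms(2)]
    by (auto intro!: continuous_on_compose2[of "{0..}" _ UNIV u] simp: C1_lipschitz_def)
  then have "continuous_on UNIV (\<lambda>x. (\<eta> x * \<psi> (u x)) *\<^sub>R g x + \<Psi> (u x) *\<^sub>R g\<eta> x)"
    using assms C1_continuous[OF assms(1)] by (intro continuous_intros) (auto simp: C1_def)
  moreover have "GDERIV (\<lambda>x. \<eta> x * \<Psi> (u x)) x :> (\<eta> x * \<psi> (u x)) *\<^sub>R g x + \<Psi> (u x) *\<^sub>R g\<eta> x" for x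
  proof -
    have "GDERIV u x :> g x" "GDERIV \<eta> x :> g\<eta> x" using assms by (auto simp: C1_def)
    moreover have "DERIV \<Psi> (u x) :> \<psi> (u x)" using assms by (auto simp: C1_lipschitz_def)
    ultimately have "GDERIV (\<lambda>x. \<eta> x * \<Psi> (u x)) x :> \<eta> x *\<^sub>R (\<psi> (u x) *\<^sub>R g x) + \<Psi> (u x) *\<^sub>R g\<eta> x"
      by (intro GDERIV_mult GDERIV_DERIV_compose)
    then show ?thesis by simp
  qed
  ultimately show ?thesis by (simp add: C1_def)
qed

lemma C1_measurable: "C1 f g \<Longrightarrow> f \<in> borel_measurable borel" "C1 f g \<Longrightarrow> g \<in> borel_measurable borel"
  using C1_continuous by (auto simp: C1_def intro: borel_measurable_continuous_onI)

lemma composite_limit: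
  assumes "C1_lipschitz L \<Psi> \<psi>" "u \<longlonglongrightarrow> t" "\<And>n. u n \<ge> 0" "t \<ge> 0"
  shows "(\<lambda>n. \<Psi> (u n)) \<longlonglongrightarrow> \<Psi> t" "(\<lambda>n. \<psi> (u n)) \<longlonglongrightarrow> \<psi> t"
  using C1_lipschitz_continuous[OF assms(1)] assms
  by (auto intro!: continuous_on_tendsto_compose[of "{0..}" _ u] simp: C1_lipschitz_def)

lemma integrable_ball_affine:
  fixes P :: "'a::euclidean_space \<Rightarrow> real"
  assumes "integrable lborel P"
  shows "integrable lborel (\<lambda>x. indicator (ball x0 r) x *\<^sub>R (A * (P x + 1)))"
proof -
  have "integrable lborel (\<lambda>x. indicator (ball x0 r) x *\<^sub>R (A * P x) + A * indicator (ball x0 r) x)"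
    by (intro Bochner_Integration.integrable_add integrable_mult_indicator integrable_mult_right
         integrable_real_indicator emeasure_lborel_ball_finite assms) auto
  then show ?thesis by (simp add: algebra_simps)
qed

text \<open>For the smooth approximations of \<open>U\<close> the composite is a \<open>C\<^sup>1\<close> test function. The passage to the limit is
  by dominated convergence: by Young's inequality \<open>\<bar>J\<bar> \<bar>D\<bar>\<close> is bounded by the common majorant of the \<open>p\<close>-th
  powers.\<close>
lemma weak_solution_composite_test:
  fixes U :: "'a::euclidean_space \<Rightarrow> real"
  assumes W: "weak_solution p c K x0 \<rho> U G J" and p: "p > 1" and K: "K > 0"
    and C: "C1 \<eta> g\<eta>" and z: "\<And>x. x \<notin> cball x0 r' \<Longrightarrow> \<eta> x = 0" and r: "r' < \<rho>"
    and \<Psi>: "C1_lipschitz L \<Psi> \<psi>"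
  shows "(\<integral>x. J x \<bullet> ((\<eta> x * \<psi> (U x)) *\<^sub>R G x + \<Psi> (U x) *\<^sub>R g\<eta> x) \<partial>lborel) = 0"
    and "integrable lborel (\<lambda>x. J x \<bullet> ((\<eta> x * \<psi> (U x)) *\<^sub>R G x + \<Psi> (U x) *\<^sub>R g\<eta> x))"
proof -
  define r where "r = (r' + \<rho>) / 2"
  have r1: "r < \<rho>" "r' < r" using r by (auto simp: r_def)
  have S: "sobolev_on_ball p x0 \<rho> U G" and U0: "\<And>x. U x \<ge> 0" and iJ: "integrable lborel J"
    and J1: "AE x in lborel. norm (J x) \<le> K * (norm (G x) powr (p - 1) + 1)"
    using W by (auto simp: weak_solution_def)
  have [measurable]: "J \<in> borel_measurable borel" "U \<in> borel_measurable borel" "G \<in> borel_measurable borel"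
    using borel_measurable_integrable[OF iJ] S by (auto simp: sobolev_on_ball_def dest: borel_measurable_integrable)
  have gz: "x \<notin> cball x0 r' \<Longrightarrow> g\<eta> x = 0" for x by (rule C1_zero_outside_cball[OF C z])
  obtain M1 where M1: "\<And>x. \<bar>\<eta> x\<bar> \<le> M1" using bounded_if_zero_outside_cball[OF C1_continuous[OF C] z] by (metis real_norm_def)
  have "continuous_on UNIV g\<eta>" using C by (simp add: C1_def)
  from bounded_if_zero_outside_cball[OF this gz] obtain M2 where M2: "\<And>x. norm (g\<eta> x) \<le> M2" by metis
  have M0: "M1 \<ge> 0" "M2 \<ge> 0" using M1[of x0] M2[of x0] norm_ge_zero[of "g\<eta> x0"] by linarith+
  have L0: "L \<ge> 0" by (rule C1_lipschitz_L[OF \<Psi>])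
  have K0: "K \<ge> 0" using K by simp
  have [measurable]: "\<eta> \<in> borel_measurable borel" "g\<eta> \<in> borel_measurable borel" using C1_measurable[OF C] by auto
  have [measurable]: "(\<lambda>x. \<psi> (U x)) \<in> borel_measurable borel" "(\<lambda>x. \<Psi> (U x)) \<in> borel_measurable borel"
    using C1_lipschitz_measurable[OF \<Psi>, of U borel] U0 \<open>U \<in> borel_measurable borel\<close> by auto
  obtain u g P where ug: "\<And>n. C1 (u n) (g n)" "\<And>n x. u n x \<ge> 0" "integrable lborel P" "\<And>x. P x \<ge> 0"
    "AE x in lborel. (\<lambda>n. u n x) \<longlonglongrightarrow> U x"
    "AE x in lborel. \<forall>n. u n x powr p \<le> P x"
    "AE x in lborel. x \<in> ball x0 r \<longrightarrow> (\<lambda>n. g n x) \<longlonglongrightarrow> G x"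
    "AE x in lborel. x \<in> ball x0 r \<longrightarrow> (\<forall>n. norm (g n x) powr p \<le> P x)"
    "AE x in lborel. norm (G x) powr p \<le> P x"
    by (rule sobolev_approximation[OF S p r1(1) U0]) blast
  define D where "D n x = (\<eta> x * \<psi> (u n x)) *\<^sub>R g n x + \<Psi> (u n x) *\<^sub>R g\<eta> x" for n x
  have CD: "C1 (\<lambda>x. \<eta> x * \<Psi> (u n x)) (D n)" for n
    unfolding D_def[abs_def] by (rule C1_mult_composite[OF C ug(1,2) \<Psi>])
  have z0: "(\<integral>x. J x \<bullet> D n x \<partial>lborel) = 0" for n
    by (rule weak_solution_C1_test[OF W CD _ r]) (use z in auto)
  have [measurable]: "D n \<in> borel_measurable borel" for n by (rule C1_measurable(2)[OF CD])
  define A where "A = 3 * K * (M1 * L + M2 * (\<bar>\<Psi> 0\<bar> + L))"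
  let ?w = "\<lambda>x. indicator (ball x0 r) x *\<^sub>R (A * (P x + 1))"
  let ?f = "\<lambda>x. J x \<bullet> ((\<eta> x * \<psi> (U x)) *\<^sub>R G x + \<Psi> (U x) *\<^sub>R g\<eta> x)"
  have lim: "AE x in lborel. (\<lambda>n. J x \<bullet> D n x) \<longlonglongrightarrow> ?f x"
    using ug(5,7)
  proof eventually_elim
    case (elim x)
    show ?case
    proof (cases "x \<in> cball x0 r'")
      case True
      then have "x \<in> ball x0 r" using r1 by auto
      then have "(\<lambda>n. g n x) \<longlonglongrightarrow> G x" using elim by blast
      moreover have "(\<lambda>n. \<Psi> (u n x)) \<longlonglongrightarrow> \<Psi> (U x)" "(\<lambda>n. \<psi> (u n x)) \<longlonglongrightarrow> \<psi> (U x)"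
        using composite_limit[OF \<Psi> elim(1)] ug(2) U0 by auto
      ultimately show ?thesis unfolding D_def by (intro tendsto_intros)
    next
      case False
      then show ?thesis using z gz by (simp add: D_def)
    qed
  qed
  have bound: "AE x in lborel. norm (J x \<bullet> D n x) \<le> ?w x" for n
    using ug(6,8,9) J1
  proof eventually_elim
    case (elim x)
    show ?case
    proof (cases "x \<in> ball x0 r")
      case False
      then have "x \<notin> cball x0 r'" using r1 by auto
      then show ?thesis using z gz False by (simp add: D_def)
    next
      case True
      have n1: "norm (D n x) \<le> M1 * L * norm (g n x) + M2 * (\<bar>\<Psi> 0\<bar> + L * u n x)"
      proof -
        have "\<bar>\<eta> x\<bar> * \<bar>\<psi> (u n x)\<bar> \<le> M1 * L"
          using \<Psi> ug(2) M0 by (intro mult_mono M1) (auto simp: C1_lipschitz_def)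
        then have a: "norm ((\<eta> x * \<psi> (u n x)) *\<^sub>R g n x) \<le> M1 * L * norm (g n x)"
          by (simp add: abs_mult mult_right_mono)
        have "\<bar>\<Psi> (u n x)\<bar> * norm (g\<eta> x) \<le> (\<bar>\<Psi> 0\<bar> + L * u n x) * M2"
          using C1_lipschitz_growth[OF \<Psi> ug(2)] L0 ug(2) by (intro mult_mono M2) auto
        then have b: "norm (\<Psi> (u n x) *\<^sub>R g\<eta> x) \<le> M2 * (\<bar>\<Psi> 0\<bar> + L * u n x)" by (simp add: mult.commute)
        show ?thesis unfolding D_def using norm_triangle_ineq[of "(\<eta> x * \<psi> (u n x)) *\<^sub>R g n x" "\<Psi> (u n x) *\<^sub>R g\<eta> x"] a b by linarith
      qed
      have key: "(norm (G x) powr (p - 1) + 1) * t \<le> 3 * (P x + 1)" if "t \<ge> 0" "t powr p \<le> P x" for t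
      proof -
        have "norm (G x) powr (p - 1) * t \<le> norm (G x) powr p + t powr p"
          by (rule powr_mult_le) (use p that in auto)
        moreover have "t \<le> 1 + t powr p" by (rule le_one_plus_powr) (use p that in auto)
        ultimately show ?thesis using elim that ug(4)[of x] by (simp add: algebra_simps)
      qed
      have k1: "(norm (G x) powr (p - 1) + 1) * norm (g n x) \<le> 3 * (P x + 1)"
        by (rule key) (use elim True in auto)
      have k2: "(norm (G x) powr (p - 1) + 1) * u n x \<le> 3 * (P x + 1)"
        by (rule key) (use elim ug(2) in auto)
      have k3: "norm (G x) powr (p - 1) + 1 \<le> 3 * (P x + 1)"
        using powr_mult_le[of p "norm (G x)" 1] p elim ug(4)[of x] by simp
      have "norm (J x \<bullet> D n x) \<le> norm (J x) * norm (D n x)" using Cauchy_Schwarz_ineq2 by simp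
      also have "\<dots> \<le> (K * (norm (G x) powr (p - 1) + 1)) * (M1 * L * norm (g n x) + M2 * (\<bar>\<Psi> 0\<bar> + L * u n x))"
        using n1 elim K0 by (intro mult_mono) auto
      also have "\<dots> = K * (M1 * L * ((norm (G x) powr (p - 1) + 1) * norm (g n x)) +
          M2 * (\<bar>\<Psi> 0\<bar> * (norm (G x) powr (p - 1) + 1) + L * ((norm (G x) powr (p - 1) + 1) * u n x)))"
        by (simp add: algebra_simps)
      also have "\<dots> \<le> K * (M1 * L * (3 * (P x + 1)) + M2 * (\<bar>\<Psi> 0\<bar> * (3 * (P x + 1)) + L * (3 * (P x + 1))))"
        by (intro mult_left_mono add_mono k1 k2 k3) (use K0 M0 L0 in auto)
      also have "\<dots> = A * (P x + 1)" by (simp add: A_def algebra_simps)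
      finally show ?thesis using True by simp
    qed
  qed
  have iw: "integrable lborel ?w"
    by (rule integrable_ball_affine[OF ug(3)])
  have m: "?f \<in> borel_measurable lborel" "\<And>n. (\<lambda>x. J x \<bullet> D n x) \<in> borel_measurable lborel" by measurable
  note d = integrable_dominated_convergence[OF m iw lim bound] integral_dominated_convergence[OF m iw lim bound]
  show "integrable lborel ?f" by (rule d)
  show "(\<integral>x. ?f x \<partial>lborel) = 0" using d(2) z0 by (simp add: LIMSEQ_const_iff)
qed

section \<open>Translation estimate\<close>

text \<open>Write the increment as an integral of the derivative over the segment and apply Jensen's inequality.\<close>
lemma C1_segment_powr_le:
  fixes f :: "'a::euclidean_space \<Rightarrow> real"
  assumes C: "C1 f g" and p: "p > 1"
  shows "ennreal (\<bar>f (x + z) - f x\<bar> powr p)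
      \<le> ennreal (norm z powr p) * (\<integral>\<^sup>+t. indicator {0..1} t * ennreal (norm (g (x + t *\<^sub>R z)) powr p) \<partial>lborel)"
proof -
  have gc: "continuous_on UNIV g" using C by (simp add: C1_def)
  have c1: "continuous_on {0..1} (\<lambda>t. g (x + t *\<^sub>R z))"
    by (rule continuous_on_compose2[OF gc]) (auto intro!: continuous_intros)
  define w where "w = (indicator {0..1} :: real \<Rightarrow> real)"
  let ?n = "\<lambda>t. norm (g (x + t *\<^sub>R z))"
  have i0: "integrable lborel (\<lambda>t. w t * (z \<bullet> g (x + t *\<^sub>R z)))"
    unfolding w_def using borel_integrable_compact[of "{0..1}" "\<lambda>t. z \<bullet> g (x + t *\<^sub>R z)"] c1
    by (simp add: continuous_on_inner)
  have i1: "integrable lborel (\<lambda>t. w t * ?n t)"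
    unfolding w_def using borel_integrable_compact[of "{0..1}" ?n] c1 by (simp add: continuous_on_norm)
  have "continuous_on {0..1} (\<lambda>t. ?n t powr p)"
    by (rule continuous_on_powr') (use c1 p in \<open>auto intro!: continuous_intros\<close>)
  then have i2: "integrable lborel (\<lambda>t. w t * ?n t powr p)"
    unfolding w_def using borel_integrable_compact[of "{0..1}" "\<lambda>t. ?n t powr p"] by simp
  have iw: "integrable lborel w" "(\<integral>t. w t \<partial>lborel) = 1" unfolding w_def by auto
  have "has_bochner_integral lborel (\<lambda>t. indicator {0..1} t *\<^sub>R (z \<bullet> g (x + t *\<^sub>R z)))
      (f (x + 1 *\<^sub>R z) - f (x + 0 *\<^sub>R z))"
  proof (rule has_bochner_integral_FTC_Icc)
    fix t :: real
    have "((\<lambda>t. x + t *\<^sub>R z) has_derivative (\<lambda>s. s *\<^sub>R z)) (at t)"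
      by (auto intro!: derivative_eq_intros)
    moreover have "(f has_derivative (\<lambda>k. k \<bullet> g (x + t *\<^sub>R z))) (at (x + t *\<^sub>R z))"
      using C by (simp add: C1_def gderiv_def)
    ultimately have "((\<lambda>t. f (x + t *\<^sub>R z)) has_derivative (\<lambda>s. (s *\<^sub>R z) \<bullet> g (x + t *\<^sub>R z))) (at t)"
      by (rule has_derivative_compose)
    then show "((\<lambda>t. f (x + t *\<^sub>R z)) has_vector_derivative z \<bullet> g (x + t *\<^sub>R z)) (at t within {0..1})"
      unfolding has_vector_derivative_def by (auto intro: has_derivative_at_withinI)
  qed (use c1 in \<open>auto intro: continuous_on_inner\<close>)
  then have "f (x + z) - f x = (\<integral>t. w t * (z \<bullet> g (x + t *\<^sub>R z)) \<partial>lborel)"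
    by (simp add: has_bochner_integral_iff w_def)
  also have "\<bar>\<dots>\<bar> \<le> (\<integral>t. norm z * (w t * ?n t) \<partial>lborel)"
    unfolding real_norm_def[symmetric]
  proof (rule Bochner_Integration.integral_norm_bound_integral)
    show "integrable lborel (\<lambda>t. w t * (z \<bullet> g (x + t *\<^sub>R z)))" by (rule i0)
    show "integrable lborel (\<lambda>t. norm z * (w t * ?n t))" using i1 by simp
    fix t
    have "\<bar>z \<bullet> g (x + t *\<^sub>R z)\<bar> \<le> norm z * ?n t" by (rule Cauchy_Schwarz_ineq2)
    then show "norm (w t * (z \<bullet> g (x + t *\<^sub>R z))) \<le> norm z * (w t * ?n t)"
      by (simp add: w_def indicator_def)
  qed
  also have "\<dots> = norm z * (\<integral>t. w t * ?n t \<partial>lborel)" by simp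
  finally have "\<bar>f (x + z) - f x\<bar> powr p \<le> (norm z * (\<integral>t. w t * ?n t \<partial>lborel)) powr p"
    using p by (intro powr_mono2) auto
  also have "\<dots> = norm z powr p * (\<integral>t. w t * ?n t \<partial>lborel) powr p"
    by (rule powr_mult)
  also have "\<dots> \<le> norm z powr p * (\<integral>t. w t * ?n t powr p \<partial>lborel)"
    by (intro mult_left_mono jensen_powr p iw i1 i2) (auto simp: w_def)
  finally have "ennreal (\<bar>f (x + z) - f x\<bar> powr p) \<le> ennreal (norm z powr p * (\<integral>t. w t * ?n t powr p \<partial>lborel))"
    by (rule ennreal_leI)
  also have "\<dots> = ennreal (norm z powr p) * (\<integral>\<^sup>+t. ennreal (w t * ?n t powr p) \<partial>lborel)"
    by (subst nn_integral_eq_integral[OF i2]) (auto simp: w_def ennreal_mult' integral_nonneg)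
  also have "(\<integral>\<^sup>+t. ennreal (w t * ?n t powr p) \<partial>lborel) = (\<integral>\<^sup>+t. indicator {0..1} t * ennreal (?n t powr p) \<partial>lborel)"
    by (intro nn_integral_cong) (auto simp: w_def indicator_def)
  finally show ?thesis .
qed

lemma C1_translation_estimate:
  fixes f :: "'a::euclidean_space \<Rightarrow> real"
  assumes C: "C1 f g" and p: "p > 1" and [measurable]: "A \<in> sets borel" "A' \<in> sets borel"
    and seg: "\<And>x t. x \<in> A \<Longrightarrow> 0 \<le> t \<Longrightarrow> t \<le> 1 \<Longrightarrow> x + t *\<^sub>R z \<in> A'"
  shows "(\<integral>\<^sup>+x. indicator A x * ennreal (\<bar>f (x + z) - f x\<bar> powr p) \<partial>lborel)
      \<le> ennreal (norm z powr p) * (\<integral>\<^sup>+x. indicator A' x * ennreal (norm (g x) powr p) \<partial>lborel)"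
proof -
  have [measurable]: "f \<in> borel_measurable borel" "g \<in> borel_measurable borel" using C1_measurable[OF C] by auto
  let ?h = "\<lambda>x. ennreal (norm (g x) powr p)"
  have "(\<integral>\<^sup>+x. indicator A x * ennreal (\<bar>f (x + z) - f x\<bar> powr p) \<partial>lborel)
      \<le> (\<integral>\<^sup>+x. indicator A x * (ennreal (norm z powr p) * (\<integral>\<^sup>+t. indicator {0..1} t * ?h (x + t *\<^sub>R z) \<partial>lborel)) \<partial>lborel)"
    by (intro nn_integral_mono mult_left_mono C1_segment_powr_le[OF C p]) auto
  also have "\<dots> = ennreal (norm z powr p) * (\<integral>\<^sup>+x. (\<integral>\<^sup>+t. indicator A x * (indicator {0..1::real} t * ?h (x + t *\<^sub>R z)) \<partial>lborel) \<partial>lborel)"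
    by (simp add: nn_integral_cmult[symmetric] mult.left_commute)
  also have "(\<integral>\<^sup>+x. (\<integral>\<^sup>+t. indicator A x * (indicator {0..1::real} t * ?h (x + t *\<^sub>R z)) \<partial>lborel) \<partial>lborel)
      = (\<integral>\<^sup>+t. (\<integral>\<^sup>+x. indicator A x * (indicator {0..1::real} t * ?h (x + t *\<^sub>R z)) \<partial>lborel) \<partial>lborel)"
    by (rule lborel_pair.Fubini') measurable
  also have "\<dots> \<le> (\<integral>\<^sup>+t. indicator {0..1::real} t * (\<integral>\<^sup>+x. indicator A' x * ?h x \<partial>lborel) \<partial>lborel)"
  proof (intro nn_integral_mono)
    fix t :: real
    have "(\<integral>\<^sup>+x. indicator A x * (indicator {0..1::real} t * ?h (x + t *\<^sub>R z)) \<partial>lborel)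
      \<le> (\<integral>\<^sup>+x. indicator {0..1::real} t * (indicator A' (x + t *\<^sub>R z) * ?h (x + t *\<^sub>R z)) \<partial>lborel)"
      by (intro nn_integral_mono) (use seg in \<open>auto simp: indicator_def\<close>)
    also have "\<dots> = indicator {0..1::real} t * (\<integral>\<^sup>+x. indicator A' (x + t *\<^sub>R z) * ?h (x + t *\<^sub>R z) \<partial>lborel)"
      by (rule nn_integral_cmult) measurable
    also have "(\<integral>\<^sup>+x. indicator A' (x + t *\<^sub>R z) * ?h (x + t *\<^sub>R z) \<partial>lborel) = (\<integral>\<^sup>+x. indicator A' x * ?h x \<partial>lborel)"
      by (rule nn_integral_translate) measurable
    finally show "(\<integral>\<^sup>+x. indicator A x * (indicator {0..1::real} t * ?h (x + t *\<^sub>R z)) \<partial>lborel)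
        \<le> indicator {0..1::real} t * (\<integral>\<^sup>+x. indicator A' x * ?h x \<partial>lborel)" .
  qed
  also have "\<dots> = (\<integral>\<^sup>+x. indicator A' x * ?h x \<partial>lborel)"
    by (subst nn_integral_multc) auto
  finally show ?thesis by (simp add: mult_left_mono)
qed

text \<open>For \<open>C\<^sup>1\<close> functions this is Fubini's theorem applied to the bound along segments. The general case
  follows by approximation: on the right the integrals converge by domination, and on the left Fatou's
  lemma suffices. The second set must contain the segments that start in the first, and \<open>\<eta>\<close> must vanish where
  it leaves the ball on which \<open>G\<close> is the gradient.\<close>
lemma translation_estimate:
  fixes U :: "'a::euclidean_space \<Rightarrow> real"
  assumes S: "sobolev_on_ball p x0 \<rho> U G" and U0: "\<And>x. U x \<ge> 0" and p: "p > 1" and r: "r < \<rho>"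
    and C: "C1 \<eta> g\<eta>" and M1: "\<And>x. \<bar>\<eta> x\<bar> \<le> M1" and M2: "\<And>x. norm (g\<eta> x) \<le> M2"
    and \<Psi>: "C1_lipschitz L \<Psi> \<psi>"
    and [measurable]: "A \<in> sets borel" "A' \<in> sets borel"
    and seg: "\<And>x t. x \<in> A \<Longrightarrow> 0 \<le> t \<Longrightarrow> t \<le> 1 \<Longrightarrow> x + t *\<^sub>R z \<in> A'"
    and out: "\<And>x. x \<in> A' \<Longrightarrow> x \<notin> ball x0 r \<Longrightarrow> \<eta> x = 0 \<and> g\<eta> x = 0"
  shows "(\<integral>\<^sup>+x. indicator A x * ennreal (\<bar>\<eta> (x + z) * \<Psi> (U (x + z)) - \<eta> x * \<Psi> (U x)\<bar> powr p) \<partial>lborel)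
      \<le> ennreal (norm z powr p) * (\<integral>\<^sup>+x. indicator A' x *
            ennreal (norm ((\<eta> x * \<psi> (U x)) *\<^sub>R G x + \<Psi> (U x) *\<^sub>R g\<eta> x) powr p) \<partial>lborel)"
proof -
  have [measurable]: "U \<in> borel_measurable borel" "G \<in> borel_measurable borel"
    using S by (auto simp: sobolev_on_ball_def dest: borel_measurable_integrable)
  have L0: "L \<ge> 0" by (rule C1_lipschitz_L[OF \<Psi>])
  have M0: "M1 \<ge> 0" "M2 \<ge> 0" using M1[of x0] M2[of x0] norm_ge_zero[of "g\<eta> x0"] by linarith+
  have [measurable]: "\<eta> \<in> borel_measurable borel" "g\<eta> \<in> borel_measurable borel" using C1_measurable[OF C] by auto
  have [measurable]: "(\<lambda>x. \<psi> (U x)) \<in> borel_measurable borel" "(\<lambda>x. \<Psi> (U x)) \<in> borel_measurable borel"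
    using C1_lipschitz_measurable[OF \<Psi>, of U borel] U0 \<open>U \<in> borel_measurable borel\<close> by auto
  have [measurable]: "(\<lambda>x. \<Psi> (U (x + z))) \<in> borel_measurable borel"
    using measurable_compose[of "\<lambda>x. x + z" borel borel "\<lambda>x. \<Psi> (U x)" borel] by simp
  obtain u g P where ug: "\<And>n. C1 (u n) (g n)" "\<And>n x. u n x \<ge> 0" "integrable lborel P" "\<And>x. P x \<ge> 0"
    "AE x in lborel. (\<lambda>n. u n x) \<longlonglongrightarrow> U x"
    "AE x in lborel. \<forall>n. u n x powr p \<le> P x"
    "AE x in lborel. x \<in> ball x0 r \<longrightarrow> (\<lambda>n. g n x) \<longlonglongrightarrow> G x"
    "AE x in lborel. x \<in> ball x0 r \<longrightarrow> (\<forall>n. norm (g n x) powr p \<le> P x)"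
    "AE x in lborel. norm (G x) powr p \<le> P x"
    by (rule sobolev_approximation[OF S p r U0]) blast
  define f where "f n x = \<eta> x * \<Psi> (u n x)" for n x
  define D where "D n x = (\<eta> x * \<psi> (u n x)) *\<^sub>R g n x + \<Psi> (u n x) *\<^sub>R g\<eta> x" for n x
  let ?D = "\<lambda>x. (\<eta> x * \<psi> (U x)) *\<^sub>R G x + \<Psi> (U x) *\<^sub>R g\<eta> x"
  let ?F = "\<lambda>x. \<eta> x * \<Psi> (U x)"
  have CD: "C1 (f n) (D n)" for n
    unfolding D_def[abs_def] f_def[abs_def] by (rule C1_mult_composite[OF C ug(1,2) \<Psi>])
  have [measurable]: "f n \<in> borel_measurable borel" "D n \<in> borel_measurable borel" for n
    using C1_measurable[OF CD] by auto
  define B where "B = 2 powr p * ((M1 * L) powr p + M2 powr p * (2 powr p * (\<bar>\<Psi> 0\<bar> powr p + L powr p)))"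
  have Dlim: "(\<lambda>n. \<integral>\<^sup>+x. indicator A' x * ennreal (norm (D n x) powr p) \<partial>lborel)
      \<longlonglongrightarrow> (\<integral>\<^sup>+x. indicator A' x * ennreal (norm (?D x) powr p) \<partial>lborel)"
  proof (rule nn_integral_dominated_convergence[where w = "\<lambda>x. ennreal (indicator (ball x0 r) x *\<^sub>R (B * (P x + 1)))"])
    show "AE x in lborel. indicator A' x * ennreal (norm (D n x) powr p)
        \<le> ennreal (indicator (ball x0 r) x *\<^sub>R (B * (P x + 1)))" for n
      using ug(6,8)
    proof eventually_elim
      case (elim x)
      show ?case
      proof (cases "x \<in> A' \<and> x \<in> ball x0 r")
        case False
        then show ?thesis using out[of x] p by (cases "x \<in> A'") (auto simp: D_def)
      next
        case True
        have "\<bar>\<eta> x\<bar> * \<bar>\<psi> (u n x)\<bar> \<le> M1 * L"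
          using \<Psi> ug(2) M0 by (intro mult_mono M1) (auto simp: C1_lipschitz_def)
        then have a: "norm ((\<eta> x * \<psi> (u n x)) *\<^sub>R g n x) \<le> M1 * L * norm (g n x)"
          by (simp add: abs_mult mult_right_mono)
        have "\<bar>\<Psi> (u n x)\<bar> * norm (g\<eta> x) \<le> (\<bar>\<Psi> 0\<bar> + L * u n x) * M2"
          using C1_lipschitz_growth[OF \<Psi> ug(2)] L0 ug(2) by (intro mult_mono M2) auto
        then have b: "norm (\<Psi> (u n x) *\<^sub>R g\<eta> x) \<le> M2 * (\<bar>\<Psi> 0\<bar> + L * u n x)" by (simp add: mult.commute)
        have "norm (D n x) powr p \<le> (M1 * L * norm (g n x) + M2 * (\<bar>\<Psi> 0\<bar> + L * u n x)) powr p"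
          unfolding D_def using a b p
          by (intro powr_mono2) (auto intro: order_trans[OF norm_triangle_ineq])
        also have "\<dots> \<le> 2 powr p * ((M1 * L * norm (g n x)) powr p + (M2 * (\<bar>\<Psi> 0\<bar> + L * u n x)) powr p)"
          by (rule powr_add_le) (use p M0 L0 ug(2) in auto)
        also have "\<dots> = 2 powr p * ((M1 * L) powr p * norm (g n x) powr p + M2 powr p * (\<bar>\<Psi> 0\<bar> + L * u n x) powr p)"
          using M0 L0 ug(2) by (simp add: powr_mult)
        also have "\<dots> \<le> 2 powr p * ((M1 * L) powr p * (P x + 1) + M2 powr p * (2 powr p * (\<bar>\<Psi> 0\<bar> powr p + L powr p) * (P x + 1)))"
        proof (intro mult_left_mono add_mono)
          show "norm (g n x) powr p \<le> P x + 1" using elim True by (auto intro: order_trans[of _ "P x"])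
          have "(\<bar>\<Psi> 0\<bar> + L * u n x) powr p \<le> 2 powr p * (\<bar>\<Psi> 0\<bar> powr p + (L * u n x) powr p)"
            by (rule powr_add_le) (use p L0 ug(2) in auto)
          also have "\<dots> = 2 powr p * (\<bar>\<Psi> 0\<bar> powr p * 1 + L powr p * u n x powr p)"
            using L0 ug(2) by (simp add: powr_mult)
          also have "\<dots> \<le> 2 powr p * (\<bar>\<Psi> 0\<bar> powr p * (P x + 1) + L powr p * (P x + 1))"
            by (intro mult_left_mono add_mono) (use elim ug(4)[of x] in \<open>auto intro: order_trans[of _ "P x"]\<close>)
          also have "\<dots> = 2 powr p * (\<bar>\<Psi> 0\<bar> powr p + L powr p) * (P x + 1)" by (simp add: algebra_simps)
          finally show "(\<bar>\<Psi> 0\<bar> + L * u n x) powr p \<le> 2 powr p * (\<bar>\<Psi> 0\<bar> powr p + L powr p) * (P x + 1)" .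
        qed auto
        also have "\<dots> = B * (P x + 1)" by (simp add: B_def algebra_simps)
        finally show ?thesis using True by (simp add: ennreal_leI)
      qed
    qed
    have "integrable lborel (\<lambda>x. indicator (ball x0 r) x *\<^sub>R (B * (P x + 1)))"
      by (rule integrable_ball_affine[OF ug(3)])
    moreover have "B \<ge> 0" by (simp add: B_def)
    ultimately show "(\<integral>\<^sup>+x. ennreal (indicator (ball x0 r) x *\<^sub>R (B * (P x + 1))) \<partial>lborel) < \<infinity>"
      using ug(4) by (subst nn_integral_eq_integral) (auto intro!: AE_I2 mult_nonneg_nonneg add_nonneg_nonneg)
    show "AE x in lborel. (\<lambda>n. indicator A' x * ennreal (norm (D n x) powr p))
        \<longlonglongrightarrow> indicator A' x * ennreal (norm (?D x) powr p)"
      using ug(5,7)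
    proof eventually_elim
      case (elim x)
      show ?case
      proof (cases "x \<in> A' \<and> x \<in> ball x0 r")
        case False
        then show ?thesis using out[of x] by (cases "x \<in> A'") (auto simp: D_def)
      next
        case True
        then have "(\<lambda>n. g n x) \<longlonglongrightarrow> G x" using elim by blast
        moreover have "(\<lambda>n. \<Psi> (u n x)) \<longlonglongrightarrow> \<Psi> (U x)" "(\<lambda>n. \<psi> (u n x)) \<longlonglongrightarrow> \<psi> (U x)"
          using composite_limit[OF \<Psi> elim(1)] ug(2) U0 by auto
        ultimately have "(\<lambda>n. norm (D n x)) \<longlonglongrightarrow> norm (?D x)" unfolding D_def by (intro tendsto_intros)
        then have "(\<lambda>n. norm (D n x) powr p) \<longlonglongrightarrow> norm (?D x) powr p"
          by (rule tendsto_powr2) (use p in auto)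
        then show ?thesis using True by (simp add: tendsto_ennrealI)
      qed
    qed
    show "(\<lambda>x. ennreal (indicator (ball x0 r) x *\<^sub>R (B * (P x + 1)))) \<in> borel_measurable lborel"
      by (rule measurable_compose[OF borel_measurable_integrable[OF integrable_ball_affine[OF ug(3)]] measurable_ennreal])
  qed measurable
  have ae_z: "AE x in lborel. (\<lambda>n. u n (x + z)) \<longlonglongrightarrow> U (x + z)"
    using AE_translate[OF ug(5)] .
  have "(\<integral>\<^sup>+x. indicator A x * ennreal (\<bar>?F (x + z) - ?F x\<bar> powr p) \<partial>lborel)
      = (\<integral>\<^sup>+x. liminf (\<lambda>n. indicator A x * ennreal (\<bar>f n (x + z) - f n x\<bar> powr p)) \<partial>lborel)"
  proof (rule nn_integral_cong_AE)
    show "AE x in lborel. indicator A x * ennreal (\<bar>?F (x + z) - ?F x\<bar> powr p)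
        = liminf (\<lambda>n. indicator A x * ennreal (\<bar>f n (x + z) - f n x\<bar> powr p))"
      using ug(5) ae_z
    proof eventually_elim
      case (elim x)
      have "(\<lambda>n. \<Psi> (u n x)) \<longlonglongrightarrow> \<Psi> (U x)" "(\<lambda>n. \<Psi> (u n (x + z))) \<longlonglongrightarrow> \<Psi> (U (x + z))"
        using composite_limit(1)[OF \<Psi> elim(1)] composite_limit(1)[OF \<Psi> elim(2)] ug(2) U0 by auto
      then have "(\<lambda>n. \<bar>f n (x + z) - f n x\<bar>) \<longlonglongrightarrow> \<bar>?F (x + z) - ?F x\<bar>"
        unfolding f_def by (intro tendsto_intros)
      then have "(\<lambda>n. \<bar>f n (x + z) - f n x\<bar> powr p) \<longlonglongrightarrow> \<bar>?F (x + z) - ?F x\<bar> powr p"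
        by (rule tendsto_powr2) (use p in auto)
      then have "(\<lambda>n. indicator A x * ennreal (\<bar>f n (x + z) - f n x\<bar> powr p))
          \<longlonglongrightarrow> indicator A x * ennreal (\<bar>?F (x + z) - ?F x\<bar> powr p)"
        by (cases "x \<in> A") (auto simp: tendsto_ennrealI)
      then show ?case by (simp add: lim_imp_Liminf)
    qed
  qed
  also have "\<dots> \<le> liminf (\<lambda>n. \<integral>\<^sup>+x. indicator A x * ennreal (\<bar>f n (x + z) - f n x\<bar> powr p) \<partial>lborel)"
    by (rule nn_integral_liminf) measurable
  also have "\<dots> \<le> liminf (\<lambda>n. ennreal (norm z powr p) * (\<integral>\<^sup>+x. indicator A' x * ennreal (norm (D n x) powr p) \<partial>lborel))"
    by (intro Liminf_mono eventuallyI C1_translation_estimate[OF CD p] seg) auto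
  also have "\<dots> = ennreal (norm z powr p) * (\<integral>\<^sup>+x. indicator A' x * ennreal (norm (?D x) powr p) \<partial>lborel)"
    by (intro lim_imp_Liminf ennreal_tendsto_cmult Dlim) auto
  finally show ?thesis .
qed

lemma ennreal_mult_add:
  "a \<ge> 0 \<Longrightarrow> b \<ge> 0 \<Longrightarrow> c \<ge> 0 \<Longrightarrow> ennreal a * (ennreal b + ennreal c) = ennreal (a * (b + c))"
  by (simp add: ennreal_mult)

text \<open>Compare \<open>F x\<close> with \<open>F (x + z)\<close> and average over \<open>\<bar>z\<bar> < h\<close>. The differences are controlled by \<open>D\<close>, while
  the values \<open>F (x + z)\<close> with \<open>x \<in> E\<close> contribute at most the fraction \<open>\<bar>E\<bar> / \<bar>B\<^sub>h\<bar>\<close> of the left-hand side. The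
  volume condition allows that part to be absorbed. With the optimal \<open>h\<close> this is the inequality of Faber and
  Krahn: \<open>\<integral>\<bar>F\<bar>\<^sup>p\<close> is at most a multiple of \<open>\<bar>E\<bar>\<^bsup>p/d\<^esup> \<integral>\<bar>DF\<bar>\<^sup>p\<close>.\<close>
lemma faber_krahn_of_translations:
  fixes F :: "'a::euclidean_space \<Rightarrow> real"
  assumes [measurable]: "F \<in> borel_measurable borel" "E \<in> sets borel" and z: "\<And>x. x \<notin> E \<Longrightarrow> F x = 0"
    and iF: "integrable lborel (\<lambda>x. \<bar>F x\<bar> powr p)" and p: "p > 1" and h: "h > 0" and D: "D \<ge> 0"
    and T: "\<And>z. norm z \<le> h \<Longrightarrow> (\<integral>\<^sup>+x. ennreal (\<bar>F (x + z) - F x\<bar> powr p) \<partial>lborel) \<le> ennreal (norm z powr p * D)"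
    and Efin: "emeasure lborel E < \<infinity>"
    and E: "2 powr (p + 1) * measure lborel E \<le> measure lborel (ball (0::'a) h)"
  shows "(\<integral>x. \<bar>F x\<bar> powr p \<partial>lborel) \<le> 2 powr (p + 1) * h powr p * D"
proof -
  define I where "I = (\<integral>x. \<bar>F x\<bar> powr p \<partial>lborel)"
  define V where "V = measure lborel (ball (0::'a) h)"
  have [measurable]: "ball (0::'a) h \<in> sets borel" by simp
  have I0: "I \<ge> 0" by (simp add: I_def)
  have V: "V > 0" unfolding V_def by (rule content_ball_pos[OF h])
  have nnI: "(\<integral>\<^sup>+x. ennreal (\<bar>F x\<bar> powr p) \<partial>lborel) = ennreal I"
    unfolding I_def by (rule nn_integral_eq_integral[OF iF]) simp
  have nnV: "emeasure lborel (ball (0::'a) h) = ennreal V"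
    unfolding V_def by (rule emeasure_eq_ennreal_measure) (use emeasure_lborel_ball_finite in \<open>auto simp: less_top\<close>)
  have nnE: "emeasure lborel E = ennreal (measure lborel E)"
    by (rule emeasure_eq_ennreal_measure) (use Efin in auto)
  let ?b = "\<lambda>z. indicator (ball (0::'a) h) z :: ennreal"
  have "ennreal (V * I) = (\<integral>\<^sup>+z. ?b z * (\<integral>\<^sup>+x. ennreal (\<bar>F x\<bar> powr p) \<partial>lborel) \<partial>lborel)"
    using I0 V by (subst nn_integral_multc) (auto simp: nnV nnI ennreal_mult intro!: borel_measurable_indicator)
  also have "\<dots> \<le> (\<integral>\<^sup>+z. ?b z * (\<integral>\<^sup>+x. ennreal (2 powr p) * (ennreal (\<bar>F (x + z) - F x\<bar> powr p) + indicator E x * ennreal (\<bar>F (x + z)\<bar> powr p)) \<partial>lborel) \<partial>lborel)"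
  proof (intro nn_integral_mono mult_left_mono)
    fix z x :: 'a
    show "ennreal (\<bar>F x\<bar> powr p) \<le> ennreal (2 powr p) * (ennreal (\<bar>F (x + z) - F x\<bar> powr p) + indicator E x * ennreal (\<bar>F (x + z)\<bar> powr p))"
    proof (cases "x \<in> E")
      case True
      have "\<bar>F x\<bar> powr p \<le> (\<bar>F (x + z) - F x\<bar> + \<bar>F (x + z)\<bar>) powr p"
        using p by (intro powr_mono2) auto
      also have "\<dots> \<le> 2 powr p * (\<bar>F (x + z) - F x\<bar> powr p + \<bar>F (x + z)\<bar> powr p)"
        by (rule powr_add_le) (use p in auto)
      finally have "ennreal (\<bar>F x\<bar> powr p) \<le> ennreal (2 powr p * (\<bar>F (x + z) - F x\<bar> powr p + \<bar>F (x + z)\<bar> powr p))"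
        by (rule ennreal_leI)
      then show ?thesis using True by (simp add: ennreal_mult' flip: ennreal_plus)
    next
      case False
      then show ?thesis using z[of x] by simp
    qed
  qed simp
  also have "\<dots> = ennreal (2 powr p) * (\<integral>\<^sup>+z. ?b z * (\<integral>\<^sup>+x. ennreal (\<bar>F (x + z) - F x\<bar> powr p) \<partial>lborel)
        + ?b z * (\<integral>\<^sup>+x. indicator E x * ennreal (\<bar>F (x + z)\<bar> powr p) \<partial>lborel) \<partial>lborel)"
  proof -
    have "(\<integral>\<^sup>+x. ennreal (2 powr p) * (ennreal (\<bar>F (x + z) - F x\<bar> powr p) + indicator E x * ennreal (\<bar>F (x + z)\<bar> powr p)) \<partial>lborel)
        = ennreal (2 powr p) * ((\<integral>\<^sup>+x. ennreal (\<bar>F (x + z) - F x\<bar> powr p) \<partial>lborel)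
          + (\<integral>\<^sup>+x. indicator E x * ennreal (\<bar>F (x + z)\<bar> powr p) \<partial>lborel))" for z
    proof -
      have m: "(\<lambda>x. ennreal (\<bar>F (x + z) - F x\<bar> powr p)) \<in> borel_measurable lborel"
        "(\<lambda>x. indicator E x * ennreal (\<bar>F (x + z)\<bar> powr p)) \<in> borel_measurable lborel" by measurable
      show ?thesis using m by (subst nn_integral_cmult) (measurable, simp only: nn_integral_add[OF m])
    qed
    moreover define a1 where "a1 z = (\<integral>\<^sup>+x. ennreal (\<bar>F (x + z) - F x\<bar> powr p) \<partial>lborel)" for z
    moreover define a2 where "a2 z = (\<integral>\<^sup>+x. indicator E x * ennreal (\<bar>F (x + z)\<bar> powr p) \<partial>lborel)" for z
    moreover have [measurable]: "a1 \<in> borel_measurable borel" "a2 \<in> borel_measurable borel"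
      unfolding a1_def[abs_def] a2_def[abs_def] by measurable
    moreover have "(\<integral>\<^sup>+z. ?b z * (ennreal (2 powr p) * (a1 z + a2 z)) \<partial>lborel)
        = (\<integral>\<^sup>+z. ennreal (2 powr p) * (?b z * a1 z + ?b z * a2 z) \<partial>lborel)"
      by (intro nn_integral_cong) (simp add: distrib_left mult.left_commute)
    moreover have "\<dots> = ennreal (2 powr p) * (\<integral>\<^sup>+z. ?b z * a1 z + ?b z * a2 z \<partial>lborel)"
      by (rule nn_integral_cmult) measurable
    ultimately show ?thesis by simp
  qed
  also have "\<dots> \<le> ennreal (2 powr p) * (ennreal (V * (h powr p * D)) + ennreal (measure lborel E * I))"
  proof (intro mult_left_mono)
    have "(\<integral>\<^sup>+z. ?b z * (\<integral>\<^sup>+x. ennreal (\<bar>F (x + z) - F x\<bar> powr p) \<partial>lborel) \<partial>lborel) \<le> (\<integral>\<^sup>+z. ?b z * ennreal (h powr p * D) \<partial>lborel)"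
    proof (intro nn_integral_mono)
      fix z :: 'a
      show "?b z * (\<integral>\<^sup>+x. ennreal (\<bar>F (x + z) - F x\<bar> powr p) \<partial>lborel) \<le> ?b z * ennreal (h powr p * D)"
      proof (cases "norm z < h")
        case True
        then have "(\<integral>\<^sup>+x. ennreal (\<bar>F (x + z) - F x\<bar> powr p) \<partial>lborel) \<le> ennreal (norm z powr p * D)" by (intro T) auto
        also have "\<dots> \<le> ennreal (h powr p * D)"
          using True p D by (intro ennreal_leI mult_right_mono powr_mono2) auto
        finally show ?thesis using True by simp
      qed simp
    qed
    also have "\<dots> = ennreal (V * (h powr p * D))"
      using V D by (subst nn_integral_multc) (auto simp: nnV ennreal_mult intro!: borel_measurable_indicator)
    finally have 1: "(\<integral>\<^sup>+z. ?b z * (\<integral>\<^sup>+x. ennreal (\<bar>F (x + z) - F x\<bar> powr p) \<partial>lborel) \<partial>lborel) \<le> ennreal (V * (h powr p * D))" .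
    have "(\<integral>\<^sup>+z. ?b z * (\<integral>\<^sup>+x. indicator E x * ennreal (\<bar>F (x + z)\<bar> powr p) \<partial>lborel) \<partial>lborel)
        \<le> (\<integral>\<^sup>+z. (\<integral>\<^sup>+x. indicator E x * ennreal (\<bar>F (z + x)\<bar> powr p) \<partial>lborel) \<partial>lborel)"
      by (intro nn_integral_mono) (simp add: indicator_def add.commute)
    also have "\<dots> = (\<integral>\<^sup>+x. (\<integral>\<^sup>+z. indicator E x * ennreal (\<bar>F (z + x)\<bar> powr p) \<partial>lborel) \<partial>lborel)"
      by (rule lborel_pair.Fubini') measurable
    also have "\<dots> = (\<integral>\<^sup>+x. indicator E x * ennreal I \<partial>lborel)"
    proof (intro nn_integral_cong)
      fix x :: 'a
      have "(\<integral>\<^sup>+z. indicator E x * ennreal (\<bar>F (z + x)\<bar> powr p) \<partial>lborel) = indicator E x * (\<integral>\<^sup>+z. ennreal (\<bar>F (z + x)\<bar> powr p) \<partial>lborel)"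
        by (rule nn_integral_cmult) measurable
      also have "(\<integral>\<^sup>+z. ennreal (\<bar>F (z + x)\<bar> powr p) \<partial>lborel) = ennreal I"
        using nn_integral_translate[of "\<lambda>z. ennreal (\<bar>F z\<bar> powr p)" x] nnI by simp
      finally show "(\<integral>\<^sup>+z. indicator E x * ennreal (\<bar>F (z + x)\<bar> powr p) \<partial>lborel) = indicator E x * ennreal I" .
    qed
    also have "\<dots> = ennreal (measure lborel E * I)"
      using I0 by (subst nn_integral_multc) (auto simp: nnE ennreal_mult)
    finally have 2: "(\<integral>\<^sup>+z. ?b z * (\<integral>\<^sup>+x. indicator E x * ennreal (\<bar>F (x + z)\<bar> powr p) \<partial>lborel) \<partial>lborel) \<le> ennreal (measure lborel E * I)" .
    show "(\<integral>\<^sup>+z. ?b z * (\<integral>\<^sup>+x. ennreal (\<bar>F (x + z) - F x\<bar> powr p) \<partial>lborel)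
        + ?b z * (\<integral>\<^sup>+x. indicator E x * ennreal (\<bar>F (x + z)\<bar> powr p) \<partial>lborel) \<partial>lborel)
      \<le> ennreal (V * (h powr p * D)) + ennreal (measure lborel E * I)"
      by (subst nn_integral_add) (measurable, intro add_mono 1 2)
  qed simp
  also have "\<dots> = ennreal (2 powr p * (V * (h powr p * D) + measure lborel E * I))"
    using V D I0 by (intro ennreal_mult_add) auto
  finally have "V * I \<le> 2 powr p * (V * (h powr p * D) + measure lborel E * I)"
    by (subst (asm) ennreal_le_iff) (use V D I0 in auto)
  also have "\<dots> = 2 powr p * V * (h powr p * D) + (2 powr (p + 1) * measure lborel E) * I / 2"
    by (simp add: powr_add algebra_simps)
  also have "\<dots> \<le> 2 powr p * V * (h powr p * D) + V * I / 2"
    using E I0 by (simp add: V_def mult_right_mono)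
  finally have "V * I \<le> V * (2 powr (p + 1) * h powr p * D)"
    by (simp add: powr_add algebra_simps)
  then show ?thesis using V by (simp add: I_def)
qed

section \<open>Cutoff functions and the energy estimate\<close>

lemma DERIV_max_power:
  fixes t :: real
  assumes "N \<ge> 2"
  shows "((\<lambda>t. (max 0 t) ^ N) has_real_derivative (real N * (max 0 t) ^ (N - 1))) (at t)"
proof (cases t "0::real" rule: linorder_cases)
  case less
  have "((\<lambda>_. 0::real) has_real_derivative 0) (at t)" by simp
  then have "((\<lambda>t. (max 0 t) ^ N) has_real_derivative 0) (at t)"
    by (rule has_field_derivative_transform_within_open[where S="{..<0}"])
       (use less assms in \<open>auto simp: max_def power_0_left\<close>)
  then show ?thesis using less assms by (simp add: max_def power_0_left)
next
  case greater
  have "((\<lambda>t. t ^ N) has_real_derivative (real N * t ^ (N - 1))) (at t)"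
    using DERIV_pow[of N t] by simp
  then have "((\<lambda>t. (max 0 t) ^ N) has_real_derivative (real N * t ^ (N - 1))) (at t)"
    by (rule has_field_derivative_transform_within_open[where S="{0<..}"])
       (use greater in \<open>auto simp: max_def\<close>)
  then show ?thesis using greater by (simp add: max_def)
next
  case equal
  obtain n where N: "N = Suc (Suc n)" using assms by (metis add_2_eq_Suc le_Suc_ex)
  have "((\<lambda>h::real. (max 0 h) ^ N / h) \<longlongrightarrow> 0) (at 0)"
  proof (rule Lim_null_comparison)
    show "\<forall>\<^sub>F h::real in at 0. norm ((max 0 h) ^ N / h) \<le> \<bar>h\<bar> ^ Suc n"
    proof (rule eventuallyI)
      fix h :: real
      have "0 \<le> \<bar>h\<bar> ^ Suc n" by (rule zero_le_power) simp
      then show "norm ((max 0 h) ^ N / h) \<le> \<bar>h\<bar> ^ Suc n"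
        by (cases "h > 0") (auto simp: N max_def abs_mult power_abs)
    qed
    show "((\<lambda>h::real. \<bar>h\<bar> ^ Suc n) \<longlongrightarrow> 0) (at 0)"
      by (rule tendsto_eq_intros refl)+ simp
  qed
  then show ?thesis using equal
    by (simp add: has_field_derivative_iff N)
qed

text \<open>An explicit paraboloid without a plateau. Its powers are \<open>C\<^sup>1\<close>, and on a smaller concentric ball of radius
  \<open>\<sigma>\<close> it is at least \<open>1 - \<sigma> / s\<close>, which serves the same purpose as being equal to one.\<close>
definition cutoff :: "'a::euclidean_space \<Rightarrow> real \<Rightarrow> 'a \<Rightarrow> real" where
  "cutoff y s x = max 0 (1 - (norm (x - y))\<^sup>2 / s\<^sup>2)"

definition cutoff_gradient :: "nat \<Rightarrow> 'a::euclidean_space \<Rightarrow> real \<Rightarrow> 'a \<Rightarrow> 'a" where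
  "cutoff_gradient N y s x = (real N * cutoff y s x ^ (N - 1)) *\<^sub>R ((- 2 / s\<^sup>2) *\<^sub>R (x - y))"

lemma cutoff_nonneg: "cutoff y s x \<ge> 0" and cutoff_le_1: "cutoff y s x \<le> 1"
  by (auto simp: cutoff_def)

lemma cutoff_outside: "s > 0 \<Longrightarrow> x \<notin> ball y s \<Longrightarrow> cutoff y s x = 0"
proof -
  assume s: "s > 0" and "x \<notin> ball y s"
  then have "norm (x - y) \<ge> s" by (simp add: dist_norm norm_minus_commute)
  then have "(norm (x - y))\<^sup>2 / s\<^sup>2 \<ge> 1"
    using s by (simp add: power_mono)
  then show ?thesis by (simp add: cutoff_def)
qed

lemma cutoff_inner:
  assumes "s > 0" "0 \<le> \<sigma>" "\<sigma> \<le> s" "norm (x - y) \<le> \<sigma>"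
  shows "cutoff y s x \<ge> 1 - \<sigma> / s"
proof -
  have "(norm (x - y))\<^sup>2 / s\<^sup>2 = (norm (x - y) / s) * (norm (x - y) / s)" by (simp add: power2_eq_square)
  also have "\<dots> \<le> (\<sigma> / s) * 1"
    using assms by (intro mult_mono divide_right_mono) (auto simp: divide_le_eq_1)
  finally show ?thesis by (simp add: cutoff_def)
qed

lemma C1_cutoff:
  assumes "N \<ge> 2"
  shows "C1 (\<lambda>x. cutoff y s x ^ N) (cutoff_gradient N y s)"
proof -
  have "GDERIV (\<lambda>x. cutoff y s x ^ N) x :> cutoff_gradient N y s x" for x
  proof -
    have "((\<lambda>x. 1 - (x - y) \<bullet> (x - y) / s\<^sup>2) has_derivative (\<lambda>h. h \<bullet> ((- 2 / s\<^sup>2) *\<^sub>R (x - y)))) (at x)"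
      unfolding divide_inverse
      by (auto intro!: derivative_eq_intros ext simp: inner_diff_left inner_diff_right inner_commute algebra_simps)
    then have "GDERIV (\<lambda>x. 1 - (norm (x - y))\<^sup>2 / s\<^sup>2) x :> (- 2 / s\<^sup>2) *\<^sub>R (x - y)"
      by (simp add: gderiv_def power2_norm_eq_inner)
    from GDERIV_DERIV_compose[OF this DERIV_max_power[OF assms]] show ?thesis
      by (simp add: cutoff_def cutoff_gradient_def)
  qed
  moreover have "continuous_on UNIV (cutoff_gradient N y s)"
    unfolding cutoff_gradient_def[abs_def] cutoff_def[abs_def] divide_inverse by (intro continuous_intros)
  ultimately show ?thesis by (simp add: C1_def)
qed

lemma cutoff_gradient_le:
  assumes s: "s > 0" and N: "N \<ge> 2"
  shows "norm (cutoff_gradient N y s x) \<le> 2 * real N / s * cutoff y s x ^ (N - 1)"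
proof (cases "x \<in> ball y s")
  case False
  then show ?thesis using N cutoff_outside[OF s False] by (simp add: cutoff_gradient_def power_0_left)
next
  case True
  then have "norm (x - y) \<le> s" by (simp add: dist_norm norm_minus_commute)
  have "norm (cutoff_gradient N y s x) = real N * cutoff y s x ^ (N - 1) * (2 / s\<^sup>2 * norm (x - y))"
    using cutoff_nonneg[of y s x] by (simp add: cutoff_gradient_def)
  also have "\<dots> \<le> real N * cutoff y s x ^ (N - 1) * (2 / s\<^sup>2 * s)"
    using cutoff_nonneg[of y s x] \<open>norm (x - y) \<le> s\<close> by (intro mult_left_mono) auto
  also have "\<dots> = 2 * real N / s * cutoff y s x ^ (N - 1)" using s by (simp add: power2_eq_square)
  finally show ?thesis .
qed

lemma cutoff_power_le_1: "cutoff y s x ^ n \<le> 1" and cutoff_power_nonneg: "cutoff y s x ^ n \<ge> 0"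
  using cutoff_nonneg[of y s x] cutoff_le_1[of y s x] by (auto simp: power_le_one)

lemma cutoff_measurable [measurable]: "cutoff y s \<in> borel_measurable borel"
  unfolding cutoff_def[abs_def] by measurable

text \<open>Young's inequality by cases, according to which of \<open>q\<close> and \<open>\<theta> \<xi> g\<close> is larger. A high power \<open>N \<ge> p\<close> of the
  cutoff absorbs the power that is lost by differentiating it.\<close>
lemma young_with_cutoff:
  fixes q g \<xi> \<theta> p :: real
  assumes "p > 1" "q \<ge> 0" "g \<ge> 0" "0 \<le> \<xi>" "\<xi> \<le> 1" "real N \<ge> p" "N \<ge> 2" "\<theta> > 0"
  shows "q * g powr (p - 1) * \<xi> ^ (N - 1) \<le> \<theta> * (\<xi> ^ N * g powr p) + \<theta> powr (1 - p) * q powr p"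
proof (cases "q \<le> \<theta> * (\<xi> * g)")
  case True
  have e: "g * g powr (p - 1) = g powr p" using assms by (cases "g = 0") (auto simp: powr_diff)
  have e2: "\<xi> * \<xi> ^ (N - 1) = \<xi> ^ N" using assms by (cases N) auto
  have "q * (g powr (p - 1) * \<xi> ^ (N - 1)) \<le> \<theta> * (\<xi> * g) * (g powr (p - 1) * \<xi> ^ (N - 1))"
    by (rule mult_right_mono[OF True]) (use assms in auto)
  also have "\<dots> = \<theta> * ((\<xi> * \<xi> ^ (N - 1)) * (g * g powr (p - 1)))" by (simp add: algebra_simps)
  finally show ?thesis unfolding e e2 by (simp add: mult.assoc add_increasing2)
next
  case False
  have "0 \<le> \<theta> * (\<xi> * g)" using assms by simp
  then have q: "q > 0" using False by linarith
  have *: "\<xi> * g \<le> q / \<theta>"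
    using False assms by (simp add: pos_le_divide_eq mult.commute)
  have pw: "\<xi> ^ (N - 1) \<le> \<xi> powr (p - 1)"
  proof (cases "\<xi> = 0")
    case False
    then have "\<xi> > 0" using assms by simp
    then have "\<xi> ^ (N - 1) = \<xi> powr real (N - 1)" by (rule powr_realpow[symmetric])
    also have "\<dots> \<le> \<xi> powr (p - 1)" using assms by (intro powr_mono') auto
    finally show ?thesis .
  qed (use assms in \<open>auto simp: power_0_left\<close>)
  have "q * g powr (p - 1) * \<xi> ^ (N - 1) \<le> q * g powr (p - 1) * \<xi> powr (p - 1)"
    by (intro mult_left_mono pw) (use assms in auto)
  also have "\<dots> = q * (\<xi> * g) powr (p - 1)" using assms by (simp add: powr_mult)
  also have "\<dots> \<le> q * (q / \<theta>) powr (p - 1)"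
    using assms * by (intro mult_left_mono powr_mono2) auto
  also have "\<dots> = \<theta> powr (1 - p) * q powr p"
    using q assms by (simp add: powr_divide powr_diff field_simps)
  finally show ?thesis using assms by (simp add: add_increasing)
qed

text \<open>The argument \<open>c / (4 N K)\<close> is the parameter of Young's inequality for which half of the coercivity
  survives.\<close>
definition energy_const :: "real \<Rightarrow> real \<Rightarrow> real \<Rightarrow> nat \<Rightarrow> real" where
  "energy_const p c K N = 2 * (K + 2 * real N * K * ((c / (4 * real N * K)) powr (1 - p) + 1)) / c"

lemma energy_const_pos: "c > 0 \<Longrightarrow> K > 0 \<Longrightarrow> energy_const p c K N > 0"
  unfolding energy_const_def
  by (intro divide_pos_pos mult_pos_pos add_pos_nonneg mult_nonneg_nonneg add_nonneg_nonneg) auto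

lemma sobolev_measurable:
  assumes "sobolev_on_ball p x0 \<rho> U G"
  shows "U \<in> borel_measurable borel" "G \<in> borel_measurable borel"
  using assms by (auto simp: sobolev_on_ball_def dest: borel_measurable_integrable)

lemma integrable_ball_powr:
  fixes U :: "'a::euclidean_space \<Rightarrow> real"
  assumes S: "sobolev_on_ball p x0 \<rho> U G" and p: "p \<ge> 1" and U0: "\<And>x. U x \<ge> 0"
    and [measurable]: "f \<in> borel_measurable borel"
    and f: "\<And>x. \<bar>f x\<bar> \<le> A * (1 + U x) powr p"
  shows "integrable lborel (\<lambda>x. indicator (ball y s) x * f x)"
proof (rule Bochner_Integration.integrable_bound)
  have [measurable]: "ball y s \<in> sets borel" by simp
  have iU: "integrable lborel (\<lambda>x. U x powr p)" using S U0 by (simp add: sobolev_on_ball_def)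
  show "integrable lborel (\<lambda>x. indicator (ball y s) x *\<^sub>R ((\<bar>A\<bar> * 2 powr p) * (U x powr p + 1)))"
    by (rule integrable_ball_affine[OF iU])
  show "(\<lambda>x. indicator (ball y s) x * f x) \<in> borel_measurable lborel" by measurable
  show "AE x in lborel. norm (indicator (ball y s) x * f x)
      \<le> norm (indicator (ball y s) x *\<^sub>R ((\<bar>A\<bar> * 2 powr p) * (U x powr p + 1)))"
  proof (rule AE_I2)
    fix x
    have "\<bar>f x\<bar> \<le> \<bar>A\<bar> * (1 + U x) powr p"
      using f[of x] by (smt (verit) mult_right_mono powr_ge_zero)
    also have "\<dots> \<le> \<bar>A\<bar> * (2 powr p * (1 powr p + U x powr p))"
      using powr_add_le[of p 1 "U x"] p U0 by (intro mult_left_mono) auto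
    also have "\<dots> = (\<bar>A\<bar> * 2 powr p) * (U x powr p + 1)" by simp
    finally show "norm (indicator (ball y s) x * f x)
      \<le> norm (indicator (ball y s) x *\<^sub>R ((\<bar>A\<bar> * 2 powr p) * (U x powr p + 1)))"
      by (auto simp: indicator_def)
  qed
qed

text \<open>Caccioppoli's inequality for the test function \<open>\<xi> ^ N \<Psi>(U)\<close>. Here \<open>\<sigma>\<close> is the sign of \<open>\<psi>\<close>, so that increasing
  functions (for upper bounds) and decreasing ones (for lower bounds) are covered at once. The condition
  \<open>\<Psi> \<le> l \<bar>\<psi>\<bar>\<close> makes \<open>\<bar>\<psi>(U)\<bar>\<close> a common weight of all terms: the cutoff term becomes
  \<open>l(U)/s\<close> times the weight, to which Young's inequality applies with the gradient.\<close>
lemma energy_estimate: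
  fixes U :: "'a::euclidean_space \<Rightarrow> real"
  assumes W: "weak_solution p c K x0 \<rho> U G J" and p: "p > 1" and c: "c > 0" and K: "K > 0"
    and N: "N \<ge> 2" "real N \<ge> p" and s: "s > 0" "dist x0 y + s < \<rho>"
    and \<Psi>: "C1_lipschitz L \<Psi> \<psi>" and \<Psi>0: "\<And>t. t \<ge> 0 \<Longrightarrow> \<Psi> t \<ge> 0"
    and sg: "\<bar>\<sigma>\<bar> = 1" "\<And>t. t \<ge> 0 \<Longrightarrow> \<sigma> * \<psi> t \<ge> 0"
    and [measurable]: "l \<in> borel_measurable borel"
    and l: "\<And>t. t \<ge> 0 \<Longrightarrow> 0 \<le> l t" "\<And>t. t \<ge> 0 \<Longrightarrow> l t \<le> A * (1 + t)"
      "\<And>t. t \<ge> 0 \<Longrightarrow> \<Psi> t \<le> l t * \<bar>\<psi> t\<bar>"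
  shows "(\<integral>x. \<bar>\<psi> (U x)\<bar> * (cutoff y s x ^ N * norm (G x) powr p) \<partial>lborel)
    \<le> energy_const p c K N * (\<integral>x. indicator (ball y s) x * (\<bar>\<psi> (U x)\<bar> * (1 + (l (U x) / s) powr p)) \<partial>lborel)"
    and "integrable lborel (\<lambda>x. indicator (ball y s) x * (\<bar>\<psi> (U x)\<bar> * (1 + (l (U x) / s) powr p)))"
    and "integrable lborel (\<lambda>x. \<bar>\<psi> (U x)\<bar> * (cutoff y s x ^ N * norm (G x) powr p))"
proof -
  have S: "sobolev_on_ball p x0 \<rho> U G" and U0: "\<And>x. U x \<ge> 0" and iJ: "integrable lborel J"
    and J1: "AE x in lborel. norm (J x) \<le> K * (norm (G x) powr (p - 1) + 1)"
    and J2: "AE x in lborel. J x \<bullet> G x \<ge> c * norm (G x) powr p - K"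
    using W by (auto simp: weak_solution_def)
  note [measurable] = sobolev_measurable[OF S]
  have [measurable]: "(\<lambda>x. \<psi> (U x)) \<in> borel_measurable borel"
    using C1_lipschitz_measurable[OF \<Psi>, of U borel] U0 sobolev_measurable[OF S] by auto
  have L0: "L \<ge> 0" by (rule C1_lipschitz_L[OF \<Psi>])
  have \<psi>L: "\<bar>\<psi> (U x)\<bar> \<le> L" for x using \<Psi> U0 by (simp add: C1_lipschitz_def)
  let ?\<eta> = "\<lambda>x. cutoff y s x ^ N"
  let ?X = "\<lambda>x. J x \<bullet> ((?\<eta> x * \<psi> (U x)) *\<^sub>R G x + \<Psi> (U x) *\<^sub>R cutoff_gradient N y s x)"
  have z: "?\<eta> x = 0" if "x \<notin> cball x0 (dist x0 y + s)" for x
  proof -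
    have "x \<notin> ball y s" using that dist_triangle[of x0 x y] by (auto simp: dist_commute)
    then show ?thesis using cutoff_outside[OF s(1)] N by simp
  qed
  note X = weak_solution_composite_test[OF W p K C1_cutoff[OF N(1)] z s(2) \<Psi>]
  define \<theta> where "\<theta> = c / (4 * real N * K)"
  have \<theta>: "\<theta> > 0" using c K N by (simp add: \<theta>_def)
  define C' where "C' = K + 2 * real N * K * (\<theta> powr (1 - p) + 1)"
  have C'0: "C' \<ge> 0" using K by (auto simp: C'_def intro!: add_nonneg_nonneg mult_nonneg_nonneg)
  let ?q = "\<lambda>x. l (U x) / s"
  have A1: "l t \<le> \<bar>A\<bar> * (1 + t)" if "t \<ge> 0" for t
    using l(2)[OF that] that by (smt (verit) mult_right_mono)
  have ir: "integrable lborel (\<lambda>x. indicator (ball y s) x * (\<bar>\<psi> (U x)\<bar> * (1 + ?q x powr p)))"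
  proof (rule integrable_ball_powr[OF S _ U0])
    fix x
    have "?q x powr p \<le> (\<bar>A\<bar> * (1 + U x) / s) powr p"
      using A1[OF U0[of x]] l(1)[OF U0[of x]] s p by (intro powr_mono2 divide_right_mono) auto
    also have "\<dots> = (\<bar>A\<bar> / s) powr p * (1 + U x) powr p"
      using U0[of x] by (simp add: powr_mult[symmetric])
    finally have "?q x powr p \<le> (\<bar>A\<bar> / s) powr p * (1 + U x) powr p" .
    moreover have "1 \<le> (1 + U x) powr p" using U0[of x] p by (intro ge_one_powr_ge_zero) auto
    ultimately have "1 + ?q x powr p \<le> (1 + (\<bar>A\<bar> / s) powr p) * (1 + U x) powr p" by (simp add: algebra_simps)
    then have "\<bar>\<psi> (U x)\<bar> * (1 + ?q x powr p) \<le> L * ((1 + (\<bar>A\<bar> / s) powr p) * (1 + U x) powr p)"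
      by (intro mult_mono \<psi>L) (use L0 in auto)
    then show "\<bar>\<bar>\<psi> (U x)\<bar> * (1 + ?q x powr p)\<bar> \<le> (L * (1 + (\<bar>A\<bar> / s) powr p)) * (1 + U x) powr p"
      by (simp add: mult.assoc abs_mult)
  qed (use p in auto)
  have il: "integrable lborel (\<lambda>x. \<bar>\<psi> (U x)\<bar> * (?\<eta> x * norm (G x) powr p))"
  proof (rule Bochner_Integration.integrable_bound)
    show "integrable lborel (\<lambda>x. L * norm (G x) powr p)" using S by (simp add: sobolev_on_ball_def)
    show "AE x in lborel. norm (\<bar>\<psi> (U x)\<bar> * (?\<eta> x * norm (G x) powr p)) \<le> norm (L * norm (G x) powr p)"
    proof (rule AE_I2)
      fix x
      have "\<bar>\<psi> (U x)\<bar> * (?\<eta> x * norm (G x) powr p) \<le> L * (1 * norm (G x) powr p)"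
        by (intro mult_mono \<psi>L cutoff_power_le_1) (use L0 cutoff_power_nonneg[of y s x] in auto)
      then show "norm (\<bar>\<psi> (U x)\<bar> * (?\<eta> x * norm (G x) powr p)) \<le> norm (L * norm (G x) powr p)"
        using L0 cutoff_power_nonneg[of y s x N] by simp
    qed
  qed measurable
  have "AE x in lborel. (c / 2) * (\<bar>\<psi> (U x)\<bar> * (?\<eta> x * norm (G x) powr p))
      \<le> \<sigma> * ?X x + C' * (indicator (ball y s) x * (\<bar>\<psi> (U x)\<bar> * (1 + ?q x powr p)))"
    using J1 J2
  proof eventually_elim
    case (elim x)
    show ?case
    proof (cases "x \<in> ball y s")
      case False
      have "?\<eta> x = 0" "cutoff_gradient N y s x = 0"
        using cutoff_outside[OF s(1) False] N by (auto simp: cutoff_gradient_def power_0_left)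
      then show ?thesis using False N by (simp add: power_0_left)
    next
      case True
      define \<xi> where "\<xi> = cutoff y s x"
      define g where "g = norm (G x)"
      define f where "f = \<bar>\<psi> (U x)\<bar>"
      define q where "q = ?q x"
      have b: "0 \<le> \<xi>" "\<xi> \<le> 1" "g \<ge> 0" "f \<ge> 0" "q \<ge> 0"
        using cutoff_nonneg cutoff_le_1 l(1) U0 s by (auto simp: \<xi>_def g_def f_def q_def)
      have f: "\<sigma> * \<psi> (U x) = f"
        using sg(1) sg(2)[OF U0[of x]] by (auto simp: f_def abs_mult abs_if split: if_splits)
      have t1: "f * (\<xi> ^ N * (c * g powr p - K)) \<le> f * (\<xi> ^ N * (J x \<bullet> G x))"
        using elim b by (intro mult_left_mono) (auto simp: g_def)
      have t2: "\<xi> ^ N * K \<le> K" using b K by (simp add: mult_left_le_one_le power_le_one)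
      have "\<bar>J x \<bullet> cutoff_gradient N y s x\<bar> \<le> norm (J x) * norm (cutoff_gradient N y s x)"
        by (rule Cauchy_Schwarz_ineq2)
      also have "\<dots> \<le> (K * (g powr (p - 1) + 1)) * (2 * real N / s * \<xi> ^ (N - 1))"
        using elim cutoff_gradient_le[OF s(1) N(1)] K by (intro mult_mono) (auto simp: g_def \<xi>_def)
      finally have t3: "\<bar>J x \<bullet> cutoff_gradient N y s x\<bar> \<le> (K * (g powr (p - 1) + 1)) * (2 * real N / s * \<xi> ^ (N - 1))" .
      have "\<bar>\<sigma> * (\<Psi> (U x) * (J x \<bullet> cutoff_gradient N y s x))\<bar> = \<Psi> (U x) * \<bar>J x \<bullet> cutoff_gradient N y s x\<bar>"
        using sg(1) \<Psi>0[OF U0[of x]] by (simp add: abs_mult)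
      also have "\<dots> \<le> (l (U x) * f) * ((K * (g powr (p - 1) + 1)) * (2 * real N / s * \<xi> ^ (N - 1)))"
        using l(3)[OF U0[of x]] l(1)[OF U0[of x]] b t3 by (intro mult_mono) (auto simp: f_def)
      also have "\<dots> = f * (2 * real N * K * (q * g powr (p - 1) * \<xi> ^ (N - 1) + q * \<xi> ^ (N - 1)))"
        by (simp add: q_def algebra_simps add_divide_distrib)
      also have "\<dots> \<le> f * (2 * real N * K * ((\<theta> * (\<xi> ^ N * g powr p) + \<theta> powr (1 - p) * q powr p) + (1 + q powr p)))"
      proof (intro mult_left_mono add_mono)
        show "q * g powr (p - 1) * \<xi> ^ (N - 1) \<le> \<theta> * (\<xi> ^ N * g powr p) + \<theta> powr (1 - p) * q powr p"
          by (rule young_with_cutoff) (use p b N \<theta> in auto)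
        have "q * \<xi> ^ (N - 1) \<le> q * 1" using b by (intro mult_left_mono power_le_one) auto
        also have "\<dots> \<le> 1 + q powr p" using le_one_plus_powr[of p q] p b by simp
        finally show "q * \<xi> ^ (N - 1) \<le> 1 + q powr p" .
      qed (use K b in auto)
      finally have t4: "\<sigma> * (\<Psi> (U x) * (J x \<bullet> cutoff_gradient N y s x))
          \<ge> - (f * (2 * real N * K * ((\<theta> * (\<xi> ^ N * g powr p) + \<theta> powr (1 - p) * q powr p) + (1 + q powr p))))"
        by linarith
      have th: "2 * real N * K * \<theta> = c / 2" using K N by (simp add: \<theta>_def field_simps)
      have "\<sigma> * ?X x = f * (\<xi> ^ N * (J x \<bullet> G x)) + \<sigma> * (\<Psi> (U x) * (J x \<bullet> cutoff_gradient N y s x))"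
        unfolding f[symmetric] by (simp add: inner_add_right \<xi>_def algebra_simps)
      then have "\<sigma> * ?X x \<ge> f * (\<xi> ^ N * (c * g powr p - K))
          - f * (2 * real N * K * ((\<theta> * (\<xi> ^ N * g powr p) + \<theta> powr (1 - p) * q powr p) + (1 + q powr p)))"
        using t1 t4 by linarith
      moreover have "f * (\<xi> ^ N * (c * g powr p - K))
          - f * (2 * real N * K * ((\<theta> * (\<xi> ^ N * g powr p) + \<theta> powr (1 - p) * q powr p) + (1 + q powr p)))
          = f * ((c - 2 * real N * K * \<theta>) * (\<xi> ^ N * g powr p) - (\<xi> ^ N * K + 2 * real N * K * (\<theta> powr (1 - p) * q powr p + (1 + q powr p))))"
        by (simp add: algebra_simps)
      moreover have "\<dots> \<ge> f * ((c / 2) * (\<xi> ^ N * g powr p) - C' * (1 + q powr p))"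
      proof (rule mult_left_mono)
        have "\<xi> ^ N * K + 2 * real N * K * (\<theta> powr (1 - p) * q powr p + (1 + q powr p))
            \<le> K * (1 + q powr p) + 2 * real N * K * (\<theta> powr (1 - p) * (1 + q powr p) + (1 + q powr p))"
        proof (intro add_mono mult_left_mono)
          have "K * 1 \<le> K * (1 + q powr p)" using K by (intro mult_left_mono) auto
          then show "\<xi> ^ N * K \<le> K * (1 + q powr p)" using t2 by simp
        qed (use K in auto)
        also have "\<dots> = C' * (1 + q powr p)" by (simp add: C'_def algebra_simps)
        finally show "(c / 2) * (\<xi> ^ N * g powr p) - C' * (1 + q powr p)
          \<le> (c - 2 * real N * K * \<theta>) * (\<xi> ^ N * g powr p) - (\<xi> ^ N * K + 2 * real N * K * (\<theta> powr (1 - p) * q powr p + (1 + q powr p)))"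
          unfolding th by simp
      qed (use b in simp)
      ultimately have "f * ((c / 2) * (\<xi> ^ N * g powr p) - C' * (1 + q powr p)) \<le> \<sigma> * ?X x" by linarith
      then show ?thesis using True unfolding \<xi>_def[symmetric] g_def[symmetric] f_def[symmetric] q_def[symmetric]
        by (simp add: algebra_simps)
    qed
  qed
  then have "(\<integral>x. (c / 2) * (\<bar>\<psi> (U x)\<bar> * (?\<eta> x * norm (G x) powr p)) \<partial>lborel)
      \<le> (\<integral>x. \<sigma> * ?X x + C' * (indicator (ball y s) x * (\<bar>\<psi> (U x)\<bar> * (1 + ?q x powr p))) \<partial>lborel)"
    by (intro integral_mono_AE) (use il ir X(2) in auto)
  also have "\<dots> = \<sigma> * (\<integral>x. ?X x \<partial>lborel) + C' * (\<integral>x. indicator (ball y s) x * (\<bar>\<psi> (U x)\<bar> * (1 + ?q x powr p)) \<partial>lborel)"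
    using ir X(2) by simp
  also have "\<dots> = C' * (\<integral>x. indicator (ball y s) x * (\<bar>\<psi> (U x)\<bar> * (1 + ?q x powr p)) \<partial>lborel)"
    using X(1) by simp
  finally have "(c / 2) * (\<integral>x. \<bar>\<psi> (U x)\<bar> * (?\<eta> x * norm (G x) powr p) \<partial>lborel)
      \<le> C' * (\<integral>x. indicator (ball y s) x * (\<bar>\<psi> (U x)\<bar> * (1 + ?q x powr p)) \<partial>lborel)" by simp
  then show "(\<integral>x. \<bar>\<psi> (U x)\<bar> * (?\<eta> x * norm (G x) powr p) \<partial>lborel)
    \<le> energy_const p c K N * (\<integral>x. indicator (ball y s) x * (\<bar>\<psi> (U x)\<bar> * (1 + ?q x powr p)) \<partial>lborel)"
    using c by (simp add: energy_const_def C'_def \<theta>_def field_simps)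
  show "integrable lborel (\<lambda>x. indicator (ball y s) x * (\<bar>\<psi> (U x)\<bar> * (1 + ?q x powr p)))"
    "integrable lborel (\<lambda>x. \<bar>\<psi> (U x)\<bar> * (?\<eta> x * norm (G x) powr p))" by fact+
qed

section \<open>Smoothed truncations\<close>

text \<open>A \<open>C\<^sup>1\<close> version of the truncation \<open>max 0 (t - a)\<close> whose derivative rises linearly from zero at \<open>a\<close> to one at
  \<open>b\<close>.\<close>
definition ramp :: "real \<Rightarrow> real \<Rightarrow> real \<Rightarrow> real" where
  "ramp a b t = ((max 0 (t - a))\<^sup>2 - (max 0 (t - b))\<^sup>2) / (2 * (b - a))"

definition ramp_deriv :: "real \<Rightarrow> real \<Rightarrow> real \<Rightarrow> real" where
  "ramp_deriv a b t = (max 0 (t - a) - max 0 (t - b)) / (b - a)"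

lemma DERIV_ramp:
  assumes "a < b"
  shows "(ramp a b has_real_derivative ramp_deriv a b t) (at t)"
proof -
  have d: "((\<lambda>t. (max 0 (t - a))\<^sup>2) has_real_derivative 2 * max 0 (t - a)) (at t)" for a :: real
  proof -
    have 1: "((\<lambda>t. (max 0 t)\<^sup>2) has_real_derivative 2 * max 0 (t - a)) (at (t - a))"
      using DERIV_max_power[of 2 "t - a"] by simp
    have 2: "((\<lambda>t. t - a) has_real_derivative 1) (at t)" by (auto intro!: derivative_eq_intros)
    show ?thesis
      using DERIV_chain2[where f = "\<lambda>t. (max 0 t)\<^sup>2" and g = "\<lambda>t. t - a", OF 1 2] by simp
  qed
  have "((\<lambda>t. ((max 0 (t - a))\<^sup>2 - (max 0 (t - b))\<^sup>2) / (2 * (b - a))) has_real_derivative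
      (2 * max 0 (t - a) - 2 * max 0 (t - b)) / (2 * (b - a))) (at t)"
    by (intro DERIV_cdivide DERIV_diff d)
  moreover have "(2 * max 0 (t - a) - 2 * max 0 (t - b)) / (2 * (b - a)) = ramp_deriv a b t"
    unfolding ramp_deriv_def using assms by (simp add: divide_simps) (simp add: algebra_simps)
  ultimately show ?thesis by (simp add: ramp_def[abs_def])
qed

lemma continuous_ramp_deriv: "a < b \<Longrightarrow> continuous_on S (ramp_deriv a b)"
  unfolding ramp_deriv_def[abs_def] by (intro continuous_intros) auto

lemma ramp_deriv_bounds:
  assumes "a < b"
  shows "0 \<le> ramp_deriv a b t" "ramp_deriv a b t \<le> 1" "t \<le> a \<Longrightarrow> ramp_deriv a b t = 0" "b \<le> t \<Longrightarrow> ramp_deriv a b t = 1"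
  using assms by (auto simp: ramp_deriv_def max_def field_simps)

lemma ramp_bounds:
  assumes "a < b"
  shows "max 0 (t - b) \<le> ramp a b t" "ramp a b t \<le> max 0 (t - a)" "ramp a b t \<le> max 0 (t - a) * ramp_deriv a b t"
proof -
  consider "t \<le> a" | "a < t" "t \<le> b" | "b < t" by linarith
  then have "max 0 (t - b) \<le> ramp a b t \<and> ramp a b t \<le> max 0 (t - a) * ramp_deriv a b t"
  proof cases
    case 1
    then show ?thesis using assms by (simp add: ramp_def ramp_deriv_def max_def)
  next
    case 2
    have "(t - a)\<^sup>2 / (2 * (b - a)) \<le> (t - a)\<^sup>2 / (b - a)"
      by (rule divide_left_mono) (use assms in auto)
    moreover have "0 \<le> (t - a)\<^sup>2 / (2 * (b - a))" using assms by simp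
    moreover have "ramp a b t = (t - a)\<^sup>2 / (2 * (b - a))" "ramp_deriv a b t = (t - a) / (b - a)"
      using 2 by (simp_all add: ramp_def ramp_deriv_def max_def)
    ultimately show ?thesis using 2 by (simp add: max_def power2_eq_square)
  next
    case 3
    have "ramp a b t = t - (a + b) / 2"
      using 3 assms by (simp add: ramp_def max_def power2_eq_square field_simps)
    then show ?thesis using 3 assms by (simp add: ramp_deriv_def max_def field_simps)
  qed
  moreover have "max 0 (t - a) * ramp_deriv a b t \<le> max 0 (t - a) * 1"
    by (intro mult_left_mono ramp_deriv_bounds assms) auto
  ultimately have "max 0 (t - b) \<le> ramp a b t \<and> ramp a b t \<le> max 0 (t - a)
      \<and> ramp a b t \<le> max 0 (t - a) * ramp_deriv a b t" by auto
  then show "max 0 (t - b) \<le> ramp a b t" "ramp a b t \<le> max 0 (t - a)" "ramp a b t \<le> max 0 (t - a) * ramp_deriv a b t"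
    by blast+
qed

lemma C1_lipschitz_compose:
  assumes \<Theta>: "C1_lipschitz L \<Theta> \<theta>" and g: "\<And>v. (g has_real_derivative g' v) (at v)" "continuous_on UNIV g'"
    and b: "\<And>v. \<bar>g' v\<bar> \<le> B"
  shows "C1_lipschitz (B * L) (\<lambda>t. g (\<Theta> t)) (\<lambda>t. g' (\<Theta> t) * \<theta> t)"
  unfolding C1_lipschitz_def
proof (intro conjI allI impI)
  show "continuous_on {0..} (\<lambda>t. g' (\<Theta> t) * \<theta> t)"
    using \<Theta> C1_lipschitz_continuous[OF \<Theta>] continuous_on_compose2[OF g(2)]
    by (intro continuous_intros) (auto simp: C1_lipschitz_def)
  fix t :: real assume t: "0 \<le> t"
  show "((\<lambda>t. g (\<Theta> t)) has_real_derivative g' (\<Theta> t) * \<theta> t) (at t)"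
    by (rule DERIV_chain2[OF g(1)]) (use \<Theta> t in \<open>simp add: C1_lipschitz_def\<close>)
  show "\<bar>g' (\<Theta> t) * \<theta> t\<bar> \<le> B * L"
    unfolding abs_mult using b \<Theta> t order_trans[OF abs_ge_zero b[of 0]]
    by (intro mult_mono) (simp_all add: C1_lipschitz_def)
qed

section \<open>De Giorgi iteration\<close>

text \<open>The energy of \<open>\<Theta>(U)\<close> above the level \<open>b\<close>, up to the cutoff, is controlled by the excess over a lower level
  \<open>a\<close>, uniformly in the gap: the gap is the room that is needed for a \<open>C\<^sup>1\<close> truncation.\<close>
definition level_energy ::
  "real \<Rightarrow> real \<Rightarrow> nat \<Rightarrow> 'a::euclidean_space \<Rightarrow> real \<Rightarrow> ('a \<Rightarrow> real) \<Rightarrow> ('a \<Rightarrow> 'a) \<Rightarrow> (real \<Rightarrow> real) \<Rightarrow> (real \<Rightarrow> real) \<Rightarrow> bool" where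
  "level_energy p C N y s U G \<Theta> \<theta> \<longleftrightarrow> (\<forall>a b. 0 \<le> a \<and> a < b \<longrightarrow>
     (\<integral>x. indicator {b..} (\<Theta> (U x)) * (cutoff y s x ^ N * norm (\<theta> (U x) *\<^sub>R G x) powr p) \<partial>lborel)
     \<le> C * s powr (-p) * (\<integral>x. indicator (ball y s) x * (indicator {a<..} (\<Theta> (U x)) * (1 + max 0 (\<Theta> (U x) - a) powr p)) \<partial>lborel))"

definition excess :: "real \<Rightarrow> 'a::euclidean_space \<Rightarrow> ('a \<Rightarrow> real) \<Rightarrow> real \<Rightarrow> real \<Rightarrow> real" where
  "excess p y w s k = (\<integral>x. indicator (ball y s) x * max 0 (w x - k) powr p \<partial>lborel)"

lemma level_growth:
  assumes \<Theta>: "C1_lipschitz L \<Theta> \<theta>" and t: "t \<ge> 0" and k: "k \<ge> 0"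
  shows "max 0 (\<Theta> t - k) \<le> (\<bar>\<Theta> 0\<bar> + L) * (1 + t)"
proof -
  have "\<bar>\<Theta> t\<bar> \<le> \<bar>\<Theta> 0\<bar> + L * t" by (rule C1_lipschitz_growth[OF \<Theta> t])
  moreover have "L \<ge> 0" by (rule C1_lipschitz_L[OF \<Theta>])
  then have "\<bar>\<Theta> 0\<bar> + L * t \<le> (\<bar>\<Theta> 0\<bar> + L) * (1 + t)" using t by (simp add: algebra_simps)
  moreover have "0 \<le> (\<bar>\<Theta> 0\<bar> + L) * (1 + t)" using t \<open>L \<ge> 0\<close> by simp
  ultimately show ?thesis using k by (auto simp: max_def)
qed

lemma
  fixes U :: "'a::euclidean_space \<Rightarrow> real"
  assumes S: "sobolev_on_ball p x0 \<rho> U G" and p: "p > 1" and U0: "\<And>x. U x \<ge> 0"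
    and \<Theta>: "C1_lipschitz L \<Theta> \<theta>" and k: "k \<ge> 0"
  shows integrable_excess: "integrable lborel (\<lambda>x. indicator (ball y s) x * max 0 (\<Theta> (U x) - k) powr p)"
    and excess_nonneg: "excess p y (\<lambda>x. \<Theta> (U x)) s k \<ge> 0"
    and excess_mono: "\<sigma> \<le> s \<Longrightarrow> k \<le> k' \<Longrightarrow> excess p y (\<lambda>x. \<Theta> (U x)) \<sigma> k' \<le> excess p y (\<lambda>x. \<Theta> (U x)) s k"
proof -
  have [measurable]: "(\<lambda>x. \<Theta> (U x)) \<in> borel_measurable borel"
    using C1_lipschitz_measurable[OF \<Theta>, of U borel] U0 sobolev_measurable[OF S] by auto
  have i: "integrable lborel (\<lambda>x. indicator (ball y s) x * max 0 (\<Theta> (U x) - k) powr p)" if "k \<ge> 0" for k s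
  proof (rule integrable_ball_powr[OF S _ U0])
    fix x
    have "max 0 (\<Theta> (U x) - k) powr p \<le> ((\<bar>\<Theta> 0\<bar> + L) * (1 + U x)) powr p"
      using level_growth[OF \<Theta> U0 that, of x] p by (intro powr_mono2) auto
    also have "\<dots> = (\<bar>\<Theta> 0\<bar> + L) powr p * (1 + U x) powr p" by (simp add: powr_mult)
    finally show "\<bar>max 0 (\<Theta> (U x) - k) powr p\<bar> \<le> (\<bar>\<Theta> 0\<bar> + L) powr p * (1 + U x) powr p" by simp
  qed (use p in auto)
  then show "integrable lborel (\<lambda>x. indicator (ball y s) x * max 0 (\<Theta> (U x) - k) powr p)" using k .
  show "excess p y (\<lambda>x. \<Theta> (U x)) s k \<ge> 0" unfolding excess_def by (intro integral_nonneg_AE) auto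
  show "excess p y (\<lambda>x. \<Theta> (U x)) \<sigma> k' \<le> excess p y (\<lambda>x. \<Theta> (U x)) s k" if "\<sigma> \<le> s" "k \<le> k'"
    unfolding excess_def
  proof (rule integral_mono)
    show "indicator (ball y \<sigma>) x * max 0 (\<Theta> (U x) - k') powr p
        \<le> indicator (ball y s) x * max 0 (\<Theta> (U x) - k) powr p" for x
      using that p by (intro mult_mono powr_mono2) (auto simp: indicator_def)
  qed (use i that k in auto)
qed

text \<open>The constant of the Faber-Krahn inequality times that of the energy bound for the truncated function.\<close>
definition step_const :: "'a::euclidean_space itself \<Rightarrow> real \<Rightarrow> real \<Rightarrow> nat \<Rightarrow> real" where
  "step_const _ p C N = 2 powr (p + 1) * (2 powr (p + 1) / measure lborel (ball (0::'a) 1)) powr (p / DIM('a)) *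
     (2 powr p * (2 * C + (2 * real N) powr p))"

lemma step_const_pos: "C \<ge> 0 \<Longrightarrow> N \<ge> 1 \<Longrightarrow> step_const TYPE('a::euclidean_space) p C N > 0"
proof -
  assume "C \<ge> 0" "N \<ge> 1"
  moreover have "measure lborel (ball (0::'a) 1) > 0" by (rule content_ball_pos) simp
  ultimately show ?thesis unfolding step_const_def
    by (intro mult_pos_pos add_nonneg_pos) auto
qed

lemma ball_volume: "r \<ge> 0 \<Longrightarrow> measure lborel (ball (c::'a::euclidean_space) r) = measure lborel (ball (0::'a) 1) * r ^ DIM('a)"
  by (simp add: content_ball)

text \<open>Four levels \<open>e < e + \<delta> < e + 2\<delta> < e + 3\<delta>\<close> are used. By Chebyshev's inequality the set above \<open>e + \<delta>\<close> has
  measure at most \<open>X = \<delta>\<^bsup>-p\<^esup> Z s e\<close>, and the level energy above \<open>e + 2\<delta>\<close> is then bounded by a multiple of \<open>X\<close>.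
  The truncation between \<open>e + 2\<delta>\<close> and \<open>e + 3\<delta>\<close>, times the cutoff, is supported in a set of measure at most
  \<open>X\<close>, and the Faber-Krahn inequality contributes the superlinear factor \<open>X\<^bsup>p/d\<^esup>\<close>.\<close>
lemma degiorgi_step:
  fixes U :: "'a::euclidean_space \<Rightarrow> real"
  assumes S: "sobolev_on_ball p x0 \<rho> U G" and p: "p > 1" and U0: "\<And>x. U x \<ge> 0"
    and \<Theta>: "C1_lipschitz L \<Theta> \<theta>" and N: "N \<ge> 2" and C: "C \<ge> 0"
    and s: "0 < \<sigma>" "\<sigma> < s" "dist x0 y + s < \<rho>"
    and E: "level_energy p C N y s U G \<Theta> \<theta>"
    and e: "0 \<le> e" "0 < \<delta>" "\<delta> \<le> 1"
  defines "Z \<equiv> excess p y (\<lambda>x. \<Theta> (U x))"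
  shows "Z \<sigma> (e + 3 * \<delta>) \<le> step_const TYPE('a) p C N * (1 - \<sigma> / s) powr (- (real N * p)) * s powr (-p)
      * (\<delta> powr (-p) * Z s e) powr (1 + p / DIM('a))"
proof -
  note [measurable] = sobolev_measurable[OF S]
  have [measurable]: "ball y s \<in> sets borel" "ball y \<sigma> \<in> sets borel" by simp_all
  have [measurable]: "(\<lambda>x. \<Theta> (U x)) \<in> borel_measurable borel" "(\<lambda>x. \<theta> (U x)) \<in> borel_measurable borel"
    using C1_lipschitz_measurable[OF \<Theta>, of U borel] U0 sobolev_measurable[OF S] by auto
  define a b k where "a = e + \<delta>" and "b = e + 2 * \<delta>" and "k = e + 3 * \<delta>"
  have abk: "0 \<le> a" "e < a" "a < b" "b < k" "0 \<le> b" using e by (auto simp: a_def b_def k_def)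
  define z where "z = Z s e"
  have z0: "z \<ge> 0" unfolding z_def Z_def by (rule excess_nonneg[OF S p U0 \<Theta> e(1)])
  let ?w = "\<lambda>x. \<Theta> (U x)"
  let ?B = "\<lambda>x. indicator (ball y s) x :: real"
  let ?\<xi> = "cutoff y s"
  have iz: "integrable lborel (\<lambda>x. ?B x * max 0 (?w x - e) powr p)"
    by (rule integrable_excess[OF S p U0 \<Theta> e(1)])
  have s0: "s > 0" using s by simp
  show ?thesis
  proof (cases "z = 0")
    case True
    have "Z \<sigma> (e + 3 * \<delta>) \<le> z"
      unfolding z_def Z_def by (rule excess_mono[OF S p U0 \<Theta> e(1)]) (use s e in auto)
    then show ?thesis using True by (simp add: z_def[symmetric])
  next
    case False
    then have z: "z > 0" using z0 by simp
    let ?\<omega> = "measure lborel (ball (0::'a) 1)"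
    have \<omega>: "?\<omega> > 0" by (rule content_ball_pos) simp
    define X where "X = \<delta> powr (-p) * z"
    have X: "X > 0" using z e by (simp add: X_def)
    have cheb: "1 \<le> \<delta> powr (-p) * max 0 (v - e) powr p" if "v > a" for v
    proof -
      have "1 = \<delta> powr (-p) * \<delta> powr p" using e by (simp flip: powr_add)
      also have "\<dots> \<le> \<delta> powr (-p) * max 0 (v - e) powr p"
        using that e p by (intro mult_left_mono powr_mono2) (auto simp: a_def)
      finally show ?thesis .
    qed
    have iX: "integrable lborel (\<lambda>x. \<delta> powr (-p) * (?B x * max 0 (?w x - e) powr p))"
      using iz by simp
    have vX: "(\<integral>x. \<delta> powr (-p) * (?B x * max 0 (?w x - e) powr p) \<partial>lborel) = X"
      by (simp add: X_def z_def Z_def excess_def)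
    define Ee where "Ee = {x. x \<in> ball y s \<and> ?w x > b}"
    have [measurable]: "Ee \<in> sets borel" unfolding Ee_def by measurable
    have Efin: "emeasure lborel Ee < \<infinity>"
    proof -
      have "Ee \<subseteq> ball y s" by (auto simp: Ee_def)
      then have "emeasure lborel Ee \<le> emeasure lborel (ball y s)" by (rule emeasure_mono) simp
      then show ?thesis using emeasure_lborel_ball_finite by (rule le_less_trans)
    qed
    have iE: "integrable lborel (indicator Ee :: 'a \<Rightarrow> real)" using Efin by (simp add: integrable_indicator_iff)
    have mE: "measure lborel Ee \<le> X"
    proof -
      have "measure lborel Ee = (\<integral>x. indicator Ee x \<partial>lborel)" by simp
      also have "\<dots> \<le> (\<integral>x. \<delta> powr (-p) * (?B x * max 0 (?w x - e) powr p) \<partial>lborel)"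
        by (rule integral_mono[OF iE iX]) (use cheb abk in \<open>auto simp: Ee_def indicator_def\<close>)
      finally show ?thesis using vX by simp
    qed
    define \<Psi> where "\<Psi> t = ramp b k (\<Theta> t)" for t
    define \<psi> where "\<psi> t = ramp_deriv b k (\<Theta> t) * \<theta> t" for t
    have \<Psi>: "C1_lipschitz (1 * L) \<Psi> \<psi>"
      unfolding \<Psi>_def[abs_def] \<psi>_def[abs_def]
      by (rule C1_lipschitz_compose[OF \<Theta> DERIV_ramp continuous_ramp_deriv])
         (use ramp_deriv_bounds[OF abk(4)] abk in auto)
    have [measurable]: "(\<lambda>x. \<Psi> (U x)) \<in> borel_measurable borel" "(\<lambda>x. \<psi> (U x)) \<in> borel_measurable borel"
      using C1_lipschitz_measurable[OF \<Psi>, of U borel] U0 sobolev_measurable[OF S] by auto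
    have \<Psi>0: "\<Psi> t \<ge> 0" "\<Psi> t \<le> max 0 (\<Theta> t - b)" "\<Psi> t \<ge> max 0 (\<Theta> t - k)" for t
      using ramp_bounds[OF abk(4), of "\<Theta> t"] by (auto simp: \<Psi>_def)
    define F where "F x = ?\<xi> x ^ N * \<Psi> (U x)" for x
    let ?g = "cutoff_gradient N y s"
    define DF where "DF x = (?\<xi> x ^ N * \<psi> (U x)) *\<^sub>R G x + \<Psi> (U x) *\<^sub>R ?g x" for x
    have gm [measurable]: "?g \<in> borel_measurable borel" by (rule C1_measurable(2)[OF C1_cutoff[OF N]])
    have [measurable]: "F \<in> borel_measurable borel" "DF \<in> borel_measurable borel"
      unfolding F_def[abs_def] DF_def[abs_def] by measurable
    have gout: "?\<xi> x = 0 \<and> ?g x = 0" if "x \<notin> ball y s" for x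
      using cutoff_outside[OF s0 that] N by (auto simp: cutoff_gradient_def power_0_left)
    \<comment> \<open>The derivative of the truncation is supported above \<open>b\<close>, where the level energy controls the
        gradient.\<close>
    let ?L1 = "\<lambda>x. indicator {b..} (?w x) * (?\<xi> x ^ N * norm (\<theta> (U x) *\<^sub>R G x) powr p)"
    have ptD: "norm (DF x) powr p \<le> 2 powr p * (?L1 x + (2 * real N / s) powr p * (?B x * max 0 (?w x - e) powr p))" for x
    proof (cases "x \<in> ball y s")
      case False
      then show ?thesis using gout[OF False] N by (simp add: DF_def power_0_left)
    next
      case True
      have \<xi>1: "0 \<le> ?\<xi> x ^ N" "?\<xi> x ^ N \<le> 1" by (rule cutoff_power_nonneg cutoff_power_le_1)+
      have "norm (DF x) \<le> norm ((?\<xi> x ^ N * \<psi> (U x)) *\<^sub>R G x) + norm (\<Psi> (U x) *\<^sub>R ?g x)"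
        unfolding DF_def by (rule norm_triangle_ineq)
      then have "norm (DF x) powr p \<le> (norm ((?\<xi> x ^ N * \<psi> (U x)) *\<^sub>R G x) + norm (\<Psi> (U x) *\<^sub>R ?g x)) powr p"
        using p by (intro powr_mono2) auto
      also have "\<dots> \<le> 2 powr p * (norm ((?\<xi> x ^ N * \<psi> (U x)) *\<^sub>R G x) powr p + norm (\<Psi> (U x) *\<^sub>R ?g x) powr p)"
        by (rule powr_add_le) (use p in auto)
      also have "\<dots> \<le> 2 powr p * (?L1 x + (2 * real N / s) powr p * (?B x * max 0 (?w x - e) powr p))"
      proof (intro mult_left_mono add_mono)
        show "norm ((?\<xi> x ^ N * \<psi> (U x)) *\<^sub>R G x) powr p \<le> ?L1 x"
        proof (cases "?w x \<ge> b")
          case True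
          have "norm ((?\<xi> x ^ N * \<psi> (U x)) *\<^sub>R G x) = ?\<xi> x ^ N * (ramp_deriv b k (?w x) * norm (\<theta> (U x) *\<^sub>R G x))"
            using \<xi>1 ramp_deriv_bounds(1)[OF abk(4)] cutoff_nonneg[of y s x] by (simp add: \<psi>_def abs_mult)
          also have "\<dots> \<le> ?\<xi> x ^ N * (1 * norm (\<theta> (U x) *\<^sub>R G x))"
            using \<xi>1 ramp_deriv_bounds(2)[OF abk(4)] by (intro mult_left_mono mult_right_mono) auto
          finally have "norm ((?\<xi> x ^ N * \<psi> (U x)) *\<^sub>R G x) powr p \<le> (?\<xi> x ^ N * norm (\<theta> (U x) *\<^sub>R G x)) powr p"
            using p by (intro powr_mono2) auto
          also have "\<dots> = (?\<xi> x ^ N) powr p * norm (\<theta> (U x) *\<^sub>R G x) powr p" by (rule powr_mult)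
          also have "\<dots> \<le> ?\<xi> x ^ N * norm (\<theta> (U x) *\<^sub>R G x) powr p"
          proof (rule mult_right_mono)
            have "(?\<xi> x ^ N) powr p \<le> (?\<xi> x ^ N) powr 1" using \<xi>1 p by (intro powr_mono') auto
            then show "(?\<xi> x ^ N) powr p \<le> ?\<xi> x ^ N" using \<xi>1 by simp
          qed simp
          finally show ?thesis using True by simp
        next
          case False
          then have "\<psi> (U x) = 0" using ramp_deriv_bounds(3)[OF abk(4), of "?w x"] by (simp add: \<psi>_def)
          then show ?thesis using False by simp
        qed
        have "norm (?g x) \<le> 2 * real N / s * ?\<xi> x ^ (N - 1)" by (rule cutoff_gradient_le[OF s0 N])
        also have "\<dots> \<le> 2 * real N / s * 1" using s0 cutoff_power_le_1 by (intro mult_left_mono) auto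
        finally have g1: "norm (?g x) \<le> 2 * real N / s" by simp
        have "norm (\<Psi> (U x) *\<^sub>R ?g x) \<le> max 0 (?w x - e) * (2 * real N / s)"
          unfolding norm_scaleR using \<Psi>0(1,2)[of "U x"] abk g1 by (intro mult_mono) (auto simp: max_def split: if_splits)
        then have "norm (\<Psi> (U x) *\<^sub>R ?g x) powr p \<le> (max 0 (?w x - e) * (2 * real N / s)) powr p"
          using p by (intro powr_mono2) auto
        also have "\<dots> = (2 * real N / s) powr p * max 0 (?w x - e) powr p"
          by (simp only: powr_mult mult.commute)
        finally show "norm (\<Psi> (U x) *\<^sub>R ?g x) powr p \<le> (2 * real N / s) powr p * (?B x * max 0 (?w x - e) powr p)"
          using True by simp
      qed simp
      finally show ?thesis .
    qed
    have iL1: "integrable lborel ?L1"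
    proof (rule Bochner_Integration.integrable_bound)
      show "integrable lborel (\<lambda>x. L powr p * norm (G x) powr p)" using S by (simp add: sobolev_on_ball_def)
      show "AE x in lborel. norm (?L1 x) \<le> norm (L powr p * norm (G x) powr p)"
      proof (rule AE_I2)
        fix x
        have "norm (\<theta> (U x) *\<^sub>R G x) powr p \<le> (L * norm (G x)) powr p"
          using \<Theta> U0 p by (intro powr_mono2) (auto simp: C1_lipschitz_def mult_right_mono)
        also have "\<dots> = L powr p * norm (G x) powr p" by (rule powr_mult)
        finally have "?\<xi> x ^ N * norm (\<theta> (U x) *\<^sub>R G x) powr p \<le> 1 * (L powr p * norm (G x) powr p)"
          using cutoff_power_le_1[of y s x N] cutoff_power_nonneg[of y s x N] by (intro mult_mono) auto
        then show "norm (?L1 x) \<le> norm (L powr p * norm (G x) powr p)"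
          using cutoff_power_nonneg[of y s x N] by (auto simp: indicator_def abs_mult)
      qed
    qed measurable
    have iDF: "integrable lborel (\<lambda>x. norm (DF x) powr p)"
    proof (rule Bochner_Integration.integrable_bound)
      show "integrable lborel (\<lambda>x. 2 powr p * (?L1 x + (2 * real N / s) powr p * (?B x * max 0 (?w x - e) powr p)))"
        using iL1 iz by simp
      show "AE x in lborel. norm (norm (DF x) powr p)
          \<le> norm (2 powr p * (?L1 x + (2 * real N / s) powr p * (?B x * max 0 (?w x - e) powr p)))"
        using ptD by (intro AE_I2) (auto intro: order_trans[OF _ abs_ge_self])
    qed measurable
    define D where "D = (\<integral>x. norm (DF x) powr p \<partial>lborel)"
    have D0: "D \<ge> 0" by (simp add: D_def)
    have DX: "D \<le> 2 powr p * (2 * C + (2 * real N) powr p) * s powr (-p) * X"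
    proof -
      have "D \<le> (\<integral>x. 2 powr p * (?L1 x + (2 * real N / s) powr p * (?B x * max 0 (?w x - e) powr p)) \<partial>lborel)"
        unfolding D_def by (rule integral_mono[OF iDF _ ptD]) (use iL1 iz in simp)
      also have "\<dots> = 2 powr p * ((\<integral>x. ?L1 x \<partial>lborel) + (2 * real N / s) powr p * z)"
        using iL1 iz by (simp add: z_def Z_def excess_def)
      also have "\<dots> \<le> 2 powr p * (C * s powr (-p) * (2 * X) + (2 * real N / s) powr p * X)"
      proof (intro mult_left_mono add_mono)
        have "(\<integral>x. ?L1 x \<partial>lborel) \<le> C * s powr (-p) * (\<integral>x. ?B x * (indicator {a<..} (?w x) * (1 + max 0 (?w x - a) powr p)) \<partial>lborel)"
          using E abk by (simp add: level_energy_def)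
        also have "\<dots> \<le> C * s powr (-p) * (\<integral>x. 2 * (\<delta> powr (-p) * (?B x * max 0 (?w x - e) powr p)) \<partial>lborel)"
        proof (intro mult_left_mono integral_mono')
          show "integrable lborel (\<lambda>x. 2 * (\<delta> powr (-p) * (?B x * max 0 (?w x - e) powr p)))" using iX by simp
          fix x
          show "?B x * (indicator {a<..} (?w x) * (1 + max 0 (?w x - a) powr p)) \<le> 2 * (\<delta> powr (-p) * (?B x * max 0 (?w x - e) powr p))"
          proof (cases "x \<in> ball y s \<and> ?w x > a")
            case True
            have "\<delta> powr (-p) \<ge> 1" using e p by (simp add: powr_minus one_le_inverse_iff powr_le1)
            then have "1 * max 0 (?w x - a) powr p \<le> \<delta> powr (-p) * max 0 (?w x - e) powr p"
              using abk p by (intro mult_mono powr_mono2) auto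
            then show ?thesis using True cheb[of "?w x"] by simp
          qed (auto simp: indicator_def)
        qed (use C in auto)
        also have "\<dots> = C * s powr (-p) * (2 * X)" using vX by simp
        finally show "(\<integral>x. ?L1 x \<partial>lborel) \<le> C * s powr (-p) * (2 * X)" .
        have "\<delta> powr (-p) \<ge> 1" using e p by (simp add: powr_minus one_le_inverse_iff powr_le1)
        then show "z \<le> X" using z unfolding X_def by simp
      qed auto
      also have "\<dots> = 2 powr p * (2 * C + (2 * real N) powr p) * s powr (-p) * X"
        using s0 by (simp add: powr_divide powr_minus field_simps)
      finally show ?thesis .
    qed
    have F0: "F x \<ge> 0" for x
      unfolding F_def by (intro mult_nonneg_nonneg \<Psi>0(1) cutoff_power_nonneg)
    have Fle: "F x \<le> ?B x * max 0 (?w x - e)" for x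
    proof (cases "x \<in> ball y s")
      case True
      have "F x \<le> 1 * max 0 (?w x - b)"
        unfolding F_def using \<Psi>0(1,2)[of "U x"] cutoff_power_le_1 by (intro mult_mono) auto
      then show ?thesis using True abk by (auto simp: max_def split: if_splits)
    next
      case False
      then show ?thesis using gout N by (simp add: F_def power_0_left)
    qed
    have iF: "integrable lborel (\<lambda>x. \<bar>F x\<bar> powr p)"
    proof (rule Bochner_Integration.integrable_bound[OF iz])
      show "AE x in lborel. norm (\<bar>F x\<bar> powr p) \<le> norm (?B x * max 0 (?w x - e) powr p)"
      proof (rule AE_I2)
        fix x
        have "F x powr p \<le> (?B x * max 0 (?w x - e)) powr p" using Fle F0 p by (intro powr_mono2) auto
        then show "norm (\<bar>F x\<bar> powr p) \<le> norm (?B x * max 0 (?w x - e) powr p)"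
          using F0 p by (cases "x \<in> ball y s") auto
      qed
    qed measurable
    define h where "h = (2 powr (p + 1) * X / ?\<omega>) powr (1 / DIM('a))"
    have h: "h > 0" using X \<omega> by (simp add: h_def)
    have hd: "h ^ DIM('a) = 2 powr (p + 1) * X / ?\<omega>"
    proof -
      have "h ^ DIM('a) = h powr real DIM('a)" using h by (rule powr_realpow[symmetric])
      also have "\<dots> = 2 powr (p + 1) * X / ?\<omega>" using X \<omega> by (simp add: h_def powr_powr)
      finally show ?thesis .
    qed
    obtain M2 where M2: "norm (?g x) \<le> M2" for x
    proof -
      have "norm (?g x) \<le> 2 * real N / s * 1" for x
        using cutoff_gradient_le[OF s0 N, of y x] cutoff_power_le_1[of y s x "N - 1"] s0
        by (meson divide_nonneg_pos mult_left_mono mult_nonneg_nonneg of_nat_0_le_iff order_trans zero_le_numeral)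
      then show thesis using that by blast
    qed
    have FK: "(\<integral>x. \<bar>F x\<bar> powr p \<partial>lborel) \<le> 2 powr (p + 1) * h powr p * D"
    proof (rule faber_krahn_of_translations[of F Ee p h D])
      show "F x = 0" if "x \<notin> Ee" for x
      proof (cases "x \<in> ball y s")
        case True
        then have "max 0 (?w x - b) = 0" using that by (auto simp: Ee_def)
        then have "\<Psi> (U x) = 0" using \<Psi>0(1,2)[of "U x"] by linarith
        then show ?thesis by (simp add: F_def)
      next
        case False
        then show ?thesis using gout N by (simp add: F_def power_0_left)
      qed
      show "2 powr (p + 1) * measure lborel Ee \<le> measure lborel (ball (0::'a) h)"
        using mE \<omega> h by (subst ball_volume) (auto simp: hd)
      fix z :: 'a
      have r: "dist x0 y + s < (dist x0 y + s + \<rho>) / 2" "(dist x0 y + s + \<rho>) / 2 < \<rho>" using s by auto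
      have "(\<integral>\<^sup>+x. indicator UNIV x * ennreal (\<bar>?\<xi> (x + z) ^ N * \<Psi> (U (x + z)) - ?\<xi> x ^ N * \<Psi> (U x)\<bar> powr p) \<partial>lborel)
          \<le> ennreal (norm z powr p) * (\<integral>\<^sup>+x. indicator UNIV x * ennreal (norm ((?\<xi> x ^ N * \<psi> (U x)) *\<^sub>R G x + \<Psi> (U x) *\<^sub>R ?g x) powr p) \<partial>lborel)"
      proof (rule translation_estimate[OF S U0 p r(2) C1_cutoff[OF N] _ M2 \<Psi>])
        show "\<bar>?\<xi> x ^ N\<bar> \<le> 1" for x using cutoff_power_nonneg[of y s x N] cutoff_power_le_1[of y s x N] by simp
        show "?\<xi> x ^ N = 0 \<and> ?g x = 0" if "x \<notin> ball x0 ((dist x0 y + s + \<rho>) / 2)" for x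
        proof -
          have "x \<notin> ball y s" using that r dist_triangle[of x0 x y] by (auto simp: dist_commute)
          from gout[OF this] N show ?thesis by (simp add: power_0_left)
        qed
      qed auto
      also have "\<dots> = ennreal (norm z powr p * D)"
        using nn_integral_eq_integral[OF iDF] D0 by (simp add: D_def DF_def ennreal_mult)
      finally show "(\<integral>\<^sup>+x. ennreal (\<bar>F (x + z) - F x\<bar> powr p) \<partial>lborel) \<le> ennreal (norm z powr p * D)"
        by (simp add: F_def)
    qed (use iF p h D0 Efin in auto)
    \<comment> \<open>On the smaller ball the cutoff is bounded below; this is where the factor in \<open>1 - \<sigma> / s\<close> comes from.\<close>
    have sg: "0 < 1 - \<sigma> / s" using s by simp
    have lower: "(1 - \<sigma> / s) powr (real N * p) * Z \<sigma> k \<le> (\<integral>x. \<bar>F x\<bar> powr p \<partial>lborel)"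
    proof -
      have "(1 - \<sigma> / s) powr (real N * p) * Z \<sigma> k
          = (\<integral>x. (1 - \<sigma> / s) powr (real N * p) * (indicator (ball y \<sigma>) x * max 0 (?w x - k) powr p) \<partial>lborel)"
        by (simp add: Z_def excess_def)
      also have "\<dots> \<le> (\<integral>x. \<bar>F x\<bar> powr p \<partial>lborel)"
      proof (rule integral_mono'[OF iF])
        fix x
        show "(1 - \<sigma> / s) powr (real N * p) * (indicator (ball y \<sigma>) x * max 0 (?w x - k) powr p) \<le> \<bar>F x\<bar> powr p"
        proof (cases "x \<in> ball y \<sigma>")
          case True
          then have "norm (x - y) \<le> \<sigma>" by (simp add: dist_norm norm_minus_commute)
          then have "1 - \<sigma> / s \<le> ?\<xi> x" using s by (intro cutoff_inner) auto
          then have "(1 - \<sigma> / s) ^ N \<le> ?\<xi> x ^ N" using sg by (intro power_mono) auto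
          then have "(1 - \<sigma> / s) ^ N * max 0 (?w x - k) \<le> F x"
            unfolding F_def using \<Psi>0(3)[of "U x"] sg by (intro mult_mono) (auto simp: cutoff_power_nonneg)
          then have "((1 - \<sigma> / s) ^ N * max 0 (?w x - k)) powr p \<le> F x powr p"
            using p sg by (intro powr_mono2) auto
          moreover have "((1 - \<sigma> / s) ^ N * max 0 (?w x - k)) powr p = (1 - \<sigma> / s) powr (real N * p) * max 0 (?w x - k) powr p"
            using sg by (simp add: powr_mult powr_powr flip: powr_realpow)
          ultimately show ?thesis using True F0[of x] by simp
        qed simp
      qed simp
      finally show ?thesis .
    qed
    have cancel: "q powr (- m) * (q powr m * v) = v" if "q > 0" for q m v :: real
      using that by (simp add: powr_minus)
    have "Z \<sigma> k = (1 - \<sigma> / s) powr (- (real N * p)) * ((1 - \<sigma> / s) powr (real N * p) * Z \<sigma> k)"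
      by (rule cancel[OF sg, symmetric])
    also have "\<dots> \<le> (1 - \<sigma> / s) powr (- (real N * p)) * (2 powr (p + 1) * h powr p * (2 powr p * (2 * C + (2 * real N) powr p) * s powr (-p) * X))"
      using order_trans[OF lower FK] DX h by (intro mult_left_mono) (auto intro: order_trans mult_left_mono)
    also have "h powr p = (2 powr (p + 1) / ?\<omega>) powr (p / DIM('a)) * X powr (p / DIM('a))"
      using X \<omega> by (simp add: h_def powr_powr powr_mult[symmetric])
    also have "(1 - \<sigma> / s) powr (- (real N * p)) * (2 powr (p + 1) * ((2 powr (p + 1) / ?\<omega>) powr (p / DIM('a)) * X powr (p / DIM('a)))
        * (2 powr p * (2 * C + (2 * real N) powr p) * s powr (-p) * X))
        = step_const TYPE('a) p C N * (1 - \<sigma> / s) powr (- (real N * p)) * s powr (-p) * (X * X powr (p / DIM('a)))"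
      by (simp add: step_const_def)
    also have "X * X powr (p / DIM('a)) = X powr (1 + p / DIM('a))" using X by (simp add: powr_add)
    finally show ?thesis by (simp add: k_def X_def z_def)
  qed
qed

text \<open>By induction \<open>Y n \<le> \<nu> q\<^sup>n\<close> with \<open>q = \<mu>\<^bsup>-1/\<kappa>\<^esup>\<close>: the superlinear power gains \<open>q\<^bsup>n\<kappa>\<^esup> = \<mu>\<^bsup>-n\<^esup>\<close>, which pays for the
  growing factor, and the smallness of \<open>\<nu>\<close> provides one more \<open>q\<close>.\<close>
lemma fast_decay:
  fixes Y :: "nat \<Rightarrow> real"
  assumes Y0: "\<And>n. Y n \<ge> 0" and rec: "\<And>n. Y (Suc n) \<le> A * \<mu> powr real n * Y n powr (1 + \<kappa>)"
    and A: "A > 0" and \<mu>: "\<mu> > 1" and \<kappa>: "\<kappa> > 0"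
    and start: "Y 0 \<le> \<nu>" and \<nu>: "\<nu> > 0" "A * \<nu> powr \<kappa> * \<mu> powr (1 / \<kappa>) \<le> 1"
  shows "Y \<longlonglongrightarrow> 0"
proof -
  define q where "q = \<mu> powr (- 1 / \<kappa>)"
  have q: "0 < q" "q < 1" using \<mu> \<kappa> by (auto simp: q_def powr_less_one)
  have bnd: "Y n \<le> \<nu> * q powr real n" for n
  proof (induction n)
    case 0
    then show ?case using start q by simp
  next
    case (Suc n)
    have "Y (Suc n) \<le> A * \<mu> powr real n * Y n powr (1 + \<kappa>)" by (rule rec)
    also have "\<dots> \<le> A * \<mu> powr real n * (\<nu> * q powr real n) powr (1 + \<kappa>)"
      using Suc Y0[of n] A \<kappa> by (intro mult_left_mono powr_mono2) auto
    also have "(\<nu> * q powr real n) powr (1 + \<kappa>) = (\<nu> * \<nu> powr \<kappa>) * (q powr real n * \<mu> powr (- real n))"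
    proof -
      have "(q powr real n) powr (1 + \<kappa>) = q powr real n * q powr (real n * \<kappa>)"
        using q by (simp add: powr_powr distrib_left powr_add)
      also have "q powr (real n * \<kappa>) = \<mu> powr (- real n)" using \<kappa> by (simp add: q_def powr_powr)
      finally show ?thesis using \<nu> by (simp add: powr_mult powr_add)
    qed
    also have "A * \<mu> powr real n * ((\<nu> * \<nu> powr \<kappa>) * (q powr real n * \<mu> powr (- real n)))
        = (A * \<nu> powr \<kappa>) * (\<nu> * q powr real n)"
      using \<mu> by (simp add: powr_minus)
    also have "\<dots> \<le> q * (\<nu> * q powr real n)"
    proof (rule mult_right_mono)
      have "A * \<nu> powr \<kappa> = A * \<nu> powr \<kappa> * \<mu> powr (1 / \<kappa>) * q"
        using \<mu> by (simp add: q_def powr_minus flip: powr_add)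
      also have "\<dots> \<le> 1 * q" using \<nu> q by (intro mult_right_mono) auto
      finally show "A * \<nu> powr \<kappa> \<le> q" by simp
    qed (use \<nu> in auto)
    also have "\<dots> = \<nu> * q powr real (Suc n)" using q by (simp add: powr_add)
    finally show ?case .
  qed
  have "(\<lambda>n. \<nu> * q ^ n) \<longlonglongrightarrow> \<nu> * 0"
    by (intro tendsto_intros LIMSEQ_power_zero) (use q in auto)
  then show ?thesis
    by (intro Lim_null_comparison[of Y "\<lambda>n. \<nu> * q ^ n"]) (use bnd Y0 q in \<open>auto simp: powr_realpow\<close>)
qed

lemma half_power: "(1 / 2 :: real) ^ m = 2 powr (- real m)"
  by (simp add: powr_minus powr_realpow power_one_over inverse_eq_divide)

text \<open>Iterate the step along the radii \<open>s (1/2 + 2\<^bsup>-j-1\<^esup>)\<close> and the levels \<open>1 - 2\<^bsup>-j\<^esup>\<close>. All factors lost are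
  geometric in \<open>j\<close>, so the normalised excess decays to zero if it is small at the start; its limit bounds the
  excess over the level one in the ball of half the radius.\<close>
lemma degiorgi_iteration:
  fixes p C :: real and N :: nat
  assumes p: "p > 1" and N: "N \<ge> 2" and C: "C \<ge> 0"
  obtains \<nu> where "\<nu> > 0"
    "\<And>(x0::'a::euclidean_space) \<rho> U G \<Theta> \<theta> L y s. sobolev_on_ball p x0 \<rho> U G \<Longrightarrow> (\<And>x. U x \<ge> 0) \<Longrightarrow>
       C1_lipschitz L \<Theta> \<theta> \<Longrightarrow> 0 < s \<Longrightarrow> dist x0 y + s < \<rho> \<Longrightarrow>
       (\<And>s'. 0 < s' \<Longrightarrow> s' \<le> s \<Longrightarrow> level_energy p C N y s' U G \<Theta> \<theta>) \<Longrightarrow>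
       excess p y (\<lambda>x. \<Theta> (U x)) s 0 \<le> \<nu> * s ^ DIM('a) \<Longrightarrow>
       AE x in lborel. x \<in> ball y (s / 2) \<longrightarrow> \<Theta> (U x) \<le> 1"
proof -
  define d where "d = real DIM('a)"
  have d: "d > 0" by (simp add: d_def)
  define \<kappa> where "\<kappa> = p / d"
  have \<kappa>: "\<kappa> > 0" using p d by (simp add: \<kappa>_def)
  define B0 where "B0 = step_const TYPE('a) p C N"
  have B0: "B0 > 0" unfolding B0_def by (rule step_const_pos) (use C N in auto)
  define n where "n = real N * p"
  have n: "n > 0" using N p by (simp add: n_def)
  define \<mu> where "\<mu> = 2 powr (n + p * (1 + \<kappa>))"
  have \<mu>: "\<mu> > 1" unfolding \<mu>_def using n p \<kappa> by (intro gr_one_powr add_pos_pos mult_pos_pos) auto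
  define A where "A = B0 * 2 powr (2 * n) * 2 powr p * 6 powr (p * (1 + \<kappa>))"
  have A: "A > 0" using B0 by (simp add: A_def)
  define \<nu> where "\<nu> = (A * \<mu> powr (1 / \<kappa>)) powr (- 1 / \<kappa>)"
  have \<nu>: "\<nu> > 0" using A \<mu> by (simp add: \<nu>_def)
  have \<nu>1: "A * \<nu> powr \<kappa> * \<mu> powr (1 / \<kappa>) \<le> 1"
  proof -
    define q where "q = A * \<mu> powr (1 / \<kappa>)"
    have q: "q > 0" using A \<mu> by (simp add: q_def)
    have "\<nu> powr \<kappa> = q powr (- 1)"
      unfolding \<nu>_def q_def[symmetric] powr_powr using \<kappa> by simp
    also have "\<dots> = inverse q" using q by (simp add: powr_minus)
    finally have "q * \<nu> powr \<kappa> = 1" using q by simp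
    then show ?thesis unfolding q_def by (simp add: mult.commute mult.left_commute)
  qed
  show thesis
  proof (rule that[OF \<nu>])
    fix x0 :: 'a and \<rho> U G \<Theta> \<theta> L y s
    assume S: "sobolev_on_ball p x0 \<rho> U G" and U0: "\<And>x. U x \<ge> 0" and \<Theta>: "C1_lipschitz L \<Theta> \<theta>"
      and s: "0 < s" "dist x0 y + s < \<rho>"
      and E: "\<And>s'. 0 < s' \<Longrightarrow> s' \<le> s \<Longrightarrow> level_energy p C N y s' U G \<Theta> \<theta>"
      and start: "excess p y (\<lambda>x. \<Theta> (U x)) s 0 \<le> \<nu> * s ^ DIM('a)"
    let ?Z = "excess p y (\<lambda>x. \<Theta> (U x))"
    note [measurable] = sobolev_measurable[OF S]
    have [measurable]: "(\<lambda>x. \<Theta> (U x)) \<in> borel_measurable borel"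
      using C1_lipschitz_measurable[OF \<Theta>, of U borel] U0 sobolev_measurable[OF S] by auto
    have sd: "s ^ DIM('a) = s powr d" using s by (simp add: d_def powr_realpow)
    define r where "r j = s * (1 / 2 + (1 / 2) ^ Suc j)" for j :: nat
    define k where "k j = 1 - (1 / 2 :: real) ^ j" for j :: nat
    define Y where "Y j = ?Z (r j) (k j) / s powr d" for j
    have h1: "(1 / 2 :: real) ^ j \<le> 1" "(1 / 2 :: real) ^ j > 0" for j by (auto simp: power_le_one)
    have k0: "k j \<ge> 0" "k j \<le> 1" for j using h1[of j] by (auto simp: k_def)
    have r: "0 < r j" "r j \<le> s" "s / 2 \<le> r j" "r (Suc j) < r j" for j
    proof -
      show "0 < r j" unfolding r_def using s h1(2)[of "Suc j"] by (intro mult_pos_pos) linarith+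
      have "(1 / 2 :: real) ^ Suc j \<le> 1 / 2" using h1(1)[of j] by simp
      then have "s * (1 / 2 + (1 / 2) ^ Suc j) \<le> s * 1" using s by (intro mult_left_mono) auto
      then show "r j \<le> s" by (simp add: r_def)
      have "s * (1 / 2) \<le> s * (1 / 2 + (1 / 2) ^ Suc j)" using s h1(2)[of "Suc j"] by (intro mult_left_mono) linarith+
      then show "s / 2 \<le> r j" by (simp add: r_def)
      show "r (Suc j) < r j" unfolding r_def using s by (intro mult_strict_left_mono) auto
    qed
    have Y0: "Y j \<ge> 0" for j
      unfolding Y_def using excess_nonneg[OF S p U0 \<Theta> k0(1)] s by simp
    have rec: "Y (Suc j) \<le> A * \<mu> powr real j * Y j powr (1 + \<kappa>)" for j
    proof -
      define \<delta> where "\<delta> = (1 / 2 :: real) ^ Suc j / 3"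
      have \<delta>: "0 < \<delta>" "\<delta> \<le> 1" using h1[of "Suc j"] by (auto simp: \<delta>_def)
      have kS: "k j + 3 * \<delta> = k (Suc j)" by (simp add: k_def \<delta>_def)
      have st: "?Z (r (Suc j)) (k j + 3 * \<delta>) \<le> B0 * (1 - r (Suc j) / r j) powr (- n) * r j powr (- p) * (\<delta> powr (- p) * ?Z (r j) (k j)) powr (1 + \<kappa>)"
        unfolding B0_def n_def \<kappa>_def d_def
        by (rule degiorgi_step[OF S p U0 \<Theta> N C r(1) r(4) _ E[OF r(1,2)] k0(1) \<delta>]) (use r(2)[of j] s in auto)
      have g: "(1 / 2) ^ (j + 2) \<le> 1 - r (Suc j) / r j"
      proof -
        have "(1 / 2) ^ (j + 2) * r j \<le> (1 / 2) ^ (j + 2) * s" using r(2)[of j] by (intro mult_left_mono) auto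
        also have "\<dots> = r j - r (Suc j)" by (simp add: r_def algebra_simps)
        finally show ?thesis using r(1)[of j] by (simp add: field_simps)
      qed
      have e1: "(1 - r (Suc j) / r j) powr (- n) \<le> 2 powr (2 * n) * 2 powr (real j * n)"
      proof -
        have "(1 - r (Suc j) / r j) powr (- n) \<le> ((1 / 2) ^ (j + 2)) powr (- n)"
          by (rule powr_mono2') (use n g h1 in auto)
        also have "(1 / 2 :: real) ^ (j + 2) = 2 powr (- real (j + 2))"
          by (rule half_power)
        also have "(2 powr (- real (j + 2))) powr (- n) = 2 powr (2 * n) * 2 powr (real j * n)"
          by (simp add: powr_powr distrib_right flip: powr_add) (simp add: algebra_simps)
        finally show ?thesis .
      qed
      have e2: "r j powr (- p) \<le> 2 powr p * s powr (- p)"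
      proof -
        have "r j powr (- p) \<le> (s / 2) powr (- p)" by (rule powr_mono2') (use p r(3)[of j] s in auto)
        also have "\<dots> = 2 powr p * s powr (- p)" using s by (simp add: powr_minus powr_divide field_simps)
        finally show ?thesis .
      qed
      have e3: "(\<delta> powr (- p)) powr (1 + \<kappa>) = 6 powr (p * (1 + \<kappa>)) * 2 powr (real j * (p * (1 + \<kappa>)))"
      proof -
        have "\<delta> = 6 powr (- 1) * 2 powr (- real j)"
          by (simp add: \<delta>_def powr_minus powr_realpow power_one_over inverse_eq_divide)
        then have "\<delta> powr (- (p * (1 + \<kappa>))) = (6 powr (- 1)) powr (- (p * (1 + \<kappa>))) * (2 powr (- real j)) powr (- (p * (1 + \<kappa>)))"
          by (simp only: powr_mult)
        also have "\<dots> = 6 powr (p * (1 + \<kappa>)) * 2 powr (real j * (p * (1 + \<kappa>)))"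
          by (simp only: powr_powr) simp
        finally show ?thesis by (simp only: powr_powr) simp
      qed
      have z: "?Z (r j) (k j) = s powr d * Y j" using s by (simp add: Y_def)
      have e4: "(s powr d * Y j) powr (1 + \<kappa>) = s powr d * s powr p * Y j powr (1 + \<kappa>)"
      proof -
        have "(s powr d) powr (1 + \<kappa>) = s powr (d + p)"
          using d by (simp add: powr_powr \<kappa>_def distrib_left)
        then show ?thesis unfolding powr_mult by (simp only: powr_add)
      qed
      have "s powr d * Y (Suc j) = ?Z (r (Suc j)) (k j + 3 * \<delta>)" using s by (simp add: Y_def kS)
      also note st
      also have "B0 * (1 - r (Suc j) / r j) powr (- n) * r j powr (- p) * (\<delta> powr (- p) * ?Z (r j) (k j)) powr (1 + \<kappa>)
          = B0 * (1 - r (Suc j) / r j) powr (- n) * r j powr (- p) * ((\<delta> powr (- p)) powr (1 + \<kappa>) * (s powr d * s powr p * Y j powr (1 + \<kappa>)))"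
        unfolding z powr_mult[of "\<delta> powr (- p)"] e4 ..
      also have "\<dots> \<le> B0 * (2 powr (2 * n) * 2 powr (real j * n)) * (2 powr p * s powr (- p)) *
          ((6 powr (p * (1 + \<kappa>)) * 2 powr (real j * (p * (1 + \<kappa>)))) * (s powr d * s powr p * Y j powr (1 + \<kappa>)))"
        unfolding e3 by (intro mult_mono mult_left_mono e1 e2 order_refl mult_nonneg_nonneg) (use B0 in auto)
      also have "\<dots> = s powr d * (A * (2 powr (real j * n) * 2 powr (real j * (p * (1 + \<kappa>)))) * Y j powr (1 + \<kappa>))"
        using s by (simp add: A_def powr_minus field_simps)
      also have "2 powr (real j * n) * 2 powr (real j * (p * (1 + \<kappa>))) = \<mu> powr real j"
        by (simp add: \<mu>_def powr_powr algebra_simps flip: powr_add)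
      finally show ?thesis using s by simp
    qed
    have r0: "r 0 = s" "k 0 = 0" by (simp_all add: r_def k_def)
    have "Y 0 \<le> \<nu>" using start s unfolding Y_def r0 sd by (simp add: pos_divide_le_eq)
    then have lim: "Y \<longlonglongrightarrow> 0" by (rule fast_decay[OF Y0 rec A \<mu> \<kappa> _ \<nu> \<nu>1])
    have "?Z (s / 2) 1 \<le> s powr d * Y j" for j
    proof -
      have "?Z (s / 2) 1 \<le> ?Z (r j) (k j)" by (rule excess_mono[OF S p U0 \<Theta> k0(1) r(3) k0(2)])
      then show ?thesis using s by (simp add: Y_def)
    qed
    moreover have "(\<lambda>j. s powr d * Y j) \<longlonglongrightarrow> s powr d * 0" by (intro tendsto_intros lim)
    ultimately have "?Z (s / 2) 1 \<le> 0" by (intro LIMSEQ_le_const[of "\<lambda>j. s powr d * Y j"]) auto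
    moreover have "?Z (s / 2) 1 \<ge> 0" by (rule excess_nonneg[OF S p U0 \<Theta>]) simp
    ultimately have "?Z (s / 2) 1 = 0" by linarith
    then have "AE x in lborel. indicator (ball y (s / 2)) x * max 0 (\<Theta> (U x) - 1) powr p = 0"
      unfolding excess_def
      by (subst (asm) integral_nonneg_eq_0_iff_AE[OF integrable_excess[OF S p U0 \<Theta>]]) auto
    then show "AE x in lborel. x \<in> ball y (s / 2) \<longrightarrow> \<Theta> (U x) \<le> 1"
      by eventually_elim (auto simp: max_def split: if_splits)
  qed
qed

section \<open>Level energies\<close>

lemma integrable_level:
  fixes U :: "'a::euclidean_space \<Rightarrow> real"
  assumes S: "sobolev_on_ball p x0 \<rho> U G" and p: "p > 1" and U0: "\<And>x. U x \<ge> 0"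
    and \<Theta>: "C1_lipschitz L \<Theta> \<theta>" and a: "a \<ge> 0"
  shows "integrable lborel (\<lambda>x. indicator (ball y s) x * (indicator {a<..} (\<Theta> (U x)) * (1 + max 0 (\<Theta> (U x) - a) powr p)))"
proof (rule Bochner_Integration.integrable_bound)
  have [measurable]: "(\<lambda>x. \<Theta> (U x)) \<in> borel_measurable borel" "ball y s \<in> sets borel"
    using C1_lipschitz_measurable[OF \<Theta>, of U borel] U0 sobolev_measurable[OF S] by auto
  show "integrable lborel (\<lambda>x. indicator (ball y s) x + indicator (ball y s) x * max 0 (\<Theta> (U x) - a) powr p)"
    by (intro Bochner_Integration.integrable_add integrable_excess[OF S p U0 \<Theta> a] integrable_real_indicator emeasure_lborel_ball_finite) simp
  show "(\<lambda>x. indicator (ball y s) x * (indicator {a<..} (\<Theta> (U x)) * (1 + max 0 (\<Theta> (U x) - a) powr p))) \<in> borel_measurable lborel"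
    by measurable
qed (auto simp: indicator_def)

lemma C1_lipschitz_affine:
  "M > 0 \<Longrightarrow> C1_lipschitz (1 / M) (\<lambda>t. (t + R) / M - 1) (\<lambda>t. 1 / M)"
  unfolding C1_lipschitz_def by (auto intro!: derivative_eq_intros continuous_intros)

text \<open>The energy estimate with the truncation of \<open>\<Theta>\<close>. Its lower order term is \<open>M\<^bsup>-p\<^esup>\<close>, which is at most \<open>s\<^bsup>-p\<^esup>\<close>
  because \<open>s \<le> M\<close>.\<close>
lemma level_energy_affine:
  fixes U :: "'a::euclidean_space \<Rightarrow> real"
  assumes W: "weak_solution p c K x0 \<rho> U G J" and p: "p > 1" and c: "c > 0" and K: "K > 0"
    and N: "N \<ge> 2" "real N \<ge> p" and s: "s > 0" "dist x0 y + s < \<rho>" and M: "s \<le> M" and R: "R \<ge> 0"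
  shows "level_energy p (energy_const p c K N) N y s U G (\<lambda>t. (t + R) / M - 1) (\<lambda>t. 1 / M)"
proof -
  have M0: "M > 0" using s M by simp
  let ?\<Theta> = "\<lambda>t. (t + R) / M - 1"
  have \<Theta>: "C1_lipschitz (1 / M) ?\<Theta> (\<lambda>t. 1 / M)" by (rule C1_lipschitz_affine[OF M0])
  have S: "sobolev_on_ball p x0 \<rho> U G" and U0: "\<And>x. U x \<ge> 0" using W by (auto simp: weak_solution_def)
  show "level_energy p (energy_const p c K N) N y s U G ?\<Theta> (\<lambda>t. 1 / M)"
    unfolding level_energy_def
  proof (intro allI impI)
    fix a b :: real assume ab: "0 \<le> a \<and> a < b"
    let ?C = "energy_const p c K N"
    have C0: "?C > 0" by (rule energy_const_pos[OF c K])
    define \<psi> where "\<psi> t = ramp_deriv a b (?\<Theta> t) * (1 / M)" for t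
    have \<Psi>: "C1_lipschitz (1 * (1 / M)) (\<lambda>t. ramp a b (?\<Theta> t)) \<psi>"
      unfolding \<psi>_def[abs_def]
      by (rule C1_lipschitz_compose[OF \<Theta> DERIV_ramp continuous_ramp_deriv])
         (use ramp_deriv_bounds[of a b] ab in auto)
    have rd: "0 \<le> ramp_deriv a b v" "ramp_deriv a b v \<le> 1" for v using ramp_deriv_bounds[of a b] ab by auto
    have \<psi>0: "\<psi> t \<ge> 0" for t using rd M0 by (simp add: \<psi>_def)
    have a\<psi>: "\<bar>\<psi> t\<bar> = ramp_deriv a b (?\<Theta> t) * (1 / M)" for t
      using abs_of_nonneg[OF \<psi>0[of t]] by (simp only: \<psi>_def)
    define l where "l t = M * max 0 (?\<Theta> t - a)" for t
    have [measurable]: "l \<in> borel_measurable borel" unfolding l_def[abs_def] by measurable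
    have rb: "0 \<le> ramp a b v" "ramp a b v \<le> max 0 (v - a) * ramp_deriv a b v" for v
      using ramp_bounds[of a b v] ab by auto
    note en = energy_estimate[OF W p c K N s \<Psi>, of 1 l "1 + R"]
    have prem: "0 \<le> ramp a b (?\<Theta> t)" "0 \<le> 1 * \<psi> t" "0 \<le> l t" "l t \<le> (1 + R) * (1 + t)"
      "ramp a b (?\<Theta> t) \<le> l t * \<bar>\<psi> t\<bar>" if "t \<ge> 0" for t
    proof -
      show "0 \<le> ramp a b (?\<Theta> t)" by (rule rb)
      show "0 \<le> 1 * \<psi> t" using \<psi>0 by simp
      show "0 \<le> l t" using M0 by (simp add: l_def)
      have "M * (?\<Theta> t - a) = t + R - M - M * a" using M0 by (simp add: field_simps)
      also have "\<dots> \<le> t + R"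
      proof -
        have "0 \<le> M * a" using M0 ab by simp
        then show ?thesis using M0 by linarith
      qed
      also have "\<dots> \<le> (1 + R) * (1 + t)" using that R by (simp add: algebra_simps)
      finally show "l t \<le> (1 + R) * (1 + t)" using that R by (simp add: l_def max_def)
      have "l t * \<bar>\<psi> t\<bar> = max 0 (?\<Theta> t - a) * ramp_deriv a b (?\<Theta> t)"
        using M0 rd by (simp add: l_def \<psi>_def abs_mult)
      then show "ramp a b (?\<Theta> t) \<le> l t * \<bar>\<psi> t\<bar>" using rb(2) by simp
    qed
    have en1: "(\<integral>x. \<bar>\<psi> (U x)\<bar> * (cutoff y s x ^ N * norm (G x) powr p) \<partial>lborel)
        \<le> ?C * (\<integral>x. indicator (ball y s) x * (\<bar>\<psi> (U x)\<bar> * (1 + (l (U x) / s) powr p)) \<partial>lborel)"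
      and en2: "integrable lborel (\<lambda>x. indicator (ball y s) x * (\<bar>\<psi> (U x)\<bar> * (1 + (l (U x) / s) powr p)))"
      and en3: "integrable lborel (\<lambda>x. \<bar>\<psi> (U x)\<bar> * (cutoff y s x ^ N * norm (G x) powr p))"
      by (rule en; use prem in simp)+
    have Mp: "M powr (1 - p) * (1 / M) = M powr (- p)" using M0 by (simp add: powr_diff powr_minus field_simps)
    have "(\<integral>x. indicator {b..} (?\<Theta> (U x)) * (cutoff y s x ^ N * norm ((1 / M) *\<^sub>R G x) powr p) \<partial>lborel)
        \<le> (\<integral>x. M powr (1 - p) * (\<bar>\<psi> (U x)\<bar> * (cutoff y s x ^ N * norm (G x) powr p)) \<partial>lborel)"
    proof (rule integral_mono')
      show "integrable lborel (\<lambda>x. M powr (1 - p) * (\<bar>\<psi> (U x)\<bar> * (cutoff y s x ^ N * norm (G x) powr p)))"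
        using en3 by simp
      fix x
      have n: "norm ((1 / M) *\<^sub>R G x) powr p = M powr (- p) * norm (G x) powr p"
        using M0 by (simp add: powr_divide powr_minus field_simps)
      have "indicator {b..} (?\<Theta> (U x)) \<le> ramp_deriv a b (?\<Theta> (U x))"
        using rd ramp_deriv_bounds(4)[of a b "?\<Theta> (U x)"] ab by (simp add: indicator_def)
      then have "indicator {b..} (?\<Theta> (U x)) * (M powr (- p) * (cutoff y s x ^ N * norm (G x) powr p))
          \<le> ramp_deriv a b (?\<Theta> (U x)) * (M powr (- p) * (cutoff y s x ^ N * norm (G x) powr p))"
        by (rule mult_right_mono) (auto simp: cutoff_power_nonneg)
      also have "\<dots> = M powr (1 - p) * (\<bar>\<psi> (U x)\<bar> * (cutoff y s x ^ N * norm (G x) powr p))"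
        unfolding a\<psi> Mp[symmetric] by simp
      finally show "indicator {b..} (?\<Theta> (U x)) * (cutoff y s x ^ N * norm ((1 / M) *\<^sub>R G x) powr p)
          \<le> M powr (1 - p) * (\<bar>\<psi> (U x)\<bar> * (cutoff y s x ^ N * norm (G x) powr p))"
        unfolding n by (simp only: mult.left_commute mult.assoc)
    qed (auto simp: cutoff_power_nonneg)
    also have "\<dots> = M powr (1 - p) * (\<integral>x. \<bar>\<psi> (U x)\<bar> * (cutoff y s x ^ N * norm (G x) powr p) \<partial>lborel)" by simp
    also have "\<dots> \<le> M powr (1 - p) * (?C * (\<integral>x. indicator (ball y s) x * (\<bar>\<psi> (U x)\<bar> * (1 + (l (U x) / s) powr p)) \<partial>lborel))"
      using en1 by (intro mult_left_mono) auto
    also have "\<dots> = ?C * (\<integral>x. M powr (1 - p) * (indicator (ball y s) x * (\<bar>\<psi> (U x)\<bar> * (1 + (l (U x) / s) powr p))) \<partial>lborel)"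
      by simp
    also have "\<dots> \<le> ?C * (\<integral>x. s powr (- p) * (indicator (ball y s) x * (indicator {a<..} (?\<Theta> (U x)) * (1 + max 0 (?\<Theta> (U x) - a) powr p))) \<partial>lborel)"
    proof (intro mult_left_mono integral_mono)
      show "integrable lborel (\<lambda>x. M powr (1 - p) * (indicator (ball y s) x * (\<bar>\<psi> (U x)\<bar> * (1 + (l (U x) / s) powr p))))"
        using en2 by simp
      show "integrable lborel (\<lambda>x. s powr (- p) * (indicator (ball y s) x * (indicator {a<..} (?\<Theta> (U x)) * (1 + max 0 (?\<Theta> (U x) - a) powr p))))"
        using integrable_level[OF S p U0 \<Theta>, of a y s] ab by simp
      fix x
      define v where "v = ?\<Theta> (U x)"
      have i: "ramp_deriv a b v \<le> indicator {a<..} v"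
        using rd[of v] ramp_deriv_bounds(3)[of a b v] ab by (auto simp: indicator_def)
      have q: "M powr (- p) * (l (U x) / s) powr p = s powr (- p) * max 0 (v - a) powr p"
        using M0 s by (simp add: l_def v_def powr_mult powr_divide powr_minus field_simps)
      have Ms: "M powr (- p) \<le> s powr (- p)" using M s p by (intro powr_mono2') auto
      have "M powr (1 - p) * (\<bar>\<psi> (U x)\<bar> * (1 + (l (U x) / s) powr p))
          = ramp_deriv a b v * (M powr (- p) + M powr (- p) * (l (U x) / s) powr p)"
        unfolding a\<psi> Mp[symmetric] v_def by (simp add: algebra_simps add_divide_distrib)
      also have "\<dots> \<le> indicator {a<..} v * (s powr (- p) + s powr (- p) * max 0 (v - a) powr p)"
        unfolding q by (intro mult_mono add_mono i Ms) auto
      also have "\<dots> = s powr (- p) * (indicator {a<..} v * (1 + max 0 (v - a) powr p))" by (simp add: algebra_simps)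
      finally show "M powr (1 - p) * (indicator (ball y s) x * (\<bar>\<psi> (U x)\<bar> * (1 + (l (U x) / s) powr p)))
          \<le> s powr (- p) * (indicator (ball y s) x * (indicator {a<..} (?\<Theta> (U x)) * (1 + max 0 (?\<Theta> (U x) - a) powr p)))"
        by (simp add: indicator_def v_def)
    qed (use C0 in simp)
    also have "\<dots> = ?C * s powr (- p) * (\<integral>x. indicator (ball y s) x * (indicator {a<..} (?\<Theta> (U x)) * (1 + max 0 (?\<Theta> (U x) - a) powr p)) \<partial>lborel)"
      by simp
    finally show "(\<integral>x. indicator {b..} (?\<Theta> (U x)) * (cutoff y s x ^ N * norm ((1 / M) *\<^sub>R G x) powr p) \<partial>lborel)
      \<le> ?C * s powr (- p) * (\<integral>x. indicator (ball y s) x * (indicator {a<..} (?\<Theta> (U x)) * (1 + max 0 (?\<Theta> (U x) - a) powr p)) \<partial>lborel)" .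
  qed
qed

definition log_const :: "real \<Rightarrow> real \<Rightarrow> real \<Rightarrow> nat \<Rightarrow> real" where
  "log_const p c K N = energy_const p c K N * (1 + (p - 1) powr (- p))"

text \<open>The test function is \<open>(U + R)\<^bsup>1-p\<^esup> g(\<Theta>(U))\<close> with \<open>\<Theta>\<close> a decreasing affine function of \<open>ln (U + R)\<close>. Both factors
  decrease in \<open>U\<close>, so its derivative is \<open>-(U + R)\<^bsup>-p\<^esup> w\<close>, and \<open>l t = (t + R)/(p - 1)\<close> is admissible in the energy
  estimate. The powers of \<open>U + R\<close> then cancel, and the lower order term is harmless because \<open>s \<le> R\<close>. With
  \<open>g = 1\<close> this bounds the gradient of the logarithm; with a truncation \<open>g\<close> it is a level energy.\<close>
lemma log_energy:
  fixes U :: "'a::euclidean_space \<Rightarrow> real"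
  assumes W: "weak_solution p c K x0 \<rho> U G J" and p: "p > 1" and c: "c > 0" and K: "K > 0"
    and N: "N \<ge> 2" "real N \<ge> p" and s: "s > 0" "dist x0 y + s < \<rho>" and R: "s \<le> R"
    and B: "0 < B" "B \<le> 1"
    and g: "\<And>v. (g has_real_derivative g' v) (at v)" "continuous_on UNIV g'"
    and g0: "\<And>v. g v \<ge> 0" "\<And>v. g' v \<ge> 0"
    and gb: "\<And>v. v \<le> A - B * ln R \<Longrightarrow> g v \<le> b0" "\<And>v. v \<le> A - B * ln R \<Longrightarrow> g' v \<le> b0"
  defines "w \<equiv> \<lambda>x. (p - 1) * g (A - B * ln (U x + R)) + B * g' (A - B * ln (U x + R))"
  shows "(\<integral>x. w x * (cutoff y s x ^ N * norm ((1 / (U x + R)) *\<^sub>R G x) powr p) \<partial>lborel)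
      \<le> log_const p c K N * s powr (- p) * (\<integral>x. indicator (ball y s) x * w x \<partial>lborel)"
    and "integrable lborel (\<lambda>x. w x * (cutoff y s x ^ N * norm ((1 / (U x + R)) *\<^sub>R G x) powr p))"
    and "integrable lborel (\<lambda>x. indicator (ball y s) x * w x)"
proof -
  have R0: "R > 0" using s R by simp
  have S: "sobolev_on_ball p x0 \<rho> U G" and U0: "\<And>x. U x \<ge> 0" using W by (auto simp: weak_solution_def)
  note [measurable] = sobolev_measurable[OF S]
  let ?\<Theta> = "\<lambda>t. A - B * ln (t + R)"
  define W where "W t = (p - 1) * g (?\<Theta> t) + B * g' (?\<Theta> t)" for t
  define \<psi> where "\<psi> t = - ((t + R) powr (- p) * W t)" for t
  define \<Psi> where "\<Psi> t = (t + R) powr (1 - p) * g (?\<Theta> t)" for t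
  have \<Theta>le: "?\<Theta> t \<le> A - B * ln R" if "t \<ge> 0" for t
    using B R0 that by simp
  have b0: "b0 \<ge> 0" using order_trans[OF g0(1) gb(1)[OF order_refl]] .
  have W0: "W t \<ge> 0" for t unfolding W_def using g0 p B by (intro add_nonneg_nonneg mult_nonneg_nonneg) auto
  have Wle: "W t \<le> p * b0" if "t \<ge> 0" for t
  proof -
    have "W t \<le> (p - 1) * b0 + 1 * b0"
      unfolding W_def using p B b0 g0 gb \<Theta>le[OF that] by (intro add_mono mult_mono) auto
    then show ?thesis by (simp add: algebra_simps)
  qed
  have g'c: "continuous_on {0..} (\<lambda>t. g' (?\<Theta> t))"
    by (rule continuous_on_compose2[OF g(2)]) (use R0 in \<open>auto intro!: continuous_intros\<close>)
  have "continuous_on UNIV g" using g(1) by (meson DERIV_isCont continuous_at_imp_continuous_on)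
  then have gc: "continuous_on {0..} (\<lambda>t. g (?\<Theta> t))"
    by (rule continuous_on_compose2) (use R0 in \<open>auto intro!: continuous_intros\<close>)
  have \<Psi>: "C1_lipschitz (R powr (- p) * (p * b0)) \<Psi> \<psi>"
    unfolding C1_lipschitz_def
  proof (intro conjI allI impI)
    show "continuous_on {0..} \<psi>"
      unfolding \<psi>_def[abs_def] W_def by (intro continuous_intros gc g'c) (use R0 in auto)
    fix t :: real assume t: "0 \<le> t"
    then have tR: "t + R > 0" using R0 by simp
    have d1: "((\<lambda>t. (t + R) powr (1 - p)) has_real_derivative (1 - p) * (t + R) powr (- p)) (at t)"
      using tR by (auto intro!: derivative_eq_intros)
    have "((\<lambda>t. ?\<Theta> t) has_real_derivative - (B / (t + R))) (at t)"
      using tR by (auto intro!: derivative_eq_intros)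
    from DERIV_chain2[OF g(1) this]
    have d2: "((\<lambda>t. g (?\<Theta> t)) has_real_derivative g' (?\<Theta> t) * - (B / (t + R))) (at t)" .
    have e: "(t + R) powr (1 - p) = (t + R) powr (- p) * (t + R)"
      using tR by (simp add: powr_diff powr_minus field_simps)
    have "((\<lambda>t. (t + R) powr (1 - p) * g (?\<Theta> t)) has_real_derivative
        (1 - p) * (t + R) powr (- p) * g (?\<Theta> t) + g' (?\<Theta> t) * - (B / (t + R)) * (t + R) powr (1 - p)) (at t)"
      by (rule DERIV_mult[OF d1 d2])
    moreover have "(1 - p) * (t + R) powr (- p) * g (?\<Theta> t) + g' (?\<Theta> t) * - (B / (t + R)) * (t + R) powr (1 - p) = \<psi> t"
    proof -
      have key: "(1 - p) * z * x + y * - (B / v) * (z * v) = - (z * ((p - 1) * x + B * y))"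
        if "v \<noteq> 0" for v x y z :: real
        using that by (simp add: field_simps)
      show ?thesis unfolding e \<psi>_def W_def by (rule key) (use tR in simp)
    qed
    ultimately show "(\<Psi> has_real_derivative \<psi> t) (at t)" by (simp add: \<Psi>_def[abs_def])
    have "\<bar>\<psi> t\<bar> = (t + R) powr (- p) * W t" using W0 by (simp add: \<psi>_def abs_mult)
    also have "\<dots> \<le> R powr (- p) * (p * b0)"
      using t R0 p W0 Wle by (intro mult_mono powr_mono2') auto
    finally show "\<bar>\<psi> t\<bar> \<le> R powr (- p) * (p * b0)" .
  qed
  have a\<psi>: "\<bar>\<psi> t\<bar> = (t + R) powr (- p) * W t" for t using W0 by (simp add: \<psi>_def abs_mult)
  define l where "l t = (t + R) / (p - 1)" for t
  have [measurable]: "l \<in> borel_measurable borel" unfolding l_def[abs_def] by measurable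
  have prem: "0 \<le> \<Psi> t" "0 \<le> - 1 * \<psi> t" "0 \<le> l t" "l t \<le> (1 + R) / (p - 1) * (1 + t)" "\<Psi> t \<le> l t * \<bar>\<psi> t\<bar>"
    if "t \<ge> 0" for t
  proof -
    have tR: "t + R > 0" using R0 that by simp
    show "0 \<le> \<Psi> t" unfolding \<Psi>_def using g0 by simp
    show "0 \<le> - 1 * \<psi> t" using W0 by (simp add: \<psi>_def)
    show "0 \<le> l t" using tR p by (simp add: l_def)
    have "t + R \<le> (1 + R) * (1 + t)" using that R0 by (simp add: algebra_simps)
    then show "l t \<le> (1 + R) / (p - 1) * (1 + t)" using p by (simp add: l_def divide_right_mono)
    have e: "(t + R) powr (1 - p) = (t + R) powr (- p) * (t + R)"
      using tR by (simp add: powr_diff powr_minus field_simps)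
    have "(p - 1) * g (?\<Theta> t) \<le> W t" unfolding W_def using B g0 by simp
    have "\<Psi> t = ((t + R) powr (- p) * (t + R) / (p - 1)) * ((p - 1) * g (?\<Theta> t))"
      using p by (simp add: \<Psi>_def e)
    also have "\<dots> \<le> ((t + R) powr (- p) * (t + R) / (p - 1)) * W t"
      using tR p \<open>(p - 1) * g (?\<Theta> t) \<le> W t\<close> by (intro mult_left_mono) auto
    also have "\<dots> = l t * \<bar>\<psi> t\<bar>" by (simp add: l_def a\<psi>)
    finally show "\<Psi> t \<le> l t * \<bar>\<psi> t\<bar>" .
  qed
  note en = energy_estimate[OF W p c K N s \<Psi>, of "-1" l "(1 + R) / (p - 1)"]
  have en1: "(\<integral>x. \<bar>\<psi> (U x)\<bar> * (cutoff y s x ^ N * norm (G x) powr p) \<partial>lborel)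
      \<le> energy_const p c K N * (\<integral>x. indicator (ball y s) x * (\<bar>\<psi> (U x)\<bar> * (1 + (l (U x) / s) powr p)) \<partial>lborel)"
    and en2: "integrable lborel (\<lambda>x. indicator (ball y s) x * (\<bar>\<psi> (U x)\<bar> * (1 + (l (U x) / s) powr p)))"
    and en3: "integrable lborel (\<lambda>x. \<bar>\<psi> (U x)\<bar> * (cutoff y s x ^ N * norm (G x) powr p))"
    by (rule en; use prem in simp)+
  have wW: "w x = W (U x)" for x by (simp add: w_def W_def)
  have eqL: "w x * (cutoff y s x ^ N * norm ((1 / (U x + R)) *\<^sub>R G x) powr p)
      = \<bar>\<psi> (U x)\<bar> * (cutoff y s x ^ N * norm (G x) powr p)" for x
  proof -
    have tR: "U x + R > 0" using R0 U0[of x] by simp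
    have "norm ((1 / (U x + R)) *\<^sub>R G x) powr p = (U x + R) powr (- p) * norm (G x) powr p"
      using tR by (simp add: powr_divide powr_minus field_simps)
    then show ?thesis unfolding a\<psi> wW by simp
  qed
  show "integrable lborel (\<lambda>x. w x * (cutoff y s x ^ N * norm ((1 / (U x + R)) *\<^sub>R G x) powr p))"
    unfolding eqL by (rule en3)
  have mW: "(\<lambda>x. W (U x)) \<in> borel_measurable borel"
    unfolding W_def
    using measurable_continuous_nonneg[OF gc, of U borel] measurable_continuous_nonneg[OF g'c, of U borel] U0 sobolev_measurable[OF S]
    by (intro borel_measurable_add borel_measurable_times) auto
  show iw: "integrable lborel (\<lambda>x. indicator (ball y s) x * w x)"
    unfolding wW
  proof (rule integrable_ball_powr[OF S _ U0 mW])
    fix x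
    have "1 \<le> (1 + U x) powr p" using U0[of x] p by (intro ge_one_powr_ge_zero) auto
    then have "(p * b0) * 1 \<le> (p * b0) * (1 + U x) powr p" using p b0 by (intro mult_left_mono) auto
    then show "\<bar>W (U x)\<bar> \<le> (p * b0) * (1 + U x) powr p" using W0 Wle[OF U0[of x]] by simp
  qed (use p in auto)
  have "(\<integral>x. w x * (cutoff y s x ^ N * norm ((1 / (U x + R)) *\<^sub>R G x) powr p) \<partial>lborel)
      \<le> energy_const p c K N * (\<integral>x. indicator (ball y s) x * (\<bar>\<psi> (U x)\<bar> * (1 + (l (U x) / s) powr p)) \<partial>lborel)"
    unfolding eqL by (rule en1)
  also have "\<dots> \<le> energy_const p c K N * (\<integral>x. ((1 + (p - 1) powr (- p)) * s powr (- p)) * (indicator (ball y s) x * w x) \<partial>lborel)"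
  proof (intro mult_left_mono integral_mono en2)
    show "integrable lborel (\<lambda>x. ((1 + (p - 1) powr (- p)) * s powr (- p)) * (indicator (ball y s) x * w x))"
      using iw by simp
    fix x
    define v where "v = U x + R"
    have v: "v \<ge> s" "v > 0" using U0[of x] R R0 by (auto simp: v_def)
    have "(l (U x) / s) powr p = v powr p * ((p - 1) powr (- p) * s powr (- p))"
    proof -
      have "l (U x) / s = v / ((p - 1) * s)" by (simp add: l_def v_def)
      then show ?thesis by (simp only: powr_divide powr_mult powr_minus) (simp add: divide_inverse)
    qed
    then have "v powr (- p) * (1 + (l (U x) / s) powr p) = v powr (- p) + (p - 1) powr (- p) * s powr (- p)"
      using v by (simp add: powr_minus field_simps)
    also have "\<dots> \<le> s powr (- p) + (p - 1) powr (- p) * s powr (- p)"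
      using v s p by (intro add_right_mono powr_mono2') auto
    finally have "W (U x) * (v powr (- p) * (1 + (l (U x) / s) powr p)) \<le> W (U x) * (s powr (- p) + (p - 1) powr (- p) * s powr (- p))"
      using W0 by (intro mult_left_mono)
    then show "indicator (ball y s) x * (\<bar>\<psi> (U x)\<bar> * (1 + (l (U x) / s) powr p))
        \<le> ((1 + (p - 1) powr (- p)) * s powr (- p)) * (indicator (ball y s) x * w x)"
      unfolding a\<psi> wW v_def by (simp add: indicator_def algebra_simps)
  qed (use energy_const_pos[OF c K] in \<open>auto intro: less_imp_le\<close>)
  also have "\<dots> = log_const p c K N * s powr (- p) * (\<integral>x. indicator (ball y s) x * w x \<partial>lborel)"
    by (simp add: log_const_def)
  finally show "(\<integral>x. w x * (cutoff y s x ^ N * norm ((1 / (U x + R)) *\<^sub>R G x) powr p) \<partial>lborel)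
      \<le> log_const p c K N * s powr (- p) * (\<integral>x. indicator (ball y s) x * w x \<partial>lborel)" .
qed

lemma log_const_pos: "c > 0 \<Longrightarrow> K > 0 \<Longrightarrow> log_const p c K N > 0"
  unfolding log_const_def by (intro mult_pos_pos energy_const_pos add_pos_nonneg) auto

lemma C1_lipschitz_log:
  assumes R0: "R > 0" and B: "B > 0"
  shows "C1_lipschitz (B / R) (\<lambda>t. A - B * ln (t + R)) (\<lambda>t. - B / (t + R))"
  unfolding C1_lipschitz_def
proof (intro conjI allI impI)
  show "continuous_on {0..} (\<lambda>t. - B / (t + R))" using R0 by (intro continuous_intros) auto
  fix t :: real assume t: "0 \<le> t"
  show "((\<lambda>t. A - B * ln (t + R)) has_real_derivative - B / (t + R)) (at t)"
    using t R0 by (auto intro!: derivative_eq_intros)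
  show "\<bar>- B / (t + R)\<bar> \<le> B / R" using t R0 B by (simp add: divide_left_mono)
qed

text \<open>The weight \<open>w\<close> contains \<open>B g'\<close>, which is at least \<open>B\<^sup>p\<close> above the level \<open>b\<close> since \<open>B \<le> 1\<close>. So the constant does
  not depend on \<open>B\<close>, and the logarithm may be scaled down as much as the iteration requires.\<close>
lemma level_energy_log:
  fixes U :: "'a::euclidean_space \<Rightarrow> real"
  assumes W: "weak_solution p c K x0 \<rho> U G J" and p: "p > 1" and c: "c > 0" and K: "K > 0"
    and N: "N \<ge> 2" "real N \<ge> p" and s: "s > 0" "dist x0 y + s < \<rho>" and R: "s \<le> R"
    and B: "0 < B" "B \<le> 1"
  shows "level_energy p (log_const p c K N * p) N y s U G (\<lambda>t. A - B * ln (t + R)) (\<lambda>t. - B / (t + R))"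
proof -
  have R0: "R > 0" using s R by simp
  let ?\<Theta> = "\<lambda>t. A - B * ln (t + R)"
  have \<Theta>: "C1_lipschitz (B / R) ?\<Theta> (\<lambda>t. - B / (t + R))" by (rule C1_lipschitz_log[OF R0 B(1)])
  have S: "sobolev_on_ball p x0 \<rho> U G" and U0: "\<And>x. U x \<ge> 0" using W by (auto simp: weak_solution_def)
  show "level_energy p (log_const p c K N * p) N y s U G ?\<Theta> (\<lambda>t. - B / (t + R))"
    unfolding level_energy_def
  proof (intro allI impI)
    fix a b :: real assume ab: "0 \<le> a \<and> a < b"
    have rd: "0 \<le> ramp_deriv a b v" "ramp_deriv a b v \<le> 1" for v using ramp_deriv_bounds[of a b] ab by auto
    have rb: "0 \<le> ramp a b v" "ramp a b v \<le> max 0 (v - a)" for v using ramp_bounds[of a b v] ab by auto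
    define b0 where "b0 = \<bar>A - B * ln R\<bar> + 1"
    have gb: "ramp a b v \<le> b0" "ramp_deriv a b v \<le> b0" if "v \<le> A - B * ln R" for v
      using rb(2)[of v] rd(2)[of v] that ab by (auto simp: b0_def max_def split: if_splits)
    define w where "w x = (p - 1) * ramp a b (?\<Theta> (U x)) + B * ramp_deriv a b (?\<Theta> (U x))" for x
    have en: "(\<integral>x. w x * (cutoff y s x ^ N * norm ((1 / (U x + R)) *\<^sub>R G x) powr p) \<partial>lborel)
        \<le> log_const p c K N * s powr (- p) * (\<integral>x. indicator (ball y s) x * w x \<partial>lborel)"
      "integrable lborel (\<lambda>x. w x * (cutoff y s x ^ N * norm ((1 / (U x + R)) *\<^sub>R G x) powr p))"
      "integrable lborel (\<lambda>x. indicator (ball y s) x * w x)"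
      unfolding w_def using ab
      by (intro log_energy[OF W p c K N s R B, of "ramp a b" "ramp_deriv a b" A b0] DERIV_ramp continuous_ramp_deriv rb rd gb; simp)+
    have w0: "w x \<ge> 0" for x unfolding w_def using rb rd p B by simp
    have "(\<integral>x. indicator {b..} (?\<Theta> (U x)) * (cutoff y s x ^ N * norm ((- B / (U x + R)) *\<^sub>R G x) powr p) \<partial>lborel)
        \<le> (\<integral>x. w x * (cutoff y s x ^ N * norm ((1 / (U x + R)) *\<^sub>R G x) powr p) \<partial>lborel)"
    proof (rule integral_mono'[OF en(2)])
      fix x
      have tR: "U x + R > 0" using R0 U0[of x] by simp
      have n: "norm ((- B / (U x + R)) *\<^sub>R G x) = B * norm ((1 / (U x + R)) *\<^sub>R G x)"
        using tR B by simp
      have "B powr p \<le> B powr 1" using B p by (intro powr_mono') auto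
      then have Bp: "B powr p \<le> B" using B by simp
      have "indicator {b..} (?\<Theta> (U x)) * B powr p \<le> ramp_deriv a b (?\<Theta> (U x)) * B"
        using rd ramp_deriv_bounds(4)[of a b "?\<Theta> (U x)"] ab Bp B by (auto simp: indicator_def)
      also have "\<dots> \<le> w x" unfolding w_def using rb p by (simp add: mult.commute)
      finally have "(indicator {b..} (?\<Theta> (U x)) * B powr p) * (cutoff y s x ^ N * norm ((1 / (U x + R)) *\<^sub>R G x) powr p)
          \<le> w x * (cutoff y s x ^ N * norm ((1 / (U x + R)) *\<^sub>R G x) powr p)"
        by (rule mult_right_mono) (auto simp: cutoff_power_nonneg)
      then show "indicator {b..} (?\<Theta> (U x)) * (cutoff y s x ^ N * norm ((- B / (U x + R)) *\<^sub>R G x) powr p)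
          \<le> w x * (cutoff y s x ^ N * norm ((1 / (U x + R)) *\<^sub>R G x) powr p)"
        unfolding n powr_mult by (simp only: mult.assoc mult.left_commute)
      show "0 \<le> w x * (cutoff y s x ^ N * norm ((1 / (U x + R)) *\<^sub>R G x) powr p)"
        using w0 cutoff_power_nonneg by (intro mult_nonneg_nonneg) auto
    qed
    also note en(1)
    also have "log_const p c K N * s powr (- p) * (\<integral>x. indicator (ball y s) x * w x \<partial>lborel)
        \<le> log_const p c K N * s powr (- p) * (\<integral>x. p * (indicator (ball y s) x * (indicator {a<..} (?\<Theta> (U x)) * (1 + max 0 (?\<Theta> (U x) - a) powr p))) \<partial>lborel)"
    proof (intro mult_left_mono integral_mono en(3))
      show "integrable lborel (\<lambda>x. p * (indicator (ball y s) x * (indicator {a<..} (?\<Theta> (U x)) * (1 + max 0 (?\<Theta> (U x) - a) powr p))))"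
        using integrable_level[OF S p U0 \<Theta>, of a y s] ab by simp
      fix x
      define v where "v = ?\<Theta> (U x)"
      have "w x \<le> p * (indicator {a<..} v * (1 + max 0 (v - a) powr p))"
      proof (cases "v > a")
        case True
        have "max 0 (v - a) \<le> 1 + max 0 (v - a) powr p" by (rule le_one_plus_powr) (use p in auto)
        then have "ramp a b v \<le> 1 + max 0 (v - a) powr p" using rb(2)[of v] by linarith
        moreover have "B * ramp_deriv a b v \<le> 1 * 1" using B rd by (intro mult_mono) auto
        then have "B * ramp_deriv a b v \<le> 1 + max 0 (v - a) powr p" by (simp add: add_increasing2)
        ultimately have "w x \<le> (p - 1) * (1 + max 0 (v - a) powr p) + (1 + max 0 (v - a) powr p)"
          unfolding w_def v_def[symmetric] using p by (intro add_mono mult_left_mono) auto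
        also have "\<dots> = p * (1 + max 0 (v - a) powr p)" by (simp add: algebra_simps)
        finally show ?thesis using True by simp
      next
        case False
        then have "ramp a b v = 0" "ramp_deriv a b v = 0"
          using rb[of v] ramp_deriv_bounds(3)[of a b v] ab by auto
        then show ?thesis using False by (simp add: w_def v_def)
      qed
      then show "indicator (ball y s) x * w x
          \<le> p * (indicator (ball y s) x * (indicator {a<..} (?\<Theta> (U x)) * (1 + max 0 (?\<Theta> (U x) - a) powr p)))"
        by (simp add: indicator_def v_def)
    qed (use log_const_pos[OF c K, of p N] in simp)
    also have "\<dots> = log_const p c K N * p * s powr (- p) * (\<integral>x. indicator (ball y s) x * (indicator {a<..} (?\<Theta> (U x)) * (1 + max 0 (?\<Theta> (U x) - a) powr p)) \<partial>lborel)"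
      by simp
    finally show "(\<integral>x. indicator {b..} (?\<Theta> (U x)) * (cutoff y s x ^ N * norm ((- B / (U x + R)) *\<^sub>R G x) powr p) \<partial>lborel)
        \<le> log_const p c K N * p * s powr (- p) * (\<integral>x. indicator (ball y s) x * (indicator {a<..} (?\<Theta> (U x)) * (1 + max 0 (?\<Theta> (U x) - a) powr p)) \<partial>lborel)" .
  qed
qed

section \<open>Local boundedness and expansion of positivity\<close>

text \<open>The iteration for \<open>(U + R)/M - 1\<close>, with a threshold that depends on \<open>p\<close>, \<open>c\<close>, \<open>K\<close> and the dimension only.\<close>
lemma local_upper_bound:
  fixes p c K :: real
  assumes p: "p > 1" and c: "c > 0" and K: "K > 0"
  obtains \<nu> where "\<nu> > 0"
    "\<And>(x0::'a::euclidean_space) \<rho> U G J R M y s. weak_solution p c K x0 \<rho> U G J \<Longrightarrow> 0 < s \<Longrightarrow> s \<le> M \<Longrightarrow> 0 \<le> R \<Longrightarrow>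
       dist x0 y + s < \<rho> \<Longrightarrow> excess p y (\<lambda>x. (U x + R) / M - 1) s 0 \<le> \<nu> * s ^ DIM('a) \<Longrightarrow>
       AE x in lborel. x \<in> ball y (s / 2) \<longrightarrow> U x + R \<le> 2 * M"
proof -
  define N where "N = max 2 (nat \<lceil>p\<rceil>)"
  have N: "N \<ge> 2" "real N \<ge> p" by (auto simp: N_def le_max_iff_disj) linarith
  obtain \<nu> where \<nu>: "\<nu> > 0"
    and dg: "\<And>(x0::'a) \<rho> U G \<Theta> \<theta> L y s. sobolev_on_ball p x0 \<rho> U G \<Longrightarrow> (\<And>x. U x \<ge> 0) \<Longrightarrow>
       C1_lipschitz L \<Theta> \<theta> \<Longrightarrow> 0 < s \<Longrightarrow> dist x0 y + s < \<rho> \<Longrightarrow>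
       (\<And>s'. 0 < s' \<Longrightarrow> s' \<le> s \<Longrightarrow> level_energy p (energy_const p c K N) N y s' U G \<Theta> \<theta>) \<Longrightarrow>
       excess p y (\<lambda>x. \<Theta> (U x)) s 0 \<le> \<nu> * s ^ DIM('a) \<Longrightarrow>
       AE x in lborel. x \<in> ball y (s / 2) \<longrightarrow> \<Theta> (U x) \<le> 1"
    using degiorgi_iteration[OF p N(1) less_imp_le[OF energy_const_pos[OF c K]]] by blast
  show thesis
  proof (rule that[OF \<nu>])
    fix x0 :: 'a and \<rho> U G J R M y s
    assume W: "weak_solution p c K x0 \<rho> U G J" and s: "0 < s" and M: "s \<le> M" and R: "0 \<le> R"
      and y: "dist x0 y + s < \<rho>" and small: "excess p y (\<lambda>x. (U x + R) / M - 1) s 0 \<le> \<nu> * s ^ DIM('a)"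
    have S: "sobolev_on_ball p x0 \<rho> U G" and U0: "\<And>x. U x \<ge> 0" using W by (auto simp: weak_solution_def)
    have "AE x in lborel. x \<in> ball y (s / 2) \<longrightarrow> (U x + R) / M - 1 \<le> 1"
    proof (rule dg[OF S U0 _ s y _ small])
      show "C1_lipschitz (1 / M) (\<lambda>t. (t + R) / M - 1) (\<lambda>t. 1 / M)"
        by (rule C1_lipschitz_affine) (use s M in simp)
      show "level_energy p (energy_const p c K N) N y s' U G (\<lambda>t. (t + R) / M - 1) (\<lambda>t. 1 / M)"
        if "0 < s'" "s' \<le> s" for s'
        by (rule level_energy_affine[OF W p c K N that(1) _ _ R]) (use that y M in auto)
    qed
    then show "AE x in lborel. x \<in> ball y (s / 2) \<longrightarrow> U x + R \<le> 2 * M"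
      by eventually_elim (use s M in \<open>auto simp: field_simps\<close>)
  qed
qed

text \<open>If \<open>x + z \<in> Z\<close>, then \<open>F x\<close> is itself an increment of \<open>F\<close>. Integrate over all \<open>x\<close> in the large ball and all
  \<open>z\<close> that lead into \<open>Z\<close>; for fixed \<open>x\<close> these have the measure of \<open>Z\<close>.\<close>
lemma poincare_of_translations:
  fixes F :: "'a::euclidean_space \<Rightarrow> real"
  assumes [measurable]: "F \<in> borel_measurable borel" "Z \<in> sets borel"
    and Z: "Z \<subseteq> ball y s" "\<And>x. x \<in> Z \<Longrightarrow> F x = 0"
    and T: "\<And>z. norm z < 5 * s \<Longrightarrow> (\<integral>\<^sup>+x. indicator (ball y (4 * s)) x * ennreal (\<bar>F (x + z) - F x\<bar> powr p) \<partial>lborel) \<le> ennreal T"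
  shows "emeasure lborel Z * (\<integral>\<^sup>+x. indicator (ball y (4 * s)) x * ennreal (\<bar>F x\<bar> powr p) \<partial>lborel)
      \<le> emeasure lborel (ball (0::'a) (5 * s)) * ennreal T"
proof -
  have [measurable]: "ball y (4 * s) \<in> sets borel" "ball (0::'a) (5 * s) \<in> sets borel" by simp_all
  let ?A = "\<lambda>x. indicator (ball y (4 * s)) x :: ennreal"
  let ?f = "\<lambda>x. ?A x * ennreal (\<bar>F x\<bar> powr p)"
  have Zx: "emeasure lborel Z = (\<integral>\<^sup>+z. indicator Z (z + x) \<partial>lborel)" for x
    by (subst nn_integral_translate) auto
  have "emeasure lborel Z * (\<integral>\<^sup>+x. ?f x \<partial>lborel) = (\<integral>\<^sup>+x. emeasure lborel Z * ?f x \<partial>lborel)"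
    by (rule nn_integral_cmult[symmetric]) measurable
  also have "\<dots> = (\<integral>\<^sup>+x. (\<integral>\<^sup>+z. indicator Z (z + x) * ?f x \<partial>lborel) \<partial>lborel)"
    by (intro nn_integral_cong, subst nn_integral_multc, measurable) (simp add: Zx[symmetric])
  also have "\<dots> \<le> (\<integral>\<^sup>+x. (\<integral>\<^sup>+z. indicator (ball (0::'a) (5 * s)) z * (?A x * ennreal (\<bar>F (x + z) - F x\<bar> powr p)) \<partial>lborel) \<partial>lborel)"
  proof (intro nn_integral_mono)
    fix x z :: 'a
    show "indicator Z (z + x) * ?f x \<le> indicator (ball (0::'a) (5 * s)) z * (?A x * ennreal (\<bar>F (x + z) - F x\<bar> powr p))"
    proof (cases "x \<in> ball y (4 * s) \<and> z + x \<in> Z")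
      case True
      then have "dist y x < 4 * s" "dist y (z + x) < s" using Z by auto
      moreover have "norm z \<le> dist y (z + x) + dist y x"
        using norm_triangle_ineq4[of "y - x" "y - (z + x)"] by (simp add: dist_norm)
      ultimately have "norm z < 5 * s" by linarith
      moreover have "F (x + z) = 0" using True Z(2)[of "z + x"] by (simp add: add.commute)
      ultimately show ?thesis using True by simp
    qed (auto simp: indicator_def)
  qed
  also have "\<dots> = (\<integral>\<^sup>+z. (\<integral>\<^sup>+x. indicator (ball (0::'a) (5 * s)) z * (?A x * ennreal (\<bar>F (x + z) - F x\<bar> powr p)) \<partial>lborel) \<partial>lborel)"
    by (rule lborel_pair.Fubini') measurable
  also have "\<dots> \<le> (\<integral>\<^sup>+z. indicator (ball (0::'a) (5 * s)) z * ennreal T \<partial>lborel)"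
  proof (intro nn_integral_mono)
    fix z :: 'a
    have "(\<integral>\<^sup>+x. indicator (ball (0::'a) (5 * s)) z * (?A x * ennreal (\<bar>F (x + z) - F x\<bar> powr p)) \<partial>lborel)
        = indicator (ball (0::'a) (5 * s)) z * (\<integral>\<^sup>+x. ?A x * ennreal (\<bar>F (x + z) - F x\<bar> powr p) \<partial>lborel)"
      by (rule nn_integral_cmult) measurable
    also have "\<dots> \<le> indicator (ball (0::'a) (5 * s)) z * ennreal T"
      using T[of z] by (cases "norm z < 5 * s") auto
    finally show "(\<integral>\<^sup>+x. indicator (ball (0::'a) (5 * s)) z * (?A x * ennreal (\<bar>F (x + z) - F x\<bar> powr p)) \<partial>lborel)
        \<le> indicator (ball (0::'a) (5 * s)) z * ennreal T" .
  qed
  also have "\<dots> = emeasure lborel (ball (0::'a) (5 * s)) * ennreal T"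
    by (subst nn_integral_multc) auto
  finally show ?thesis .
qed

lemma C1_const: "C1 (\<lambda>_::'a::euclidean_space. 1) (\<lambda>_. 0)"
  by (auto simp: C1_def gderiv_def)

text \<open>The truncated logarithm vanishes where \<open>U + R \<ge> M\<close>, a set of positive density, and its gradient is bounded
  by the logarithmic energy, which does not see the size of \<open>U\<close>. Poincare's inequality applies. The radii are
  \<open>4s\<close> for the conclusion, \<open>12s\<close> to contain all segments towards the set, and \<open>24s\<close> so that the cutoff is at
  least one half on the ball of radius \<open>12s\<close>.\<close>
lemma log_excess_bound:
  fixes p c K :: real and N :: nat
  assumes p: "p > 1" and c: "c > 0" and K: "K > 0" and N: "N \<ge> 2" "real N \<ge> p" and \<nu>: "\<nu> > 0"
  obtains C5 where "C5 > 0"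
    "\<And>(x0::'a::euclidean_space) \<rho> U G J R M y s. weak_solution p c K x0 \<rho> U G J \<Longrightarrow> 0 < s \<Longrightarrow> 24 * s \<le> R \<Longrightarrow>
       dist x0 y + 24 * s < \<rho> \<Longrightarrow> 0 < M \<Longrightarrow> measure lborel {x\<in>ball y s. M \<le> U x + R} \<ge> \<nu> * s ^ DIM('a) \<Longrightarrow>
       excess p y (\<lambda>x. ramp 0 1 (ln M - 1 * ln (U x + R))) (4 * s) 0 \<le> C5 * s ^ DIM('a)"
proof -
  let ?d = "DIM('a)"
  define \<omega> where "\<omega> = measure lborel (ball (0::'a) 1)"
  have \<omega>: "\<omega> > 0" unfolding \<omega>_def by (rule content_ball_pos) simp
  define C4 where "C4 = 2 ^ N * log_const p c K N * (\<omega> * 24 ^ ?d)"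
  have C4: "C4 > 0" unfolding C4_def using log_const_pos[OF c K] \<omega> by simp
  define C5 where "C5 = \<omega> * 5 ^ ?d * C4 / \<nu>"
  have C5: "C5 > 0" unfolding C5_def using C4 \<omega> \<nu> by simp
  show thesis
  proof (rule that[OF C5])
    fix x0 :: 'a and \<rho> U G J R M y s
    assume W: "weak_solution p c K x0 \<rho> U G J" and s: "0 < s" and R: "24 * s \<le> R"
      and y: "dist x0 y + 24 * s < \<rho>" and M: "0 < M"
      and Zm: "measure lborel {x\<in>ball y s. M \<le> U x + R} \<ge> \<nu> * s ^ ?d"
    have S: "sobolev_on_ball p x0 \<rho> U G" and U0: "\<And>x. U x \<ge> 0" using W by (auto simp: weak_solution_def)
    have R0: "R > 0" using s R by simp
    note [measurable] = sobolev_measurable[OF S]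
    have [measurable]: "ball y t \<in> sets borel" for t by simp
    let ?\<Theta> = "\<lambda>t. ln M - 1 * ln (t + R)"
    have s24: "0 < 24 * s" using s by simp
    have \<Theta>: "C1_lipschitz (1 / R) ?\<Theta> (\<lambda>t. - 1 / (t + R))"
      by (rule C1_lipschitz_log[OF R0]) simp
    define \<Phi> where "\<Phi> t = ramp 0 1 (?\<Theta> t)" for t
    define \<phi> where "\<phi> t = ramp_deriv 0 1 (?\<Theta> t) * (- 1 / (t + R))" for t
    have rd: "0 \<le> ramp_deriv 0 1 v" "ramp_deriv 0 1 v \<le> 1" for v using ramp_deriv_bounds[of 0 1] by auto
    have \<Phi>: "C1_lipschitz (1 * (1 / R)) \<Phi> \<phi>"
      unfolding \<Phi>_def[abs_def] \<phi>_def[abs_def]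
      by (rule C1_lipschitz_compose[OF \<Theta> DERIV_ramp continuous_ramp_deriv]) (use rd in auto)
    have [measurable]: "(\<lambda>x. \<Phi> (U x)) \<in> borel_measurable borel" "(\<lambda>x. \<phi> (U x)) \<in> borel_measurable borel"
      using C1_lipschitz_measurable[OF \<Phi>, of U borel] U0 sobolev_measurable[OF S] by auto
    define F where "F x = \<Phi> (U x)" for x
    have [measurable]: "F \<in> borel_measurable borel" unfolding F_def[abs_def] by measurable
    have F0: "F x \<ge> 0" for x unfolding F_def \<Phi>_def using ramp_bounds(1)[of 0 1 "?\<Theta> (U x)"] by simp
    \<comment> \<open>With \<open>g = 1\<close> the weight is the constant \<open>p - 1\<close>, which cancels.\<close>
    let ?n = "\<lambda>x. norm ((1 / (U x + R)) *\<^sub>R G x) powr p"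
    let ?\<xi> = "cutoff y (24 * s)"
    have le: "(\<integral>x. ((p - 1) * 1 + 1 * 0) * (?\<xi> x ^ N * ?n x) \<partial>lborel)
        \<le> log_const p c K N * (24 * s) powr (- p) * (\<integral>x. indicator (ball y (24 * s)) x * ((p - 1) * 1 + 1 * 0) \<partial>lborel)"
      and li: "integrable lborel (\<lambda>x. ((p - 1) * 1 + 1 * 0) * (?\<xi> x ^ N * ?n x))"
      by (rule log_energy[OF W p c K N s24 y R, of 1 "\<lambda>_. 1" "\<lambda>_. 0" 0 1]; simp)+
    have vol: "measure lborel (ball y t) = \<omega> * t ^ ?d" if "t \<ge> 0" for y :: 'a and t
      unfolding \<omega>_def by (rule ball_volume[OF that])
    have le': "(\<integral>x. ?\<xi> x ^ N * ?n x \<partial>lborel) \<le> log_const p c K N * (24 * s) powr (- p) * (\<omega> * (24 * s) ^ ?d)"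
    proof -
      have "(p - 1) * (\<integral>x. ?\<xi> x ^ N * ?n x \<partial>lborel) \<le> log_const p c K N * (24 * s) powr (- p) * ((p - 1) * (\<omega> * (24 * s) ^ ?d))"
        using le vol[of "24 * s" y] s by (simp add: mult.commute)
      also have "\<dots> = (p - 1) * (log_const p c K N * (24 * s) powr (- p) * (\<omega> * (24 * s) ^ ?d))" by simp
      finally show ?thesis using p by (subst (asm) mult_le_cancel_left_pos) auto
    qed
    have li': "integrable lborel (\<lambda>x. ?\<xi> x ^ N * ?n x)" using li p by simp
    define D0 where "D0 = 2 ^ N * (log_const p c K N * (24 * s) powr (- p) * (\<omega> * (24 * s) ^ ?d))"
    have D00: "D0 \<ge> 0" unfolding D0_def using log_const_pos[OF c K, of p N] \<omega> s by simp
    have nnD: "(\<integral>\<^sup>+x. indicator (ball y (12 * s)) x * ennreal (norm ((1 * \<phi> (U x)) *\<^sub>R G x + \<Phi> (U x) *\<^sub>R 0) powr p) \<partial>lborel) \<le> ennreal D0"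
    proof -
      have "(\<integral>\<^sup>+x. indicator (ball y (12 * s)) x * ennreal (norm ((1 * \<phi> (U x)) *\<^sub>R G x + \<Phi> (U x) *\<^sub>R 0) powr p) \<partial>lborel)
          \<le> (\<integral>\<^sup>+x. ennreal (2 ^ N * (?\<xi> x ^ N * ?n x)) \<partial>lborel)"
      proof (intro nn_integral_mono)
        fix x
        show "indicator (ball y (12 * s)) x * ennreal (norm ((1 * \<phi> (U x)) *\<^sub>R G x + \<Phi> (U x) *\<^sub>R 0) powr p)
            \<le> ennreal (2 ^ N * (?\<xi> x ^ N * ?n x))"
        proof (cases "x \<in> ball y (12 * s)")
          case True
          have tR: "U x + R > 0" using R0 U0[of x] by simp
          have "norm (x - y) \<le> 12 * s" using True by (simp add: dist_norm norm_minus_commute)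
          then have "1 - 12 * s / (24 * s) \<le> ?\<xi> x" using s by (intro cutoff_inner) auto
          then have "1 \<le> 2 * ?\<xi> x" using s by simp
          then have "1 \<le> (2 * ?\<xi> x) ^ N" by (rule one_le_power)
          then have one: "1 \<le> 2 ^ N * ?\<xi> x ^ N" by (simp add: power_mult_distrib)
          have "norm ((1 * \<phi> (U x)) *\<^sub>R G x + \<Phi> (U x) *\<^sub>R 0) = ramp_deriv 0 1 (?\<Theta> (U x)) * norm ((1 / (U x + R)) *\<^sub>R G x)"
            using rd(1)[of "?\<Theta> (U x)"] tR by (simp add: \<phi>_def abs_mult)
          also have "\<dots> \<le> 1 * norm ((1 / (U x + R)) *\<^sub>R G x)" by (intro mult_right_mono rd) simp
          finally have "norm ((1 * \<phi> (U x)) *\<^sub>R G x + \<Phi> (U x) *\<^sub>R 0) powr p \<le> 1 * ?n x"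
            using p by (simp only: mult_1_left) (intro powr_mono2, auto)
          also have "\<dots> \<le> (2 ^ N * ?\<xi> x ^ N) * ?n x" by (intro mult_right_mono one) simp
          finally show ?thesis using True by (simp add: ennreal_leI mult.assoc)
        qed simp
      qed
      also have "\<dots> = ennreal (2 ^ N * (\<integral>x. ?\<xi> x ^ N * ?n x \<partial>lborel))"
        using li' by (subst nn_integral_eq_integral) (auto simp: cutoff_power_nonneg)
      also have "\<dots> \<le> ennreal D0"
        unfolding D0_def by (intro ennreal_leI mult_left_mono le') simp
      finally show ?thesis .
    qed
    have T: "(\<integral>\<^sup>+x. indicator (ball y (4 * s)) x * ennreal (\<bar>F (x + z) - F x\<bar> powr p) \<partial>lborel) \<le> ennreal ((5 * s) powr p * D0)"
      if z: "norm z < 5 * s" for z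
    proof -
      have r: "dist x0 y + 24 * s < (dist x0 y + 24 * s + \<rho>) / 2" "(dist x0 y + 24 * s + \<rho>) / 2 < \<rho>" using y by auto
      have "(\<integral>\<^sup>+x. indicator (ball y (4 * s)) x * ennreal (\<bar>1 * \<Phi> (U (x + z)) - 1 * \<Phi> (U x)\<bar> powr p) \<partial>lborel)
          \<le> ennreal (norm z powr p) * (\<integral>\<^sup>+x. indicator (ball y (12 * s)) x *
            ennreal (norm ((1 * \<phi> (U x)) *\<^sub>R G x + \<Phi> (U x) *\<^sub>R 0) powr p) \<partial>lborel)"
      proof (rule translation_estimate[OF S U0 p r(2) C1_const _ _ \<Phi>])
        show "\<bar>1\<bar> \<le> (1::real)" "norm (0::'a) \<le> 0" by simp_all
        fix x :: 'a and t :: real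
        assume "x \<in> ball y (4 * s)" "0 \<le> t" "t \<le> 1"
        moreover have "norm (t *\<^sub>R z) \<le> norm z" using \<open>0 \<le> t\<close> \<open>t \<le> 1\<close> by (simp add: mult_left_le_one_le)
        moreover have "dist y (x + t *\<^sub>R z) \<le> dist y x + norm (t *\<^sub>R z)"
          using norm_triangle_ineq4[of "y - x" "t *\<^sub>R z"] by (simp add: dist_norm algebra_simps)
        ultimately have "dist y (x + t *\<^sub>R z) < 12 * s" using z s by simp
        then show "x + t *\<^sub>R z \<in> ball y (12 * s)" by simp
      next
        fix x assume "x \<in> ball y (12 * s)" "x \<notin> ball x0 ((dist x0 y + 24 * s + \<rho>) / 2)"
        then show "(1::real) = 0 \<and> (0::'a) = 0"
          using r s dist_triangle[of x0 x y] by simp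
      qed simp_all
      also have "\<dots> \<le> ennreal ((5 * s) powr p) * ennreal D0"
        using z p by (intro mult_mono nnD ennreal_leI powr_mono2) auto
      finally show ?thesis using D00 by (simp add: F_def ennreal_mult)
    qed
    define Z where "Z = {x\<in>ball y s. M \<le> U x + R}"
    have [measurable]: "Z \<in> sets borel" unfolding Z_def by measurable
    have ZF: "F x = 0" if "x \<in> Z" for x
    proof -
      have "ln M \<le> ln (U x + R)" using that M by (auto simp: Z_def)
      then have "max 0 (?\<Theta> (U x) - 0) = 0" by simp
      then show ?thesis using ramp_bounds(2)[of 0 1 "?\<Theta> (U x)"] F0[of x] by (simp add: F_def \<Phi>_def)
    qed
    define I where "I = excess p y (\<lambda>x. \<Phi> (U x)) (4 * s) 0"
    have I0: "I \<ge> 0" unfolding I_def by (rule excess_nonneg[OF S p U0 \<Phi>]) simp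
    have nnI: "(\<integral>\<^sup>+x. indicator (ball y (4 * s)) x * ennreal (\<bar>F x\<bar> powr p) \<partial>lborel) = ennreal I"
    proof -
      have "(\<integral>\<^sup>+x. indicator (ball y (4 * s)) x * ennreal (\<bar>F x\<bar> powr p) \<partial>lborel)
          = (\<integral>\<^sup>+x. ennreal (indicator (ball y (4 * s)) x * max 0 (\<Phi> (U x) - 0) powr p) \<partial>lborel)"
        using F0 by (intro nn_integral_cong) (auto simp: indicator_def F_def max_absorb2)
      also have "\<dots> = ennreal I"
        unfolding I_def excess_def
        by (rule nn_integral_eq_integral[OF integrable_excess[OF S p U0 \<Phi>]]) auto
      finally show ?thesis .
    qed
    have fin: "emeasure lborel B = ennreal (measure lborel B)" if "B \<subseteq> ball x t" for B and x :: 'a and t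
    proof (rule emeasure_eq_ennreal_measure)
      have "emeasure lborel B \<le> emeasure lborel (ball x t)" using that by (rule emeasure_mono) simp
      also have "\<dots> < \<infinity>" by (rule emeasure_lborel_ball_finite)
      finally show "emeasure lborel B \<noteq> top" by simp
    qed
    have "emeasure lborel Z * ennreal I \<le> emeasure lborel (ball (0::'a) (5 * s)) * ennreal ((5 * s) powr p * D0)"
      unfolding nnI[symmetric]
      by (rule poincare_of_translations[OF _ _ _ ZF T]) (auto simp: Z_def[symmetric], auto simp: Z_def)
    then have "ennreal (measure lborel Z * I) \<le> ennreal (measure lborel (ball (0::'a) (5 * s)) * ((5 * s) powr p * D0))"
      using fin[of Z y s] fin[of "ball (0::'a) (5 * s)" 0 "5 * s"] I0 D00
      by (simp add: ennreal_mult Z_def[symmetric]) (simp add: Z_def subset_iff)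
    then have "measure lborel Z * I \<le> measure lborel (ball (0::'a) (5 * s)) * ((5 * s) powr p * D0)"
      using D00 by (subst (asm) ennreal_le_iff) auto
    also have "\<dots> \<le> (\<omega> * (5 * s) ^ ?d) * (C4 * s ^ ?d)"
    proof (rule mult_mono)
      show "measure lborel (ball (0::'a) (5 * s)) \<le> \<omega> * (5 * s) ^ ?d" using vol[of "5 * s" 0] s by simp
      have "(5 * s) powr p * (24 * s) powr (- p) \<le> (24 * s) powr p * (24 * s) powr (- p)"
        using s p by (intro mult_right_mono powr_mono2) auto
      also have "\<dots> = 1" using s by (simp flip: powr_add)
      finally have le: "((5 * s) powr p * (24 * s) powr (- p)) * (C4 * s ^ ?d) \<le> 1 * (C4 * s ^ ?d)"
        using C4 s by (intro mult_right_mono) auto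
      have eq: "(5 * s) powr p * D0 = ((5 * s) powr p * (24 * s) powr (- p)) * (C4 * s ^ ?d)"
        by (simp add: D0_def C4_def power_mult_distrib)
      show "(5 * s) powr p * D0 \<le> C4 * s ^ ?d" using le unfolding eq by simp
    qed (use D00 \<omega> s in auto)
    finally have "measure lborel Z * I \<le> (\<omega> * (5 * s) ^ ?d) * (C4 * s ^ ?d)" .
    moreover have "(\<nu> * s ^ ?d) * I \<le> measure lborel Z * I"
      using Zm I0 unfolding Z_def by (intro mult_right_mono) auto
    ultimately have "s ^ ?d * (\<nu> * I) \<le> s ^ ?d * (\<omega> * 5 ^ ?d * C4 * s ^ ?d)"
      by (simp add: power_mult_distrib algebra_simps)
    then have "\<nu> * I \<le> \<omega> * 5 ^ ?d * C4 * s ^ ?d"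
      using s by (subst (asm) mult_le_cancel_left_pos) auto
    then have "I \<le> C5 * s ^ ?d" using \<nu> by (simp add: C5_def field_simps)
    then show "excess p y (\<lambda>x. ramp 0 1 (ln M - 1 * ln (U x + R))) (4 * s) 0 \<le> C5 * s ^ ?d"
      by (simp add: I_def \<Phi>_def)
  qed
qed

text \<open>The excess of \<open>ln (M/(U + R)) - 1\<close> is bounded but not small. Dividing this function by a large \<open>l\<close> makes its
  excess as small as the iteration requires, while its level energies keep their constant. The resulting
  bound by one means \<open>U + R \<ge> exp (-1 - l) M\<close>.\<close>
lemma expansion_of_positivity:
  fixes p c K \<nu> :: real
  assumes p: "p > 1" and c: "c > 0" and K: "K > 0" and \<nu>: "\<nu> > 0"
  obtains e where "0 < e" "e < 1"
    "\<And>(x0::'a::euclidean_space) \<rho> U G J R M y s. weak_solution p c K x0 \<rho> U G J \<Longrightarrow> 0 < s \<Longrightarrow> 24 * s \<le> R \<Longrightarrow>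
       dist x0 y + 24 * s < \<rho> \<Longrightarrow> 0 < M \<Longrightarrow> measure lborel {x\<in>ball y s. M \<le> U x + R} \<ge> \<nu> * s ^ DIM('a) \<Longrightarrow>
       AE x in lborel. x \<in> ball y (2 * s) \<longrightarrow> e * M \<le> U x + R"
proof -
  let ?d = "DIM('a)"
  define N where "N = max 2 (nat \<lceil>p\<rceil>)"
  have N: "N \<ge> 2" "real N \<ge> p" by (auto simp: N_def le_max_iff_disj) linarith
  obtain C5 where C5: "C5 > 0"
    and lb: "\<And>(x0::'a) \<rho> U G J R M y s. weak_solution p c K x0 \<rho> U G J \<Longrightarrow> 0 < s \<Longrightarrow> 24 * s \<le> R \<Longrightarrow>
       dist x0 y + 24 * s < \<rho> \<Longrightarrow> 0 < M \<Longrightarrow> measure lborel {x\<in>ball y s. M \<le> U x + R} \<ge> \<nu> * s ^ ?d \<Longrightarrow>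
       excess p y (\<lambda>x. ramp 0 1 (ln M - 1 * ln (U x + R))) (4 * s) 0 \<le> C5 * s ^ ?d"
    using log_excess_bound[OF p c K N \<nu>] by blast
  have lp: "log_const p c K N * p \<ge> 0" using log_const_pos[OF c K, of p N] p by simp
  obtain \<nu>' where \<nu>': "\<nu>' > 0"
    and dg: "\<And>(x0::'a) \<rho> U G \<Theta> \<theta> L y s. sobolev_on_ball p x0 \<rho> U G \<Longrightarrow> (\<And>x. U x \<ge> 0) \<Longrightarrow>
       C1_lipschitz L \<Theta> \<theta> \<Longrightarrow> 0 < s \<Longrightarrow> dist x0 y + s < \<rho> \<Longrightarrow>
       (\<And>s'. 0 < s' \<Longrightarrow> s' \<le> s \<Longrightarrow> level_energy p (log_const p c K N * p) N y s' U G \<Theta> \<theta>) \<Longrightarrow>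
       excess p y (\<lambda>x. \<Theta> (U x)) s 0 \<le> \<nu>' * s ^ ?d \<Longrightarrow>
       AE x in lborel. x \<in> ball y (s / 2) \<longrightarrow> \<Theta> (U x) \<le> 1"
    using degiorgi_iteration[OF p N(1) lp] by blast
  define l where "l = max 1 ((C5 / \<nu>') powr (1 / p))"
  have l1: "l \<ge> 1" by (simp add: l_def)
  have lpow: "C5 \<le> l powr p * \<nu>'"
  proof -
    have "C5 / \<nu>' = ((C5 / \<nu>') powr (1 / p)) powr p" using C5 \<nu>' p by (simp add: powr_powr)
    also have "\<dots> \<le> l powr p" using p by (intro powr_mono2) (auto simp: l_def)
    finally show ?thesis using \<nu>' by (simp add: field_simps)
  qed
  define e where "e = exp (- 1 - l)"
  have e: "0 < e" "e < 1" using l1 by (auto simp: e_def)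
  show thesis
  proof (rule that[OF e])
    fix x0 :: 'a and \<rho> U G J R M y s
    assume W: "weak_solution p c K x0 \<rho> U G J" and s: "0 < s" and R: "24 * s \<le> R"
      and y: "dist x0 y + 24 * s < \<rho>" and M: "0 < M"
      and Zm: "measure lborel {x\<in>ball y s. M \<le> U x + R} \<ge> \<nu> * s ^ ?d"
    have S: "sobolev_on_ball p x0 \<rho> U G" and U0: "\<And>x. U x \<ge> 0" using W by (auto simp: weak_solution_def)
    have R0: "R > 0" using s R by simp
    have B: "0 < 1 / l" "1 / l \<le> 1" using l1 by auto
    have s4: "0 < 4 * s" "dist x0 y + 4 * s < \<rho>" "4 * s \<le> R" using s y R by auto
    let ?\<Theta> = "\<lambda>t. (ln M - 1) / l - (1 / l) * ln (t + R)"
    note \<Theta> = C1_lipschitz_log[OF R0 B(1), of "(ln M - 1) / l"]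
    have \<Theta>1: "C1_lipschitz (1 / R) (\<lambda>t. ln M - 1 * ln (t + R)) (\<lambda>t. - 1 / (t + R))"
      by (rule C1_lipschitz_log[OF R0]) simp
    have \<Phi>: "C1_lipschitz (1 * (1 / R)) (\<lambda>t. ramp 0 1 (ln M - 1 * ln (t + R)))
        (\<lambda>t. ramp_deriv 0 1 (ln M - 1 * ln (t + R)) * (- 1 / (t + R)))"
      by (rule C1_lipschitz_compose[OF \<Theta>1 DERIV_ramp continuous_ramp_deriv]) (use ramp_deriv_bounds[of 0 1] in auto)
    have "AE x in lborel. x \<in> ball y (4 * s / 2) \<longrightarrow> ?\<Theta> (U x) \<le> 1"
    proof (rule dg[OF S U0 \<Theta> s4(1,2)])
      show "level_energy p (log_const p c K N * p) N y s' U G ?\<Theta> (\<lambda>t. - (1 / l) / (t + R))"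
        if "0 < s'" "s' \<le> 4 * s" for s'
        by (rule level_energy_log[OF W p c K N that(1) _ _ B]) (use that s4 in auto)
      have "excess p y (\<lambda>x. ?\<Theta> (U x)) (4 * s) 0
          \<le> (\<integral>x. l powr (- p) * (indicator (ball y (4 * s)) x * max 0 (ramp 0 1 (ln M - 1 * ln (U x + R)) - 0) powr p) \<partial>lborel)"
        unfolding excess_def
      proof (rule integral_mono)
        show "integrable lborel (\<lambda>x. indicator (ball y (4 * s)) x * max 0 (?\<Theta> (U x) - 0) powr p)"
          by (rule integrable_excess[OF S p U0 \<Theta>]) simp
        show "integrable lborel (\<lambda>x. l powr (- p) * (indicator (ball y (4 * s)) x * max 0 (ramp 0 1 (ln M - 1 * ln (U x + R)) - 0) powr p))"
          using integrable_excess[OF S p U0 \<Phi>, of 0 y "4 * s"] by simp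
        fix x
        define v where "v = ln M - 1 * ln (U x + R)"
        have "?\<Theta> (U x) - 0 = (v - 1) / l" by (simp add: v_def diff_divide_distrib)
        then have "max 0 (?\<Theta> (U x) - 0) = max 0 (v - 1) / l"
          using l1 by (simp only: max_divide_distrib_right) simp
        also have "\<dots> \<le> max 0 (ramp 0 1 v - 0) / l"
          using ramp_bounds(1)[of 0 1 v] l1 by (intro divide_right_mono) auto
        finally have "max 0 (?\<Theta> (U x) - 0) powr p \<le> (max 0 (ramp 0 1 v - 0) / l) powr p"
          using p by (intro powr_mono2) auto
        also have "\<dots> = l powr (- p) * max 0 (ramp 0 1 v - 0) powr p"
          by (simp only: powr_divide powr_minus) (simp add: divide_inverse)
        finally show "indicator (ball y (4 * s)) x * max 0 (?\<Theta> (U x) - 0) powr p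
            \<le> l powr (- p) * (indicator (ball y (4 * s)) x * max 0 (ramp 0 1 (ln M - 1 * ln (U x + R)) - 0) powr p)"
          by (simp add: indicator_def v_def)
      qed
      also have "\<dots> = l powr (- p) * excess p y (\<lambda>x. ramp 0 1 (ln M - 1 * ln (U x + R))) (4 * s) 0"
        by (simp add: excess_def)
      also have "\<dots> \<le> l powr (- p) * (C5 * s ^ ?d)"
        by (intro mult_left_mono lb[OF W s R y M Zm]) simp
      also have "\<dots> \<le> l powr (- p) * ((l powr p * \<nu>') * (4 * s) ^ ?d)"
        using lpow C5 s \<nu>' by (intro mult_left_mono mult_mono power_mono) auto
      also have "\<dots> = \<nu>' * (4 * s) ^ ?d" using l1 by (simp add: powr_minus)
      finally show "excess p y (\<lambda>x. ?\<Theta> (U x)) (4 * s) 0 \<le> \<nu>' * (4 * s) ^ ?d" .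
    qed
    then show "AE x in lborel. x \<in> ball y (2 * s) \<longrightarrow> e * M \<le> U x + R"
    proof eventually_elim
      case (elim x)
      show ?case
      proof
        assume "x \<in> ball y (2 * s)"
        then have "?\<Theta> (U x) \<le> 1" using elim by simp
        then have "(ln M - 1 - ln (U x + R)) / l \<le> 1" by (simp add: diff_divide_distrib)
        then have "ln M - 1 - ln (U x + R) \<le> l" using l1 by (simp add: divide_le_eq)
        then have "- 1 - l + ln M \<le> ln (U x + R)" by simp
        then have "exp (- 1 - l + ln M) \<le> exp (ln (U x + R))" by simp
        then show "e * M \<le> U x + R" using M R0 U0[of x] by (simp add: e_def exp_add)
      qed
    qed
  qed
qed

section \<open>Harnack inequality for weak solutions\<close>

text \<open>Separability: countably many of the balls cover \<open>S\<close>.\<close>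
lemma AE_ball_cover:
  fixes S :: "'a::euclidean_space set"
  assumes "\<And>y. y \<in> S \<Longrightarrow> \<exists>r>0. AE x in lborel. x \<in> ball y r \<longrightarrow> P x"
  shows "AE x in lborel. x \<in> S \<longrightarrow> P x"
proof -
  obtain r where r: "\<And>y. y \<in> S \<Longrightarrow> r y > 0 \<and> (AE x in lborel. x \<in> ball y (r y) \<longrightarrow> P x)"
    using assms by metis
  obtain \<B> where \<B>: "\<B> \<subseteq> (\<lambda>y. ball y (r y)) ` S" "countable \<B>" "\<Union>\<B> = \<Union>((\<lambda>y. ball y (r y)) ` S)"
    using Lindelof[of "(\<lambda>y. ball y (r y)) ` S"] by auto
  have "AE x in lborel. \<forall>b\<in>\<B>. x \<in> b \<longrightarrow> P x"
    using \<B>(1,2) r by (subst AE_ball_countable) auto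
  then show ?thesis
  proof eventually_elim
    case (elim x)
    show ?case
    proof
      assume "x \<in> S"
      then have "x \<in> \<Union>((\<lambda>y. ball y (r y)) ` S)" using r by force
      then show "P x" using elim \<B>(3) by blast
    qed
  qed
qed

text \<open>The essential supremum of \<open>Q\<close> over \<open>S\<close> as a real number, in the form used for the maximisation below.\<close>
lemma essential_bound_ex:
  fixes Q :: "'a::euclidean_space \<Rightarrow> real"
  assumes up: "AE x in lborel. x \<in> S \<longrightarrow> Q x \<le> k1"
    and lo: "\<And>k. k < k0 \<Longrightarrow> \<not> (AE x in lborel. x \<in> S \<longrightarrow> Q x \<le> k)"
  obtains N where "k0 \<le> N" "AE x in lborel. x \<in> S \<longrightarrow> Q x \<le> N"
    "\<And>k. k < N \<Longrightarrow> \<not> (AE x in lborel. x \<in> S \<longrightarrow> Q x \<le> k)"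
proof -
  define X where "X = {k. AE x in lborel. x \<in> S \<longrightarrow> Q x \<le> k}"
  have k1: "k1 \<in> X" using up by (simp add: X_def)
  have lb: "k0 \<le> k" if "k \<in> X" for k using lo[of k] that by (force simp: X_def)
  then have bdd: "bdd_below X" by (meson bdd_belowI)
  define N where "N = Inf X"
  have "AE x in lborel. \<forall>n::nat. x \<in> S \<longrightarrow> Q x \<le> N + 1 / real (Suc n)"
  proof (subst AE_all_countable, intro allI)
    fix n :: nat
    obtain k where k: "k \<in> X" "k < N + 1 / real (Suc n)"
      using cInf_lessD[of X "N + 1 / real (Suc n)"] k1 by (auto simp: N_def)
    then show "AE x in lborel. x \<in> S \<longrightarrow> Q x \<le> N + 1 / real (Suc n)"
      unfolding X_def mem_Collect_eq by (auto elim!: eventually_mono)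
  qed
  then have "AE x in lborel. x \<in> S \<longrightarrow> Q x \<le> N"
  proof eventually_elim
    case (elim x)
    show ?case
    proof
      assume "x \<in> S"
      then have "Q x \<le> N + 1 / real (Suc n)" for n using elim by blast
      moreover have "(\<lambda>n. N + 1 / real (Suc n)) \<longlonglongrightarrow> N + 0"
        using LIMSEQ_inverse_real_of_nat by (intro tendsto_intros) (simp add: inverse_eq_divide)
      ultimately show "Q x \<le> N" by (intro LIMSEQ_le_const[of "\<lambda>n. N + 1 / real (Suc n)"]) auto
    qed
  qed
  moreover have "k0 \<le> N" unfolding N_def by (rule cInf_greatest) (use k1 lb in auto)
  moreover have "\<not> (AE x in lborel. x \<in> S \<longrightarrow> Q x \<le> k)" if "k < N" for k
    using cInf_lower[OF _ bdd, of k] that by (force simp: X_def N_def)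
  ultimately show thesis using that by blast
qed

lemma not_AE_ball_False:
  assumes "r > 0"
  shows "\<not> (AE x in lborel. x \<notin> ball (y::'a::euclidean_space) r)"
proof
  assume "AE x in lborel. x \<notin> ball y r"
  then have "emeasure lborel (ball y r) = 0"
    by (subst (asm) AE_iff_measurable[of "ball y r"]) auto
  then show False using content_ball_pos[OF assms, of y] by (simp add: measure_def)
qed

text \<open>Choosing \<open>M\<close> large makes the excess small, since \<open>U powr p\<close> is integrable. This bound depends on the solution;
  it only ensures that the maximum in the proof of Harnack's inequality is finite.\<close>
lemma weak_solution_locally_bounded:
  fixes U :: "'a::euclidean_space \<Rightarrow> real"
  assumes p: "p > 1" and c: "c > 0" and K: "K > 0" and R: "R > 0"
    and W: "weak_solution p c K x0 (15 / 8 * R) U G J"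
  obtains M where "AE x in lborel. x \<in> ball x0 (3 / 2 * R) \<longrightarrow> U x + R \<le> M"
proof -
  obtain \<nu> where \<nu>: "\<nu> > 0"
    and ub: "\<And>(x0::'a) \<rho> U G J R M y s. weak_solution p c K x0 \<rho> U G J \<Longrightarrow> 0 < s \<Longrightarrow> s \<le> M \<Longrightarrow> 0 \<le> R \<Longrightarrow>
       dist x0 y + s < \<rho> \<Longrightarrow> excess p y (\<lambda>x. (U x + R) / M - 1) s 0 \<le> \<nu> * s ^ DIM('a) \<Longrightarrow>
       AE x in lborel. x \<in> ball y (s / 2) \<longrightarrow> U x + R \<le> 2 * M"
    using local_upper_bound[OF p c K] by blast
  have S: "sobolev_on_ball p x0 (15 / 8 * R) U G" and U0: "\<And>x. U x \<ge> 0" using W by (auto simp: weak_solution_def)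
  note [measurable] = sobolev_measurable[OF S]
  define s where "s = R / 4"
  have s: "s > 0" using R by (simp add: s_def)
  define I where "I = (\<integral>x. indicator (ball x0 (2 * R)) x * (U x + R) powr p \<partial>lborel)"
  have iI: "integrable lborel (\<lambda>x. indicator (ball x0 (2 * R)) x * (U x + R) powr p)"
  proof (rule integrable_ball_powr[OF S _ U0])
    fix x
    have "U x + R \<le> (1 + R) * (1 + U x)" using U0[of x] R by (simp add: algebra_simps)
    then have "(U x + R) powr p \<le> ((1 + R) * (1 + U x)) powr p" using U0[of x] R p by (intro powr_mono2) auto
    then show "\<bar>(U x + R) powr p\<bar> \<le> (1 + R) powr p * (1 + U x) powr p" by (simp add: powr_mult)
  qed (use p in auto)
  have I0: "I \<ge> 0" unfolding I_def by (intro integral_nonneg_AE) auto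
  define M where "M = max s ((I / (\<nu> * s ^ DIM('a))) powr (1 / p))"
  have M: "s \<le> M" "M > 0" using s by (auto simp: M_def)
  have IM: "M powr (- p) * I \<le> \<nu> * s ^ DIM('a)"
  proof -
    have "I / (\<nu> * s ^ DIM('a)) = ((I / (\<nu> * s ^ DIM('a))) powr (1 / p)) powr p"
      using I0 \<nu> s p by (simp add: powr_powr)
    also have "\<dots> \<le> M powr p" using p by (intro powr_mono2) (auto simp: M_def)
    finally have "I \<le> M powr p * (\<nu> * s ^ DIM('a))" using \<nu> s by (simp add: pos_divide_le_eq)
    then have "M powr (- p) * I \<le> M powr (- p) * (M powr p * (\<nu> * s ^ DIM('a)))" by (intro mult_left_mono) auto
    also have "\<dots> = \<nu> * s ^ DIM('a)" using M by (simp add: powr_minus)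
    finally show ?thesis .
  qed
  have "AE x in lborel. x \<in> ball x0 (3 / 2 * R) \<longrightarrow> U x + R \<le> 2 * M"
  proof (rule AE_ball_cover)
    fix y assume y: "y \<in> ball x0 (3 / 2 * R)"
    have d: "dist x0 y + s < 15 / 8 * R" using y R by (simp add: s_def)
    have "AE x in lborel. x \<in> ball y (s / 2) \<longrightarrow> U x + R \<le> 2 * M"
    proof (rule ub[OF W s M(1) _ d])
      have "excess p y (\<lambda>x. (U x + R) / M - 1) s 0 \<le> (\<integral>x. M powr (- p) * (indicator (ball x0 (2 * R)) x * (U x + R) powr p) \<partial>lborel)"
        unfolding excess_def
      proof (rule integral_mono')
        fix x
        have i: "indicator (ball y s) x \<le> (indicator (ball x0 (2 * R)) x :: real)"
          using d dist_triangle[of x0 x y] R by (auto simp: indicator_def)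
        have "max 0 ((U x + R) / M - 1 - 0) \<le> (U x + R) / M"
          using U0[of x] R M by (auto simp: max_def)
        then have "max 0 ((U x + R) / M - 1 - 0) powr p \<le> ((U x + R) / M) powr p"
          using p by (intro powr_mono2) auto
        also have "\<dots> = M powr (- p) * (U x + R) powr p"
          by (simp only: powr_divide powr_minus) (simp add: divide_inverse)
        finally show "indicator (ball y s) x * max 0 ((U x + R) / M - 1 - 0) powr p
            \<le> M powr (- p) * (indicator (ball x0 (2 * R)) x * (U x + R) powr p)"
          using mult_mono[OF i, of "max 0 ((U x + R) / M - 1 - 0) powr p" "M powr (- p) * (U x + R) powr p"]
          by (simp add: mult.left_commute)
      qed (use iI in auto)
      also have "\<dots> = M powr (- p) * I" by (simp add: I_def)
      finally show "excess p y (\<lambda>x. (U x + R) / M - 1) s 0 \<le> \<nu> * s ^ DIM('a)" using IM by linarith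
    qed (use R in simp)
    then show "\<exists>r>0. AE x in lborel. x \<in> ball y r \<longrightarrow> U x + R \<le> 2 * M"
      using s by (intro exI[of _ "s / 2"]) auto
  qed
  then show thesis by (rule that)
qed

lemma dyadic_scale_ex:
  fixes s r :: real
  assumes "0 < s" "s \<le> r"
  obtains n :: nat where "2 ^ n * s \<le> r" "r < 2 ^ Suc n * s"
proof -
  obtain m :: nat where m: "r / s < 2 ^ m" using real_arch_pow[of 2 "r / s"] by auto
  define k where "k = (LEAST m::nat. r < 2 ^ m * s)"
  have k: "r < 2 ^ k * s"
    unfolding k_def by (rule LeastI[of _ m]) (use m assms in \<open>simp add: pos_divide_less_eq\<close>)
  have "k \<noteq> 0" using k assms by (cases k) auto
  then obtain n where n: "k = Suc n" using not0_implies_Suc by blast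
  have "\<not> r < 2 ^ n * s" using not_less_Least[of n "\<lambda>m. r < 2 ^ m * s"] n by (simp add: k_def)
  then show thesis using that[of n] k n by simp
qed

lemma full_measure_of_AE:
  fixes U :: "'a::euclidean_space \<Rightarrow> real"
  assumes [measurable]: "U \<in> borel_measurable borel" and r: "r > 0"
    and ae: "AE x in lborel. x \<in> ball y r \<longrightarrow> M \<le> U x + R"
  shows "measure lborel (ball (0::'a) 1) * r ^ DIM('a) \<le> measure lborel {x\<in>ball y r. M \<le> U x + R}"
proof -
  have [measurable]: "ball y r \<in> sets borel" by simp
  have "measure lborel {x\<in>ball y r. M \<le> U x + R} = measure lborel (ball y r)"
    by (rule measure_eq_AE) (use ae in \<open>auto elim!: eventually_mono\<close>)
  then show ?thesis using r by (subst ball_volume[symmetric]) auto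
qed

text \<open>Everything is measured against the maximum \<open>N\<close> of \<open>Q = (U + R) D\<^sup>b\<close>, where \<open>D = 3/2 - \<bar>x - x0\<bar>/R\<close> is the
  normalised distance to the boundary of the ball of radius \<open>3R/2\<close>. At a maximum point \<open>y\<close> the solution has
  size \<open>N D(y)\<^bsup>-b\<^esup>\<close> at the scale \<open>D(y) R\<close>. Enlarging this scale to a fixed multiple of \<open>R\<close> takes about
  \<open>log\<^sub>2 (1/D(y))\<close> doublings, each of which multiplies the lower bound by \<open>e0\<close>. As \<open>2\<^bsup>-b\<^esup> \<le> e0\<close>, the
  product of these factors is at least \<open>D(y)\<^sup>b\<close> up to a constant and makes up for the size: a fixed fraction of \<open>N\<close> arrives, wherever \<open>y\<close> lies. On \<open>B\<^sub>R\<close>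
  itself the weight is at least \<open>2\<^bsup>-b\<^esup>\<close>, so \<open>N\<close> controls the solution there from above. The radius
  \<open>15R/8\<close> leaves room for the balls of radius \<open>24 \<cdot> R/128 < 3R/8\<close> around points of the ball of radius \<open>3R/2\<close>.\<close>
lemma harnack_weak_solution:
  fixes p c K :: real
  assumes p: "p > 1" and c: "c > 0" and K: "K > 0"
  obtains C where "C > 0"
    "\<And>(x0::'a::euclidean_space) R U G J. R > 0 \<Longrightarrow> weak_solution p c K x0 (15 / 8 * R) U G J \<Longrightarrow>
       \<exists>k. (AE x in lborel. x \<in> ball x0 R \<longrightarrow> U x + R \<le> C * k) \<and> (AE x in lborel. x \<in> ball x0 R \<longrightarrow> k \<le> U x + R)"
proof -
  let ?d = "DIM('a)"
  obtain \<nu>1 where \<nu>1: "\<nu>1 > 0"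
    and ub: "\<And>(x0::'a) \<rho> U G J R M y s. weak_solution p c K x0 \<rho> U G J \<Longrightarrow> 0 < s \<Longrightarrow> s \<le> M \<Longrightarrow> 0 \<le> R \<Longrightarrow>
       dist x0 y + s < \<rho> \<Longrightarrow> excess p y (\<lambda>x. (U x + R) / M - 1) s 0 \<le> \<nu>1 * s ^ ?d \<Longrightarrow>
       AE x in lborel. x \<in> ball y (s / 2) \<longrightarrow> U x + R \<le> 2 * M"
    using local_upper_bound[OF p c K] by blast
  define \<omega> where "\<omega> = measure lborel (ball (0::'a) 1)"
  have \<omega>: "\<omega> > 0" unfolding \<omega>_def by (rule content_ball_pos) simp
  obtain e0 where e0: "0 < e0" "e0 < 1"
    and ex0: "\<And>(x0::'a) \<rho> U G J R M y s. weak_solution p c K x0 \<rho> U G J \<Longrightarrow> 0 < s \<Longrightarrow> 24 * s \<le> R \<Longrightarrow>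
       dist x0 y + 24 * s < \<rho> \<Longrightarrow> 0 < M \<Longrightarrow> measure lborel {x\<in>ball y s. M \<le> U x + R} \<ge> \<omega> * s ^ ?d \<Longrightarrow>
       AE x in lborel. x \<in> ball y (2 * s) \<longrightarrow> e0 * M \<le> U x + R"
    using expansion_of_positivity[OF p c K \<omega>] by blast
  obtain b :: nat where b: "(1 / 2) ^ b \<le> e0"
    using real_arch_pow_inv[of e0 "1 / 2"] e0 by (auto intro: less_imp_le)
  \<comment> \<open>In a ball around the maximum point where \<open>D\<close> varies between one half and three halves of its value
      at the centre, \<open>U + R\<close> is at most \<open>q M\<close>.\<close>
  define q where "q = (4 * 3 ^ b :: real)"
  have q: "q > 0" by (simp add: q_def)
  define \<nu>2 where "\<nu>2 = \<nu>1 * q powr (- p)"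
  have \<nu>2: "\<nu>2 > 0" using \<nu>1 q by (simp add: \<nu>2_def)
  obtain e2 where e2: "0 < e2" "e2 < 1"
    and ex2: "\<And>(x0::'a) \<rho> U G J R M y s. weak_solution p c K x0 \<rho> U G J \<Longrightarrow> 0 < s \<Longrightarrow> 24 * s \<le> R \<Longrightarrow>
       dist x0 y + 24 * s < \<rho> \<Longrightarrow> 0 < M \<Longrightarrow> measure lborel {x\<in>ball y s. M \<le> U x + R} \<ge> \<nu>2 * s ^ ?d \<Longrightarrow>
       AE x in lborel. x \<in> ball y (2 * s) \<longrightarrow> e2 * M \<le> U x + R"
    using expansion_of_positivity[OF p c K \<nu>2] by blast
  \<comment> \<open>The factor \<open>(4/9) ^ b\<close> ensures \<open>s \<le> M\<close> for the radius \<open>s\<close> below, as required by the upper bound: the weight is at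
      most \<open>3/2\<close> and \<open>N \<ge> R\<close>.\<close>
  define \<kappa> where "\<kappa> = (4 / 9) ^ b / (256 :: real)"
  have \<kappa>: "0 < \<kappa>" "\<kappa> \<le> 1 / 256" by (auto simp: \<kappa>_def power_le_one)
  define c1 where "c1 = (128 * \<kappa> * 2 / 3) ^ b / 4"
  have c1: "c1 > 0" using \<kappa> by (simp add: c1_def)
  define c2 where "c2 = e0 ^ 320 * (e2 * c1)"
  have c2: "c2 > 0" using e0 e2 c1 by (simp add: c2_def)
  have C0: "2 ^ b / c2 > 0" using c2 by simp
  show thesis
  proof (rule that[OF C0])
    fix x0 :: 'a and R U G J
    assume R: "R > 0" and W: "weak_solution p c K x0 (15 / 8 * R) U G J"
    have S: "sobolev_on_ball p x0 (15 / 8 * R) U G" and U0: "\<And>x. U x \<ge> 0" using W by (auto simp: weak_solution_def)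
    note [measurable] = sobolev_measurable[OF S]
    have [measurable]: "ball y t \<in> sets borel" for y :: 'a and t by simp
    let ?S = "ball x0 (3 / 2 * R)"
    define D where "D x = 3 / 2 - dist x0 x / R" for x
    have D0: "D x > 0" if "x \<in> ?S" for x using that R by (simp add: D_def field_simps)
    have D1: "D x \<le> 3 / 2" for x using R by (simp add: D_def)
    define Q where "Q x = (U x + R) * D x ^ b" for x
    obtain M0 where M0: "AE x in lborel. x \<in> ?S \<longrightarrow> U x + R \<le> M0"
      using weak_solution_locally_bounded[OF p c K R W] by blast
    have up: "AE x in lborel. x \<in> ?S \<longrightarrow> Q x \<le> \<bar>M0\<bar> * (3 / 2) ^ b"
      using M0
    proof eventually_elim
      case (elim x)
      show ?case
      proof
        assume x: "x \<in> ?S"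
        have "Q x \<le> \<bar>M0\<bar> * D x ^ b" unfolding Q_def using elim x D0[OF x] by (intro mult_right_mono) auto
        also have "\<dots> \<le> \<bar>M0\<bar> * (3 / 2) ^ b" using D0[OF x] D1 by (intro mult_left_mono power_mono) auto
        finally show "Q x \<le> \<bar>M0\<bar> * (3 / 2) ^ b" .
      qed
    qed
    have lo: "\<not> (AE x in lborel. x \<in> ?S \<longrightarrow> Q x \<le> k)" if "k < R" for k
    proof
      assume "AE x in lborel. x \<in> ?S \<longrightarrow> Q x \<le> k"
      then have "AE x in lborel. x \<notin> ball x0 (R / 2)"
      proof eventually_elim
        case (elim x)
        show ?case
        proof
          assume x: "x \<in> ball x0 (R / 2)"
          then have "1 \<le> D x" using R by (simp add: D_def field_simps)
          then have "1 \<le> D x ^ b" by (rule one_le_power)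
          then have "R * 1 \<le> Q x" unfolding Q_def using R U0[of x] by (intro mult_mono) auto
          moreover have "x \<in> ?S" using x R by simp
          ultimately show False using elim that by auto
        qed
      qed
      then show False using not_AE_ball_False[of "R / 2" x0] R by simp
    qed
    obtain N where N: "R \<le> N" "AE x in lborel. x \<in> ?S \<longrightarrow> Q x \<le> N"
      "\<And>k. k < N \<Longrightarrow> \<not> (AE x in lborel. x \<in> ?S \<longrightarrow> Q x \<le> k)"
      using essential_bound_ex[OF up lo] by blast
    have N0: "N > 0" using N R by simp
    \<comment> \<open>\<open>Q\<close> is only defined up to null sets, so a maximum point is replaced by one in whose every neighbourhood
        \<open>Q\<close> exceeds \<open>N/2\<close> on a set of positive measure. If there were none, countably many of the
        neighbourhoods would cover the ball.\<close>
    have "\<exists>y\<in>?S. \<forall>r>0. \<not> (AE x in lborel. x \<in> ball y r \<longrightarrow> (x \<in> ?S \<longrightarrow> Q x \<le> N / 2))"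
    proof (rule ccontr)
      assume "\<not> ?thesis"
      then have "AE x in lborel. x \<in> ?S \<longrightarrow> (x \<in> ?S \<longrightarrow> Q x \<le> N / 2)"
        by (intro AE_ball_cover) blast
      then have "AE x in lborel. x \<in> ?S \<longrightarrow> Q x \<le> N / 2" by simp
      then show False using N(3)[of "N / 2"] N0 by simp
    qed
    then obtain y where y: "y \<in> ?S"
      and ymax: "\<And>r. r > 0 \<Longrightarrow> \<not> (AE x in lborel. x \<in> ball y r \<longrightarrow> (x \<in> ?S \<longrightarrow> Q x \<le> N / 2))" by blast
    define Dy where "Dy = D y"
    have Dy: "0 < Dy" "Dy \<le> 3 / 2" using D0[OF y] D1 by (auto simp: Dy_def)
    define s where "s = \<kappa> * Dy * R"
    have s: "s > 0" using \<kappa> Dy R by (simp add: s_def)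
    have sle: "s \<le> R / 170"
    proof -
      have "\<kappa> * Dy \<le> 1 / 256 * (3 / 2)" using \<kappa> Dy by (intro mult_mono) auto
      then have "\<kappa> * Dy * R \<le> (1 / 170) * R" using R by (intro mult_right_mono) auto
      then show ?thesis by (simp add: s_def)
    qed
    define M where "M = N / 4 * (2 / (3 * Dy)) ^ b"
    have M: "M > 0" using N0 Dy by (simp add: M_def)
    have sM: "s \<le> M"
    proof -
      have "s \<le> (4 / 9) ^ b * (R / 4)"
      proof -
        have "s = (4 / 9) ^ b * (Dy * R / 256)" by (simp add: s_def \<kappa>_def)
        also have "\<dots> \<le> (4 / 9) ^ b * (R / 4)" using Dy R by (intro mult_left_mono) auto
        finally show ?thesis .
      qed
      also have "\<dots> \<le> (2 / (3 * Dy)) ^ b * (N / 4)"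
      proof (intro mult_mono power_mono)
        show "4 / 9 \<le> 2 / (3 * Dy)" using Dy by (simp add: field_simps)
      qed (use N R Dy in auto)
      finally show ?thesis by (simp add: M_def mult.commute)
    qed
    have Dx: "Dy / 2 \<le> D x" "D x \<le> 3 * Dy / 2" "x \<in> ?S" if "x \<in> ball y s" for x
    proof -
      have "dist x0 x \<le> dist x0 y + s" "dist x0 y \<le> dist x0 x + s"
        using that dist_triangle[of x0 x y] dist_triangle[of x0 y x] by (auto simp: dist_commute)
      then have "dist x0 x / R \<le> dist x0 y / R + s / R" "dist x0 y / R \<le> dist x0 x / R + s / R"
        using R by (simp_all add: divide_right_mono flip: add_divide_distrib)
      moreover have "s / R \<le> Dy / 2"
      proof -
        have "\<kappa> * Dy \<le> 1 / 2 * Dy" using \<kappa> Dy by (intro mult_right_mono) auto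
        then show ?thesis using R by (simp add: s_def)
      qed
      moreover have "Dy = 3 / 2 - dist x0 y / R" "D x = 3 / 2 - dist x0 x / R" by (simp_all add: Dy_def D_def)
      ultimately have *: "Dy / 2 \<le> D x \<and> D x \<le> 3 * Dy / 2" by (intro conjI; linarith)
      then show 1: "Dy / 2 \<le> D x" and "D x \<le> 3 * Dy / 2" by blast+
      have "0 < D x" using 1 Dy by linarith
      then show "x \<in> ?S" using R by (simp add: D_def field_simps)
    qed
    have pw: "(3 * Dy / 2) ^ b * (2 / (3 * Dy)) ^ b = 1" using Dy by (simp flip: power_mult_distrib)
    \<comment> \<open>If the excess over \<open>M\<close> were small, then \<open>U + R \<le> 2 M\<close> near \<open>y\<close>, and \<open>M\<close> is chosen such that this means
        \<open>Q \<le> N/2\<close>. So the excess is large; as \<open>U + R\<close> is at most \<open>q M\<close>, this needs a set of positive density.\<close>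
    have big: "\<nu>2 * s ^ ?d \<le> measure lborel {x\<in>ball y s. M \<le> U x + R}"
    proof -
      have "\<not> (excess p y (\<lambda>x. (U x + R) / M - 1) s 0 \<le> \<nu>1 * s ^ ?d)"
      proof
        assume ex: "excess p y (\<lambda>x. (U x + R) / M - 1) s 0 \<le> \<nu>1 * s ^ ?d"
        have "AE x in lborel. x \<in> ball y (s / 2) \<longrightarrow> U x + R \<le> 2 * M"
          by (rule ub[OF W s sM _ _ ex]) (use R y sle in auto)
        then have "AE x in lborel. x \<in> ball y (s / 2) \<longrightarrow> (x \<in> ?S \<longrightarrow> Q x \<le> N / 2)"
        proof eventually_elim
          case (elim x)
          show ?case
          proof (intro impI)
            assume x: "x \<in> ball y (s / 2)"
            then have x': "x \<in> ball y s" using s by simp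
            have "Q x \<le> (2 * M) * (3 * Dy / 2) ^ b"
              unfolding Q_def using elim x Dx[OF x'] Dy M by (intro mult_mono power_mono) auto
            also have "\<dots> = N / 2 * ((3 * Dy / 2) ^ b * (2 / (3 * Dy)) ^ b)" by (simp add: M_def)
            finally show "Q x \<le> N / 2" unfolding pw by simp
          qed
        qed
        then show False using ymax[of "s / 2"] s by simp
      qed
      then have "\<nu>1 * s ^ ?d \<le> excess p y (\<lambda>x. (U x + R) / M - 1) s 0" by simp
      also have "\<dots> \<le> (\<integral>x. q powr p * indicator {x\<in>ball y s. M \<le> U x + R} x \<partial>lborel)"
        unfolding excess_def
      proof (rule integral_mono_AE)
        have fin: "emeasure lborel {x\<in>ball y s. M \<le> U x + R} < \<infinity>"
        proof -
          have "emeasure lborel {x\<in>ball y s. M \<le> U x + R} \<le> emeasure lborel (ball y s)"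
            by (rule emeasure_mono) auto
          also have "\<dots> < \<infinity>" by (rule emeasure_lborel_ball_finite)
          finally show ?thesis .
        qed
        show "integrable lborel (\<lambda>x. indicator (ball y s) x * max 0 ((U x + R) / M - 1 - 0) powr p)"
          by (rule integrable_excess[OF S p U0 C1_lipschitz_affine[OF M]]) simp
        show "integrable lborel (\<lambda>x. q powr p * indicator {x\<in>ball y s. M \<le> U x + R} x)"
          using fin by (intro integrable_mult_right integrable_real_indicator) auto
        show "AE x in lborel. indicator (ball y s) x * max 0 ((U x + R) / M - 1 - 0) powr p
            \<le> q powr p * indicator {x\<in>ball y s. M \<le> U x + R} x"
          using N(2)
        proof eventually_elim
          case (elim x)
          show ?case
          proof (cases "x \<in> ball y s \<and> M \<le> U x + R")
            case True
            have "(U x + R) * (Dy / 2) ^ b \<le> Q x"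
              unfolding Q_def using Dx[of x] True Dy U0[of x] R by (intro mult_left_mono power_mono) auto
            also have "\<dots> \<le> N" using elim Dx(3)[of x] True by simp
            finally have "(U x + R) * (Dy / 2) ^ b \<le> N" .
            also have "N = N * ((3 * Dy / 2) ^ b * (2 / (3 * Dy)) ^ b)" unfolding pw by simp
            also have "\<dots> = M * (4 * (3 * Dy / 2) ^ b)" by (simp add: M_def)
            also have "\<dots> = (M * q) * (Dy / 2) ^ b" by (simp add: q_def power_divide power_mult_distrib)
            finally have "U x + R \<le> M * q" using Dy by (subst (asm) mult_le_cancel_right_pos) auto
            then have "(U x + R) / M \<le> q" using M by (simp add: pos_divide_le_eq mult.commute)
            then have "max 0 ((U x + R) / M - 1 - 0) powr p \<le> q powr p" using p q by (intro powr_mono2) auto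
            then show ?thesis using True by simp
          next
            case False
            then show ?thesis using M by (auto simp: indicator_def max_def field_simps)
          qed
        qed
      qed
      also have "\<dots> = q powr p * measure lborel {x\<in>ball y s. M \<le> U x + R}" by simp
      finally have "q powr (- p) * (\<nu>1 * s ^ ?d) \<le> q powr (- p) * (q powr p * measure lborel {x\<in>ball y s. M \<le> U x + R})"
        by (intro mult_left_mono) auto
      also have "\<dots> = measure lborel {x\<in>ball y s. M \<le> U x + R}" using q by (simp add: powr_minus)
      finally show ?thesis by (simp add: \<nu>2_def mult.commute mult.left_commute)
    qed
    have b0: "AE x in lborel. x \<in> ball y (2 * s) \<longrightarrow> e2 * M \<le> U x + R"
      by (rule ex2[OF W s _ _ M big]) (use R y sle in auto)
    define r0 where "r0 = R / 128"
    have r0: "r0 > 0" "s \<le> r0" using R sle by (auto simp: r0_def)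
    have dbl: "2 ^ n * s \<le> r0 \<Longrightarrow> AE x in lborel. x \<in> ball y (2 * (2 ^ n * s)) \<longrightarrow> e0 ^ n * (e2 * M) \<le> U x + R" for n
    proof (induction n)
      case 0
      then show ?case using b0 by simp
    next
      case (Suc n)
      have le: "2 * (2 ^ n * s) \<le> r0" using Suc.prems by simp
      have pos: "0 < 2 * (2 ^ n * s)" using s by simp
      have "2 ^ n * s \<le> r0" using le pos by linarith
      note ih = Suc.IH[OF this]
      have "AE x in lborel. x \<in> ball y (2 * (2 * (2 ^ n * s))) \<longrightarrow> e0 * (e0 ^ n * (e2 * M)) \<le> U x + R"
      proof (rule ex0[OF W pos])
        show "\<omega> * (2 * (2 ^ n * s)) ^ ?d \<le> measure lborel {x\<in>ball y (2 * (2 ^ n * s)). e0 ^ n * (e2 * M) \<le> U x + R}"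
          unfolding \<omega>_def by (rule full_measure_of_AE[OF _ pos ih]) measurable
        show "24 * (2 * (2 ^ n * s)) \<le> R" using le R by (simp add: r0_def)
        have "dist x0 y < 3 / 2 * R" using y by simp
        then show "dist x0 y + 24 * (2 * (2 ^ n * s)) < 15 / 8 * R" using le R by (simp add: r0_def)
      qed (use e0 e2 M in auto)
      then show ?case by (simp add: mult.assoc)
    qed
    obtain n where n: "2 ^ n * s \<le> r0" "r0 < 2 ^ Suc n * s" using dyadic_scale_ex[OF s r0(2)] by blast
    define k1 where "k1 = e2 * (c1 * N)"
    have k1: "k1 > 0" using e2 c1 N0 by (simp add: k1_def)
    \<comment> \<open>The choice of \<open>b\<close> enters here: the loss \<open>e0 ^ n\<close> is at least \<open>(s / r0) ^ b\<close>, and the powers of the weight at \<open>y\<close>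
        in \<open>s\<close> and in \<open>M\<close> cancel.\<close>
    have low: "k1 \<le> e0 ^ n * (e2 * M)"
    proof -
      have "(s / r0) ^ b \<le> ((1 / 2) ^ n) ^ b"
      proof (rule power_mono)
        show "s / r0 \<le> (1 / 2) ^ n" using n(1) r0 by (simp add: power_one_over field_simps)
      qed (use s r0 in auto)
      also have "\<dots> = ((1 / 2) ^ b) ^ n" by (simp add: mult.commute flip: power_mult)
      also have "\<dots> \<le> e0 ^ n" using b by (intro power_mono) auto
      finally have "(s / r0) ^ b * (e2 * M) \<le> e0 ^ n * (e2 * M)" using e2 M by (intro mult_right_mono) auto
      moreover have "(s / r0) ^ b * M = c1 * N"
      proof -
        have "(s / r0) ^ b * (2 / (3 * Dy)) ^ b = (128 * \<kappa> * 2 / 3) ^ b"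
          unfolding power_mult_distrib[symmetric] using R Dy by (simp add: s_def r0_def field_simps)
        then have "(s / r0) ^ b * (2 / (3 * Dy)) ^ b * (N / 4) = (128 * \<kappa> * 2 / 3) ^ b * (N / 4)" by simp
        then show ?thesis by (simp add: M_def c1_def mult.commute mult.left_commute)
      qed
      ultimately show ?thesis unfolding k1_def by (metis mult.left_commute)
    qed
    have start: "AE x in lborel. x \<in> ball y r0 \<longrightarrow> k1 \<le> U x + R"
      using dbl[OF n(1)] by eventually_elim (use n(2) low in auto)
    \<comment> \<open>The distance from \<open>y\<close> to \<open>z\<close> is less than \<open>5R/2 = 320 r0\<close>.\<close>
    have chain: "AE x in lborel. x \<in> ball z r0 \<longrightarrow> e0 ^ 320 * k1 \<le> U x + R" if z: "z \<in> ball x0 R" for z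
    proof -
      define w where "w i = y + (real i / 320) *\<^sub>R (z - y)" for i :: nat
      have yz: "norm (z - y) \<le> 5 / 2 * R"
        using dist_triangle[of z y x0] y z by (simp add: dist_norm norm_minus_commute)
      have "i \<le> 320 \<Longrightarrow> AE x in lborel. x \<in> ball (w i) r0 \<longrightarrow> e0 ^ i * k1 \<le> U x + R" for i
      proof (induction i)
        case 0
        then show ?case using start by (simp add: w_def)
      next
        case (Suc i)
        have win: "w i \<in> ?S"
        proof -
          have zS: "z \<in> ?S" using z R by simp
          have "(1 - real i / 320) *\<^sub>R y + (real i / 320) *\<^sub>R z \<in> ?S"
            by (rule convexD[OF convex_ball y zS]) (use Suc.prems in auto)
          then show ?thesis by (simp add: w_def algebra_simps)
        qed
        have ih: "AE x in lborel. x \<in> ball (w i) r0 \<longrightarrow> e0 ^ i * k1 \<le> U x + R" using Suc by simp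
        have nx: "AE x in lborel. x \<in> ball (w i) (2 * r0) \<longrightarrow> e0 * (e0 ^ i * k1) \<le> U x + R"
        proof (rule ex0[OF W r0(1)])
          show "\<omega> * r0 ^ ?d \<le> measure lborel {x\<in>ball (w i) r0. e0 ^ i * k1 \<le> U x + R}"
            unfolding \<omega>_def by (rule full_measure_of_AE[OF _ r0(1) ih]) measurable
          show "24 * r0 \<le> R" using R by (simp add: r0_def)
          have "dist x0 (w i) < 3 / 2 * R" using win by simp
          then show "dist x0 (w i) + 24 * r0 < 15 / 8 * R" using R by (simp add: r0_def)
        qed (use e0 k1 in auto)
        have "dist (w i) (w (Suc i)) \<le> r0"
        proof -
          have "w (Suc i) - w i = (1 / 320) *\<^sub>R (z - y)" by (simp add: w_def add_divide_distrib algebra_simps)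
          moreover have "dist (w i) (w (Suc i)) = norm (w (Suc i) - w i)" by (simp add: dist_norm norm_minus_commute)
          ultimately have "dist (w i) (w (Suc i)) = norm (z - y) / 320" by simp
          then show ?thesis using yz by (simp add: r0_def)
        qed
        then have sub: "x \<in> ball (w i) (2 * r0)" if "x \<in> ball (w (Suc i)) r0" for x
          using that dist_triangle[of "w i" x "w (Suc i)"] by simp
        show ?case using nx by eventually_elim (use sub in \<open>auto simp: mult.assoc\<close>)
      qed
      from this[of 320] show ?thesis by (simp add: w_def)
    qed
    have lower: "AE x in lborel. x \<in> ball x0 R \<longrightarrow> c2 * N \<le> U x + R"
    proof (rule AE_ball_cover)
      fix z assume "z \<in> ball x0 R"
      from chain[OF this] r0 show "\<exists>r>0. AE x in lborel. x \<in> ball z r \<longrightarrow> c2 * N \<le> U x + R"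
        by (intro exI[of _ r0]) (simp add: c2_def k1_def mult.assoc)
    qed
    have upper: "AE x in lborel. x \<in> ball x0 R \<longrightarrow> U x + R \<le> 2 ^ b / c2 * (c2 * N)"
      using N(2)
    proof eventually_elim
      case (elim x)
      show ?case
      proof
        assume x: "x \<in> ball x0 R"
        then have "x \<in> ?S" using R by simp
        then have "Q x \<le> N" using elim by simp
        have "1 / 2 \<le> D x" using x R by (simp add: D_def field_simps)
        then have "(U x + R) * (1 / 2) ^ b \<le> Q x"
          unfolding Q_def using U0[of x] R by (intro mult_left_mono power_mono) auto
        then have "(U x + R) * (1 / 2) ^ b \<le> N" using \<open>Q x \<le> N\<close> by linarith
        then have "U x + R \<le> 2 ^ b * N" by (simp add: power_one_over field_simps)
        then show "U x + R \<le> 2 ^ b / c2 * (c2 * N)" using c2 by simp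
      qed
    qed
    show "\<exists>k. (AE x in lborel. x \<in> ball x0 R \<longrightarrow> U x + R \<le> 2 ^ b / c2 * k) \<and> (AE x in lborel. x \<in> ball x0 R \<longrightarrow> k \<le> U x + R)"
      using lower upper by blast
  qed
qed

section \<open>Structure conditions for the current\<close>

text \<open>The structural assumptions at one point \<open>x\<close>, with \<open>h\<close> for \<open>H x\<close> and \<open>D\<close> for its gradient in \<open>p\<close>.\<close>
definition fibre_assumptions ::
  "real \<Rightarrow> real \<Rightarrow> real \<Rightarrow> real \<Rightarrow> real \<Rightarrow> real \<Rightarrow> ('a::euclidean_space \<Rightarrow> real \<Rightarrow> real) \<Rightarrow> ('a \<Rightarrow> real \<Rightarrow> 'a) \<Rightarrow> bool" where
  "fibre_assumptions \<alpha> \<tau> \<beta> \<delta> \<epsilon> C h D \<longleftrightarrow>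
     (\<forall>p. \<forall>m>0. GDERIV (\<lambda>q. h q m) p :> D p m) \<and>
     (\<forall>p. \<forall>m>0. norm (D p m) \<le> C * (1 / m + 1 / m powr \<tau>) * norm p powr (\<alpha> - 1) + C * (m powr (\<beta> - \<delta>) + 1 / m)) \<and>
     (\<forall>p. \<forall>m>0. D p m \<bullet> p \<ge> 1 / C * (1 / (m powr \<tau> + 1)) * norm p powr \<alpha> - C * (m powr (\<beta> - \<delta> - \<epsilon>) + 1) * norm p) \<and>
     (\<forall>m>0. h 0 m \<ge> - C * (m powr \<beta> + 1)) \<and>
     (\<forall>m\<ge>C. h 0 m \<le> - (1 / C) * m powr \<beta>)"

lemma fibre_mean_value:
  fixes h :: "'a::euclidean_space \<Rightarrow> real \<Rightarrow> real"
  assumes F: "fibre_assumptions \<alpha> \<tau> \<beta> \<delta> \<epsilon> C h D" and m: "m > 0" and st: "s < t"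
  obtains r where "s < r" "r < t" "h (t *\<^sub>R p) m - h (s *\<^sub>R p) m = (t - s) * (D (r *\<^sub>R p) m \<bullet> p)"
proof -
  have "((\<lambda>t. h (t *\<^sub>R p) m) has_real_derivative D (r *\<^sub>R p) m \<bullet> p) (at r)" for r
  proof -
    have "((\<lambda>t. t *\<^sub>R p) has_derivative (\<lambda>s. s *\<^sub>R p)) (at r)" by (auto intro!: derivative_eq_intros)
    moreover have "((\<lambda>q. h q m) has_derivative (\<lambda>k. k \<bullet> D (r *\<^sub>R p) m)) (at (r *\<^sub>R p))"
      using F m by (simp add: fibre_assumptions_def gderiv_def)
    ultimately have "((\<lambda>t. h (t *\<^sub>R p) m) has_derivative (\<lambda>s. (s *\<^sub>R p) \<bullet> D (r *\<^sub>R p) m)) (at r)"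
      by (rule has_derivative_compose)
    then show ?thesis
      by (simp add: has_field_derivative_def inner_commute mult.commute[of _ "_ \<bullet> _"])
  qed
  then obtain r where "s < r" "r < t" "h (t *\<^sub>R p) m - h (s *\<^sub>R p) m = (t - s) * (D (r *\<^sub>R p) m \<bullet> p)"
    using MVT2[OF st, of "\<lambda>t. h (t *\<^sub>R p) m" "\<lambda>r. D (r *\<^sub>R p) m \<bullet> p"] by blast
  then show thesis by (rule that)
qed

text \<open>The coercivity bound gives \<open>D(rp) \<bullet> p\<close> a lower bound that degenerates as \<open>r\<close> tends to zero, so one mean value
  on \<open>[0,1]\<close> would not do. On \<open>[1/2,1]\<close> the intermediate point is at least \<open>1/2\<close>; on \<open>[0,1/2]\<close> the term of order
  \<open>\<alpha>\<close> is dropped.\<close>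
lemma fibre_lower:
  fixes h :: "'a::euclidean_space \<Rightarrow> real \<Rightarrow> real"
  assumes F: "fibre_assumptions \<alpha> \<tau> \<beta> \<delta> \<epsilon> C h D" and m: "m > 0" and \<alpha>: "\<alpha> > 1" and C: "C > 0"
  shows "h p m \<ge> - C * (m powr \<beta> + 1) + (1 / 2) powr \<alpha> / C * (1 / (m powr \<tau> + 1)) * norm p powr \<alpha>
      - C * (m powr (\<beta> - \<delta> - \<epsilon>) + 1) * norm p"
proof -
  define a b where ab: "a = 1 / C * (1 / (m powr \<tau> + 1))" "b = C * (m powr (\<beta> - \<delta> - \<epsilon>) + 1)"
  have mt: "m powr \<tau> + 1 > 0" by (simp add: add_nonneg_pos)
  have a0: "a > 0" using C mt by (simp add: ab)
  have b0: "b \<ge> 0" using C by (simp add: ab)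
  have low: "D (r *\<^sub>R p) m \<bullet> p \<ge> a * r powr (\<alpha> - 1) * norm p powr \<alpha> - b * norm p" if "r > 0" for r
  proof -
    have "a * norm (r *\<^sub>R p) powr \<alpha> - b * norm (r *\<^sub>R p) \<le> D (r *\<^sub>R p) m \<bullet> (r *\<^sub>R p)"
      using F m unfolding fibre_assumptions_def ab by blast
    moreover have "norm (r *\<^sub>R p) powr \<alpha> = r * (r powr (\<alpha> - 1) * norm p powr \<alpha>)" "norm (r *\<^sub>R p) = r * norm p"
      using that by (simp_all add: powr_mult powr_diff)
    ultimately have "r * (a * r powr (\<alpha> - 1) * norm p powr \<alpha> - b * norm p) \<le> r * (D (r *\<^sub>R p) m \<bullet> p)"
      using that by (simp add: algebra_simps)
    then show ?thesis using that by (subst (asm) mult_le_cancel_left_pos) auto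
  qed
  obtain r1 where r1: "0 < r1" "r1 < 1 / 2" "h ((1 / 2) *\<^sub>R p) m - h (0 *\<^sub>R p) m = (1 / 2 - 0) * (D (r1 *\<^sub>R p) m \<bullet> p)"
    using fibre_mean_value[OF F m, of 0 "1 / 2" p] by auto
  obtain r2 where r2: "1 / 2 < r2" "r2 < 1" "h (1 *\<^sub>R p) m - h ((1 / 2) *\<^sub>R p) m = (1 - 1 / 2) * (D (r2 *\<^sub>R p) m \<bullet> p)"
    using fibre_mean_value[OF F m, of "1 / 2" 1 p] by auto
  have "0 \<le> a * r1 powr (\<alpha> - 1) * norm p powr \<alpha>" using a0 by simp
  then have 1: "D (r1 *\<^sub>R p) m \<bullet> p \<ge> - (b * norm p)" using low[OF r1(1)] by linarith
  have "a * (1 / 2) powr (\<alpha> - 1) * norm p powr \<alpha> \<le> a * r2 powr (\<alpha> - 1) * norm p powr \<alpha>"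
    using a0 \<alpha> r2 by (intro mult_right_mono mult_left_mono powr_mono2) auto
  then have 2: "D (r2 *\<^sub>R p) m \<bullet> p \<ge> a * (1 / 2) powr (\<alpha> - 1) * norm p powr \<alpha> - b * norm p"
    using low[of r2] r2 by linarith
  have h0: "h 0 m \<ge> - C * (m powr \<beta> + 1)" using F m unfolding fibre_assumptions_def by blast
  have e: "(1 / 2) * (a * (1 / 2) powr (\<alpha> - 1) * norm p powr \<alpha>) = (1 / 2) powr \<alpha> / C * (1 / (m powr \<tau> + 1)) * norm p powr \<alpha>"
    by (simp add: powr_diff ab)
  have "h p m - h 0 m = (1 / 2) * (D (r1 *\<^sub>R p) m \<bullet> p) + (1 / 2) * (D (r2 *\<^sub>R p) m \<bullet> p)"
    using r1(3) r2(3) by simp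
  then show ?thesis using 1 2 h0 unfolding e[symmetric] ab(2)[symmetric] by linarith
qed

lemma fibre_upper:
  fixes h :: "'a::euclidean_space \<Rightarrow> real \<Rightarrow> real"
  assumes F: "fibre_assumptions \<alpha> \<tau> \<beta> \<delta> \<epsilon> C h D" and m: "m \<ge> C" and \<alpha>: "\<alpha> > 1" and C: "C > 0"
  shows "h p m \<le> - (1 / C) * m powr \<beta> + C * (1 / m + 1 / m powr \<tau>) * norm p powr \<alpha> + C * (m powr (\<beta> - \<delta>) + 1 / m) * norm p"
proof -
  have m0: "m > 0" using m C by simp
  obtain r where r: "0 < r" "r < 1" "h (1 *\<^sub>R p) m - h (0 *\<^sub>R p) m = (1 - 0) * (D (r *\<^sub>R p) m \<bullet> p)"
    using fibre_mean_value[OF F m0, of 0 1 p] by auto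
  have "norm (r *\<^sub>R p) \<le> 1 * norm p" unfolding norm_scaleR using r by (intro mult_right_mono) auto
  then have np: "norm (r *\<^sub>R p) powr (\<alpha> - 1) \<le> norm p powr (\<alpha> - 1)"
    using \<alpha> by (intro powr_mono2) auto
  have "D (r *\<^sub>R p) m \<bullet> p \<le> norm (D (r *\<^sub>R p) m) * norm p"
    using Cauchy_Schwarz_ineq2[of "D (r *\<^sub>R p) m" p] by linarith
  also have "\<dots> \<le> (C * (1 / m + 1 / m powr \<tau>) * norm p powr (\<alpha> - 1) + C * (m powr (\<beta> - \<delta>) + 1 / m)) * norm p"
  proof (rule mult_right_mono)
    have "norm (D (r *\<^sub>R p) m) \<le> C * (1 / m + 1 / m powr \<tau>) * norm (r *\<^sub>R p) powr (\<alpha> - 1) + C * (m powr (\<beta> - \<delta>) + 1 / m)"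
      using F m0 unfolding fibre_assumptions_def by blast
    also have "\<dots> \<le> C * (1 / m + 1 / m powr \<tau>) * norm p powr (\<alpha> - 1) + C * (m powr (\<beta> - \<delta>) + 1 / m)"
      using C m0 by (intro add_right_mono mult_left_mono np) auto
    finally show "norm (D (r *\<^sub>R p) m) \<le> C * (1 / m + 1 / m powr \<tau>) * norm p powr (\<alpha> - 1) + C * (m powr (\<beta> - \<delta>) + 1 / m)" .
  qed simp
  also have "\<dots> = C * (1 / m + 1 / m powr \<tau>) * (norm p powr (\<alpha> - 1) * norm p) + C * (m powr (\<beta> - \<delta>) + 1 / m) * norm p"
    by (simp add: algebra_simps)
  also have "norm p powr (\<alpha> - 1) * norm p = norm p powr \<alpha>"
    by (cases "p = 0") (auto simp: powr_diff)
  finally have "h p m - h 0 m \<le> C * (1 / m + 1 / m powr \<tau>) * norm p powr \<alpha> + C * (m powr (\<beta> - \<delta>) + 1 / m) * norm p"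
    using r(3) by simp
  moreover have "h 0 m \<le> - (1 / C) * m powr \<beta>" using F m unfolding fibre_assumptions_def by blast
  ultimately show ?thesis by linarith
qed

text \<open>If \<open>h p m\<close> is bounded above, the lower bound gives \<open>\<bar>p\<bar>\<^sup>\<alpha> \<le> const \<cdot> m\<^bsup>\<beta>+\<tau>\<^esup>\<close> for \<open>m \<ge> 1\<close> up to
  terms of the same or lower order if \<open>\<bar>p\<bar>\<close> counts like \<open>m\<^sup>\<delta>\<close>, and \<open>\<beta> + \<tau> = \<alpha> \<delta>\<close>. The threshold is one instead of zero because at \<open>m = 0\<close> the value
  is a limit of values that may be slightly positive.\<close>
lemma fibre_gradient_le_density:
  fixes \<alpha> \<tau> \<beta> \<delta> \<epsilon> C :: real
  assumes par: "\<alpha> > 1" "0 \<le> \<tau>" "\<delta> > 0" "\<epsilon> > 0" "\<beta> - \<delta> > \<epsilon>" "\<alpha> * \<delta> = \<beta> + \<tau>" and C: "C \<ge> 1"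
  obtains A1 where "A1 \<ge> 1"
    "\<And>(h::'a::euclidean_space \<Rightarrow> real \<Rightarrow> real) D p m. fibre_assumptions \<alpha> \<tau> \<beta> \<delta> \<epsilon> C h D \<Longrightarrow> m > 0 \<Longrightarrow> h p m \<le> 1 \<Longrightarrow>
       norm p \<le> A1 * max 1 m powr \<delta>"
proof -
  define c1 where "c1 = (1 / 2) powr \<alpha> / C"
  have c1: "c1 > 0" using C by (simp add: c1_def)
  define A1 where "A1 = max 1 ((10 * C / c1) powr (1 / (\<alpha> - 1)))"
  show thesis
  proof (rule that[of A1])
    show "A1 \<ge> 1" by (simp add: A1_def)
    fix h :: "'a \<Rightarrow> real \<Rightarrow> real" and D p m
    assume F: "fibre_assumptions \<alpha> \<tau> \<beta> \<delta> \<epsilon> C h D" and m: "m > 0" and h1: "h p m \<le> 1"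
    define Q where "Q = max 1 m"
    have Q: "Q \<ge> 1" "m \<le> Q" by (auto simp: Q_def)
    have mQ: "m powr e \<le> Q powr e" "1 \<le> Q powr e" if "e \<ge> 0" for e
      using Q m that by (auto intro: powr_mono2 ge_one_powr_ge_zero)
    have \<beta>0: "\<beta> \<ge> 0" using par by linarith
    have mt: "m powr \<tau> + 1 > 0" by (simp add: add_nonneg_pos)
    have Ct: "0 \<le> C" using C by simp
    have "c1 * (1 / (m powr \<tau> + 1)) * norm p powr \<alpha> \<le> 1 + C * (m powr \<beta> + 1) + C * (m powr (\<beta> - \<delta> - \<epsilon>) + 1) * norm p"
      using fibre_lower[OF F m par(1), of p] C h1 unfolding c1_def by linarith
    then have "c1 * norm p powr \<alpha> \<le> (m powr \<tau> + 1) * (1 + C * (m powr \<beta> + 1) + C * (m powr (\<beta> - \<delta> - \<epsilon>) + 1) * norm p)"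
      using mt by (simp add: field_simps)
    also have "\<dots> \<le> (2 * Q powr \<tau>) * (3 * C * Q powr \<beta> + (2 * C * Q powr (\<beta> - \<delta>)) * norm p)"
    proof (rule mult_mono)
      show "m powr \<tau> + 1 \<le> 2 * Q powr \<tau>" using mQ[of \<tau>] par by simp
      have "C * (m powr \<beta> + 1) \<le> C * (2 * Q powr \<beta>)" using mQ[OF \<beta>0] C by (intro mult_left_mono) auto
      moreover have "1 * 1 \<le> C * Q powr \<beta>" using C mQ[OF \<beta>0] by (intro mult_mono) auto
      ultimately have 1: "1 + C * (m powr \<beta> + 1) \<le> 3 * C * Q powr \<beta>" by simp
      have "m powr (\<beta> - \<delta> - \<epsilon>) \<le> Q powr (\<beta> - \<delta> - \<epsilon>)" using mQ par by simp
      also have "\<dots> \<le> Q powr (\<beta> - \<delta>)" using Q par by (intro powr_mono) auto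
      finally have "m powr (\<beta> - \<delta> - \<epsilon>) + 1 \<le> 2 * Q powr (\<beta> - \<delta>)" using mQ(2)[of "\<beta> - \<delta>"] par by simp
      then have "C * (m powr (\<beta> - \<delta> - \<epsilon>) + 1) * norm p \<le> C * (2 * Q powr (\<beta> - \<delta>)) * norm p"
        using Ct by (intro mult_right_mono mult_left_mono) auto
      then show "1 + C * (m powr \<beta> + 1) + C * (m powr (\<beta> - \<delta> - \<epsilon>) + 1) * norm p \<le> 3 * C * Q powr \<beta> + (2 * C * Q powr (\<beta> - \<delta>)) * norm p"
        using 1 by simp
    qed (use Ct in auto)
    finally have main: "c1 * norm p powr \<alpha> \<le> (2 * Q powr \<tau>) * (3 * C * Q powr \<beta> + (2 * C * Q powr (\<beta> - \<delta>)) * norm p)" .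
    define t where "t = norm p / Q powr \<delta>"
    have Q0: "Q powr e > 0" for e using Q by simp
    have t: "t \<ge> 0" "norm p = t * Q powr \<delta>" using Q0[of \<delta>] by (auto simp: t_def)
    have "c1 * t powr \<alpha> * Q powr (\<alpha> * \<delta>) = c1 * norm p powr \<alpha>"
      unfolding t(2) using t(1) by (simp add: powr_mult powr_powr mult.commute)
    also note main
    also have "(2 * Q powr \<tau>) * (3 * C * Q powr \<beta> + (2 * C * Q powr (\<beta> - \<delta>)) * norm p)
        = (6 * C + 4 * C * t) * Q powr (\<alpha> * \<delta>)"
    proof -
      have "Q powr \<tau> * Q powr \<beta> = Q powr (\<alpha> * \<delta>)" using par by (simp add: add.commute flip: powr_add)
      moreover have "Q powr \<tau> * Q powr (\<beta> - \<delta>) * Q powr \<delta> = Q powr (\<alpha> * \<delta>)" using par by (simp add: add.commute flip: powr_add)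
      ultimately have "6 * C * (Q powr \<tau> * Q powr \<beta>) + 4 * C * t * (Q powr \<tau> * Q powr (\<beta> - \<delta>) * Q powr \<delta>) = (6 * C + 4 * C * t) * Q powr (\<alpha> * \<delta>)"
        by (simp add: algebra_simps)
      then show ?thesis unfolding t(2) by (simp add: algebra_simps)
    qed
    finally have "c1 * t powr \<alpha> \<le> 6 * C + 4 * C * t" using Q0[of "\<alpha> * \<delta>"] by (subst (asm) mult_le_cancel_right_pos) auto
    have "t \<le> A1"
    proof (cases "t \<le> 1")
      case False
      have "6 * C * 1 \<le> 6 * C * t" using False Ct by (intro mult_left_mono) auto
      then have "c1 * t powr \<alpha> \<le> 10 * C * t" using \<open>c1 * t powr \<alpha> \<le> 6 * C + 4 * C * t\<close> by simp
      moreover have "t powr \<alpha> = t powr (\<alpha> - 1) * t" using False by (simp add: powr_diff)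
      ultimately have "c1 * t powr (\<alpha> - 1) \<le> 10 * C" using False by (simp add: mult.assoc[symmetric])
      then have "t powr (\<alpha> - 1) \<le> 10 * C / c1" using c1 by (simp add: pos_le_divide_eq mult.commute)
      then have "(t powr (\<alpha> - 1)) powr (1 / (\<alpha> - 1)) \<le> (10 * C / c1) powr (1 / (\<alpha> - 1))"
        using par by (intro powr_mono2) auto
      then show ?thesis using par False by (simp add: powr_powr A1_def)
    qed (simp add: A1_def)
    then have "t * Q powr \<delta> \<le> A1 * Q powr \<delta>" by (intro mult_right_mono) auto
    then show "norm p \<le> A1 * max 1 m powr \<delta>" using t(2) by (simp add: Q_def)
  qed
qed

text \<open>If \<open>h p m\<close> is nonnegative and \<open>m\<close> is large, then \<open>m\<^sup>\<beta>\<close> is at most a sum of \<open>m\<^bsup>-\<tau>\<^esup> \<bar>p\<bar>\<^sup>\<alpha>\<close> and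
  \<open>m\<^bsup>\<beta>-\<delta>\<^esup> \<bar>p\<bar>\<close>, up to constants. Both are \<open>m\<^sup>\<beta>\<close> times a positive power of \<open>\<bar>p\<bar> / m\<^sup>\<delta>\<close>, so this quotient is bounded below.\<close>
lemma fibre_density_le_gradient:
  fixes h :: "'a::euclidean_space \<Rightarrow> real \<Rightarrow> real"
  assumes par: "\<alpha> > 1" "0 \<le> \<tau>" "\<tau> < 1" "\<delta> > 0" "\<epsilon> > 0" "\<beta> - \<delta> > \<epsilon>" "\<alpha> * \<delta> = \<beta> + \<tau>" and C: "C \<ge> 1"
    and F: "fibre_assumptions \<alpha> \<tau> \<beta> \<delta> \<epsilon> C h D" and m: "m > 0" and h0: "h p m \<ge> 0"
  shows "m \<le> max C ((4 * C\<^sup>2) powr (1 / \<delta>)) * max 1 (norm p) powr (1 / \<delta>)"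
proof -
  define P where "P = max 1 (norm p)"
  have P: "P \<ge> 1" "norm p \<le> P" by (auto simp: P_def)
  have P1: "P powr (1 / \<delta>) \<ge> 1" using P par by (intro ge_one_powr_ge_zero) auto
  let ?A = "max C ((4 * C\<^sup>2) powr (1 / \<delta>))"
  show ?thesis
  proof (cases "m \<le> C")
    case True
    have "m * 1 \<le> ?A * P powr (1 / \<delta>)" using True m P1 C by (intro mult_mono) auto
    then show ?thesis by (simp add: P_def)
  next
    case False
    then have m1: "m \<ge> C" "m \<ge> 1" using C by auto
    have mp: "m powr e > 0" for e using m by simp
    have u: "0 \<le> - (1 / C) * m powr \<beta> + C * (1 / m + 1 / m powr \<tau>) * norm p powr \<alpha> + C * (m powr (\<beta> - \<delta>) + 1 / m) * norm p"
      using fibre_upper[OF F m1(1) par(1), of p] h0 C by linarith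
    have mt: "1 / m \<le> m powr (- \<tau>)"
    proof -
      have "m powr (- 1) \<le> m powr (- \<tau>)" using m1 par by (intro powr_mono) auto
      then show ?thesis using m by (simp add: powr_minus inverse_eq_divide)
    qed
    have "1 / m \<le> 1" using m1 by simp
    also have "1 \<le> m powr (\<beta> - \<delta>)" using m1 par by (intro ge_one_powr_ge_zero) auto
    finally have md: "1 / m \<le> m powr (\<beta> - \<delta>)" .
    have "C * (1 / m + 1 / m powr \<tau>) * norm p powr \<alpha> \<le> C * (2 * m powr (- \<tau>)) * norm p powr \<alpha>"
      using mt C by (intro mult_right_mono mult_left_mono) (auto simp: powr_minus inverse_eq_divide)
    moreover have "C * (m powr (\<beta> - \<delta>) + 1 / m) * norm p \<le> C * (2 * m powr (\<beta> - \<delta>)) * norm p"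
      using md C by (intro mult_right_mono mult_left_mono) auto
    ultimately have main: "(1 / C) * m powr \<beta> \<le> 2 * C * (m powr (- \<tau>) * norm p powr \<alpha>) + 2 * C * (m powr (\<beta> - \<delta>) * norm p)"
      using u by simp
    define t where "t = norm p / m powr \<delta>"
    have t: "t \<ge> 0" "norm p = t * m powr \<delta>" using mp[of \<delta>] by (auto simp: t_def)
    have e1: "m powr (- \<tau>) * norm p powr \<alpha> = t powr \<alpha> * m powr \<beta>"
    proof -
      have "norm p powr \<alpha> = t powr \<alpha> * m powr (\<alpha> * \<delta>)" unfolding t(2) using t(1) by (simp add: powr_mult powr_powr mult.commute)
      moreover have "m powr (- \<tau>) * m powr (\<alpha> * \<delta>) = m powr \<beta>" using par by (simp flip: powr_add)
      ultimately show ?thesis by (simp add: mult.left_commute)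
    qed
    have e2: "m powr (\<beta> - \<delta>) * norm p = t * m powr \<beta>"
      unfolding t(2) by (simp add: mult.left_commute flip: powr_add)
    have "(1 / C) * m powr \<beta> \<le> (2 * C * t powr \<alpha> + 2 * C * t) * m powr \<beta>"
      using main unfolding e1 e2 by (simp add: algebra_simps)
    then have tt: "1 / C \<le> 2 * C * t powr \<alpha> + 2 * C * t" using mp[of \<beta>] by (subst (asm) mult_le_cancel_right_pos) auto
    have "1 \<le> 4 * C\<^sup>2 * t"
    proof (cases "t \<le> 1")
      case True
      have "t powr \<alpha> \<le> t powr 1" using t(1) True par by (intro powr_mono') auto
      then have "2 * C * t powr \<alpha> \<le> 2 * C * t" using t(1) C by (intro mult_left_mono) auto
      then have "1 / C \<le> 4 * C * t" using tt by simp
      then have "1 \<le> (4 * C * t) * C" using C by (simp add: pos_divide_le_eq)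
      also have "\<dots> = 4 * C\<^sup>2 * t" by (simp add: power2_eq_square)
      finally show ?thesis .
    next
      case False
      have "1 * 1 \<le> C * C" using C by (intro mult_mono) auto
      then have "1 * 1 \<le> (4 * C\<^sup>2) * t" using False by (intro mult_mono) (auto simp: power2_eq_square)
      then show ?thesis by simp
    qed
    then have "m powr \<delta> * 1 \<le> m powr \<delta> * (4 * C\<^sup>2 * t)" by (intro mult_left_mono) auto
    also have "\<dots> = 4 * C\<^sup>2 * norm p" unfolding t(2) by (simp add: algebra_simps)
    also have "\<dots> \<le> 4 * C\<^sup>2 * P" using P by (intro mult_left_mono) auto
    finally have "(m powr \<delta>) powr (1 / \<delta>) \<le> (4 * C\<^sup>2 * P) powr (1 / \<delta>)" using par by (intro powr_mono2) auto
    then have "m \<le> (4 * C\<^sup>2) powr (1 / \<delta>) * P powr (1 / \<delta>)" using par m by (simp add: powr_powr powr_mult)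
    also have "\<dots> \<le> ?A * P powr (1 / \<delta>)" by (intro mult_right_mono) auto
    finally show ?thesis by (simp add: P_def)
  qed
qed

lemma max_powr_le:
  fixes a e :: real
  assumes "a \<ge> 0"
  shows "max 1 a powr e \<le> a powr e + 1"
  using assms by (auto simp: max_def)

text \<open>For \<open>m > 0\<close>, replace \<open>m\<close> by powers of \<open>\<bar>p\<bar>\<close>. The exponents match because
  \<open>(1 - \<tau>)/\<delta> + \<alpha> = (1 + \<beta> - \<delta>)/\<delta> + 1 = \<gamma>\<close>, and the negative term in the coercivity bound has the smaller
  exponent \<open>\<gamma> - \<epsilon>/\<delta>\<close>, so that it is absorbed once \<open>\<bar>p\<bar>\<close> exceeds the constant \<open>p0\<close> of the proof. For \<open>m = 0\<close>,
  membership of a nonpositive \<open>z\<close> in the closure of the graph of \<open>h\<close> bounds \<open>p\<close>, and then the growth bound for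
  \<open>m D\<close>, in which all powers of \<open>m\<close> are nonnegative, bounds \<open>j\<close>.\<close>
lemma structure_conditions:
  fixes \<alpha> \<tau> \<beta> \<delta> \<epsilon> \<gamma> C :: real
  assumes par: "\<alpha> > 1" "0 \<le> \<tau>" "\<tau> < 1" "\<delta> > 0" "\<epsilon> > 0" "\<beta> - \<delta> > \<epsilon>" "\<alpha> * \<delta> = \<beta> + \<tau>" "\<gamma> * \<delta> = \<beta> + 1"
    and C: "C \<ge> 1"
  obtains c K where "c > 0" "K > 0"
    "\<And>(h::'a::euclidean_space \<Rightarrow> real \<Rightarrow> real) D p m z j. fibre_assumptions \<alpha> \<tau> \<beta> \<delta> \<epsilon> C h D \<Longrightarrow> m \<ge> 0 \<Longrightarrow>
       z \<in> graph_closure h p m \<Longrightarrow> z \<le> 0 \<Longrightarrow> (m > 0 \<longrightarrow> z = 0) \<Longrightarrow> j \<in> graph_closure (\<lambda>p r. r *\<^sub>R D p r) p m \<Longrightarrow>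
       norm j \<le> K * (norm p powr (\<gamma> - 1) + 1) \<and> j \<bullet> p \<ge> c * norm p powr \<gamma> - K"
proof -
  obtain A1 where A1: "A1 \<ge> 1"
    and gd: "\<And>(h::'a \<Rightarrow> real \<Rightarrow> real) D p m. fibre_assumptions \<alpha> \<tau> \<beta> \<delta> \<epsilon> C h D \<Longrightarrow> m > 0 \<Longrightarrow> h p m \<le> 1 \<Longrightarrow>
       norm p \<le> A1 * max 1 m powr \<delta>"
    using fibre_gradient_le_density[OF par(1,2,4,5,6,7) C] by blast
  have \<gamma>d: "\<gamma> = (\<beta> + 1) / \<delta>" using par by (simp add: field_simps)
  have \<gamma>1: "\<gamma> > 1" using par by (simp add: \<gamma>d)
  define A3 where "A3 = max C ((4 * C\<^sup>2) powr (1 / \<delta>))"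
  have A3: "A3 \<ge> 1" using C by (simp add: A3_def)
  define K1 where "K1 = C * (1 + A3 powr (1 - \<tau>)) + C * (A3 powr (1 + \<beta> - \<delta>) + 1)"
  have K1: "K1 > 0" unfolding K1_def using C by (intro add_pos_nonneg mult_pos_pos mult_nonneg_nonneg) (auto simp: add_pos_nonneg)
  define c2 where "c2 = 1 / (2 * C) * A1 powr (- (1 - \<tau>) / \<delta>)"
  have c2: "c2 > 0" using C A1 by (simp add: c2_def)
  define B where "B = 2 * C * A3 powr (1 + \<beta> - \<delta> - \<epsilon>)"
  have B: "B > 0" using C A3 by (simp add: B_def)
  define p0 where "p0 = max A1 ((2 * B / c2) powr (\<delta> / \<epsilon>))"
  have p0: "p0 \<ge> 1" using A1 by (simp add: p0_def)
  define c where "c = c2 / 2"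
  have c: "c > 0" using c2 by (simp add: c_def)
  define J0 where "J0 = 2 * C * (A1 + 1) powr (\<alpha> - 1) + 2 * C"
  have J0: "J0 > 0" unfolding J0_def using C by (intro add_nonneg_pos) auto
  define K where "K = K1 + (K1 + c) * p0 powr \<gamma> + J0 + c * A1 powr \<gamma> + J0 * A1"
  have "K1 \<le> K" "(K1 + c) * p0 powr \<gamma> \<le> K" "J0 \<le> K" "c * A1 powr \<gamma> + J0 * A1 \<le> K"
    using K1 c J0 A1 by (auto simp: K_def intro!: add_nonneg_nonneg mult_nonneg_nonneg)
  note Kle = this
  have K: "K > 0" using K1 Kle by linarith
  show thesis
  proof (rule that[OF c K])
    fix h :: "'a \<Rightarrow> real \<Rightarrow> real" and D p m z j
    assume F: "fibre_assumptions \<alpha> \<tau> \<beta> \<delta> \<epsilon> C h D" and m0: "m \<ge> 0"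
      and z: "z \<in> graph_closure h p m" "z \<le> 0" "m > 0 \<longrightarrow> z = 0"
      and j: "j \<in> graph_closure (\<lambda>p r. r *\<^sub>R D p r) p m"
    have jb: "norm (m *\<^sub>R D p m) \<le> C * (1 + m powr (1 - \<tau>)) * norm p powr (\<alpha> - 1) + C * (m powr (1 + \<beta> - \<delta>) + 1)"
      if "m > 0" for p m
    proof -
      have "norm (D p m) \<le> C * (1 / m + 1 / m powr \<tau>) * norm p powr (\<alpha> - 1) + C * (m powr (\<beta> - \<delta>) + 1 / m)"
        using F that unfolding fibre_assumptions_def by blast
      then have "m * norm (D p m) \<le> m * (C * (1 / m + 1 / m powr \<tau>) * norm p powr (\<alpha> - 1) + C * (m powr (\<beta> - \<delta>) + 1 / m))"
        using that by (intro mult_left_mono) auto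
      also have "\<dots> = C * (m * (1 / m) + m * (1 / m powr \<tau>)) * norm p powr (\<alpha> - 1) + C * (m * m powr (\<beta> - \<delta>) + m * (1 / m))"
        by (simp only: distrib_left distrib_right mult.assoc mult.left_commute)
      also have "m * (1 / m) = 1" using that by simp
      also have "m * (1 / m powr \<tau>) = m powr (1 - \<tau>)" using that by (simp add: powr_diff)
      also have "m * m powr (\<beta> - \<delta>) = m powr (1 + \<beta> - \<delta>)"
        using that powr_add[of m 1 "\<beta> - \<delta>"] by (simp add: add_diff_eq)
      finally show ?thesis using that by simp
    qed
    show "norm j \<le> K * (norm p powr (\<gamma> - 1) + 1) \<and> j \<bullet> p \<ge> c * norm p powr \<gamma> - K"
    proof (cases "m > 0")
      case True
      then have hz: "h p m = 0" and jm: "j = m *\<^sub>R D p m" using z j by (auto simp: graph_closure_def)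
      define P where "P = max 1 (norm p)"
      have P: "P \<ge> 1" "norm p \<le> P" by (auto simp: P_def)
      have mP: "m \<le> A3 * P powr (1 / \<delta>)"
        unfolding A3_def P_def by (rule fibre_density_le_gradient[OF par(1-7) C F True]) (use hz in simp)
      have mpow: "m powr e \<le> A3 powr e * P powr (e / \<delta>)" if "e \<ge> 0" for e
      proof -
        have "m powr e \<le> (A3 * P powr (1 / \<delta>)) powr e" using mP True that by (intro powr_mono2) auto
        also have "\<dots> = A3 powr e * P powr (e / \<delta>)" using A3 by (simp add: powr_mult powr_powr)
        finally show ?thesis .
      qed
      have ex1: "(1 - \<tau>) / \<delta> + (\<alpha> - 1) = \<gamma> - 1" using par by (simp add: \<gamma>d field_simps)
      have ex2: "(1 + \<beta> - \<delta>) / \<delta> = \<gamma> - 1" using par by (simp add: \<gamma>d field_simps)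
      have P1: "1 \<le> P powr e" if "e \<ge> 0" for e using P that by (intro ge_one_powr_ge_zero) auto
      have jP: "norm j \<le> K1 * P powr (\<gamma> - 1)"
      proof -
        have a: "(1 + m powr (1 - \<tau>)) * norm p powr (\<alpha> - 1) \<le> (1 + A3 powr (1 - \<tau>)) * P powr (\<gamma> - 1)"
        proof -
          have "1 + m powr (1 - \<tau>) \<le> P powr ((1 - \<tau>) / \<delta>) + A3 powr (1 - \<tau>) * P powr ((1 - \<tau>) / \<delta>)"
            using par by (intro add_mono mpow P1) auto
          moreover have "norm p powr (\<alpha> - 1) \<le> P powr (\<alpha> - 1)" using P par by (intro powr_mono2) auto
          ultimately have "(1 + m powr (1 - \<tau>)) * norm p powr (\<alpha> - 1)
              \<le> (P powr ((1 - \<tau>) / \<delta>) + A3 powr (1 - \<tau>) * P powr ((1 - \<tau>) / \<delta>)) * P powr (\<alpha> - 1)"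
            by (intro mult_mono) auto
          also have "\<dots> = (1 + A3 powr (1 - \<tau>)) * (P powr ((1 - \<tau>) / \<delta>) * P powr (\<alpha> - 1))" by (simp add: algebra_simps)
          finally show ?thesis unfolding powr_add[symmetric] ex1 .
        qed
        have b: "m powr (1 + \<beta> - \<delta>) + 1 \<le> (A3 powr (1 + \<beta> - \<delta>) + 1) * P powr (\<gamma> - 1)"
          using mpow[of "1 + \<beta> - \<delta>"] P1[of "\<gamma> - 1"] par \<gamma>1 unfolding ex2 by (simp add: algebra_simps)
        have "norm j \<le> C * ((1 + m powr (1 - \<tau>)) * norm p powr (\<alpha> - 1)) + C * (m powr (1 + \<beta> - \<delta>) + 1)"
          unfolding jm using jb[OF True, of p] by (simp add: mult.assoc)
        also have "\<dots> \<le> C * ((1 + A3 powr (1 - \<tau>)) * P powr (\<gamma> - 1)) + C * ((A3 powr (1 + \<beta> - \<delta>) + 1) * P powr (\<gamma> - 1))"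
          using C by (intro add_mono mult_left_mono a b) auto
        finally show ?thesis by (simp add: K1_def algebra_simps)
      qed
      have "norm j \<le> K * (norm p powr (\<gamma> - 1) + 1)"
      proof -
        have "K1 * P powr (\<gamma> - 1) \<le> K * (norm p powr (\<gamma> - 1) + 1)"
          unfolding P_def using Kle(1) K by (intro mult_mono max_powr_le) auto
        then show ?thesis using jP by linarith
      qed
      moreover have "j \<bullet> p \<ge> c * norm p powr \<gamma> - K"
      proof (cases "norm p \<le> p0")
        case True
        have Pp: "P \<le> p0" using True p0 by (simp add: P_def)
        have "\<bar>j \<bullet> p\<bar> \<le> norm j * norm p" by (rule Cauchy_Schwarz_ineq2)
        also have "\<dots> \<le> (K1 * P powr (\<gamma> - 1)) * P" using jP P K1 by (intro mult_mono) auto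
        also have "\<dots> = K1 * P powr \<gamma>" using P by (simp add: powr_diff)
        also have "\<dots> \<le> K1 * p0 powr \<gamma>" using P Pp K1 \<gamma>1 by (intro mult_left_mono powr_mono2) auto
        finally have "j \<bullet> p \<ge> - (K1 * p0 powr \<gamma>)" by linarith
        moreover have "c * norm p powr \<gamma> \<le> c * p0 powr \<gamma>" using True c \<gamma>1 by (intro mult_left_mono powr_mono2) auto
        ultimately show ?thesis using Kle(2) by (simp add: distrib_right)
      next
        case False
        then have np: "norm p > p0" "norm p > A1" "norm p > 1" using p0 by (auto simp: p0_def)
        have PP: "P = norm p" using np by (simp add: P_def)
        have pQ: "norm p \<le> A1 * max 1 m powr \<delta>" by (rule gd[OF F True]) (use hz in simp)
        have m1: "m > 1"
        proof (rule ccontr)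
          assume "\<not> m > 1"
          then have "max 1 m powr \<delta> = 1" by (simp add: max_def)
          then show False using pQ np by simp
        qed
        have "norm p / A1 \<le> m powr \<delta>" using pQ m1 A1 by (simp add: max_def divide_le_eq mult.commute)
        then have "(norm p / A1) powr ((1 - \<tau>) / \<delta>) \<le> (m powr \<delta>) powr ((1 - \<tau>) / \<delta>)"
          using par A1 by (intro powr_mono2) auto
        then have mlow: "A1 powr (- (1 - \<tau>) / \<delta>) * norm p powr ((1 - \<tau>) / \<delta>) \<le> m powr (1 - \<tau>)"
        proof -
          have "(m powr \<delta>) powr ((1 - \<tau>) / \<delta>) = m powr (1 - \<tau>)" using par by (simp add: powr_powr)
          moreover have "(norm p / A1) powr ((1 - \<tau>) / \<delta>) = A1 powr (- (1 - \<tau>) / \<delta>) * norm p powr ((1 - \<tau>) / \<delta>)"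
            by (simp only: powr_divide powr_minus minus_divide_left[symmetric]) (simp add: divide_inverse)
          ultimately show ?thesis using \<open>(norm p / A1) powr ((1 - \<tau>) / \<delta>) \<le> (m powr \<delta>) powr ((1 - \<tau>) / \<delta>)\<close> by simp
        qed
        have "m powr (1 - \<tau>) / 2 \<le> m / (m powr \<tau> + 1)"
        proof -
          have "1 \<le> m powr \<tau>" using m1 par by (intro ge_one_powr_ge_zero) auto
          then have "m / (2 * m powr \<tau>) \<le> m / (m powr \<tau> + 1)" using True by (intro divide_left_mono) auto
          then show ?thesis using True by (simp add: powr_diff)
        qed
        then have first: "c2 * norm p powr \<gamma> \<le> 1 / C * (m / (m powr \<tau> + 1)) * norm p powr \<alpha>"
        proof -
          have "c2 * norm p powr \<gamma> = 1 / (2 * C) * (A1 powr (- (1 - \<tau>) / \<delta>) * norm p powr ((1 - \<tau>) / \<delta>)) * norm p powr \<alpha>"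
          proof -
            have "\<gamma> = (1 - \<tau>) / \<delta> + \<alpha>" using ex1 by simp
            then show ?thesis by (simp add: c2_def powr_add)
          qed
          also have "\<dots> \<le> 1 / (2 * C) * m powr (1 - \<tau>) * norm p powr \<alpha>"
            using mlow C by (intro mult_right_mono mult_left_mono) auto
          also have "\<dots> = 1 / C * (m powr (1 - \<tau>) / 2) * norm p powr \<alpha>" by simp
          also have "\<dots> \<le> 1 / C * (m / (m powr \<tau> + 1)) * norm p powr \<alpha>"
            using \<open>m powr (1 - \<tau>) / 2 \<le> m / (m powr \<tau> + 1)\<close> C by (intro mult_right_mono mult_left_mono) auto
          finally show ?thesis .
        qed
        have second: "C * (m * (m powr (\<beta> - \<delta> - \<epsilon>) + 1)) * norm p \<le> c * norm p powr \<gamma>"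
        proof -
          have "1 \<le> m powr (\<beta> - \<delta> - \<epsilon>)" using m1 par by (intro ge_one_powr_ge_zero) auto
          then have "m * (m powr (\<beta> - \<delta> - \<epsilon>) + 1) \<le> m * (2 * m powr (\<beta> - \<delta> - \<epsilon>))" using True by (intro mult_left_mono) auto
          also have "\<dots> = 2 * m powr (1 + \<beta> - \<delta> - \<epsilon>)"
            using True powr_add[of m 1 "\<beta> - \<delta> - \<epsilon>"] by (simp add: add_diff_eq)
          also have "\<dots> \<le> 2 * (A3 powr (1 + \<beta> - \<delta> - \<epsilon>) * norm p powr ((1 + \<beta> - \<delta> - \<epsilon>) / \<delta>))"
            using mpow[of "1 + \<beta> - \<delta> - \<epsilon>"] par unfolding PP by simp
          finally have "C * (m * (m powr (\<beta> - \<delta> - \<epsilon>) + 1)) * norm p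
              \<le> C * (2 * (A3 powr (1 + \<beta> - \<delta> - \<epsilon>) * norm p powr ((1 + \<beta> - \<delta> - \<epsilon>) / \<delta>))) * norm p"
            using C by (intro mult_right_mono mult_left_mono) auto
          also have "\<dots> = B * (norm p powr ((1 + \<beta> - \<delta> - \<epsilon>) / \<delta>) * norm p)" by (simp add: B_def)
          also have "norm p powr ((1 + \<beta> - \<delta> - \<epsilon>) / \<delta>) * norm p = norm p powr (\<gamma> - \<epsilon> / \<delta>)"
          proof -
            have "(1 + \<beta> - \<delta> - \<epsilon>) / \<delta> + 1 = \<gamma> - \<epsilon> / \<delta>" using par by (simp add: \<gamma>d field_simps)
            then show ?thesis using np powr_add[of "norm p" "(1 + \<beta> - \<delta> - \<epsilon>) / \<delta>" 1] by simp
          qed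
          also have "B * norm p powr (\<gamma> - \<epsilon> / \<delta>) \<le> c * norm p powr \<gamma>"
          proof -
            have "(2 * B / c2) powr (\<delta> / \<epsilon>) \<le> norm p" using np by (simp add: p0_def)
            then have "((2 * B / c2) powr (\<delta> / \<epsilon>)) powr (\<epsilon> / \<delta>) \<le> norm p powr (\<epsilon> / \<delta>)"
              using par by (intro powr_mono2) auto
            then have "2 * B / c2 \<le> norm p powr (\<epsilon> / \<delta>)" using par B c2 by (simp add: powr_powr)
            then have "B \<le> c * norm p powr (\<epsilon> / \<delta>)" using c2 by (simp add: c_def field_simps)
            then have "B * norm p powr (\<gamma> - \<epsilon> / \<delta>) \<le> c * norm p powr (\<epsilon> / \<delta>) * norm p powr (\<gamma> - \<epsilon> / \<delta>)"
              by (intro mult_right_mono) auto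
            also have "\<dots> = c * norm p powr \<gamma>" by (simp flip: powr_add)
            finally show ?thesis .
          qed
          finally show ?thesis .
        qed
        have "1 / C * (1 / (m powr \<tau> + 1)) * norm p powr \<alpha> - C * (m powr (\<beta> - \<delta> - \<epsilon>) + 1) * norm p \<le> D p m \<bullet> p"
          using F True unfolding fibre_assumptions_def by blast
        then have "m * (1 / C * (1 / (m powr \<tau> + 1)) * norm p powr \<alpha> - C * (m powr (\<beta> - \<delta> - \<epsilon>) + 1) * norm p) \<le> m * (D p m \<bullet> p)"
          using True by (intro mult_left_mono) auto
        then have "1 / C * (m / (m powr \<tau> + 1)) * norm p powr \<alpha> - C * (m * (m powr (\<beta> - \<delta> - \<epsilon>) + 1)) * norm p \<le> j \<bullet> p"
          unfolding jm by (simp add: right_diff_distrib mult.assoc mult.left_commute)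
        then have "c2 * norm p powr \<gamma> - c * norm p powr \<gamma> \<le> j \<bullet> p" using first second by linarith
        then show ?thesis using K by (simp add: c_def)
      qed
      ultimately show ?thesis by blast
    next
      case False
      then have m: "m = 0" using m0 by simp
      obtain Pk Mk where s: "\<And>k. Mk k > (0::real)" "Pk \<longlonglongrightarrow> p" "Mk \<longlonglongrightarrow> 0" "(\<lambda>k. h (Pk k) (Mk k)) \<longlonglongrightarrow> z"
        using z(1) m by (auto simp: graph_closure_def)
      have pA: "norm p \<le> A1"
      proof -
        have "\<forall>\<^sub>F k in sequentially. h (Pk k) (Mk k) < 1" using s(4) z(2) by (intro order_tendstoD) auto
        moreover have "\<forall>\<^sub>F k in sequentially. Mk k < 1" using s(3) by (intro order_tendstoD) auto
        ultimately have "\<forall>\<^sub>F k in sequentially. norm (Pk k) \<le> A1"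
        proof eventually_elim
          case (elim k)
          have "norm (Pk k) \<le> A1 * max 1 (Mk k) powr \<delta>" by (rule gd[OF F s(1)]) (use elim in simp)
          then show ?case using elim by (simp add: max_def)
        qed
        then show ?thesis by (rule tendsto_upperbound[OF tendsto_norm[OF s(2)]]) simp
      qed
      obtain Pk' Mk' where s': "\<And>k. Mk' k > (0::real)" "Pk' \<longlonglongrightarrow> p" "Mk' \<longlonglongrightarrow> 0"
        "(\<lambda>k. Mk' k *\<^sub>R D (Pk' k) (Mk' k)) \<longlonglongrightarrow> j"
        using j m by (auto simp: graph_closure_def)
      have jJ: "norm j \<le> J0"
      proof -
        have "\<forall>\<^sub>F k in sequentially. norm (Pk' k) < A1 + 1" using tendsto_norm[OF s'(2)] pA by (intro order_tendstoD) auto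
        moreover have "\<forall>\<^sub>F k in sequentially. Mk' k < 1" using s'(3) by (intro order_tendstoD) auto
        ultimately have "\<forall>\<^sub>F k in sequentially. norm (Mk' k *\<^sub>R D (Pk' k) (Mk' k)) \<le> J0"
        proof eventually_elim
          case (elim k)
          have le1: "Mk' k powr e \<le> 1" if "e \<ge> 0" for e
            using elim s'(1)[of k] that by (intro powr_le1) auto
          have "norm (Mk' k *\<^sub>R D (Pk' k) (Mk' k)) \<le> C * (1 + Mk' k powr (1 - \<tau>)) * norm (Pk' k) powr (\<alpha> - 1) + C * (Mk' k powr (1 + \<beta> - \<delta>) + 1)"
            by (rule jb[OF s'(1)])
          also have "\<dots> \<le> C * (1 + 1) * (A1 + 1) powr (\<alpha> - 1) + C * (1 + 1)"
            using C par elim by (intro add_mono mult_mono mult_left_mono powr_mono2 le1) auto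
          finally show ?case by (simp add: J0_def)
        qed
        then show ?thesis by (rule tendsto_upperbound[OF tendsto_norm[OF s'(4)]]) simp
      qed
      have "J0 * 1 \<le> K * (norm p powr (\<gamma> - 1) + 1)"
        using Kle(3) K by (intro mult_mono) auto
      moreover have "j \<bullet> p \<ge> c * norm p powr \<gamma> - K"
      proof -
        have "\<bar>j \<bullet> p\<bar> \<le> norm j * norm p" by (rule Cauchy_Schwarz_ineq2)
        also have "\<dots> \<le> J0 * A1" using jJ pA J0 by (intro mult_mono) auto
        finally have "j \<bullet> p \<ge> - (J0 * A1)" by linarith
        moreover have "c * norm p powr \<gamma> \<le> c * A1 powr \<gamma>" using pA c \<gamma>1 by (intro mult_left_mono powr_mono2) auto
        ultimately show ?thesis using Kle(4) by linarith
      qed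
      ultimately show ?thesis using jJ by simp
    qed
  qed
qed

section \<open>From the system to the weak equation\<close>

lemma AE_lebesgue_on_iff:
  "S \<in> sets lebesgue \<Longrightarrow> (AE x in lebesgue_on S. P x) \<longleftrightarrow> (AE x in lborel. x \<in> S \<longrightarrow> P x)"
  by (simp add: AE_restrict_space_iff AE_completion_iff)

text \<open>A Lebesgue measurable function agrees almost everywhere with a Borel function. Passing to Borel versions
  gives access to translations and to Fubini's theorem for \<open>lborel\<close>.\<close>
lemma borel_version:
  fixes f :: "'a::euclidean_space \<Rightarrow> 'b::euclidean_space"
  assumes f: "f \<in> borel_measurable (lebesgue_on \<Omega>)" and S: "S \<in> sets borel" "S \<subseteq> \<Omega>"
  obtains g where "g \<in> borel_measurable borel" "\<And>x. x \<notin> S \<Longrightarrow> g x = 0" "AE x in lborel. x \<in> S \<longrightarrow> g x = f x"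
proof -
  have fS: "f \<in> borel_measurable (lebesgue_on S)" by (rule measurable_restrict_mono[OF f S(2)])
  have SL: "S \<in> sets lebesgue" using S(1) by simp
  have f': "(\<lambda>x. if x \<in> S then f x else 0) \<in> borel_measurable lebesgue"
    using fS SL borel_measurable_if_I by blast
  have "\<exists>g\<in>borel_measurable lborel. AE x in lborel. (if x \<in> S then f x else 0) \<bullet> i = g x" for i
    by (rule completion_ex_borel_measurable_real) (use f' in measurable)
  then obtain g where g: "\<And>i. g i \<in> borel_measurable lborel"
    "\<And>i. AE x in lborel. (if x \<in> S then f x else 0) \<bullet> i = g i x" by metis
  define G where "G x = indicator S x *\<^sub>R (\<Sum>i\<in>Basis. g i x *\<^sub>R i)" for x
  have [measurable]: "S \<in> sets borel" "\<And>i. g i \<in> borel_measurable borel" using S g by auto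
  have "AE x in lborel. \<forall>i\<in>Basis. (if x \<in> S then f x else 0) \<bullet> i = g i x"
    using g(2) by (simp add: AE_finite_all)
  then have "AE x in lborel. x \<in> S \<longrightarrow> G x = f x"
  proof eventually_elim
    case (elim x)
    show ?case
    proof
      assume x: "x \<in> S"
      then have "G x = (\<Sum>i\<in>Basis. (f x \<bullet> i) *\<^sub>R i)" using elim by (simp add: G_def)
      then show "G x = f x" by (simp add: euclidean_representation)
    qed
  qed
  moreover have "G \<in> borel_measurable borel" unfolding G_def[abs_def] by measurable
  ultimately show thesis using that[of G] by (simp add: G_def)
qed

lemma measurable_lebesgue_on_if_borel:
  "g \<in> borel_measurable borel \<Longrightarrow> g \<in> borel_measurable (lebesgue_on S)"
  by (intro measurable_restrict_space1 measurable_completion) simp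

lemma
  fixes F F' :: "'a::euclidean_space \<Rightarrow> 'b::euclidean_space"
  assumes S: "S \<in> sets lebesgue" and F: "F \<in> borel_measurable (lebesgue_on S)" and F': "F' \<in> borel_measurable borel"
    and eq: "AE x in lborel. x \<in> S \<longrightarrow> F x = F' x" and out: "\<And>x. x \<notin> S \<Longrightarrow> F' x = 0"
  shows lebesgue_on_integral_eq: "(LINT x|lebesgue_on S. F x) = (\<integral>x. F' x \<partial>lborel)"
    and lebesgue_on_integrable_iff: "integrable (lebesgue_on S) F \<longleftrightarrow> integrable lborel F'"
proof -
  have F'L: "F' \<in> borel_measurable (lebesgue_on S)" by (rule measurable_lebesgue_on_if_borel[OF F'])
  have ae: "AE x in lebesgue_on S. F x = F' x" using eq S by (simp add: AE_lebesgue_on_iff)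
  have SS: "S \<inter> space lebesgue \<in> sets lebesgue" using S by simp
  have id: "(\<lambda>x. indicator S x *\<^sub>R F' x) = F'" using out by (auto simp: indicator_def)
  have "(LINT x|lebesgue_on S. F x) = (LINT x|lebesgue_on S. F' x)"
    by (rule integral_cong_AE[OF F F'L ae])
  also have "\<dots> = (LINT x|lebesgue. indicator S x *\<^sub>R F' x)" by (rule integral_restrict_space[OF SS])
  also have "\<dots> = (\<integral>x. F' x \<partial>lborel)" unfolding id by (rule integral_completion) (use F' in simp)
  finally show "(LINT x|lebesgue_on S. F x) = (\<integral>x. F' x \<partial>lborel)" .
  have "integrable (lebesgue_on S) F \<longleftrightarrow> integrable (lebesgue_on S) F'"
    by (rule integrable_cong_AE[OF F F'L ae])
  also have "\<dots> \<longleftrightarrow> integrable lebesgue (\<lambda>x. indicator S x *\<^sub>R F' x)" by (rule integrable_restrict_space[OF SS])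
  also have "\<dots> \<longleftrightarrow> integrable lborel F'" unfolding id by (rule integrable_completion) (use F' in simp)
  finally show "integrable (lebesgue_on S) F \<longleftrightarrow> integrable lborel F'" .
qed

lemma integrable_powr_if_Lp_loc:
  fixes f :: "'a::euclidean_space \<Rightarrow> 'b::euclidean_space"
  assumes f: "f \<in> Lp_loc \<Omega> p" and K: "compact K" "K \<subseteq> \<Omega>" and p: "p > 0"
    and g: "g \<in> borel_measurable borel" "\<And>x. x \<notin> K \<Longrightarrow> g x = 0" "AE x in lborel. x \<in> K \<longrightarrow> g x = f x"
  shows "integrable lborel (\<lambda>x. norm (g x) powr p)"
proof -
  have KL: "K \<in> sets lebesgue" using K(1) by (simp add: lmeasurable_compact fmeasurableD)
  have fK: "f \<in> borel_measurable (lebesgue_on K)"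
    by (rule measurable_restrict_mono[OF _ K(2)]) (use f in \<open>simp add: Lp_loc_def\<close>)
  have [measurable]: "g \<in> borel_measurable borel" by (rule g)
  have "integrable (lebesgue_on K) (\<lambda>x. norm (f x) powr p)" using f K by (simp add: Lp_loc_def)
  moreover have "integrable (lebesgue_on K) (\<lambda>x. norm (f x) powr p) \<longleftrightarrow> integrable lborel (\<lambda>x. norm (g x) powr p)"
  proof (rule lebesgue_on_integrable_iff[OF KL])
    show "(\<lambda>x. norm (f x) powr p) \<in> borel_measurable (lebesgue_on K)" using fK by measurable
    show "AE x in lborel. x \<in> K \<longrightarrow> norm (f x) powr p = norm (g x) powr p"
      using g(3) by eventually_elim simp
  qed (use g p in auto)
  ultimately show ?thesis by blast
qed

lemma integrable_if_Lp_loc_1: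
  fixes f :: "'a::euclidean_space \<Rightarrow> 'b::euclidean_space"
  assumes "f \<in> Lp_loc \<Omega> 1" "compact K" "K \<subseteq> \<Omega>"
    and g: "g \<in> borel_measurable borel" "\<And>x. x \<notin> K \<Longrightarrow> g x = 0" "AE x in lborel. x \<in> K \<longrightarrow> g x = f x"
  shows "integrable lborel g"
proof -
  have "integrable lborel (\<lambda>x. norm (g x) powr 1)" by (rule integrable_powr_if_Lp_loc[OF assms(1-3) _ g]) simp
  then have "integrable lborel (\<lambda>x. norm (g x))" by simp
  then show ?thesis using g(1) by (simp add: integrable_norm_iff)
qed

lemma test_function_if_zero_outside_cball:
  assumes "smooth \<phi>" "\<And>x. x \<notin> cball c r \<Longrightarrow> \<phi> x = 0" "cball c r \<subseteq> \<Omega>"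
  shows "\<phi> \<in> test_functions \<Omega>"
proof -
  have "{x. \<phi> x \<noteq> 0} \<subseteq> cball c r" using assms(2) by blast
  then have "closure {x. \<phi> x \<noteq> 0} \<subseteq> cball c r" by (simp add: closure_minimal)
  moreover from this have "compact (closure {x. \<phi> x \<noteq> 0})"
    by (meson bounded_cball bounded_subset closed_closure compact_eq_bounded_closed)
  ultimately show ?thesis using assms by (auto simp: test_functions_def)
qed

lemma weak_gradient_test:
  fixes u :: "'a::euclidean_space \<Rightarrow> real"
  assumes \<Omega>: "open \<Omega>" and wg: "weak_gradient \<Omega> u G" and K: "cball c \<rho> \<subseteq> \<Omega>" and r: "r < \<rho>"
    and U: "U \<in> borel_measurable borel" "\<And>x. x \<notin> cball c \<rho> \<Longrightarrow> U x = 0" "AE x in lborel. x \<in> cball c \<rho> \<longrightarrow> U x = u x"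
    and V: "V \<in> borel_measurable borel" "\<And>x. x \<notin> cball c \<rho> \<Longrightarrow> V x = 0" "AE x in lborel. x \<in> cball c \<rho> \<longrightarrow> V x = G x"
    and \<phi>: "smooth \<phi>" "\<And>x. x \<notin> cball c r \<Longrightarrow> \<phi> x = 0"
  shows "(\<integral>x. U x *\<^sub>R gradient \<phi> x \<partial>lborel) = - (\<integral>x. \<phi> x *\<^sub>R V x \<partial>lborel)"
proof -
  have C: "C1 \<phi> (gradient \<phi>)" by (rule smooth_C1[OF \<phi>(1)])
  have gz: "gradient \<phi> x = 0" if "x \<notin> cball c r" for x by (rule C1_zero_outside_cball[OF C \<phi>(2) that])
  have sub: "cball c r \<subseteq> cball c \<rho>" using r by auto
  have \<Omega>L: "\<Omega> \<in> sets lebesgue" using \<Omega> by simp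
  have [measurable]: "\<phi> \<in> borel_measurable borel" "gradient \<phi> \<in> borel_measurable borel" using C1_measurable[OF C] by auto
  have [measurable]: "U \<in> borel_measurable borel" "V \<in> borel_measurable borel" by fact+
  have [measurable]: "\<phi> \<in> borel_measurable (lebesgue_on \<Omega>)" "gradient \<phi> \<in> borel_measurable (lebesgue_on \<Omega>)"
    by (rule measurable_lebesgue_on_if_borel; measurable)+
  have [measurable]: "u \<in> borel_measurable (lebesgue_on \<Omega>)" "G \<in> borel_measurable (lebesgue_on \<Omega>)"
    using wg by (auto simp: weak_gradient_def Lp_loc_def)
  have "\<phi> \<in> test_functions \<Omega>"
    by (rule test_function_if_zero_outside_cball[OF \<phi>]) (use sub K in auto)
  then have "(LINT x|lebesgue_on \<Omega>. u x *\<^sub>R gradient \<phi> x) = - (LINT x|lebesgue_on \<Omega>. \<phi> x *\<^sub>R G x)"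
    using wg by (simp add: weak_gradient_def)
  also have "(LINT x|lebesgue_on \<Omega>. u x *\<^sub>R gradient \<phi> x) = (\<integral>x. U x *\<^sub>R gradient \<phi> x \<partial>lborel)"
  proof (rule lebesgue_on_integral_eq[OF \<Omega>L])
    show "AE x in lborel. x \<in> \<Omega> \<longrightarrow> u x *\<^sub>R gradient \<phi> x = U x *\<^sub>R gradient \<phi> x"
      using U(3) by eventually_elim (use gz sub in \<open>metis subsetD scaleR_zero_right\<close>)
    show "U x *\<^sub>R gradient \<phi> x = 0" if "x \<notin> \<Omega>" for x
    proof -
      have "x \<notin> cball c \<rho>" using that K by blast
      then have "U x = 0" by (rule U(2))
      then show ?thesis by simp
    qed
  qed measurable
  also have "(LINT x|lebesgue_on \<Omega>. \<phi> x *\<^sub>R G x) = (\<integral>x. \<phi> x *\<^sub>R V x \<partial>lborel)"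
  proof (rule lebesgue_on_integral_eq[OF \<Omega>L])
    show "AE x in lborel. x \<in> \<Omega> \<longrightarrow> \<phi> x *\<^sub>R G x = \<phi> x *\<^sub>R V x"
      using V(3) by eventually_elim (use \<phi>(2) sub in \<open>metis subsetD scaleR_zero_left\<close>)
    show "\<phi> x *\<^sub>R V x = 0" if "x \<notin> \<Omega>" for x
    proof -
      have "x \<notin> cball c \<rho>" using that K by blast
      then have "V x = 0" by (rule V(2))
      then show ?thesis by simp
    qed
  qed measurable
  finally show ?thesis .
qed

text \<open>The mollifications of the two gradients agree and converge to them almost everywhere. Uniqueness is needed
  because the gradient for which the system holds is only known to be locally integrable, whereas the one
  with the integrability \<open>\<gamma>\<close> comes from the Sobolev space.\<close>
lemma weak_gradient_unique:
  fixes u :: "'a::euclidean_space \<Rightarrow> real"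
  assumes \<Omega>: "open \<Omega>" and wg: "weak_gradient \<Omega> u G1" "weak_gradient \<Omega> u G2" and K: "cball c \<rho> \<subseteq> \<Omega>" and r: "r < \<rho>"
  shows "AE x in lborel. x \<in> cball c r \<longrightarrow> G1 x = G2 x"
proof -
  have B: "cball c \<rho> \<in> sets borel" by simp
  have m: "u \<in> borel_measurable (lebesgue_on \<Omega>)" "G1 \<in> borel_measurable (lebesgue_on \<Omega>)" "G2 \<in> borel_measurable (lebesgue_on \<Omega>)"
    using wg by (auto simp: weak_gradient_def Lp_loc_def)
  obtain U where U: "U \<in> borel_measurable borel" "\<And>x. x \<notin> cball c \<rho> \<Longrightarrow> U x = 0" "AE x in lborel. x \<in> cball c \<rho> \<longrightarrow> U x = u x"
    using borel_version[OF m(1) B K] by blast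
  obtain V1 where V1: "V1 \<in> borel_measurable borel" "\<And>x. x \<notin> cball c \<rho> \<Longrightarrow> V1 x = 0" "AE x in lborel. x \<in> cball c \<rho> \<longrightarrow> V1 x = G1 x"
    using borel_version[OF m(2) B K] by blast
  obtain V2 where V2: "V2 \<in> borel_measurable borel" "\<And>x. x \<notin> cball c \<rho> \<Longrightarrow> V2 x = 0" "AE x in lborel. x \<in> cball c \<rho> \<longrightarrow> V2 x = G2 x"
    using borel_version[OF m(3) B K] by blast
  have L: "G1 \<in> Lp_loc \<Omega> 1" "G2 \<in> Lp_loc \<Omega> 1" using wg by (auto simp: weak_gradient_def)
  have i1: "integrable lborel V1" by (rule integrable_if_Lp_loc_1[OF L(1) compact_cball K V1])
  have i2: "integrable lborel V2" by (rule integrable_if_Lp_loc_1[OF L(2) compact_cball K V2])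
  have iV: "integrable lborel (\<lambda>x. V1 x - V2 x)" using i1 i2 by simp
  have "(\<rho> - r) / 2 > 0" using r by simp
  then obtain e :: "nat \<Rightarrow> real" and P where e: "\<And>n. 0 < e n" "\<And>n. e n \<le> (\<rho> - r) / 2"
    "AE x in lborel. (\<forall>n. norm (conv (mollifier (e n)) (\<lambda>x. V1 x - V2 x) x - (V1 x - V2 x)) \<le> P x) \<and>
      (\<lambda>n. conv (mollifier (e n)) (\<lambda>x. V1 x - V2 x) x) \<longlonglongrightarrow> V1 x - V2 x"
    by (rule mollifier_sequence[OF iV]) blast
  have z: "conv (mollifier (e n)) (\<lambda>x. V1 x - V2 x) x = 0" if x: "x \<in> cball c r" for n x
  proof -
    let ?\<phi> = "\<lambda>y. mollifier (e n) (x - y)"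
    have "unit_kernel (e n) (mollifier (e n) :: 'a \<Rightarrow> real)" by (rule unit_kernel_mollifier[OF e(1)])
    then have kz: "\<And>w::'a. w \<notin> cball 0 (e n) \<Longrightarrow> mollifier (e n) w = 0" and kc: "continuous_on UNIV (mollifier (e n) :: 'a \<Rightarrow> real)"
      by (auto simp: unit_kernel_def)
    have \<phi>z: "?\<phi> y = 0" if "y \<notin> cball c (r + e n)" for y
    proof (rule kz)
      show "x - y \<notin> cball 0 (e n)"
        using that x dist_triangle[of c y x] by (simp add: dist_norm norm_minus_commute)
    qed
    have re: "r + e n < \<rho>" using e(2)[of n] r by (simp add: field_simps)
    have "- (\<integral>y. ?\<phi> y *\<^sub>R V1 y \<partial>lborel) = - (\<integral>y. ?\<phi> y *\<^sub>R V2 y \<partial>lborel)"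
      using weak_gradient_test[OF \<Omega> wg(1) K re U V1 smooth_mollifier_translate(1) \<phi>z]
        weak_gradient_test[OF \<Omega> wg(2) K re U V2 smooth_mollifier_translate(1) \<phi>z] by simp
    moreover obtain M where M: "\<And>w::'a. \<bar>mollifier (e n) w\<bar> \<le> M"
      using bounded_if_zero_outside_cball[OF kc kz] by (metis real_norm_def)
    have mm: "(\<lambda>y. mollifier (e n) (x - y)) \<in> borel_measurable borel"
      using C1_measurable(1)[OF smooth_C1[OF smooth_mollifier_translate(1)]] .
    have "integrable lborel (\<lambda>y. ?\<phi> y *\<^sub>R V1 y)" "integrable lborel (\<lambda>y. ?\<phi> y *\<^sub>R V2 y)"
      using integrable_bounded_scaleR[OF i1 mm M] integrable_bounded_scaleR[OF i2 mm M] by auto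
    ultimately show ?thesis by (simp add: conv_def scaleR_diff_right)
  qed
  show ?thesis
    using e(3) V1(3) V2(3)
  proof eventually_elim
    case (elim x)
    show ?case
    proof
      assume x: "x \<in> cball c r"
      then have "V1 x - V2 x = 0" using elim(1) z[OF x] LIMSEQ_unique by (simp add: LIMSEQ_const_iff)
      moreover have "x \<in> cball c \<rho>" using x r by auto
      ultimately show "G1 x = G2 x" using elim by simp
    qed
  qed
qed

lemma fibre_assumptions_if_structural:
  assumes H: "hamiltonian \<Omega> H" and S: "structural_assumptions \<alpha> \<tau> \<beta> \<epsilon> C0 \<Omega> H" and C: "0 < C0" "C0 \<le> C" and x: "x \<in> \<Omega>"
  shows "fibre_assumptions \<alpha> \<tau> \<beta> (delta \<alpha> \<tau> \<beta>) \<epsilon> C (H x) (Dp H x)"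
  unfolding fibre_assumptions_def
proof (intro conjI allI impI)
  let ?\<delta> = "delta \<alpha> \<tau> \<beta>"
  fix p m assume m: "(0::real) < m"
  have "(\<lambda>q. H x q m) differentiable (at p)" using H x m by (simp add: hamiltonian_def)
  then show "GDERIV (\<lambda>q. H x q m) p :> Dp H x p m" unfolding Dp_def by (rule GDERIV_gradient)
  have "norm (Dp H x p m) \<le> C0 * (1 / m + 1 / m powr \<tau>) * norm p powr (\<alpha> - 1) + C0 * (m powr (\<beta> - ?\<delta>) + 1 / m)"
    using S x m unfolding structural_assumptions_def by blast
  also have "\<dots> \<le> C * (1 / m + 1 / m powr \<tau>) * norm p powr (\<alpha> - 1) + C * (m powr (\<beta> - ?\<delta>) + 1 / m)"
    using C m by (intro add_mono mult_right_mono) auto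
  finally show "norm (Dp H x p m) \<le> C * (1 / m + 1 / m powr \<tau>) * norm p powr (\<alpha> - 1) + C * (m powr (\<beta> - ?\<delta>) + 1 / m)" .
  have "1 / C * (1 / (m powr \<tau> + 1)) * norm p powr \<alpha> - C * (m powr (\<beta> - ?\<delta> - \<epsilon>) + 1) * norm p
      \<le> 1 / C0 * (1 / (m powr \<tau> + 1)) * norm p powr \<alpha> - C0 * (m powr (\<beta> - ?\<delta> - \<epsilon>) + 1) * norm p"
    using C by (intro diff_mono mult_right_mono) (auto intro!: divide_left_mono add_nonneg_nonneg)
  also have "\<dots> \<le> Dp H x p m \<bullet> p" using S x m unfolding structural_assumptions_def by blast
  finally show "1 / C * (1 / (m powr \<tau> + 1)) * norm p powr \<alpha> - C * (m powr (\<beta> - ?\<delta> - \<epsilon>) + 1) * norm p \<le> Dp H x p m \<bullet> p" .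
next
  fix m assume m: "(0::real) < m"
  have "- C * (m powr \<beta> + 1) \<le> - C0 * (m powr \<beta> + 1)" using C by (intro mult_right_mono) (auto intro: add_nonneg_nonneg)
  also have "\<dots> \<le> H x 0 m" using S x m unfolding structural_assumptions_def by blast
  finally show "- C * (m powr \<beta> + 1) \<le> H x 0 m" .
next
  fix m assume m: "C \<le> m"
  have "H x 0 m \<le> - (1 / C0) * m powr \<beta>" using S x m C unfolding structural_assumptions_def by auto
  also have "\<dots> \<le> - (1 / C) * m powr \<beta>" using C by (intro mult_right_mono) (auto intro: divide_left_mono)
  finally show "H x 0 m \<le> - (1 / C) * m powr \<beta>" .
qed

text \<open>The assumption on \<open>c\<close> and \<open>K\<close> is the conclusion of \<open>structure_conditions\<close>; stating it as a premise makes
  visible that the constants are fixed before the solution. \<open>U\<close> is the absolute value of a Borel version of \<open>u\<close>,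
  which makes it nonnegative everywhere.\<close>
lemma weak_solution_if_solution:
  fixes u :: "'a::euclidean_space \<Rightarrow> real" and \<Omega> :: "'a set"
  assumes \<Omega>: "open \<Omega>" and H: "hamiltonian \<Omega> H" and St: "structural_assumptions \<alpha> \<tau> \<beta> \<epsilon> C0 \<Omega> H"
    and sol: "solution \<alpha> \<tau> \<beta> \<Omega> H m u" and C: "0 < C0" "C0 \<le> C" and g: "gamma \<alpha> \<tau> \<beta> = \<gamma>" "\<gamma> > 1" and K: "K > 0"
    and str: "\<And>(h::'a \<Rightarrow> real \<Rightarrow> real) D p m z j. fibre_assumptions \<alpha> \<tau> \<beta> (delta \<alpha> \<tau> \<beta>) \<epsilon> C h D \<Longrightarrow> m \<ge> 0 \<Longrightarrow>
       z \<in> graph_closure h p m \<Longrightarrow> z \<le> 0 \<Longrightarrow> (m > 0 \<longrightarrow> z = 0) \<Longrightarrow> j \<in> graph_closure (\<lambda>p r. r *\<^sub>R D p r) p m \<Longrightarrow>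
       norm j \<le> K * (norm p powr (\<gamma> - 1) + 1) \<and> j \<bullet> p \<ge> c * norm p powr \<gamma> - K"
    and R: "R > 0" and ball: "ball x0 (2 * R) \<subseteq> \<Omega>" and u0: "AE x in lebesgue_on (ball x0 (2 * R)). u x \<ge> 0"
  obtains U G J where "weak_solution \<gamma> c K x0 (15 / 8 * R) U G J"
    "AE x in lborel. x \<in> cball x0 (15 / 8 * R) \<longrightarrow> U x = u x"
proof -
  define \<rho> where "\<rho> = 15 / 8 * R"
  let ?B = "cball x0 \<rho>"
  have B2: "cball x0 (31 / 16 * R) \<subseteq> ball x0 (2 * R)" using R by auto
  have B: "?B \<subseteq> ball x0 (2 * R)" using R by (auto simp: \<rho>_def)
  have B\<Omega>: "?B \<subseteq> \<Omega>" "cball x0 (31 / 16 * R) \<subseteq> \<Omega>" using B B2 ball by auto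
  have \<Omega>L: "\<Omega> \<in> sets lebesgue" using \<Omega> by simp
  obtain G2 where G2: "G2 \<in> Lp_loc \<Omega> \<gamma>" "weak_gradient \<Omega> u G2" and uL: "u \<in> Lp_loc \<Omega> \<gamma>"
    using sol g by (auto simp: solution_def W1p_loc_def)
  have m0: "AE x in lborel. x \<in> \<Omega> \<longrightarrow> m x \<ge> 0" using sol \<Omega>L by (simp add: solution_def AE_lebesgue_on_iff)
  obtain Du h j where Du: "weak_gradient \<Omega> u Du" and h: "admissible_h \<Omega> H m Du h"
    "AE x in lebesgue_on \<Omega>. h x \<le> 0" "AE x in lebesgue_on \<Omega>. m x > 0 \<longrightarrow> h x = 0"
    and j: "admissible_j \<Omega> H m Du j" "\<forall>\<phi>\<in>test_functions \<Omega>. (LINT x|lebesgue_on \<Omega>. j x \<bullet> gradient \<phi> x) = 0"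
    using sol unfolding solution_def by blast
  have DG: "AE x in lborel. x \<in> ?B \<longrightarrow> Du x = G2 x"
    by (rule weak_gradient_unique[OF \<Omega> Du G2(2) B\<Omega>(2)]) (use R in \<open>simp add: \<rho>_def\<close>)
  have jm: "j \<in> borel_measurable (lebesgue_on \<Omega>)" using j by (simp add: admissible_j_def)
  have um: "u \<in> borel_measurable (lebesgue_on \<Omega>)" "G2 \<in> borel_measurable (lebesgue_on \<Omega>)"
    using uL G2 by (auto simp: Lp_loc_def)
  have Bb: "?B \<in> sets borel" by simp
  obtain U0 where U0: "U0 \<in> borel_measurable borel" "\<And>x. x \<notin> ?B \<Longrightarrow> U0 x = 0" "AE x in lborel. x \<in> ?B \<longrightarrow> U0 x = u x"
    using borel_version[OF um(1) Bb B\<Omega>(1)] by blast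
  obtain G where G: "G \<in> borel_measurable borel" "\<And>x. x \<notin> ?B \<Longrightarrow> G x = 0" "AE x in lborel. x \<in> ?B \<longrightarrow> G x = G2 x"
    using borel_version[OF um(2) Bb B\<Omega>(1)] by blast
  obtain J where J: "J \<in> borel_measurable borel" "\<And>x. x \<notin> ?B \<Longrightarrow> J x = 0" "AE x in lborel. x \<in> ?B \<longrightarrow> J x = j x"
    using borel_version[OF jm Bb B\<Omega>(1)] by blast
  define U where "U x = \<bar>U0 x\<bar>" for x
  have [measurable]: "U0 \<in> borel_measurable borel" "G \<in> borel_measurable borel" "J \<in> borel_measurable borel" by fact+
  have u0': "AE x in lborel. x \<in> ball x0 (2 * R) \<longrightarrow> u x \<ge> 0" using u0 by (simp add: AE_lebesgue_on_iff)
  have U: "U \<in> borel_measurable borel" "\<And>x. x \<notin> ?B \<Longrightarrow> U x = 0" "AE x in lborel. x \<in> ?B \<longrightarrow> U x = u x"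
  proof -
    show "U \<in> borel_measurable borel" unfolding U_def[abs_def] by measurable
    show "\<And>x. x \<notin> ?B \<Longrightarrow> U x = 0" by (simp add: U_def U0(2))
    show "AE x in lborel. x \<in> ?B \<longrightarrow> U x = u x"
      using U0(3) u0' by eventually_elim (use B in \<open>auto simp: U_def\<close>)
  qed
  have [measurable]: "U \<in> borel_measurable borel" by (rule U)
  have uL1: "u \<in> Lp_loc \<Omega> 1" "G2 \<in> Lp_loc \<Omega> 1" using G2(2) by (auto simp: weak_gradient_def)
  have iG\<gamma>: "integrable lborel (\<lambda>x. norm (G x) powr \<gamma>)"
    by (rule integrable_powr_if_Lp_loc[OF G2(1) compact_cball B\<Omega>(1) _ G]) (use g in simp)
  have sob: "sobolev_on_ball \<gamma> x0 \<rho> U G"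
    unfolding sobolev_on_ball_def
  proof (intro conjI allI impI)
    show "integrable lborel U" by (rule integrable_if_Lp_loc_1[OF uL1(1) compact_cball B\<Omega>(1) U])
    show "integrable lborel G" by (rule integrable_if_Lp_loc_1[OF uL1(2) compact_cball B\<Omega>(1) G])
    show "integrable lborel (\<lambda>x. norm (U x) powr \<gamma>)"
      by (rule integrable_powr_if_Lp_loc[OF uL compact_cball B\<Omega>(1) _ U]) (use g in simp)
    show "integrable lborel (\<lambda>x. norm (G x) powr \<gamma>)" by (rule iG\<gamma>)
    fix r \<phi> assume "r < \<rho>" "smooth \<phi> \<and> (\<forall>x. x \<notin> cball x0 r \<longrightarrow> \<phi> x = 0)"
    then show "(\<integral>x. U x *\<^sub>R gradient \<phi> x \<partial>lborel) = - (\<integral>x. \<phi> x *\<^sub>R G x \<partial>lborel)"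
      by (intro weak_gradient_test[OF \<Omega> G2(2) B\<Omega>(1) _ U G]) auto
  qed
  have hx: "AE x in lborel. x \<in> \<Omega> \<longrightarrow> h x \<in> graph_closure (H x) (Du x) (m x) \<and> h x \<le> 0 \<and> (m x > 0 \<longrightarrow> h x = 0)"
  proof -
    have "AE x in lborel. x \<in> \<Omega> \<longrightarrow> h x \<in> graph_closure (H x) (Du x) (m x)"
      "AE x in lborel. x \<in> \<Omega> \<longrightarrow> h x \<le> 0" "AE x in lborel. x \<in> \<Omega> \<longrightarrow> (m x > 0 \<longrightarrow> h x = 0)"
      using h \<Omega>L by (simp_all add: admissible_h_def AE_lebesgue_on_iff)
    then show ?thesis by eventually_elim blast
  qed
  have jx: "AE x in lborel. x \<in> \<Omega> \<longrightarrow> j x \<in> graph_closure (\<lambda>p r. r *\<^sub>R Dp H x p r) (Du x) (m x)"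
    using j \<Omega>L by (simp add: admissible_j_def AE_lebesgue_on_iff)
  have bounds: "AE x in lborel. norm (J x) \<le> K * (norm (G x) powr (\<gamma> - 1) + 1) \<and> J x \<bullet> G x \<ge> c * norm (G x) powr \<gamma> - K"
    using hx jx m0 DG G(3) J(3)
  proof eventually_elim
    case (elim x)
    show ?case
    proof (cases "x \<in> ?B")
      case True
      then have x: "x \<in> \<Omega>" using B\<Omega> by blast
      have "norm (j x) \<le> K * (norm (Du x) powr (\<gamma> - 1) + 1) \<and> j x \<bullet> Du x \<ge> c * norm (Du x) powr \<gamma> - K"
        by (rule str[OF fibre_assumptions_if_structural[OF H St C x], of "m x" "h x"]) (use elim x in auto)
      then show ?thesis using elim True by simp
    next
      case False
      then show ?thesis using G(2)[of x] J(2)[of x] K by simp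
    qed
  qed
  have iJ: "integrable lborel J"
  proof (rule Bochner_Integration.integrable_bound)
    show "integrable lborel (\<lambda>x. (2 * K) *\<^sub>R norm (G x) powr \<gamma> + indicator ?B x * (2 * K))"
      by (intro Bochner_Integration.integrable_add integrable_scaleR_right iG\<gamma> integrable_mult_left integrable_real_indicator
          emeasure_lborel_cball_finite) simp
    show "AE x in lborel. norm (J x) \<le> norm ((2 * K) *\<^sub>R norm (G x) powr \<gamma> + indicator ?B x * (2 * K))"
      using bounds
    proof eventually_elim
      case (elim x)
      show ?case
      proof (cases "x \<in> ?B")
        case True
        have "norm (G x) powr (\<gamma> - 1) * 1 \<le> norm (G x) powr \<gamma> + 1 powr \<gamma>"
          by (rule powr_mult_le) (use g in auto)
        then have "K * (norm (G x) powr (\<gamma> - 1) + 1) \<le> K * (norm (G x) powr \<gamma> + 2)" using K by (intro mult_left_mono) auto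
        moreover have "0 \<le> K * norm (G x) powr \<gamma>" using K by simp
        ultimately have "norm (J x) \<le> 2 * K * norm (G x) powr \<gamma> + 2 * K" using elim by (simp add: distrib_left)
        then show ?thesis using True K by simp
      next
        case False
        then show ?thesis using J(2)[of x] by simp
      qed
    qed
  qed measurable
  have eq: "(\<integral>x. J x \<bullet> gradient \<phi> x \<partial>lborel) = 0"
    if r: "r < \<rho>" and \<phi>: "smooth \<phi>" "\<And>x. x \<notin> cball x0 r \<Longrightarrow> \<phi> x = 0" for r \<phi>
  proof -
    have C1\<phi>: "C1 \<phi> (gradient \<phi>)" by (rule smooth_C1[OF \<phi>(1)])
    have gz: "gradient \<phi> x = 0" if "x \<notin> cball x0 r" for x by (rule C1_zero_outside_cball[OF C1\<phi> \<phi>(2) that])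
    have sub: "cball x0 r \<subseteq> ?B" using r by auto
    have [measurable]: "gradient \<phi> \<in> borel_measurable borel" using C1_measurable[OF C1\<phi>] by auto
    have [measurable]: "gradient \<phi> \<in> borel_measurable (lebesgue_on \<Omega>)" by (rule measurable_lebesgue_on_if_borel) measurable
    have [measurable]: "j \<in> borel_measurable (lebesgue_on \<Omega>)" by (rule jm)
    have "\<phi> \<in> test_functions \<Omega>"
      by (rule test_function_if_zero_outside_cball[OF \<phi>]) (use sub B\<Omega> in auto)
    then have "0 = (LINT x|lebesgue_on \<Omega>. j x \<bullet> gradient \<phi> x)" using j(2) by simp
    also have "\<dots> = (\<integral>x. J x \<bullet> gradient \<phi> x \<partial>lborel)"
    proof (rule lebesgue_on_integral_eq[OF \<Omega>L])
      show "AE x in lborel. x \<in> \<Omega> \<longrightarrow> j x \<bullet> gradient \<phi> x = J x \<bullet> gradient \<phi> x"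
        using J(3) by eventually_elim (use gz sub in \<open>metis subsetD inner_zero_right\<close>)
      show "J x \<bullet> gradient \<phi> x = 0" if "x \<notin> \<Omega>" for x
      proof -
        have "x \<notin> ?B" using that B\<Omega>(1) by blast
        then have "J x = 0" by (rule J(2))
        then show ?thesis by simp
      qed
    qed measurable
    finally show ?thesis by simp
  qed
  have "weak_solution \<gamma> c K x0 \<rho> U G J"
    unfolding weak_solution_def using sob iJ bounds eq by (auto simp: U_def elim: eventually_mono)
  then show thesis using that U(3) by (simp add: \<rho>_def)
qed

theorem lemma3p6:
  fixes \<alpha> \<tau> \<beta> \<epsilon> C0 :: real
  assumes "admissible_parameters \<alpha> \<tau> \<beta> \<epsilon>" and "C0 > 0"
  shows "\<exists>C>0. \<forall>(\<Omega> :: (real ^ 'n) set) H m u x0 R.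
    open \<Omega> \<and> connected \<Omega> \<and>
    hamiltonian \<Omega> H \<and> structural_assumptions \<alpha> \<tau> \<beta> \<epsilon> C0 \<Omega> H \<and>
    solution \<alpha> \<tau> \<beta> \<Omega> H m u \<and>
    R > 0 \<and> ball x0 (2 * R) \<subseteq> \<Omega> \<and>
    (AE x in lebesgue_on (ball x0 (2 * R)). u x \<ge> 0) \<longrightarrow>
    esssup (lebesgue_on (ball x0 R)) (\<lambda>x. ereal (u x))
      \<le> ereal C * (essinf (lebesgue_on (ball x0 R)) (\<lambda>x. ereal (u x)) + ereal R)"
proof -
  define \<delta> where "\<delta> = delta \<alpha> \<tau> \<beta>"
  define \<gamma> where "\<gamma> = gamma \<alpha> \<tau> \<beta>"
  have ap: "\<alpha> > 1" "0 \<le> \<tau>" "\<tau> < 1" "\<beta> > \<tau> / (\<alpha> - 1)" "\<epsilon> > 0" "\<beta> - \<delta> > \<epsilon>"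
    using assms(1) by (auto simp: admissible_parameters_def \<delta>_def)
  have "\<tau> / (\<alpha> - 1) \<ge> 0" using ap by simp
  then have \<beta>: "\<beta> > 0" using ap by linarith
  have \<delta>: "\<delta> > 0" using ap \<beta> by (simp add: \<delta>_def delta_def add_pos_nonneg)
  have e1: "\<alpha> * \<delta> = \<beta> + \<tau>" using ap by (simp add: \<delta>_def delta_def)
  have e2: "\<gamma> * \<delta> = \<beta> + 1" using \<delta> by (simp add: \<gamma>_def gamma_def \<delta>_def)
  have \<gamma>: "\<gamma> > 1"
  proof -
    have "1 * \<delta> < \<gamma> * \<delta>" using e2 ap by linarith
    then show ?thesis using \<delta> by (simp add: mult_less_cancel_right)
  qed
  define C where "C = max C0 1"
  have C: "C \<ge> 1" "C0 \<le> C" by (auto simp: C_def)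
  obtain c K where cK: "c > 0" "K > 0"
    and str: "\<And>(h::real ^ 'n \<Rightarrow> real \<Rightarrow> real) D p m z j. fibre_assumptions \<alpha> \<tau> \<beta> \<delta> \<epsilon> C h D \<Longrightarrow> m \<ge> 0 \<Longrightarrow>
       z \<in> graph_closure h p m \<Longrightarrow> z \<le> 0 \<Longrightarrow> (m > 0 \<longrightarrow> z = 0) \<Longrightarrow> j \<in> graph_closure (\<lambda>p r. r *\<^sub>R D p r) p m \<Longrightarrow>
       norm j \<le> K * (norm p powr (\<gamma> - 1) + 1) \<and> j \<bullet> p \<ge> c * norm p powr \<gamma> - K"
    using structure_conditions[OF ap(1,2,3) \<delta> ap(5,6) e1 e2 C(1), where 'a = "real ^ 'n"] by blast
  obtain B where B: "B > 0"
    and har: "\<And>(x0::real ^ 'n) R U G J. R > 0 \<Longrightarrow> weak_solution \<gamma> c K x0 (15 / 8 * R) U G J \<Longrightarrow>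
       \<exists>k. (AE x in lborel. x \<in> ball x0 R \<longrightarrow> U x + R \<le> B * k) \<and> (AE x in lborel. x \<in> ball x0 R \<longrightarrow> k \<le> U x + R)"
    using harnack_weak_solution[OF \<gamma> cK, where 'a = "real ^ 'n"] by blast
  show ?thesis
  proof (intro exI[of _ B] conjI B allI impI)
    fix \<Omega> :: "(real ^ 'n) set" and H m u x0 R
    assume A: "open \<Omega> \<and> connected \<Omega> \<and> hamiltonian \<Omega> H \<and> structural_assumptions \<alpha> \<tau> \<beta> \<epsilon> C0 \<Omega> H \<and>
      solution \<alpha> \<tau> \<beta> \<Omega> H m u \<and> R > 0 \<and> ball x0 (2 * R) \<subseteq> \<Omega> \<and> (AE x in lebesgue_on (ball x0 (2 * R)). u x \<ge> 0)"
    then have R: "R > 0" and sub: "ball x0 R \<subseteq> \<Omega>" by auto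
    obtain U G J where W: "weak_solution \<gamma> c K x0 (15 / 8 * R) U G J"
      and Uu: "AE x in lborel. x \<in> cball x0 (15 / 8 * R) \<longrightarrow> U x = u x"
      using weak_solution_if_solution[of \<Omega> H \<alpha> \<tau> \<beta> \<epsilon> C0 m u C \<gamma> K c R x0] A assms(2) C(2) \<gamma> cK str
      unfolding \<delta>_def[symmetric] \<gamma>_def[symmetric] by blast
    obtain k where k: "AE x in lborel. x \<in> ball x0 R \<longrightarrow> U x + R \<le> B * k" "AE x in lborel. x \<in> ball x0 R \<longrightarrow> k \<le> U x + R"
      using har[OF R W] by blast
    have bL: "ball x0 R \<in> sets lebesgue" by simp
    have "u \<in> borel_measurable (lebesgue_on \<Omega>)" using A by (auto simp: solution_def W1p_loc_def Lp_loc_def)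
    then have um: "u \<in> borel_measurable (lebesgue_on (ball x0 R))" by (rule measurable_restrict_mono[OF _ sub])
    let ?M = "lebesgue_on (ball x0 R)"
    have up: "esssup ?M (\<lambda>x. ereal (u x)) \<le> ereal (B * k)"
    proof (rule esssup_I)
      show "(\<lambda>x. ereal (u x)) \<in> borel_measurable ?M" using um by measurable
      show "AE x in ?M. ereal (u x) \<le> ereal (B * k)"
        unfolding AE_lebesgue_on_iff[OF bL] using k(1) Uu by eventually_elim (use R in auto)
    qed
    have "esssup ?M (\<lambda>x. - ereal (u x)) \<le> ereal (R - k)"
    proof (rule esssup_I)
      show "(\<lambda>x. - ereal (u x)) \<in> borel_measurable ?M" using um by measurable
      show "AE x in ?M. - ereal (u x) \<le> ereal (R - k)"
        unfolding AE_lebesgue_on_iff[OF bL] using k(2) Uu by eventually_elim (use R in auto)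
    qed
    then have "- ereal (R - k) \<le> essinf ?M (\<lambda>x. ereal (u x))"
      unfolding essinf_def by (simp only: ereal_minus_le_minus)
    then have "- ereal (R - k) + ereal R \<le> essinf ?M (\<lambda>x. ereal (u x)) + ereal R" by (rule add_right_mono)
    then have "ereal k \<le> essinf ?M (\<lambda>x. ereal (u x)) + ereal R" by simp
    then have "ereal B * ereal k \<le> ereal B * (essinf ?M (\<lambda>x. ereal (u x)) + ereal R)"
      using B by (intro ereal_mult_left_mono) auto
    then show "esssup ?M (\<lambda>x. ereal (u x)) \<le> ereal B * (essinf ?M (\<lambda>x. ereal (u x)) + ereal R)"
      using up by simp
  qed
qed

end
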